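(* Suppose $\mathbf{k}$ is an arbitrary field. Then there is a natural one-to-one correspondence between $\mathrm{Irr}(\mathrm{Mod}_{\mathrm{FI}}^{\mathrm{gen}})$ and $\bigsqcup_{n\ge0}\mathrm{Irr}(\mathrm{Mod}_{\mathbf{k}[S_n]})$.
   Context: $\mathrm{FI}$ is the category of finite sets with injections. An $\mathrm{FI}$-module over $\mathbf{k}$ is a functor $\mathrm{FI}\to\mathrm{Mod}_{\mathbf{k}}$, where $\mathrm{Mod}_{\mathbf{k}}$ is the category of $\mathbf{k}$-vector spaces; these form the abelian category $\mathrm{Mod}_{\mathrm{FI}}$. An $\mathrm{FI}$-module $M$ is torsion if, for every finite set $X$, every $x\in M(X)$ is killed by the map induced by some $\mathrm{FI}$-morphism $X\to Y$. $\mathrm{Mod}_{\mathrm{FI}}^{\mathrm{gen}}$, the category of generic $\mathrm{FI}$-modules, is the Serre quotient of $\mathrm{Mod}_{\mathrm{FI}}$ by the subcategory of torsion modules. $S_n$ is the symmetric group on $n$ letters, and $\mathrm{Mod}_{\mathbf{k}[S_n]}$ is the category of $\mathbf{k}[S_n]$-modules. For an abelian category $\mathcal{A}$, $\mathrm{Irr}(\mathcal{A})$ denotes the set of isomorphism classes of irreducible objects of $\mathcal{A}$. *)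

theory Defs
  imports "HOL-Algebra.Sym_Groups" "HOL-Algebra.Module" "HOL-Algebra.AbelCoset"
begin

section \<open>Categories\<close>

text \<open>
  Composition and identities carry the objects involved, because arrows are not assumed to
  determine their source and target.  \<open>Comp C X Y Z g f\<close> is the composite of
  \<open>f : X \<rightarrow> Y\<close> and \<open>g : Y \<rightarrow> Z\<close>.
\<close>

record ('o, 'm) cat =
  Ob :: "'o set"
  Hom :: "'o \<Rightarrow> 'o \<Rightarrow> 'm set"
  Idn :: "'o \<Rightarrow> 'm"
  Comp :: "'o \<Rightarrow> 'o \<Rightarrow> 'o \<Rightarrow> 'm \<Rightarrow> 'm \<Rightarrow> 'm"

record ('o, 'm, 'p, 'n) functr =
  FOb :: "'o \<Rightarrow> 'p"
  FMap :: "'o \<Rightarrow> 'o \<Rightarrow> 'm \<Rightarrow> 'n"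

definition is_functor :: "('o, 'm) cat \<Rightarrow> ('p, 'n) cat \<Rightarrow> ('o, 'm, 'p, 'n) functr \<Rightarrow> bool" where
  "is_functor C D F \<longleftrightarrow>
     (\<forall>X\<in>Ob C. FOb F X \<in> Ob D \<and> FMap F X X (Idn C X) = Idn D (FOb F X)) \<and>
     (\<forall>X\<in>Ob C. \<forall>Y\<in>Ob C. \<forall>f\<in>Hom C X Y. FMap F X Y f \<in> Hom D (FOb F X) (FOb F Y)) \<and>
     (\<forall>X\<in>Ob C. \<forall>Y\<in>Ob C. \<forall>Z\<in>Ob C. \<forall>f\<in>Hom C X Y. \<forall>g\<in>Hom C Y Z.
        FMap F X Z (Comp C X Y Z g f) =
          Comp D (FOb F X) (FOb F Y) (FOb F Z) (FMap F Y Z g) (FMap F X Y f))"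

definition is_iso :: "('o, 'm) cat \<Rightarrow> 'o \<Rightarrow> 'o \<Rightarrow> 'm \<Rightarrow> bool" where
  "is_iso C X Y f \<longleftrightarrow> f \<in> Hom C X Y \<and>
     (\<exists>g\<in>Hom C Y X. Comp C X Y X g f = Idn C X \<and> Comp C Y X Y f g = Idn C Y)"

definition is_mono :: "('o, 'm) cat \<Rightarrow> 'o \<Rightarrow> 'o \<Rightarrow> 'm \<Rightarrow> bool" where
  "is_mono C X Y f \<longleftrightarrow> f \<in> Hom C X Y \<and>
     (\<forall>Z\<in>Ob C. \<forall>g\<in>Hom C Z X. \<forall>h\<in>Hom C Z X. Comp C Z X Y f g = Comp C Z X Y f h \<longrightarrow> g = h)"

definition zero_object :: "('o, 'm) cat \<Rightarrow> 'o \<Rightarrow> bool" where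
  "zero_object C Z \<longleftrightarrow> Z \<in> Ob C \<and>
     (\<forall>X\<in>Ob C. (\<exists>!f. f \<in> Hom C X Z) \<and> (\<exists>!f. f \<in> Hom C Z X))"

definition irreducible_object :: "('o, 'm) cat \<Rightarrow> 'o \<Rightarrow> bool" where
  "irreducible_object C X \<longleftrightarrow> X \<in> Ob C \<and> \<not> zero_object C X \<and>
     (\<forall>Y\<in>Ob C. \<forall>f. is_mono C Y X f \<longrightarrow> zero_object C Y \<or> is_iso C Y X f)"

definition iso_class :: "('o, 'm) cat \<Rightarrow> 'o \<Rightarrow> 'o set" where
  "iso_class C X = {Y \<in> Ob C. \<exists>f. is_iso C X Y f}"

definition Irr :: "('o, 'm) cat \<Rightarrow> 'o set set" where
  "Irr C = iso_class C ` {X. irreducible_object C X}"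


section \<open>Modules over a not necessarily commutative ring\<close>

text \<open>
  The locale \<^locale>\<open>module\<close> requires a commutative ring of scalars, which rules out group
  algebras.  The fields \<open>mult\<close> and \<open>one\<close> of the module record play no role.
\<close>

locale left_module = R?: ring R + M?: abelian_group M
  for R :: "('r, 'x) ring_scheme" (structure) and M :: "('r, 'v, 'y) module_scheme" (structure) +
  assumes smult_closed:
      "\<lbrakk>a \<in> carrier R; x \<in> carrier M\<rbrakk> \<Longrightarrow> a \<odot>\<^bsub>M\<^esub> x \<in> carrier M"
    and smult_l_distr:
      "\<lbrakk>a \<in> carrier R; b \<in> carrier R; x \<in> carrier M\<rbrakk> \<Longrightarrow>
        (a \<oplus>\<^bsub>R\<^esub> b) \<odot>\<^bsub>M\<^esub> x = a \<odot>\<^bsub>M\<^esub> x \<oplus>\<^bsub>M\<^esub> b \<odot>\<^bsub>M\<^esub> x"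
    and smult_r_distr:
      "\<lbrakk>a \<in> carrier R; x \<in> carrier M; y \<in> carrier M\<rbrakk> \<Longrightarrow>
        a \<odot>\<^bsub>M\<^esub> (x \<oplus>\<^bsub>M\<^esub> y) = a \<odot>\<^bsub>M\<^esub> x \<oplus>\<^bsub>M\<^esub> a \<odot>\<^bsub>M\<^esub> y"
    and smult_assoc:
      "\<lbrakk>a \<in> carrier R; b \<in> carrier R; x \<in> carrier M\<rbrakk> \<Longrightarrow>
        (a \<otimes>\<^bsub>R\<^esub> b) \<odot>\<^bsub>M\<^esub> x = a \<odot>\<^bsub>M\<^esub> (b \<odot>\<^bsub>M\<^esub> x)"
    and smult_one: "x \<in> carrier M \<Longrightarrow> \<one>\<^bsub>R\<^esub> \<odot>\<^bsub>M\<^esub> x = x"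

lemma left_module_iff_module:
  assumes "cring R"
  shows "left_module R M \<longleftrightarrow> module R M"
  using assms
  by (auto simp: left_module_def left_module_axioms_def module_def module_axioms_def cring_def)

definition lin_maps ::
  "('r, 'x) ring_scheme \<Rightarrow> ('r, 'v, 'y) module_scheme \<Rightarrow> ('r, 'w, 'z) module_scheme \<Rightarrow> ('v \<Rightarrow> 'w) set"
  where
  "lin_maps R M N = {f \<in> carrier M \<rightarrow>\<^sub>E carrier N.
     (\<forall>x\<in>carrier M. \<forall>y\<in>carrier M. f (x \<oplus>\<^bsub>M\<^esub> y) = f x \<oplus>\<^bsub>N\<^esub> f y) \<and>
     (\<forall>a\<in>carrier R. \<forall>x\<in>carrier M. f (a \<odot>\<^bsub>M\<^esub> x) = a \<odot>\<^bsub>N\<^esub> f x)}"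

text \<open>The category of left \<open>R\<close>-modules whose underlying sets lie in the universe \<open>'v\<close>.\<close>

definition LMod :: "('r, 'x) ring_scheme \<Rightarrow> (('r, 'v) module, 'v \<Rightarrow> 'v) cat" where
  "LMod R = \<lparr>Ob = {M. left_module R M}, Hom = lin_maps R,
            Idn = (\<lambda>M. \<lambda>x\<in>carrier M. x),
            Comp = (\<lambda>M N P g f. compose (carrier M) g f)\<rparr>"

text \<open>The group algebra of a finite group (no finite support condition is imposed).\<close>

definition group_algebra ::
  "('k, 'x) ring_scheme \<Rightarrow> ('g, 'y) monoid_scheme \<Rightarrow> ('g \<Rightarrow> 'k) ring" where
  "group_algebra K G = \<lparr>carrier = carrier G \<rightarrow>\<^sub>E carrier K,
     mult = (\<lambda>a b. \<lambda>g\<in>carrier G. \<Oplus>\<^bsub>K\<^esub>h\<in>carrier G. a h \<otimes>\<^bsub>K\<^esub> b (inv\<^bsub>G\<^esub> h \<otimes>\<^bsub>G\<^esub> g)),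
     one = (\<lambda>g\<in>carrier G. if g = \<one>\<^bsub>G\<^esub> then \<one>\<^bsub>K\<^esub> else \<zero>\<^bsub>K\<^esub>),
     zero = (\<lambda>g\<in>carrier G. \<zero>\<^bsub>K\<^esub>),
     add = (\<lambda>a b. \<lambda>g\<in>carrier G. a g \<oplus>\<^bsub>K\<^esub> b g)\<rparr>"


section \<open>FI-modules\<close>

text \<open>
  Every finite set is isomorphic in FI to a finite set of natural numbers, so we use the (small,
  equivalent) full subcategory on the latter.
\<close>

definition FI :: "(nat set, nat \<Rightarrow> nat) cat" where
  "FI = \<lparr>Ob = {X. finite X}, Hom = (\<lambda>X Y. {f \<in> X \<rightarrow>\<^sub>E Y. inj_on f X}),
         Idn = (\<lambda>X. \<lambda>x\<in>X. x),
         Comp = (\<lambda>X Y Z g f. compose X g f)\<rparr>"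

type_synonym ('k, 'v) fi_mod = "(nat set, nat \<Rightarrow> nat, ('k, 'v) module, 'v \<Rightarrow> 'v) functr"

definition FI_module :: "('k, 'x) ring_scheme \<Rightarrow> ('k, 'v) fi_mod \<Rightarrow> bool" where
  "FI_module K M \<longleftrightarrow> is_functor FI (LMod K) M"

text \<open>
  Morphisms of FI-modules, i.e. natural transformations.  The two universes may differ because a
  quotient of an FI-module with elements in \<open>'v\<close> has elements (cosets) in \<open>'v set\<close>.
\<close>

definition FI_maps ::
  "('k, 'x) ring_scheme \<Rightarrow> ('k, 'v) fi_mod \<Rightarrow> ('k, 'w) fi_mod \<Rightarrow> (nat set \<Rightarrow> 'v \<Rightarrow> 'w) set" where
  "FI_maps K M N = {\<eta> \<in> (\<Pi>\<^sub>E X\<in>Ob FI. lin_maps K (FOb M X) (FOb N X)).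
     \<forall>X\<in>Ob FI. \<forall>Y\<in>Ob FI. \<forall>f\<in>Hom FI X Y. \<forall>x\<in>carrier (FOb M X).
       \<eta> Y (FMap M X Y f x) = FMap N X Y f (\<eta> X x)}"

definition torsion :: "('k, 'v) fi_mod \<Rightarrow> bool" where
  "torsion M \<longleftrightarrow> (\<forall>X\<in>Ob FI. \<forall>x\<in>carrier (FOb M X).
     \<exists>Y\<in>Ob FI. \<exists>f\<in>Hom FI X Y. FMap M X Y f x = \<zero>\<^bsub>FOb M Y\<^esub>)"

definition sub_FI :: "('k, 'x) ring_scheme \<Rightarrow> ('k, 'v) fi_mod \<Rightarrow> (nat set \<Rightarrow> 'v set) \<Rightarrow> bool" where
  "sub_FI K M U \<longleftrightarrow> (\<forall>X\<in>Ob FI. submodule (U X) K (FOb M X)) \<and>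
     (\<forall>X\<in>Ob FI. \<forall>Y\<in>Ob FI. \<forall>f\<in>Hom FI X Y. FMap M X Y f ` U X \<subseteq> U Y)"

definition restrict_FI :: "('k, 'v) fi_mod \<Rightarrow> (nat set \<Rightarrow> 'v set) \<Rightarrow> ('k, 'v) fi_mod" where
  "restrict_FI M U = \<lparr>FOb = (\<lambda>X. (FOb M X)\<lparr>carrier := U X\<rparr>),
                      FMap = (\<lambda>X Y f. restrict (FMap M X Y f) (U X))\<rparr>"

definition quot_module :: "('k, 'v) module \<Rightarrow> 'v set \<Rightarrow> ('k, 'v set) module" where
  "quot_module V W = \<lparr>carrier = a_rcosets\<^bsub>V\<^esub> W, mult = undefined, one = undefined,
     zero = W, add = (\<lambda>A B. A <+>\<^bsub>V\<^esub> B),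
     smult = (\<lambda>a A. \<Union>x\<in>A. W +>\<^bsub>V\<^esub> (a \<odot>\<^bsub>V\<^esub> x))\<rparr>"

definition quot_FI :: "('k, 'v) fi_mod \<Rightarrow> (nat set \<Rightarrow> 'v set) \<Rightarrow> ('k, 'v set) fi_mod" where
  "quot_FI M W = \<lparr>FOb = (\<lambda>X. quot_module (FOb M X) (W X)),
     FMap = (\<lambda>X Y f. \<lambda>A\<in>a_rcosets\<^bsub>FOb M X\<^esub> (W X). \<Union>x\<in>A. W Y +>\<^bsub>FOb M Y\<^esub> FMap M X Y f x)\<rparr>"


section \<open>Generic FI-modules\<close>

text \<open>
  The Serre quotient by torsion modules has the same objects as the category of FI-modules, and
  \<open>Hom(M, N)\<close> is the colimit of \<open>Hom(U, N/W)\<close> over all submodules \<open>U\<close> of \<open>M\<close> with \<open>M/U\<close> torsion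
  and all torsion submodules \<open>W\<close> of \<open>N\<close>.  The colimit is directed, so it is a set of equivalence
  classes of triples \<open>(U, W, f)\<close>, where two triples are equivalent if they agree after shrinking
  \<open>U\<close> and enlarging \<open>W\<close>.
\<close>

type_synonym 'v gen_arrow = "(nat set \<Rightarrow> 'v set) \<times> (nat set \<Rightarrow> 'v set) \<times> (nat set \<Rightarrow> 'v \<Rightarrow> 'v set)"

definition cotorsion_sub ::
  "('k, 'x) ring_scheme \<Rightarrow> ('k, 'v) fi_mod \<Rightarrow> (nat set \<Rightarrow> 'v set) \<Rightarrow> bool" where
  "cotorsion_sub K M U \<longleftrightarrow> sub_FI K M U \<and> torsion (quot_FI M U)"

definition torsion_sub ::
  "('k, 'x) ring_scheme \<Rightarrow> ('k, 'v) fi_mod \<Rightarrow> (nat set \<Rightarrow> 'v set) \<Rightarrow> bool" where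
  "torsion_sub K N W \<longleftrightarrow> sub_FI K N W \<and> torsion (restrict_FI N W)"

definition gen_rep ::
  "('k, 'x) ring_scheme \<Rightarrow> ('k, 'v) fi_mod \<Rightarrow> ('k, 'v) fi_mod \<Rightarrow> 'v gen_arrow set" where
  "gen_rep K M N = {(U, W, f). cotorsion_sub K M U \<and> torsion_sub K N W \<and>
     f \<in> FI_maps K (restrict_FI M U) (quot_FI N W)}"

text \<open>
  For a coset \<open>f X x\<close> of \<open>W X\<close> and \<open>W X \<subseteq> W'' X\<close>, the set \<open>W'' X <+> f X x\<close> is its image in
  the quotient by \<open>W'' X\<close>.
\<close>

definition gen_rel ::
  "('k, 'x) ring_scheme \<Rightarrow> ('k, 'v) fi_mod \<Rightarrow> ('k, 'v) fi_mod \<Rightarrow> 'v gen_arrow rel" where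
  "gen_rel K M N = {((U, W, f), (U', W', f')).
     (U, W, f) \<in> gen_rep K M N \<and> (U', W', f') \<in> gen_rep K M N \<and>
     (\<exists>U'' W''. cotorsion_sub K M U'' \<and> torsion_sub K N W'' \<and>
        (\<forall>X\<in>Ob FI. U'' X \<subseteq> U X \<inter> U' X \<and> W X \<union> W' X \<subseteq> W'' X \<and>
           (\<forall>x\<in>U'' X. W'' X <+>\<^bsub>FOb N X\<^esub> f X x = W'' X <+>\<^bsub>FOb N X\<^esub> f' X x)))}"

text \<open>
  Let \<open>f : U \<rightarrow> N/W\<close> and \<open>g : U' \<rightarrow> P/W'\<close> with \<open>U'\<close> a submodule of \<open>N\<close>.  The composite is defined
  on the preimage under \<open>f\<close> of \<open>(U' + W)/W\<close>, which is isomorphic to \<open>U'/(U' \<inter> W)\<close>, and takes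
  values in the quotient of \<open>P\<close> by the preimage of \<open>g(U' \<inter> W)\<close>.
\<close>

definition gen_comp_rep :: "'v gen_arrow \<Rightarrow> 'v gen_arrow \<Rightarrow> 'v gen_arrow" where
  "gen_comp_rep = (\<lambda>(U', W', g) (U, W, f).
     let U'' = (\<lambda>X. {x \<in> U X. f X x \<inter> U' X \<noteq> {}});
         W'' = (\<lambda>X. \<Union>y\<in>W X \<inter> U' X. g X y)
     in (U'', W'', \<lambda>X\<in>Ob FI. \<lambda>x\<in>U'' X. \<Union>y\<in>f X x \<inter> U' X. g X y))"

definition gen_id_rep :: "('k, 'v) fi_mod \<Rightarrow> 'v gen_arrow" where
  "gen_id_rep M = (\<lambda>X. carrier (FOb M X), \<lambda>X. {\<zero>\<^bsub>FOb M X\<^esub>},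
     \<lambda>X\<in>Ob FI. \<lambda>x\<in>carrier (FOb M X). {x})"

definition Gen ::
  "('k, 'x) ring_scheme \<Rightarrow> (('k, 'v) fi_mod, 'v gen_arrow set) cat" where
  "Gen K = \<lparr>Ob = {M. FI_module K M},
     Hom = (\<lambda>M N. gen_rep K M N // gen_rel K M N),
     Idn = (\<lambda>M. gen_rel K M M `` {gen_id_rep M}),
     Comp = (\<lambda>M N P G F. gen_rel K M P `` {gen_comp_rep g f |g f. g \<in> G \<and> f \<in> F})\<rparr>"


section \<open>Induced FI-modules\<close>

text \<open>
  The value at \<open>{1..n}\<close> of an FI-module, as a module over the group algebra of the symmetric group.
\<close>

definition eval_at :: "nat \<Rightarrow> ('k, 'v) fi_mod \<Rightarrow> ((nat \<Rightarrow> nat) \<Rightarrow> 'k, 'v) module" where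
  "eval_at n M = (let V = FOb M {1..n} in
     \<lparr>carrier = carrier V, mult = undefined, one = undefined, zero = zero V, add = add V,
      smult = (\<lambda>a x. \<Oplus>\<^bsub>V\<^esub>\<sigma>\<in>carrier (sym_group n).
                 a \<sigma> \<odot>\<^bsub>V\<^esub> FMap M {1..n} {1..n} (restrict \<sigma> {1..n}) x)\<rparr>)"

text \<open>
  \<open>P\<close> is the FI-module induced from the module \<open>E\<close> over the group algebra of the symmetric group on
  \<open>n\<close> letters: the value at \<open>E\<close> of the left adjoint of \<^const>\<open>eval_at\<close>, characterized by its
  universal property.
\<close>

definition induced_FI ::
  "('k, 'x) ring_scheme \<Rightarrow> nat \<Rightarrow> ((nat \<Rightarrow> nat) \<Rightarrow> 'k, 'v) module \<Rightarrow> ('k, 'v) fi_mod \<Rightarrow> bool" where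
  "induced_FI K n E P \<longleftrightarrow> FI_module K P \<and>
     (\<exists>\<eta>\<in>lin_maps (group_algebra K (sym_group n)) E (eval_at n P).
        \<forall>Q :: ('k, 'v) fi_mod. FI_module K Q \<longrightarrow>
          (\<forall>\<phi>\<in>lin_maps (group_algebra K (sym_group n)) E (eval_at n Q).
             \<exists>!\<psi>. \<psi> \<in> FI_maps K P Q \<and> (\<forall>e\<in>carrier E. \<psi> {1..n} (\<eta> e) = \<phi> e)))"

end

theory Submission imports Defs begin

text \<open>
  Modulo torsion, an FI-module amounts to its colimit \<open>V\<close> over the finite subsets of the natural
  numbers, a representation of the monoid of injections \<open>\<nat> \<rightarrow> \<nat>\<close> all of whose elements have finite
  support; generic morphisms are the equivariant maps between the colimits.  For a module \<open>E\<close> over the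
  group algebra of the symmetric group on \<open>n\<close> letters, the induced FI-module gives the representation
  \<open>F(E)\<close> of finitely supported equivariant functions from the injections \<open>{1..n} \<rightarrow> \<nat>\<close> to \<open>E\<close>.

  Let \<open>D\<^sub>n\<close> be the product over \<open>a = 1, \<dots>, n\<close> of the differences \<open>1 - (a a')\<close> with fresh letters \<open>a'\<close>.
  If \<open>V\<close> is irreducible, then \<open>D\<^sub>n V\<close> vanishes for large \<open>n\<close>.  For the largest \<open>n\<close> with \<open>D\<^sub>n V \<noteq> 0\<close> the
  space \<open>E = D\<^sub>n V\<close> is an irreducible module of the symmetric group, and sending \<open>v\<close> to the function
  \<open>f \<mapsto> D\<^sub>n (g v)\<close>, with \<open>g\<close> any injection that inverts \<open>f\<close>, embeds \<open>V\<close> in \<open>F(E)\<close>.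
  Conversely, for irreducible \<open>E\<close> every nonzero subrepresentation of \<open>F(E)\<close> contains the nonzero space \<open>D\<^sub>n F(E)\<close>, so that \<open>F(E)\<close> has a unique
  irreducible subrepresentation \<open>V\<close>, and \<open>E \<cong> V / ker D\<^sub>n\<close> is recovered from \<open>V\<close>.
\<close>

section \<open>Linear algebra\<close>

text \<open>A vector with \<open>m\<close> letters in its support is killed by every product of more
  than \<open>m\<close> differences, because a factor at a letter outside the support is zero;
  irreducibility passes this bound to all of \<open>V\<close>. Maximality of \<open>n\<close> does
  the real work: every further difference kills \<open>D\<^sub>n v\<close>, so an outside letter may
  be swapped with a fresh one, and therefore \<open>D\<^sub>n v\<close> has its support over
  \<open>1, \<dots>, n\<close>. This makes the coefficient at \<open>f\<close> independent of the
  choice of \<open>g\<close>. Fresh letters become canonical by doubling: \<open>a\<close> turns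
  into \<open>2 a\<close>, with \<open>2 a + 1\<close> as its fresh partner.

  The other obstacle is typing. Objects must have elements in one type \<open>'v\<close>, while
  colimits consist of germs and induced modules of functions; both are coded back into
  \<open>'v\<close>, which is possible because \<open>'v\<close> is infinite. Generic arrows, which
  are classes of triples, are compared through the relations that they induce between
  colimits.\<close>

context left_module
begin

lemma smult_l_null:
  assumes x: "x \<in> carrier M" shows "\<zero>\<^bsub>R\<^esub> \<odot>\<^bsub>M\<^esub> x = \<zero>\<^bsub>M\<^esub>"
proof -
  have "\<zero>\<^bsub>R\<^esub> \<odot>\<^bsub>M\<^esub> x \<oplus>\<^bsub>M\<^esub> \<zero>\<^bsub>R\<^esub> \<odot>\<^bsub>M\<^esub> x = \<zero>\<^bsub>R\<^esub> \<odot>\<^bsub>M\<^esub> x"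
    using smult_l_distr[of "\<zero>\<^bsub>R\<^esub>" "\<zero>\<^bsub>R\<^esub>" x] x by simp
  then show ?thesis using smult_closed[OF R.zero_closed x] by (metis M.add.r_cancel_one')
qed

lemma smult_r_null:
  assumes a: "a \<in> carrier R" shows "a \<odot>\<^bsub>M\<^esub> \<zero>\<^bsub>M\<^esub> = \<zero>\<^bsub>M\<^esub>"
proof -
  have "a \<odot>\<^bsub>M\<^esub> \<zero>\<^bsub>M\<^esub> \<oplus>\<^bsub>M\<^esub> a \<odot>\<^bsub>M\<^esub> \<zero>\<^bsub>M\<^esub> = a \<odot>\<^bsub>M\<^esub> \<zero>\<^bsub>M\<^esub>"
    using smult_r_distr[of a "\<zero>\<^bsub>M\<^esub>" "\<zero>\<^bsub>M\<^esub>"] a by simp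
  then show ?thesis using smult_closed[OF a M.zero_closed] by (metis M.add.r_cancel_one')
qed

lemma smult_minus_one:
  assumes x: "x \<in> carrier M" shows "(\<ominus>\<^bsub>R\<^esub> \<one>\<^bsub>R\<^esub>) \<odot>\<^bsub>M\<^esub> x = \<ominus>\<^bsub>M\<^esub> x"
proof -
  have "(\<ominus>\<^bsub>R\<^esub> \<one>\<^bsub>R\<^esub>) \<odot>\<^bsub>M\<^esub> x \<oplus>\<^bsub>M\<^esub> x = \<zero>\<^bsub>M\<^esub>"
    using smult_l_distr[of "\<ominus>\<^bsub>R\<^esub> \<one>\<^bsub>R\<^esub>" "\<one>\<^bsub>R\<^esub>" x] x by (simp add: smult_one R.l_neg smult_l_null)
  then show ?thesis using smult_closed[of "\<ominus>\<^bsub>R\<^esub> \<one>\<^bsub>R\<^esub>" x] x by (metis M.minus_equality R.a_inv_closed R.one_closed)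
qed

lemma smult_minus:
  assumes "a \<in> carrier R" "x \<in> carrier M" shows "a \<odot>\<^bsub>M\<^esub> (\<ominus>\<^bsub>M\<^esub> x) = \<ominus>\<^bsub>M\<^esub> (a \<odot>\<^bsub>M\<^esub> x)"
proof -
  have "a \<odot>\<^bsub>M\<^esub> (\<ominus>\<^bsub>M\<^esub> x) \<oplus>\<^bsub>M\<^esub> a \<odot>\<^bsub>M\<^esub> x = \<zero>\<^bsub>M\<^esub>"
    using smult_r_distr[of a "\<ominus>\<^bsub>M\<^esub> x" x] assms by (simp add: M.l_neg smult_r_null)
  then show ?thesis using assms by (metis M.minus_equality smult_closed M.a_inv_closed)
qed

text \<open>Closure under inverses, which \<open>submodule\<close> inherits from
  \<open>subgroup\<close>, comes from multiplication by minus one.\<close>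

lemma submoduleI:
  assumes sub: "H \<subseteq> carrier M" and z: "\<zero>\<^bsub>M\<^esub> \<in> H"
    and add: "\<And>x y. x \<in> H \<Longrightarrow> y \<in> H \<Longrightarrow> x \<oplus>\<^bsub>M\<^esub> y \<in> H"
    and sm: "\<And>a x. a \<in> carrier R \<Longrightarrow> x \<in> H \<Longrightarrow> a \<odot>\<^bsub>M\<^esub> x \<in> H"
  shows "submodule H R M"
proof -
  have "\<ominus>\<^bsub>M\<^esub> x \<in> H" if "x \<in> H" for x
    using sm[of "\<ominus>\<^bsub>R\<^esub> \<one>\<^bsub>R\<^esub>" x] smult_minus_one[of x] that sub by auto
  then show ?thesis
    using assms by (auto simp: submodule_def subgroup_def submodule_axioms_def a_inv_def)
qed

lemma submoduleD:
  assumes "submodule H R M"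
  shows "H \<subseteq> carrier M" "\<zero>\<^bsub>M\<^esub> \<in> H" "\<And>x. x \<in> H \<Longrightarrow> x \<in> carrier M"
    "\<And>x y. x \<in> H \<Longrightarrow> y \<in> H \<Longrightarrow> x \<oplus>\<^bsub>M\<^esub> y \<in> H"
    "\<And>a x. a \<in> carrier R \<Longrightarrow> x \<in> H \<Longrightarrow> a \<odot>\<^bsub>M\<^esub> x \<in> H"
    "\<And>x. x \<in> H \<Longrightarrow> \<ominus>\<^bsub>M\<^esub> x \<in> H"
    "\<And>x y. x \<in> H \<Longrightarrow> y \<in> H \<Longrightarrow> x \<ominus>\<^bsub>M\<^esub> y \<in> H"
  using assms by (auto simp: submodule_def subgroup_def submodule_axioms_def a_inv_def a_minus_def)

lemma carrier_submodule: "submodule (carrier M) R M"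
  by (rule submoduleI) (auto simp: smult_closed)

lemma zero_submodule: "submodule {\<zero>\<^bsub>M\<^esub>} R M"
  by (rule submoduleI) (auto simp: smult_r_null)

lemma left_module_submodule:
  assumes H: "submodule H R M"
  shows "left_module R (M\<lparr>carrier := H\<rparr>)"
proof -
  note h = submoduleD[OF H]
  have "abelian_group (M\<lparr>carrier := H\<rparr>)"
  proof (rule abelian_groupI)
    fix x assume "x \<in> carrier (M\<lparr>carrier := H\<rparr>)"
    then have "x \<in> H" by simp
    then show "\<exists>y\<in>carrier (M\<lparr>carrier := H\<rparr>). y \<oplus>\<^bsub>M\<lparr>carrier := H\<rparr>\<^esub> x = \<zero>\<^bsub>M\<lparr>carrier := H\<rparr>\<^esub>"
      using h by (intro bexI[of _ "\<ominus>\<^bsub>M\<^esub> x"]) (auto simp: M.l_neg)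
  qed (use h in \<open>auto simp: M.a_ac\<close>)
  then show ?thesis
    using h R.ring_axioms
    by (auto simp: left_module_def left_module_axioms_def smult_l_distr smult_r_distr smult_assoc smult_one)
qed

end

lemma left_moduleI:
  assumes "ring R"
    and "\<And>x y. x \<in> carrier M \<Longrightarrow> y \<in> carrier M \<Longrightarrow> x \<oplus>\<^bsub>M\<^esub> y \<in> carrier M"
    and "\<zero>\<^bsub>M\<^esub> \<in> carrier M"
    and "\<And>x y z. x \<in> carrier M \<Longrightarrow> y \<in> carrier M \<Longrightarrow> z \<in> carrier M \<Longrightarrow> (x \<oplus>\<^bsub>M\<^esub> y) \<oplus>\<^bsub>M\<^esub> z = x \<oplus>\<^bsub>M\<^esub> (y \<oplus>\<^bsub>M\<^esub> z)"
    and "\<And>x y. x \<in> carrier M \<Longrightarrow> y \<in> carrier M \<Longrightarrow> x \<oplus>\<^bsub>M\<^esub> y = y \<oplus>\<^bsub>M\<^esub> x"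
    and "\<And>x. x \<in> carrier M \<Longrightarrow> \<zero>\<^bsub>M\<^esub> \<oplus>\<^bsub>M\<^esub> x = x"
    and "\<And>x. x \<in> carrier M \<Longrightarrow> \<exists>y\<in>carrier M. y \<oplus>\<^bsub>M\<^esub> x = \<zero>\<^bsub>M\<^esub>"
    and "\<And>a x. a \<in> carrier R \<Longrightarrow> x \<in> carrier M \<Longrightarrow> a \<odot>\<^bsub>M\<^esub> x \<in> carrier M"
    and "\<And>a b x. a \<in> carrier R \<Longrightarrow> b \<in> carrier R \<Longrightarrow> x \<in> carrier M \<Longrightarrow>
        (a \<oplus>\<^bsub>R\<^esub> b) \<odot>\<^bsub>M\<^esub> x = a \<odot>\<^bsub>M\<^esub> x \<oplus>\<^bsub>M\<^esub> b \<odot>\<^bsub>M\<^esub> x"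
    and "\<And>a x y. a \<in> carrier R \<Longrightarrow> x \<in> carrier M \<Longrightarrow> y \<in> carrier M \<Longrightarrow>
        a \<odot>\<^bsub>M\<^esub> (x \<oplus>\<^bsub>M\<^esub> y) = a \<odot>\<^bsub>M\<^esub> x \<oplus>\<^bsub>M\<^esub> a \<odot>\<^bsub>M\<^esub> y"
    and "\<And>a b x. a \<in> carrier R \<Longrightarrow> b \<in> carrier R \<Longrightarrow> x \<in> carrier M \<Longrightarrow>
        (a \<otimes>\<^bsub>R\<^esub> b) \<odot>\<^bsub>M\<^esub> x = a \<odot>\<^bsub>M\<^esub> (b \<odot>\<^bsub>M\<^esub> x)"
    and "\<And>x. x \<in> carrier M \<Longrightarrow> \<one>\<^bsub>R\<^esub> \<odot>\<^bsub>M\<^esub> x = x"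
  shows "left_module R M"
  unfolding left_module_def left_module_axioms_def
  by (intro conjI abelian_groupI allI impI) (use assms in auto)

lemma lin_mapsI:
  assumes "\<And>x. x \<in> carrier M \<Longrightarrow> f x \<in> carrier N" "f \<in> extensional (carrier M)"
    "\<And>x y. x \<in> carrier M \<Longrightarrow> y \<in> carrier M \<Longrightarrow> f (x \<oplus>\<^bsub>M\<^esub> y) = f x \<oplus>\<^bsub>N\<^esub> f y"
    "\<And>a x. a \<in> carrier R \<Longrightarrow> x \<in> carrier M \<Longrightarrow> f (a \<odot>\<^bsub>M\<^esub> x) = a \<odot>\<^bsub>N\<^esub> f x"
  shows "f \<in> lin_maps R M N"
  using assms by (auto simp: lin_maps_def PiE_def)

lemma lin_mapsD:
  assumes "f \<in> lin_maps R M N"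
  shows "\<And>x. x \<in> carrier M \<Longrightarrow> f x \<in> carrier N" "f \<in> extensional (carrier M)"
    "\<And>x y. x \<in> carrier M \<Longrightarrow> y \<in> carrier M \<Longrightarrow> f (x \<oplus>\<^bsub>M\<^esub> y) = f x \<oplus>\<^bsub>N\<^esub> f y"
    "\<And>a x. a \<in> carrier R \<Longrightarrow> x \<in> carrier M \<Longrightarrow> f (a \<odot>\<^bsub>M\<^esub> x) = a \<odot>\<^bsub>N\<^esub> f x"
  using assms by (auto simp: lin_maps_def PiE_def)

lemma lin_maps_eqI:
  assumes "f \<in> lin_maps R M N" "g \<in> lin_maps R M N'" "\<And>x. x \<in> carrier M \<Longrightarrow> f x = g x"
  shows "f = g"
  using extensionalityI[OF lin_mapsD(2)[OF assms(1)] lin_mapsD(2)[OF assms(2)]] assms(3) by blast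

locale lin_map = M: left_module R M + N: left_module R N
  for R :: "('r, 'x) ring_scheme" and M :: "('r, 'v, 'y) module_scheme"
    and N :: "('r, 'w, 'z) module_scheme" +
  fixes f assumes lin: "f \<in> lin_maps R M N"
begin

lemmas closed = lin_mapsD(1)[OF lin] and ext = lin_mapsD(2)[OF lin]
  and add = lin_mapsD(3)[OF lin] and smult = lin_mapsD(4)[OF lin]

lemma zero: "f \<zero>\<^bsub>M\<^esub> = \<zero>\<^bsub>N\<^esub>"
  by (metis M.R.zero_closed M.M.zero_closed M.smult_l_null N.smult_l_null closed smult)

lemma minus: "x \<in> carrier M \<Longrightarrow> f (\<ominus>\<^bsub>M\<^esub> x) = \<ominus>\<^bsub>N\<^esub> f x"
  by (metis M.R.one_closed M.R.a_inv_closed M.smult_minus_one N.smult_minus_one closed smult)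

lemma diff: "x \<in> carrier M \<Longrightarrow> y \<in> carrier M \<Longrightarrow> f (x \<ominus>\<^bsub>M\<^esub> y) = f x \<ominus>\<^bsub>N\<^esub> f y"
  by (simp add: a_minus_def add minus)

lemma kernel: "submodule {x \<in> carrier M. f x = \<zero>\<^bsub>N\<^esub>} R M"
  by (rule M.submoduleI) (auto simp: zero add smult M.smult_closed N.smult_r_null)

lemma vimage: "submodule H R N \<Longrightarrow> submodule {x \<in> carrier M. f x \<in> H} R M"
  by (rule M.submoduleI) (auto simp: zero add smult M.smult_closed dest: N.submoduleD)

lemma image: "submodule H R M \<Longrightarrow> submodule (f ` H) R N"
proof (rule N.submoduleI)
  assume H: "submodule H R M"
  note h = M.submoduleD[OF H]
  show "f ` H \<subseteq> carrier N" using h closed by auto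
  show "\<zero>\<^bsub>N\<^esub> \<in> f ` H" using h(2) zero by (metis imageI)
  show "x \<oplus>\<^bsub>N\<^esub> y \<in> f ` H" if "x \<in> f ` H" "y \<in> f ` H" for x y
  proof -
    from that obtain u v where "u \<in> H" "v \<in> H" "x = f u" "y = f v" by blast
    then show ?thesis using h(3,4) add[of u v] by (intro image_eqI[of _ _ "u \<oplus>\<^bsub>M\<^esub> v"]) auto
  qed
  show "a \<odot>\<^bsub>N\<^esub> x \<in> f ` H" if "a \<in> carrier R" "x \<in> f ` H" for a x
  proof -
    from that obtain u where "u \<in> H" "x = f u" by blast
    then show ?thesis using that h(3,5) smult[of a u] by (intro image_eqI[of _ _ "a \<odot>\<^bsub>M\<^esub> u"]) auto
  qed
qed

lemma inj_iff: "inj_on f (carrier M) \<longleftrightarrow> (\<forall>x\<in>carrier M. f x = \<zero>\<^bsub>N\<^esub> \<longrightarrow> x = \<zero>\<^bsub>M\<^esub>)"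
proof
  assume "inj_on f (carrier M)"
  then show "\<forall>x\<in>carrier M. f x = \<zero>\<^bsub>N\<^esub> \<longrightarrow> x = \<zero>\<^bsub>M\<^esub>"
    by (metis M.M.zero_closed inj_onD zero)
next
  assume *: "\<forall>x\<in>carrier M. f x = \<zero>\<^bsub>N\<^esub> \<longrightarrow> x = \<zero>\<^bsub>M\<^esub>"
  show "inj_on f (carrier M)"
  proof (rule inj_onI)
    fix x y assume xy: "x \<in> carrier M" "y \<in> carrier M" "f x = f y"
    then have "f (x \<ominus>\<^bsub>M\<^esub> y) = \<zero>\<^bsub>N\<^esub>" by (simp add: diff closed) (metis N.M.r_neg a_minus_def closed)
    then have "x \<ominus>\<^bsub>M\<^esub> y = \<zero>\<^bsub>M\<^esub>" using * xy by blast
    then show "x = y" using xy by (metis M.M.add.inv_comm M.M.minus_equality M.M.minus_minus M.M.a_inv_closed a_minus_def)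
  qed
qed

lemma inverse:
  assumes "bij_betw f (carrier M) (carrier N)"
  shows "restrict (inv_into (carrier M) f) (carrier N) \<in> lin_maps R N M"
proof (rule lin_mapsI)
  let ?g = "restrict (inv_into (carrier M) f) (carrier N)"
  have gc: "?g y \<in> carrier M" and fg: "f (?g y) = y" if "y \<in> carrier N" for y
    using that assms by (auto simp: bij_betw_def inv_into_into f_inv_into_f)
  have gf: "?g (f x) = x" if "x \<in> carrier M" for x
    using that assms closed by (auto simp: bij_betw_def)
  show "?g y \<in> carrier M" if "y \<in> carrier N" for y using gc that .
  show "?g \<in> extensional (carrier N)" by simp
  show "?g (x \<oplus>\<^bsub>N\<^esub> y) = ?g x \<oplus>\<^bsub>M\<^esub> ?g y" if "x \<in> carrier N" "y \<in> carrier N" for x y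
    using gf[of "?g x \<oplus>\<^bsub>M\<^esub> ?g y"] gc that fg by (simp add: add)
  show "?g (a \<odot>\<^bsub>N\<^esub> x) = a \<odot>\<^bsub>M\<^esub> ?g x" if "a \<in> carrier R" "x \<in> carrier N" for a x
    using gf[of "a \<odot>\<^bsub>M\<^esub> ?g x"] gc[of x] that fg[of x] smult[of a "?g x"] M.smult_closed[of a "?g x"] by metis
qed

end

lemma lin_map_iff: "lin_map R M N f \<longleftrightarrow> left_module R M \<and> left_module R N \<and> f \<in> lin_maps R M N"
  by (auto simp: lin_map_def lin_map_axioms_def)

definition simple_module :: "('r, 'x) ring_scheme \<Rightarrow> ('r, 'v, 'y) module_scheme \<Rightarrow> bool" where
  "simple_module R M \<longleftrightarrow> left_module R M \<and> carrier M \<noteq> {\<zero>\<^bsub>M\<^esub>} \<and>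
     (\<forall>H. submodule H R M \<longrightarrow> H = {\<zero>\<^bsub>M\<^esub>} \<or> H = carrier M)"

lemma lin_maps_compose:
  assumes "left_module R M" "f \<in> lin_maps R M N" "g \<in> lin_maps R N P"
  shows "compose (carrier M) g f \<in> lin_maps R M P"
proof -
  interpret M: left_module R M by fact
  show ?thesis
    by (rule lin_mapsI) (use lin_mapsD[OF assms(2)] lin_mapsD[OF assms(3)] in \<open>auto simp: compose_eq M.smult_closed compose_extensional\<close>)
qed

lemma lin_maps_id:
  assumes "left_module R M" shows "(\<lambda>x\<in>carrier M. x) \<in> lin_maps R M M"
proof -
  interpret M: left_module R M by fact
  show ?thesis by (rule lin_mapsI) (auto simp: M.smult_closed)
qed

lemma lin_maps_zero:
  assumes "left_module R M" "left_module R N"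
  shows "(\<lambda>x\<in>carrier M. \<zero>\<^bsub>N\<^esub>) \<in> lin_maps R M N"
proof -
  interpret M: left_module R M by fact
  interpret N: left_module R N by fact
  show ?thesis by (rule lin_mapsI) (auto simp: M.smult_closed N.smult_r_null)
qed

lemma lin_maps_incl:
  assumes "left_module R M" "submodule H R M"
  shows "(\<lambda>x\<in>H. x) \<in> lin_maps R (M\<lparr>carrier := H\<rparr>) M"
proof -
  interpret M: left_module R M by fact
  show ?thesis by (rule lin_mapsI) (use M.submoduleD[OF assms(2)] in auto)
qed

section \<open>Categorical notions made concrete in the category of modules\<close>

lemma LMod_simps [simp]:
  "M \<in> Ob (LMod R) \<longleftrightarrow> left_module R M" "Hom (LMod R) = lin_maps R"
  "Idn (LMod R) M = (\<lambda>x\<in>carrier M. x)" "Comp (LMod R) M N P g f = compose (carrier M) g f"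
  by (auto simp: LMod_def)

text \<open>A zero object has only one endomorphism, so its identity is the zero map.\<close>

lemma zero_object_LMod:
  fixes M :: "('r, 'v) module"
  assumes "left_module R M"
  shows "zero_object (LMod R) M \<longleftrightarrow> carrier M = {\<zero>\<^bsub>M\<^esub>}"
proof
  interpret M: left_module R M by fact
  assume "zero_object (LMod R) M"
  then have "\<exists>!f. f \<in> lin_maps R M M" using assms by (auto simp: zero_object_def)
  then have "(\<lambda>x\<in>carrier M. x) = (\<lambda>x\<in>carrier M. \<zero>\<^bsub>M\<^esub>)"
    using lin_maps_id[OF assms] lin_maps_zero[OF assms assms] by auto
  then show "carrier M = {\<zero>\<^bsub>M\<^esub>}" using M.M.zero_closed by (metis (no_types, lifting) restrict_apply' singletonD singletonI subsetI subset_antisym)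
next
  interpret M: left_module R M by fact
  assume z: "carrier M = {\<zero>\<^bsub>M\<^esub>}"
  show "zero_object (LMod R) M"
    unfolding zero_object_def
  proof (intro conjI ballI)
    show "M \<in> Ob (LMod R)" using assms by simp
    fix N :: "('r, 'v) module" assume "N \<in> Ob (LMod R)"
    then have N: "left_module R N" by simp
    interpret N: left_module R N by fact
    show "\<exists>!f. f \<in> Hom (LMod R) N M"
      by (rule ex1I[of _ "\<lambda>x\<in>carrier N. \<zero>\<^bsub>M\<^esub>"])
        (use lin_maps_zero[OF N assms] in \<open>auto simp: z intro!: lin_maps_eqI dest: lin_mapsD(1)\<close>)
    show "\<exists>!f. f \<in> Hom (LMod R) M N"
    proof (rule ex1I[of _ "\<lambda>x\<in>carrier M. \<zero>\<^bsub>N\<^esub>"])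
      show "(\<lambda>x\<in>carrier M. \<zero>\<^bsub>N\<^esub>) \<in> Hom (LMod R) M N" using lin_maps_zero[OF assms N] by simp
      fix f assume f: "f \<in> Hom (LMod R) M N"
      then interpret f: lin_map R M N f using assms N by (simp add: lin_map_iff)
      show "f = (\<lambda>x\<in>carrier M. \<zero>\<^bsub>N\<^esub>)"
        using f lin_maps_zero[OF assms N] by (intro lin_maps_eqI) (auto simp: z f.zero)
    qed
  qed
qed

lemma is_iso_LMod:
  fixes M N :: "('r, 'v) module"
  assumes "left_module R M" "left_module R N"
  shows "is_iso (LMod R) M N f \<longleftrightarrow> f \<in> lin_maps R M N \<and> bij_betw f (carrier M) (carrier N)"
proof
  assume "is_iso (LMod R) M N f"
  then obtain g where f: "f \<in> lin_maps R M N" and g: "g \<in> lin_maps R N M"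
    and gf: "compose (carrier M) g f = (\<lambda>x\<in>carrier M. x)" and fg: "compose (carrier N) f g = (\<lambda>x\<in>carrier N. x)"
    by (auto simp: is_iso_def)
  have "bij_betw f (carrier M) (carrier N)"
  proof (rule bij_betw_byWitness[where f' = g])
    show "\<forall>x\<in>carrier M. g (f x) = x" using fun_cong[OF gf] by (metis compose_eq restrict_apply')
    show "\<forall>x\<in>carrier N. f (g x) = x" using fun_cong[OF fg] by (metis compose_eq restrict_apply')
  qed (use lin_mapsD(1)[OF f] lin_mapsD(1)[OF g] in auto)
  with f show "f \<in> lin_maps R M N \<and> bij_betw f (carrier M) (carrier N)" by blast
next
  assume f: "f \<in> lin_maps R M N \<and> bij_betw f (carrier M) (carrier N)"
  then interpret f: lin_map R M N f using assms by (simp add: lin_map_iff)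
  have b: "bij_betw f (carrier M) (carrier N)" using f by blast
  show "is_iso (LMod R) M N f"
    unfolding is_iso_def
  proof (intro conjI bexI)
    show "f \<in> Hom (LMod R) M N" using f by simp
    show "restrict (inv_into (carrier M) f) (carrier N) \<in> Hom (LMod R) N M" using f.inverse b by simp
  qed (use b f.closed in \<open>auto simp: fun_eq_iff compose_def bij_betw_def f_inv_into_f\<close>)
qed

text \<open>A monomorphism is tested against the inclusion of its kernel and the zero map out of the
  kernel. The kernel is a legitimate test object because a submodule keeps the element type.\<close>

lemma is_mono_LMod:
  fixes M N :: "('r, 'v) module"
  assumes "left_module R M" "left_module R N"
  shows "is_mono (LMod R) M N f \<longleftrightarrow> f \<in> lin_maps R M N \<and> inj_on f (carrier M)"
proof
  assume m: "is_mono (LMod R) M N f"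
  then interpret f: lin_map R M N f using assms by (simp add: lin_map_iff is_mono_def)
  define H where "H = {x \<in> carrier M. f x = \<zero>\<^bsub>N\<^esub>}"
  have H: "submodule H R M" unfolding H_def by (rule f.kernel)
  let ?Z = "M\<lparr>carrier := H\<rparr>"
  have Z: "left_module R ?Z" by (rule f.M.left_module_submodule[OF H])
  have i: "(\<lambda>x\<in>H. x) \<in> lin_maps R ?Z M" by (rule lin_maps_incl[OF assms(1) H])
  have z: "(\<lambda>x\<in>H. \<zero>\<^bsub>M\<^esub>) \<in> lin_maps R ?Z M" using lin_maps_zero[OF Z assms(1)] by simp
  have "compose H f (\<lambda>x\<in>H. x) = compose H f (\<lambda>x\<in>H. \<zero>\<^bsub>M\<^esub>)"
    by (auto simp: compose_def fun_eq_iff f.zero H_def)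
  then have "(\<lambda>x\<in>H. x) = (\<lambda>x\<in>H. \<zero>\<^bsub>M\<^esub>)"
    using m i z Z unfolding is_mono_def by auto
  then have "x = \<zero>\<^bsub>M\<^esub>" if "x \<in> H" for x using that by (metis restrict_apply')
  then show "f \<in> lin_maps R M N \<and> inj_on f (carrier M)"
    using f.lin by (auto simp: f.inj_iff H_def)
next
  assume f: "f \<in> lin_maps R M N \<and> inj_on f (carrier M)"
  show "is_mono (LMod R) M N f"
    unfolding is_mono_def
  proof (intro conjI ballI impI)
    fix Z :: "('r, 'v) module" and g h
    assume g: "g \<in> Hom (LMod R) Z M" and h: "h \<in> Hom (LMod R) Z M"
      and "Comp (LMod R) Z M N f g = Comp (LMod R) Z M N f h"
    then have eq: "compose (carrier Z) f g x = compose (carrier Z) f h x" for x by simp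
    have "g x = h x" if x: "x \<in> carrier Z" for x
    proof -
      have "g x \<in> carrier M" "h x \<in> carrier M" using lin_mapsD(1)[of g R Z M x] lin_mapsD(1)[of h R Z M x] g h x by simp_all
      moreover have "f (g x) = f (h x)" using eq[of x] x by (simp add: compose_eq)
      ultimately show ?thesis using f by (meson inj_onD)
    qed
    then show "g = h" using g h by (auto intro: lin_maps_eqI)
  qed (use f in simp)
qed

text \<open>Every submodule gives a monomorphism, its inclusion, and every monomorphism has a
  submodule as its image, so both notions test the same data.\<close>

lemma irreducible_LMod:
  fixes M :: "('r, 'v) module"
  shows "irreducible_object (LMod R) M \<longleftrightarrow> simple_module R M"
proof
  assume irr: "irreducible_object (LMod R) M"
  then have M: "left_module R M" by (simp add: irreducible_object_def)
  interpret M: left_module R M by fact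
  have "H = {\<zero>\<^bsub>M\<^esub>} \<or> H = carrier M" if H: "submodule H R M" for H
  proof -
    let ?Z = "M\<lparr>carrier := H\<rparr>"
    have Z: "left_module R ?Z" by (rule M.left_module_submodule[OF H])
    have i: "(\<lambda>x\<in>H. x) \<in> lin_maps R ?Z M" by (rule lin_maps_incl[OF M H])
    have "is_mono (LMod R) ?Z M (\<lambda>x\<in>H. x)" using i by (simp add: is_mono_LMod[OF Z M])
    then have "zero_object (LMod R) ?Z \<or> is_iso (LMod R) ?Z M (\<lambda>x\<in>H. x)"
      using irr Z unfolding irreducible_object_def by auto
    then show ?thesis by (auto simp: zero_object_LMod[OF Z] is_iso_LMod[OF Z M] bij_betw_def)
  qed
  then show "simple_module R M"
    using irr M by (auto simp: simple_module_def irreducible_object_def zero_object_LMod)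
next
  assume s: "simple_module R M"
  then have M: "left_module R M" by (simp add: simple_module_def)
  interpret M: left_module R M by fact
  show "irreducible_object (LMod R) M"
    unfolding irreducible_object_def
  proof (intro conjI ballI allI impI)
    show "\<not> zero_object (LMod R) M" using s by (simp add: zero_object_LMod[OF M] simple_module_def)
    fix Y :: "('r, 'v) module" and f assume "Y \<in> Ob (LMod R)" and m: "is_mono (LMod R) Y M f"
    then have Y: "left_module R Y" by simp
    have f: "f \<in> lin_maps R Y M" "inj_on f (carrier Y)" using m by (auto simp: is_mono_LMod[OF Y M])
    interpret f: lin_map R Y M f using f Y M by (simp add: lin_map_iff)
    have "f ` carrier Y = {\<zero>\<^bsub>M\<^esub>} \<or> f ` carrier Y = carrier M"
      using f.image[OF f.M.carrier_submodule] s by (auto simp: simple_module_def)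
    then show "zero_object (LMod R) Y \<or> is_iso (LMod R) Y M f"
    proof
      assume "f ` carrier Y = {\<zero>\<^bsub>M\<^esub>}"
      then have "\<forall>x\<in>carrier Y. f x = \<zero>\<^bsub>M\<^esub>" by auto
      then show ?thesis using f.inj_iff f(2) f.M.M.zero_closed by (auto simp: zero_object_LMod[OF Y])
    qed (use f in \<open>auto simp: is_iso_LMod[OF Y M] bij_betw_def\<close>)
  qed (use M in simp)
qed

section \<open>Injections and encodings\<close>

text \<open>Outside \<open>X\<close> a shift beyond all values of \<open>f\<close> on
  \<open>X\<close> cannot collide with them.\<close>

lemma inj_extend:
  fixes f :: "nat \<Rightarrow> nat"
  assumes "finite X" "inj_on f X"
  obtains g where "inj g" "\<And>x. x \<in> X \<Longrightarrow> g x = f x"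
proof -
  define N where "N = Suc (Max (insert 0 (f ` X)))"
  define g where "g x = (if x \<in> X then f x else x + N)" for x
  have lt: "f x < N" if "x \<in> X" for x using that assms(1) by (auto simp: N_def less_Suc_eq_le)
  have "inj g"
    using assms(2) lt unfolding inj_on_def g_def by (metis UNIV_I add_right_cancel not_add_less2)
  then show thesis using that[of g] by (simp add: g_def)
qed

text \<open>The substitute for inverses in the monoid of injections: on a finite set, any injection
  can be undone and replaced by any other one.\<close>

lemma inj_divide:
  fixes g g' :: "nat \<Rightarrow> nat"
  assumes "finite X" "inj g" "inj g'"
  obtains h where "inj h" "\<And>x. x \<in> X \<Longrightarrow> h (g x) = g' x"
proof -
  have "inj_on (g' \<circ> inv' g) (g ` X)"
  proof (rule inj_onI)
    fix a b assume "a \<in> g ` X" "b \<in> g ` X" "(g' \<circ> inv' g) a = (g' \<circ> inv' g) b"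
    then show "a = b" using assms(2,3) by (metis comp_apply f_inv_into_f injD imageE rangeI)
  qed
  then obtain h where "inj h" "\<And>y. y \<in> g ` X \<Longrightarrow> h y = (g' \<circ> inv' g) y"
    using inj_extend[of "g ` X" "g' \<circ> inv' g"] assms(1) by blast
  then show thesis using that[of h] assms(2) by simp
qed

unbundle cardinal_syntax

lemma infinite_times_inj:
  assumes "infinite (UNIV :: 'v set)"
  obtains p :: "'v \<times> 'v \<Rightarrow> 'v" where "inj p"
proof -
  have "|UNIV \<times> UNIV :: ('v \<times> 'v) set| \<le>o |UNIV :: 'v set|"
    using card_of_Times_same_infinite[OF assms] ordIso_iff_ordLeq by blast
  then show thesis using that card_of_ordLeq[of "UNIV :: ('v \<times> 'v) set" "UNIV :: 'v set"] by auto
qed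

text \<open>Provides codes in \<open>'v\<close> for pairs of a level and an element of that level,
  as needed for the elements of a colimit.\<close>

lemma nat_times_inj:
  assumes "infinite (UNIV :: 'v set)"
  obtains p :: "nat \<times> 'v \<Rightarrow> 'v" where "inj p"
proof -
  obtain p :: "'v \<times> 'v \<Rightarrow> 'v" where p: "inj p" using infinite_times_inj[OF assms] .
  obtain c :: "nat \<Rightarrow> 'v" where c: "inj c" using infinite_countable_subset[OF assms] by blast
  have "inj (\<lambda>(n, x). p (c n, x))"
  proof (rule injI)
    fix a b assume "(case a of (n, x) \<Rightarrow> p (c n, x)) = (case b of (n, x) \<Rightarrow> p (c n, x))"
    then have "p (c (fst a), snd a) = p (c (fst b), snd b)" by (simp add: case_prod_beta)
    then have "(c (fst a), snd a) = (c (fst b), snd b)" by (rule injD[OF p])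
    then show "a = b" using injD[OF c] by (simp add: prod_eq_iff)
  qed
  then show thesis using that by blast
qed

text \<open>Pairing off one coordinate at a time codes a finite family as a single element. This
  later brings the values of the induced FI-module, which are spaces of functions, back into the
  type \<open>'v\<close>.\<close>

lemma finite_PiE_encoding:
  assumes "infinite (UNIV :: 'v set)" "finite (I :: 'i set)"
  shows "\<exists>e :: ('i \<Rightarrow> 'v) \<Rightarrow> 'v. inj_on e (extensional I)"
  using assms(2)
proof induction
  case empty
  show ?case by (auto simp: inj_on_def)
next
  case (insert i I)
  then obtain e :: "('i \<Rightarrow> 'v) \<Rightarrow> 'v" where e: "inj_on e (extensional I)" by blast
  obtain p :: "'v \<times> 'v \<Rightarrow> 'v" where p: "inj p" using infinite_times_inj[OF assms(1)] .
  have "inj_on (\<lambda>f. p (f i, e (restrict f I))) (extensional (insert i I))"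
  proof (rule inj_onI)
    fix f g :: "'i \<Rightarrow> 'v"
    assume fg: "f \<in> extensional (insert i I)" "g \<in> extensional (insert i I)"
      and "p (f i, e (restrict f I)) = p (g i, e (restrict g I))"
    then have "f i = g i" "e (restrict f I) = e (restrict g I)" using p by (auto dest: injD)
    then have "f i = g i" "restrict f I = restrict g I" using e by (auto dest: inj_onD)
    then have "f x = g x" if "x \<in> insert i I" for x using that by (metis insertE restrict_apply')
    then show "f = g" using fg by (auto intro: extensionalityI)
  qed
  then show ?case by blast
qed

section \<open>Representations of the monoid of injections\<close>

lemma (in abelian_group) diff_eq_zero_iff:
  assumes "x \<in> carrier G" "y \<in> carrier G" shows "x \<ominus> y = \<zero> \<longleftrightarrow> x = y"
  using assms by (metis a_minus_def a_inv_closed minus_equality minus_minus r_neg)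

lemma (in abelian_group) diff_zero: "x \<in> carrier G \<Longrightarrow> x \<ominus> \<zero> = x"
  by (simp add: a_minus_def)

lemma (in abelian_group) add_diff_add:
  assumes "a \<in> carrier G" "b \<in> carrier G" "c \<in> carrier G" "d \<in> carrier G"
  shows "(a \<oplus> b) \<ominus> (c \<oplus> d) = (a \<ominus> c) \<oplus> (b \<ominus> d)"
  using assms by (simp add: a_minus_def minus_add a_ac)

text \<open>
  An FI-module modulo torsion amounts to its colimit over the finite subsets of the natural numbers,
  on which the injections of the natural numbers act.
\<close>

locale inj_rep = left_module K V
  for K :: "('k, 'x) ring_scheme" and V :: "('k, 'w) module" +
  fixes act :: "(nat \<Rightarrow> nat) \<Rightarrow> 'w \<Rightarrow> 'w"
  assumes act_lin: "inj g \<Longrightarrow> act g \<in> lin_maps K V V"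
    and act_id: "v \<in> carrier V \<Longrightarrow> act id v = v"
    and act_comp: "inj g \<Longrightarrow> inj h \<Longrightarrow> v \<in> carrier V \<Longrightarrow> act (g \<circ> h) v = act g (act h v)"
    and finite_support: "v \<in> carrier V \<Longrightarrow>
      \<exists>X. finite X \<and> (\<forall>g h. inj g \<longrightarrow> inj h \<longrightarrow> (\<forall>x\<in>X. g x = h x) \<longrightarrow> act g v = act h v)"
begin

lemma act_map: "inj g \<Longrightarrow> lin_map K V V (act g)"
  using act_lin left_module_axioms by (simp add: lin_map_iff)

lemmas act_closed = lin_map.closed[OF act_map] and act_add = lin_map.add[OF act_map]
  and act_smult = lin_map.smult[OF act_map] and act_zero = lin_map.zero[OF act_map]
  and act_diff = lin_map.diff[OF act_map]

definition supported :: "nat set \<Rightarrow> 'w \<Rightarrow> bool" where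
  "supported X v \<longleftrightarrow> (\<forall>g h. inj g \<longrightarrow> inj h \<longrightarrow> (\<forall>x\<in>X. g x = h x) \<longrightarrow> act g v = act h v)"

lemma supportedD: "supported X v \<Longrightarrow> inj g \<Longrightarrow> inj h \<Longrightarrow> (\<And>x. x \<in> X \<Longrightarrow> g x = h x) \<Longrightarrow> act g v = act h v"
  unfolding supported_def by blast

lemma supported_fix: "supported X v \<Longrightarrow> v \<in> carrier V \<Longrightarrow> inj g \<Longrightarrow> (\<And>x. x \<in> X \<Longrightarrow> g x = x) \<Longrightarrow> act g v = v"
  using supportedD[of X v g id] act_id by simp

lemma supported_mono: "supported X v \<Longrightarrow> X \<subseteq> Y \<Longrightarrow> supported Y v"
  unfolding supported_def by (meson subsetD)

lemma supported_ex: "v \<in> carrier V \<Longrightarrow> \<exists>X. finite X \<and> supported X v"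
  using finite_support by (simp add: supported_def)

lemma supported_act:
  assumes "supported X v" "v \<in> carrier V" "inj g" shows "supported (g ` X) (act g v)"
  unfolding supported_def
proof (intro allI impI)
  fix h h' :: "nat \<Rightarrow> nat"
  assume h: "inj h" "inj h'" "\<forall>x\<in>g ` X. h x = h' x"
  then show "act h (act g v) = act h' (act g v)"
    using supportedD[OF assms(1), of "h \<circ> g" "h' \<circ> g"] assms by (simp add: act_comp[symmetric] inj_compose)
qed

lemma supported_diff:
  assumes "supported X v" "supported X w" "v \<in> carrier V" "w \<in> carrier V"
  shows "supported X (v \<ominus>\<^bsub>V\<^esub> w)"
  unfolding supported_def
proof (intro allI impI)
  fix g h :: "nat \<Rightarrow> nat" assume *: "inj g" "inj h" "\<forall>x\<in>X. g x = h x"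
  then have "act g v = act h v" "act g w = act h w" using assms supportedD by blast+
  then show "act g (v \<ominus>\<^bsub>V\<^esub> w) = act h (v \<ominus>\<^bsub>V\<^esub> w)" using * assms by (simp add: act_diff)
qed

text \<open>An injection need not be invertible, but it can be undone on the finite supports of the
  two vectors, and that is all the action sees.\<close>

lemma act_cancel:
  assumes "inj g" "v \<in> carrier V" "w \<in> carrier V" "act g v = act g w" shows "v = w"
proof -
  obtain X Y where X: "finite X" "supported X v" and Y: "finite Y" "supported Y w"
    using supported_ex assms by meson
  obtain h where h: "inj h" "\<And>x. x \<in> X \<union> Y \<Longrightarrow> h (g x) = id x"
    using inj_divide[of "X \<union> Y" g id] X Y assms by auto
  have "act (h \<circ> g) v = v" "act (h \<circ> g) w = w"
    using supported_fix[of X v "h \<circ> g"] supported_fix[of Y w "h \<circ> g"] h assms X Y by (auto simp: inj_compose)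
  then show ?thesis using assms h by (simp add: act_comp)
qed

end

section \<open>Doubled letters and the difference operators\<close>

definition dbl :: "nat \<Rightarrow> nat" where "dbl x = 2 * x"

definition tr :: "nat \<Rightarrow> nat \<Rightarrow> nat" where "tr a = Transposition.transpose (2 * a) (Suc (2 * a))"

text \<open>The action of \<open>g\<close> on the pairs \<open>{2 a, 2 a + 1}\<close>, keeping the
  parity. It is compatible both with \<open>dbl\<close> and with the swaps \<open>tr a\<close>, and
  so describes how \<open>g\<close> passes through the difference operators.\<close>

definition dup :: "(nat \<Rightarrow> nat) \<Rightarrow> nat \<Rightarrow> nat" where "dup g x = 2 * g (x div 2) + x mod 2"

lemma inj_dbl [simp]: "inj dbl" by (auto simp: inj_def dbl_def)

lemma inj_tr [simp]: "inj (tr a)" by (simp add: tr_def)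

lemma tr_div2: "tr a x div 2 = x div 2" by (auto simp: tr_def Transposition.transpose_def)

lemma tr_other: "x div 2 \<noteq> a \<Longrightarrow> tr a x = x"
  by (auto simp: tr_def Transposition.transpose_def)

lemma tr_tr: "tr a (tr a x) = x" by (simp add: tr_def)

lemma tr_commute: "tr a (tr b x) = tr b (tr a x)"
  by (cases "a = b") (metis tr_div2 tr_other)+

lemma dup_dbl: "dup g (dbl x) = dbl (g x)" by (simp add: dup_def dbl_def)

lemma dup_div2: "dup g x div 2 = g (x div 2)" by (simp add: dup_def)

lemma inj_dup:
  assumes "inj g" shows "inj (dup g)"
proof (rule injI)
  fix x y assume e: "dup g x = dup g y"
  have "x div 2 = y div 2" using arg_cong[OF e, of "\<lambda>z. z div 2"] assms by (auto simp: dup_div2 dest: injD)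
  moreover have "x mod 2 = y mod 2" using arg_cong[OF e, of "\<lambda>z. z mod 2"] by (simp add: dup_def)
  ultimately show "x = y" by (metis div_mult_mod_eq)
qed

lemma tr_dup:
  assumes "inj g" shows "tr (g a) (dup g x) = dup g (tr a x)"
proof (cases "x div 2 = a")
  case False
  then have "g (x div 2) \<noteq> g a" using assms by (auto dest: injD)
  then show ?thesis using False by (simp add: tr_other dup_div2)
next
  case True
  then have "x = 2 * a \<or> x = Suc (2 * a)" by presburger
  then show ?thesis by (auto simp: dup_def tr_def Transposition.transpose_def)
qed

text \<open>
  The operator \<open>\<Prod>a\<in>xs. (1 - tr a)\<close>, applied after moving the support to the even numbers.  The odd
  number \<open>2 a + 1\<close> is then fresh, and \<open>tr a\<close> swaps it with the copy of \<open>a\<close>.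
\<close>

primrec alt :: "('k, 'w) module \<Rightarrow> ((nat \<Rightarrow> nat) \<Rightarrow> 'w \<Rightarrow> 'w) \<Rightarrow> nat list \<Rightarrow> 'w \<Rightarrow> 'w" where
  "alt V act [] v = act dbl v"
| "alt V act (a # xs) v = alt V act xs v \<ominus>\<^bsub>V\<^esub> act (tr a) (alt V act xs v)"

definition subrep :: "('k, 'x) ring_scheme \<Rightarrow> ('k, 'w) module \<Rightarrow> ((nat \<Rightarrow> nat) \<Rightarrow> 'w \<Rightarrow> 'w) \<Rightarrow> 'w set \<Rightarrow> bool" where
  "subrep K V act W \<longleftrightarrow> submodule W K V \<and> (\<forall>g. inj g \<longrightarrow> (\<forall>v\<in>W. act g v \<in> W))"

definition simple_rep :: "('k, 'x) ring_scheme \<Rightarrow> ('k, 'w) module \<Rightarrow> ((nat \<Rightarrow> nat) \<Rightarrow> 'w \<Rightarrow> 'w) \<Rightarrow> bool" where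
  "simple_rep K V act \<longleftrightarrow> inj_rep K V act \<and> carrier V \<noteq> {\<zero>\<^bsub>V\<^esub>} \<and>
     (\<forall>W. subrep K V act W \<longrightarrow> W = {\<zero>\<^bsub>V\<^esub>} \<or> W = carrier V)"

definition rep_maps where
  "rep_maps K V act V' act' = {F \<in> lin_maps K V V'. \<forall>g. inj g \<longrightarrow> (\<forall>v\<in>carrier V. F (act g v) = act' g (F v))}"

context inj_rep
begin

abbreviation "D \<equiv> alt V act"

lemma D_closed: "v \<in> carrier V \<Longrightarrow> D xs v \<in> carrier V"
  by (induction xs) (auto simp: act_closed)

lemma D_add: "v \<in> carrier V \<Longrightarrow> w \<in> carrier V \<Longrightarrow> D xs (v \<oplus>\<^bsub>V\<^esub> w) = D xs v \<oplus>\<^bsub>V\<^esub> D xs w"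
  by (induction xs) (auto simp: act_add act_closed D_closed M.add_diff_add)

lemma D_smult: "a \<in> carrier K \<Longrightarrow> v \<in> carrier V \<Longrightarrow> D xs (a \<odot>\<^bsub>V\<^esub> v) = a \<odot>\<^bsub>V\<^esub> D xs v"
  by (induction xs) (auto simp: act_smult act_closed D_closed a_minus_def smult_r_distr smult_minus)

lemma D_lin: "restrict (D xs) (carrier V) \<in> lin_maps K V V"
  by (rule lin_mapsI) (auto simp: D_closed D_add D_smult smult_closed)

lemma D_zero: "D xs \<zero>\<^bsub>V\<^esub> = \<zero>\<^bsub>V\<^esub>"
proof -
  interpret d: lin_map K V V "restrict (D xs) (carrier V)"
    using D_lin left_module_axioms by (simp add: lin_map_iff)
  show ?thesis using d.zero by simp
qed

lemma D_diff: "v \<in> carrier V \<Longrightarrow> w \<in> carrier V \<Longrightarrow> D xs (v \<ominus>\<^bsub>V\<^esub> w) = D xs v \<ominus>\<^bsub>V\<^esub> D xs w"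
proof -
  assume *: "v \<in> carrier V" "w \<in> carrier V"
  interpret d: lin_map K V V "restrict (D xs) (carrier V)"
    using D_lin left_module_axioms by (simp add: lin_map_iff)
  show ?thesis using d.diff[of v w] * by simp
qed

text \<open>Relabelling the letters and the vector by \<open>g\<close> only moves the result by
  \<open>dup g\<close>, since \<open>dbl\<close> and each swap intertwine \<open>g\<close> with
  \<open>dup g\<close>.\<close>

lemma D_act:
  assumes "inj g" "v \<in> carrier V"
  shows "D (map g xs) (act g v) = act (dup g) (D xs v)"
proof (induction xs)
  case Nil
  have "dbl \<circ> g = dup g \<circ> dbl" by (auto simp: dup_dbl)
  then show ?case using assms by (simp add: act_comp[symmetric] inj_dup)
next
  case (Cons a xs)
  have "tr (g a) \<circ> dup g = dup g \<circ> tr a" using assms by (auto simp: tr_dup)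
  then have "act (tr (g a)) (act (dup g) (D xs v)) = act (dup g) (act (tr a) (D xs v))"
    using assms by (simp add: act_comp[symmetric] inj_dup D_closed)
  then show ?case using Cons assms by (simp add: act_diff inj_dup D_closed act_closed)
qed

lemma act_tr_commute: "v \<in> carrier V \<Longrightarrow> act (tr a) (act (tr b) v) = act (tr b) (act (tr a) v)"
proof -
  have "tr a \<circ> tr b = tr b \<circ> tr a" by (auto simp: tr_commute)
  then show "v \<in> carrier V \<Longrightarrow> ?thesis" by (metis act_comp inj_tr)
qed

text \<open>Swaps of different pairs commute, hence so do the factors
  \<open>1 - tr a\<close>.\<close>

lemma D_swap:
  assumes v: "v \<in> carrier V" shows "D (a # b # xs) v = D (b # a # xs) v"
proof -
  let ?w = "D xs v"
  have w: "?w \<in> carrier V" using v by (rule D_closed)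
  show ?thesis
    using w act_tr_commute[OF w, of a b]
    by (simp add: act_diff act_closed) (simp add: act_closed a_minus_def M.minus_add M.minus_minus M.a_ac)
qed

lemma D_Cons_cong: "D xs v = D ys v \<Longrightarrow> D (a # xs) v = D (a # ys) v"
  by simp

lemma D_remove1: "a \<in> set xs \<Longrightarrow> v \<in> carrier V \<Longrightarrow> D (a # remove1 a xs) v = D xs v"
proof (induction xs)
  case (Cons b xs)
  show ?case
  proof (cases "a = b")
    case False
    then have "D (a # remove1 a (b # xs)) v = D (b # a # remove1 a xs) v"
      using D_swap[OF Cons.prems(2), of a b] by simp
    also have "\<dots> = D (b # xs) v" using False Cons by (intro D_Cons_cong) auto
    finally show ?thesis .
  qed simp
qed simp

text \<open>As the factors commute, only the multiset of letters matters; this is what lets a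
  permutation of \<open>{1..n}\<close> act on the image of \<open>Dn n\<close>.\<close>

lemma D_perm: "mset xs = mset ys \<Longrightarrow> v \<in> carrier V \<Longrightarrow> D xs v = D ys v"
proof (induction xs arbitrary: ys)
  case (Cons a xs)
  have a: "a \<in> set ys" using Cons.prems(1) by (metis list.set_intros(1) mset_eq_setD)
  have "mset xs = mset (remove1 a ys)" using Cons.prems(1) by (metis add_mset_remove_trivial mset.simps(2) mset_remove1)
  then have "D (a # xs) v = D (a # remove1 a ys) v" using Cons by (intro D_Cons_cong) auto
  then show ?case using D_remove1[OF a Cons.prems(2)] by simp
qed simp

text \<open>After doubling, the support contains neither \<open>2 * a\<close> nor
  \<open>Suc (2 * a)\<close> when \<open>a\<close> is outside \<open>X\<close>, and
  \<open>tr a\<close> commutes with all the factors.\<close>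

lemma D_tr_fix:
  assumes "supported X v" "v \<in> carrier V" "a \<notin> X" shows "act (tr a) (D xs v) = D xs v"
proof (induction xs)
  case Nil
  have "act (tr a \<circ> dbl) v = act dbl v"
  proof (rule supportedD[OF assms(1)])
    show "inj (tr a \<circ> dbl)" by (simp add: inj_compose)
    show "(tr a \<circ> dbl) x = dbl x" if "x \<in> X" for x
      using that assms(3) by (auto simp: dbl_def intro: tr_other)
  qed simp
  then show ?case using assms by (simp add: act_comp)
next
  case (Cons b xs)
  then show ?case using assms
    by (simp add: act_diff act_closed D_closed act_tr_commute[of _ a b])
qed

text \<open>The factor at a letter outside the support is the difference of a vector with
  itself.\<close>

lemma D_zero_off:
  assumes "supported X v" "v \<in> carrier V" "a \<notin> X" "a \<in> set xs" shows "D xs v = \<zero>\<^bsub>V\<^esub>"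
  using assms(4)
proof (induction xs)
  case (Cons b xs)
  show ?case
  proof (cases "a \<in> set xs")
    case True
    then show ?thesis using Cons by (simp add: act_zero M.diff_zero)
  next
    case False
    then show ?thesis using Cons D_tr_fix[OF assms(1-3), of xs] assms(2)
      by (simp add: M.diff_eq_zero_iff D_closed)
  qed
qed simp

text \<open>The support starts with even letters only, and each factor can add at most the pair of
  its own letter.\<close>

lemma D_supported:
  assumes "supported X v" "v \<in> carrier V"
  shows "supported (dbl ` X \<union> {y. y div 2 \<in> set xs}) (D xs v)"
proof (induction xs)
  case Nil
  then show ?case using supported_act[OF assms, of dbl] by simp
next
  case (Cons a xs)
  let ?S = "dbl ` X \<union> {y. y div 2 \<in> set xs}" and ?T = "dbl ` X \<union> {y. y div 2 \<in> set (a # xs)}"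
  \<comment> \<open>\<open>tr a\<close> moves only letters whose half is \<open>a\<close>, and it
    preserves halves.\<close>
  have "tr a ` ?S \<subseteq> ?T"
  proof
    fix y assume "y \<in> tr a ` ?S"
    then obtain x where x: "x \<in> ?S" "y = tr a x" by blast
    then show "y \<in> ?T" using tr_other[of x a] tr_div2[of a x] by (cases "x div 2 = a") auto
  qed
  then have "supported ?T (act (tr a) (D xs v))"
    using supported_mono[OF supported_act[OF Cons, of "tr a"]] assms by (simp add: D_closed)
  moreover have "supported ?T (D xs v)" by (rule supported_mono[OF Cons]) auto
  ultimately show ?case using assms by (simp add: supported_diff D_closed act_closed)
qed

lemma D_subrep: "subrep K V act W \<Longrightarrow> v \<in> W \<Longrightarrow> D xs v \<in> W"
proof (induction xs)
  case (Cons a xs)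
  then have "D xs v \<in> W" "act (tr a) (D xs v) \<in> W" by (auto simp: subrep_def)
  then show ?case using submoduleD(7)[of W] Cons.prems(1) by (simp add: subrep_def)
qed (auto simp: subrep_def)

lemma inj_rep_subrep:
  assumes "subrep K V act W"
  shows "inj_rep K (V\<lparr>carrier := W\<rparr>) (\<lambda>g. restrict (act g) W)"
proof -
  have W: "submodule W K V" and gW: "\<And>g v. inj g \<Longrightarrow> v \<in> W \<Longrightarrow> act g v \<in> W"
    using assms by (auto simp: subrep_def)
  note w = submoduleD[OF W]
  show ?thesis
  proof (intro inj_rep.intro inj_rep_axioms.intro)
    show "left_module K (V\<lparr>carrier := W\<rparr>)" by (rule left_module_submodule[OF W])
    fix g :: "nat \<Rightarrow> nat" assume "inj g"
    then show "restrict (act g) W \<in> lin_maps K (V\<lparr>carrier := W\<rparr>) (V\<lparr>carrier := W\<rparr>)"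
      using w gW by (intro lin_mapsI) (auto simp: act_add act_smult)
  next
    fix v assume v: "v \<in> carrier (V\<lparr>carrier := W\<rparr>)"
    then show "restrict (act id) W v = v" using w act_id by simp
    obtain X where "finite X" "supported X v" using supported_ex[of v] w v by auto
    then show "\<exists>X. finite X \<and> (\<forall>g h. inj g \<longrightarrow> inj h \<longrightarrow> (\<forall>x\<in>X. g x = h x) \<longrightarrow> restrict (act g) W v = restrict (act h) W v)"
      using v by (intro exI[of _ X]) (auto dest: supportedD)
  next
    fix g h :: "nat \<Rightarrow> nat" and v assume "inj g" "inj h" "v \<in> carrier (V\<lparr>carrier := W\<rparr>)"
    then show "restrict (act (g \<circ> h)) W v = restrict (act g) W (restrict (act h) W v)"
      using w gW act_comp by simp
  qed
qed

end

locale rep_map = V: inj_rep K V act + V': inj_rep K V' act'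
  for K :: "('k, 'x) ring_scheme" and V :: "('k, 'v) module" and act
    and V' :: "('k, 'w) module" and act' +
  fixes F assumes rep: "F \<in> rep_maps K V act V' act'"
begin

sublocale lin: lin_map K V V' F
  using rep V.left_module_axioms V'.left_module_axioms by (simp add: lin_map_iff rep_maps_def)

lemma equivariant: "inj g \<Longrightarrow> v \<in> carrier V \<Longrightarrow> F (act g v) = act' g (F v)"
  using rep by (simp add: rep_maps_def)

lemma F_D: "v \<in> carrier V \<Longrightarrow> F (V.D xs v) = V'.D xs (F v)"
  by (induction xs) (auto simp: equivariant lin.diff V.D_closed V.act_closed)

lemma vimage_subrep: "subrep K V' act' W \<Longrightarrow> subrep K V act {v \<in> carrier V. F v \<in> W}"
  using lin.vimage by (auto simp: subrep_def equivariant V.act_closed)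

lemma zero_subrep: "subrep K V' act' {\<zero>\<^bsub>V'\<^esub>}"
  by (auto simp: subrep_def V'.zero_submodule V'.act_zero)

lemma kernel_subrep: "subrep K V act {v \<in> carrier V. F v = \<zero>\<^bsub>V'\<^esub>}"
  using vimage_subrep[OF zero_subrep] by simp

lemma image_subrep: "subrep K V act W \<Longrightarrow> subrep K V' act' (F ` W)"
  unfolding subrep_def
proof (intro conjI allI impI ballI)
  assume W: "submodule W K V \<and> (\<forall>g. inj g \<longrightarrow> (\<forall>v\<in>W. act g v \<in> W))"
  then show "submodule (F ` W) K V'" using lin.image by blast
  fix g :: "nat \<Rightarrow> nat" and w assume g: "inj g" and "w \<in> F ` W"
  then obtain v where v: "v \<in> W" "w = F v" by blast
  then have "act' g w = F (act g v)" using W V.submoduleD(3) equivariant[OF g] by auto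
  then show "act' g w \<in> F ` W" using W g v by blast
qed

lemma inj_if_simple:
  assumes "simple_rep K V act" "v \<in> carrier V" "F v \<noteq> \<zero>\<^bsub>V'\<^esub>"
  shows "inj_on F (carrier V)"
proof -
  have "{v \<in> carrier V. F v = \<zero>\<^bsub>V'\<^esub>} = {\<zero>\<^bsub>V\<^esub>}"
    using assms kernel_subrep unfolding simple_rep_def by blast
  then show ?thesis by (auto simp: lin.inj_iff)
qed

lemma inverse_rep:
  assumes "bij_betw F (carrier V) (carrier V')"
  shows "restrict (inv_into (carrier V) F) (carrier V') \<in> rep_maps K V' act' V act"
  unfolding rep_maps_def
proof (intro CollectI conjI allI impI ballI)
  let ?G = "restrict (inv_into (carrier V) F) (carrier V')"
  show "?G \<in> lin_maps K V' V" by (rule lin.inverse[OF assms])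
  fix g :: "nat \<Rightarrow> nat" and w assume g: "inj g" and w: "w \<in> carrier V'"
  obtain v where v: "v \<in> carrier V" "w = F v" using w assms by (auto simp: bij_betw_def)
  have "?G (F u) = u" if "u \<in> carrier V" for u using that assms lin.closed by (auto simp: bij_betw_def)
  then show "?G (act' g w) = act g (?G w)" using v g by (metis equivariant V.act_closed)
qed

end

lemma rep_map_iff:
  "rep_map K V act V' act' F \<longleftrightarrow> inj_rep K V act \<and> inj_rep K V' act' \<and> F \<in> rep_maps K V act V' act'"
  by (auto simp: rep_map_def rep_map_axioms_def)

lemma rep_maps_compose:
  assumes "inj_rep K V act" "F \<in> rep_maps K V act V' act'" "G \<in> rep_maps K V' act' V'' act''"
  shows "compose (carrier V) G F \<in> rep_maps K V act V'' act''"
proof -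
  interpret V: inj_rep K V act by fact
  show ?thesis
    using assms lin_maps_compose[OF V.left_module_axioms, of F V' G V'']
    by (auto simp: rep_maps_def compose_eq V.act_closed dest: lin_mapsD(1))
qed

lemma rep_maps_id:
  assumes "inj_rep K V act" shows "(\<lambda>v\<in>carrier V. v) \<in> rep_maps K V act V act"
proof -
  interpret V: inj_rep K V act by fact
  show ?thesis using lin_maps_id[OF V.left_module_axioms] by (auto simp: rep_maps_def V.act_closed)
qed

lemma rep_maps_zero:
  assumes "inj_rep K V act" "inj_rep K V' act'" shows "(\<lambda>v\<in>carrier V. \<zero>\<^bsub>V'\<^esub>) \<in> rep_maps K V act V' act'"
proof -
  interpret V: inj_rep K V act by fact
  interpret V': inj_rep K V' act' by fact
  show ?thesis using lin_maps_zero[OF V.left_module_axioms V'.left_module_axioms]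
    by (auto simp: rep_maps_def V.act_closed V'.act_zero)
qed

lemma rep_maps_incl:
  assumes "inj_rep K V act" "subrep K V act W"
  shows "(\<lambda>v\<in>W. v) \<in> rep_maps K (V\<lparr>carrier := W\<rparr>) (\<lambda>g. restrict (act g) W) V act"
proof -
  interpret V: inj_rep K V act by fact
  show ?thesis using lin_maps_incl[OF V.left_module_axioms, of W] assms(2)
    by (auto simp: rep_maps_def subrep_def)
qed

section \<open>The top degree of a simple representation\<close>

definition injections :: "nat \<Rightarrow> (nat \<Rightarrow> nat) set" where
  "injections n = {f \<in> extensional {1..n}. inj_on f {1..n}}"

definition std :: "nat \<Rightarrow> nat \<Rightarrow> nat" where "std n = (\<lambda>i\<in>{1..n}. i)"

lemma std_injection: "std n \<in> injections n" by (auto simp: std_def injections_def inj_on_def)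

lemma compose_injection: "inj h \<Longrightarrow> f \<in> injections n \<Longrightarrow> compose {1..n} h f \<in> injections n"
proof -
  assume h: "inj h" and f: "f \<in> injections n"
  have "inj_on (compose {1..n} h f) {1..n}"
  proof (rule inj_onI)
    fix i j assume ij: "i \<in> {1..n}" "j \<in> {1..n}" "compose {1..n} h f i = compose {1..n} h f j"
    then have "f i = f j" using h by (simp add: compose_eq inj_eq)
    then show "i = j" using f ij unfolding injections_def inj_on_def by blast
  qed
  then show ?thesis by (simp add: injections_def compose_extensional)
qed

lemma injection_permute:
  assumes "f \<in> injections n" "\<sigma> permutes {1..n}"
  shows "f \<circ> \<sigma> \<in> injections n"
proof -
  have "inj_on (f \<circ> \<sigma>) {1..n}"
    using assms by (intro comp_inj_on) (auto simp: injections_def permutes_image permutes_inj_on)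
  moreover have "f \<circ> \<sigma> \<in> extensional {1..n}"
    using assms by (auto simp: injections_def extensional_def permutes_not_in)
  ultimately show ?thesis by (simp add: injections_def)
qed

text \<open>The inverse of \<open>f\<close> is extended to an injection of all natural numbers,
  because only such maps act.\<close>

lemma injection_retract:
  assumes "f \<in> injections n"
  obtains g where "inj g" "\<And>i. i \<in> {1..n} \<Longrightarrow> g (f i) = i"
proof -
  obtain g where g: "inj g" "\<And>i. i \<in> {1..n} \<Longrightarrow> g i = f i"
    using inj_extend[of "{1..n}" f] assms by (auto simp: injections_def)
  obtain h where "inj h" "\<And>i. i \<in> {1..n} \<Longrightarrow> h (g i) = id i"
    using inj_divide[of "{1..n}" g id] g by auto
  then show thesis using that[of h] g by simp
qed

context inj_rep
begin

lemma act_eq_zero_iff: "inj g \<Longrightarrow> v \<in> carrier V \<Longrightarrow> act g v = \<zero>\<^bsub>V\<^esub> \<longleftrightarrow> v = \<zero>\<^bsub>V\<^esub>"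
  using act_cancel[of g v "\<zero>\<^bsub>V\<^esub>"] by (auto simp: act_zero)

text \<open>A letter missed by \<open>g\<close> lies outside the support of
  \<open>act g v\<close>.\<close>

lemma D_zero_range:
  assumes "inj g" "v \<in> carrier V" "a \<in> set xs" "a \<notin> range g"
  shows "D xs (act g v) = \<zero>\<^bsub>V\<^esub>"
proof -
  obtain X where "supported X v" using supported_ex assms by blast
  then have "supported (g ` X) (act g v)" using assms by (intro supported_act)
  then show ?thesis using D_zero_off[of "g ` X" "act g v" a xs] act_closed assms by blast
qed

text \<open>Stability under \<open>g\<close> has two cases: letters in the range of \<open>g\<close>
  are pulled back along \<open>g\<close>, and a letter outside the range kills
  \<open>act g v\<close> by itself.\<close>

lemma D_vanish_subrep:
  "subrep K V act {v \<in> carrier V. \<forall>xs. distinct xs \<longrightarrow> m < length xs \<longrightarrow> D xs v = \<zero>\<^bsub>V\<^esub>}" (is "subrep K V act ?W")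
  unfolding subrep_def
proof (intro conjI allI impI ballI)
  show "submodule ?W K V"
    by (rule submoduleI) (auto simp: D_add D_smult D_zero smult_r_null smult_closed)
  fix g :: "nat \<Rightarrow> nat" and v assume g: "inj g" and v: "v \<in> ?W"
  have "D xs (act g v) = \<zero>\<^bsub>V\<^esub>" if xs: "distinct xs" "m < length xs" for xs
  proof (cases "set xs \<subseteq> range g")
    case True
    let ?ys = "map (inv' g) xs"
    have e: "map g ?ys = xs" using True by (auto simp: map_idI f_inv_into_f subset_iff)
    then have "distinct (map g ?ys)" using xs(1) by (simp only:)
    then have "distinct ?ys" using distinct_map by blast
    then have "D ?ys v = \<zero>\<^bsub>V\<^esub>" using v xs by auto
    then have "D (map g ?ys) (act g v) = \<zero>\<^bsub>V\<^esub>"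
      using D_act[OF g, of v ?ys] v g by (simp add: act_zero inj_dup)
    then show ?thesis by (simp only: e)
  next
    case False
    then show ?thesis using D_zero_range g v by blast
  qed
  then show "act g v \<in> ?W" using g v act_closed by auto
qed

text \<open>By pigeonhole, more letters than the size of the support of one vector always include a
  letter outside it. The vectors killed by all longer products form a subrepresentation, so
  simplicity extends the bound from one nonzero vector to all.\<close>

lemma D_bounded:
  assumes s: "simple_rep K V act"
  shows "\<exists>m. \<forall>xs v. distinct xs \<longrightarrow> m < length xs \<longrightarrow> v \<in> carrier V \<longrightarrow> D xs v = \<zero>\<^bsub>V\<^esub>"
proof -
  obtain v0 where v0: "v0 \<in> carrier V" "v0 \<noteq> \<zero>\<^bsub>V\<^esub>" using s unfolding simple_rep_def by fastforce
  obtain X where X: "finite X" "supported X v0" using supported_ex v0 by blast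
  let ?W = "{v \<in> carrier V. \<forall>xs. distinct xs \<longrightarrow> card X < length xs \<longrightarrow> D xs v = \<zero>\<^bsub>V\<^esub>}"
  have "D xs v0 = \<zero>\<^bsub>V\<^esub>" if xs: "distinct xs" "card X < length xs" for xs
  proof -
    have "\<not> set xs \<subseteq> X" using xs X(1) card_mono[of X "set xs"] by (auto simp: distinct_card)
    then obtain a where "a \<in> set xs" "a \<notin> X" by blast
    then show ?thesis using D_zero_off X v0 by blast
  qed
  then have "v0 \<in> ?W" using v0 by blast
  then have "?W = carrier V"
    using s D_vanish_subrep[of "card X"] v0 unfolding simple_rep_def by blast
  then show ?thesis by blast
qed

definition vanishes_above :: "nat \<Rightarrow> bool" where
  "vanishes_above n \<longleftrightarrow> (\<forall>xs v. distinct xs \<longrightarrow> n < length xs \<longrightarrow> v \<in> carrier V \<longrightarrow> D xs v = \<zero>\<^bsub>V\<^esub>)"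

abbreviation Dn :: "nat \<Rightarrow> 'w \<Rightarrow> 'w" where "Dn n \<equiv> D [1..<Suc n]"

text \<open>An injection that renames the letters \<open>xs\<close> to
  \<open>1, \<dots>, length xs\<close> turns any nonvanishing product into one with the standard
  letters; it acts injectively.\<close>

lemma Dn_nonzero:
  assumes "distinct xs" "v \<in> carrier V" "D xs v \<noteq> \<zero>\<^bsub>V\<^esub>"
  shows "\<exists>w\<in>carrier V. Dn (length xs) w \<noteq> \<zero>\<^bsub>V\<^esub>"
proof -
  define f where "f = (\<lambda>i\<in>{1..length xs}. xs ! (i - 1))"
  have "inj_on f {1..length xs}" using assms(1) by (auto simp: f_def inj_on_def nth_eq_iff_index_eq)
  then have "f \<in> injections (length xs)" by (auto simp: injections_def f_def)
  then obtain g where g: "inj g" "\<And>i. i \<in> {1..length xs} \<Longrightarrow> g (f i) = i" using injection_retract by blast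
  have "g (xs ! i) = Suc i" if "i < length xs" for i using g(2)[of "Suc i"] that by (simp add: f_def)
  then have "map g xs = [1..<Suc (length xs)]" by (intro nth_equalityI) (auto simp del: upt_Suc)
  then have "Dn (length xs) (act g v) = act (dup g) (D xs v)" using D_act[OF g(1) assms(2), of xs] by simp
  moreover have "act (dup g) (D xs v) \<noteq> \<zero>\<^bsub>V\<^esub>" using assms g by (simp add: act_eq_zero_iff inj_dup D_closed)
  ultimately show ?thesis using act_closed g assms by metis
qed

lemma top_degree_ex:
  assumes s: "simple_rep K V act"
  shows "\<exists>n. vanishes_above n \<and> (\<exists>v\<in>carrier V. Dn n v \<noteq> \<zero>\<^bsub>V\<^esub>)"
proof -
  obtain m where m: "\<And>xs v. distinct xs \<Longrightarrow> m < length xs \<Longrightarrow> v \<in> carrier V \<Longrightarrow> D xs v = \<zero>\<^bsub>V\<^esub>"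
    using D_bounded[OF s] by blast
  obtain v0 where v0: "v0 \<in> carrier V" "v0 \<noteq> \<zero>\<^bsub>V\<^esub>" using s unfolding simple_rep_def by fastforce
  define P where "P = (\<lambda>n. \<exists>xs v. distinct xs \<and> length xs = n \<and> v \<in> carrier V \<and> D xs v \<noteq> \<zero>\<^bsub>V\<^esub>)"
  \<comment> \<open>The empty product is \<open>act dbl\<close>, which is injective, so degree 0 is
    always available and a greatest degree exists.\<close>
  have "D [] v0 \<noteq> \<zero>\<^bsub>V\<^esub>" using v0 by (simp add: act_eq_zero_iff)
  then have P0: "P 0" unfolding P_def using v0 by (intro exI[of _ "[]"]) auto
  have Pm: "\<forall>n. P n \<longrightarrow> n < Suc m" unfolding P_def using m by (meson not_le less_Suc_eq_le)
  obtain n where n: "P n" "\<forall>k. P k \<longrightarrow> k \<le> n"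
    using ex_has_greatest_nat[OF P0 Pm] by blast
  have "vanishes_above n"
    unfolding vanishes_above_def
  proof (intro allI impI, rule ccontr)
    fix xs v assume "distinct xs" "n < length xs" "v \<in> carrier V" "D xs v \<noteq> \<zero>\<^bsub>V\<^esub>"
    then have "P (length xs)" unfolding P_def by blast
    then show False using n(2) \<open>n < length xs\<close> by (meson not_le)
  qed
  moreover have "\<exists>v\<in>carrier V. Dn n v \<noteq> \<zero>\<^bsub>V\<^esub>"
    using n(1) Dn_nonzero unfolding P_def by blast
  ultimately show ?thesis by blast
qed

text \<open>If swapping \<open>y\<close> with the fresh letter \<open>z\<close> fixes
  \<open>w\<close>, then the value of an injection at \<open>y\<close> can be rerouted without
  changing its effect on \<open>w\<close>. Two injections that agree on \<open>Y\<close> are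
  rerouted to the same value at \<open>y\<close>, and then agree on the whole support.\<close>

lemma supported_remove:
  assumes s: "supported (insert y Y) w" and w: "w \<in> carrier V" and Y: "finite Y" "z \<notin> insert y Y"
    and fixed: "act (Transposition.transpose y z) w = w"
  shows "supported Y w"
proof (cases "y \<in> Y")
  case True
  then show ?thesis using s by (simp add: insert_absorb)
next
  case False
  \<comment> \<open>Take an injection that agrees with \<open>g\<close> on the support but sends
    \<open>z\<close> to \<open>k\<close>, and precompose it with the swap. The swap does not change
    the action on \<open>w\<close>, while now \<open>y\<close> goes to \<open>k\<close>.\<close>
  have move: "\<exists>q. inj q \<and> act q w = act g w \<and> (\<forall>x\<in>Y. q x = g x) \<and> q y = k"
    if g: "inj g" and k: "k \<notin> g ` insert y Y" for g k
  proof -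
    let ?f = "g(z := k)"
    have "?f ` insert y Y = g ` insert y Y" using Y(2) by (intro image_cong) auto
    moreover have "inj_on ?f (insert y Y) \<longleftrightarrow> inj_on g (insert y Y)" using Y(2) by (intro inj_on_cong) auto
    ultimately have "inj_on ?f (insert z (insert y Y))"
      using k Y(2) inj_on_subset[OF g subset_UNIV, of "insert y Y"] inj_on_insert[of ?f z "insert y Y"] by simp
    then obtain p where p: "inj p" "\<And>x. x \<in> insert z (insert y Y) \<Longrightarrow> p x = ?f x"
      using inj_extend[of "insert z (insert y Y)" ?f] Y by auto
    let ?q = "p \<circ> Transposition.transpose y z"
    have "act p w = act g w" by (rule supportedD[OF s]) (use p g Y in auto)
    moreover have "act ?q w = act p w" using p w fixed by (simp add: act_comp)
    moreover have "?q x = g x" if "x \<in> Y" for x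
    proof -
      have "x \<noteq> y" "x \<noteq> z" using that False Y by auto
      then show ?thesis using p(2)[of x] that by (simp add: transpose_apply_other)
    qed
    moreover have "?q y = k" using p(2)[of z] by simp
    moreover have "inj ?q" using p(1) by (simp add: inj_compose)
    ultimately show ?thesis by metis
  qed
  show ?thesis unfolding supported_def
  proof (intro allI impI)
    fix g h :: "nat \<Rightarrow> nat" assume gh: "inj g" "inj h" "\<forall>x\<in>Y. g x = h x"
    \<comment> \<open>The common target \<open>k\<close> must avoid both images, so that it is
      admissible for \<open>g\<close> and for \<open>h\<close>.\<close>
    have "finite (g ` insert y Y \<union> h ` insert y Y)" using Y by simp
    then obtain k where k: "k \<notin> g ` insert y Y" "k \<notin> h ` insert y Y"
      using ex_new_if_finite[OF infinite_UNIV_nat] by blast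
    obtain q where q: "inj q" "act q w = act g w" "\<forall>x\<in>Y. q x = g x" "q y = k" using move[OF gh(1) k(1)] by blast
    obtain r where r: "inj r" "act r w = act h w" "\<forall>x\<in>Y. r x = h x" "r y = k" using move[OF gh(2) k(2)] by blast
    have "act q w = act r w" by (rule supportedD[OF s]) (use q r gh in auto)
    then show "act g w = act h w" using q r by simp
  qed
qed

text \<open>For \<open>j\<close> outside \<open>{1..n}\<close> the product with the extra letter
  \<open>j\<close> vanishes, which says that \<open>tr j\<close> fixes \<open>Dn n v\<close>. So the
  letter \<open>2 * j\<close> can be removed from the support, its partner
  \<open>Suc (2 * j)\<close> being fresh.\<close>

lemma Dn_supported:
  assumes T: "vanishes_above n" and v: "v \<in> carrier V"
  shows "supported {y. y div 2 \<in> {1..n}} (Dn n v)"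
proof -
  let ?B = "{y :: nat. y div 2 \<in> {1..n}}" and ?w = "Dn n v"
  have "?B \<subseteq> {..2 * n + 1}" by auto
  then have B: "finite ?B" by (rule finite_subset) simp
  have w: "?w \<in> carrier V" using v by (rule D_closed)
  have set: "set [1..<Suc n] = {1..n}" by auto
  \<comment> \<open>\<open>Z\<close> holds the letters of the original support outside
    \<open>{1..n}\<close>; they are removed one at a time.\<close>
  have red: "supported ?B ?w" if "finite Z" "Z \<inter> {1..n} = {}" "supported (?B \<union> dbl ` Z) ?w" for Z
    using that
  proof (induction Z)
    case (insert j Z)
    have "D (j # [1..<Suc n]) v = \<zero>\<^bsub>V\<^esub>"
      using T v insert by (auto simp: vanishes_above_def simp del: upt_Suc alt.simps)
    then have "act (tr j) ?w = ?w" using w by (simp add: M.diff_eq_zero_iff act_closed del: upt_Suc)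
    moreover have "?B \<union> dbl ` insert j Z = insert (2 * j) (?B \<union> dbl ` Z)" by (auto simp: dbl_def)
    moreover have "Suc (2 * j) \<notin> insert (2 * j) (?B \<union> dbl ` Z)"
    proof -
      have "Suc (2 * j) \<noteq> 2 * x" for x by presburger
      then show ?thesis using insert by (auto simp: dbl_def)
    qed
    ultimately have "supported (?B \<union> dbl ` Z) ?w"
      using supported_remove[of "2 * j" "?B \<union> dbl ` Z" ?w "Suc (2 * j)"] insert.prems(2) insert.hyps(1) B w
      by (simp add: tr_def del: upt_Suc)
    moreover have "Z \<inter> {1..n} = {}" using insert.prems(1) by blast
    ultimately show ?case using insert.IH by blast
  qed simp
  obtain X where X: "finite X" "supported X v" using supported_ex v by blast
  have "supported (?B \<union> dbl ` (X - {1..n})) ?w"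
    by (rule supported_mono[OF D_supported[OF X(2) v]]) (auto simp: dbl_def set simp del: upt_Suc)
  moreover have "(X - {1..n}) \<inter> {1..n} = {}" by blast
  ultimately show ?thesis using red[of "X - {1..n}"] X(1) by blast
qed

text \<open>On the support of \<open>v\<close> the two injections differ by some \<open>q\<close>
  fixing \<open>1, \<dots>, n\<close>. Then \<open>dup q\<close> fixes all letters over
  \<open>{1..n}\<close>, where \<open>Dn n\<close> of any vector is supported.\<close>

lemma Dn_act_cong:
  assumes T: "vanishes_above n" and v: "v \<in> carrier V" and g: "inj g" "inj h"
    and e: "\<And>i. i \<in> {1..n} \<Longrightarrow> \<exists>x. g x = i \<and> h x = i"
  shows "Dn n (act g v) = Dn n (act h v)"
proof -
  obtain X where X: "finite X" "supported X v" using supported_ex v by blast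
  \<comment> \<open>The preimages of \<open>{1..n}\<close> are included so that \<open>q\<close>
    fixes these letters, even where they do not come from the support.\<close>
  obtain q where q: "inj q" "\<And>x. x \<in> X \<union> inv' g ` {1..n} \<Longrightarrow> q (g x) = h x"
    using inj_divide[of "X \<union> inv' g ` {1..n}" g h] X g by auto
  have qi: "q i = i" if i: "i \<in> {1..n}" for i
  proof -
    obtain x where "g x = i" "h x = i" using e[OF i] by blast
    moreover then have "x \<in> inv' g ` {1..n}" using i g by (metis imageI inv_f_f)
    ultimately show ?thesis using q(2)[of x] by simp
  qed
  have "act h v = act q (act g v)"
    using supportedD[OF X(2), of h "q \<circ> g"] g q v by (simp add: act_comp inj_compose)
  moreover have "map q [1..<Suc n] = [1..<Suc n]" using qi by (intro map_idI) auto
  ultimately have "Dn n (act h v) = act (dup q) (Dn n (act g v))"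
    using D_act[OF q(1), of "act g v" "[1..<Suc n]"] act_closed g v by (simp del: upt_Suc)
  also have "\<dots> = Dn n (act g v)"
  proof (rule supported_fix[OF Dn_supported[OF T]])
    show "dup q x = x" if "x \<in> {y. y div 2 \<in> {1..n}}" for x using that qi[of "x div 2"] by (simp add: dup_def)
  qed (use act_closed D_closed g v q inj_dup in auto)
  finally show ?thesis by simp
qed

text \<open>A permutation of \<open>{1..n}\<close> only reorders the factors, so the doubled
  permutation acts on the image of \<open>Dn n\<close>.\<close>

lemma Dn_permute:
  assumes v: "v \<in> carrier V" and \<sigma>: "\<sigma> permutes {1..n}"
  shows "Dn n (act \<sigma> v) = act (dup \<sigma>) (Dn n v)"
proof -
  have "set (map \<sigma> [1..<Suc n]) = set [1..<Suc n]" using permutes_image[OF \<sigma>] by (auto simp del: upt_Suc simp: atLeastLessThanSuc_atLeastAtMost)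
  moreover have "distinct (map \<sigma> [1..<Suc n])" using permutes_inj[OF \<sigma>] by (simp add: distinct_map inj_on_subset[OF _ subset_UNIV] del: upt_Suc)
  ultimately have "mset (map \<sigma> [1..<Suc n]) = mset [1..<Suc n]" by (metis distinct_upt set_eq_iff_mset_eq_distinct)
  then show ?thesis
    using D_act[OF permutes_inj[OF \<sigma>] v, of "[1..<Suc n]"] D_perm act_closed[OF permutes_inj[OF \<sigma>] v] by metis
qed

text \<open>The value at \<open>f\<close> of the function attached to \<open>v\<close>. The choice
  made by \<open>SOME\<close> is harmless once \<open>vanishes_above n\<close> holds: see
  \<open>coeff_eq\<close>.\<close>

definition coeff :: "nat \<Rightarrow> (nat \<Rightarrow> nat) \<Rightarrow> 'w \<Rightarrow> 'w" where
  "coeff n f v = Dn n (act (SOME g. inj g \<and> (\<forall>i\<in>{1..n}. g (f i) = i)) v)"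

context
  fixes n assumes T: "vanishes_above n"
begin

lemma coeff_eq:
  assumes "f \<in> injections n" "inj g" "\<And>i. i \<in> {1..n} \<Longrightarrow> g (f i) = i" "v \<in> carrier V"
  shows "coeff n f v = Dn n (act g v)"
proof -
  have "\<exists>g. inj g \<and> (\<forall>i\<in>{1..n}. g (f i) = i)" using injection_retract[OF assms(1)] by metis
  note h = someI_ex[OF this]
  show ?thesis unfolding coeff_def using h assms by (intro Dn_act_cong[OF T]) blast+
qed

lemma coeff_act:
  assumes f: "f \<in> injections n" and h: "inj h" and v: "v \<in> carrier V"
  shows "coeff n (compose {1..n} h f) (act h v) = coeff n f v"
proof -
  obtain g where g: "inj g" "\<And>i. i \<in> {1..n} \<Longrightarrow> g (compose {1..n} h f i) = i"
    using injection_retract[OF compose_injection[OF h f]] by blast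
  have "coeff n (compose {1..n} h f) (act h v) = Dn n (act (g \<circ> h) v)"
    using coeff_eq[OF compose_injection[OF h f] g] h v g by (simp add: act_closed act_comp)
  also have "\<dots> = coeff n f v"
    using f g h v by (intro coeff_eq[symmetric]) (auto simp: inj_compose compose_eq)
  finally show ?thesis .
qed

text \<open>If \<open>f i\<close> is missed by \<open>h\<close>, then \<open>i\<close> is missed by
  \<open>g \<circ> h\<close>, and the factor at \<open>i\<close> kills the vector. With
  \<open>coeff_act\<close> this matches the action \<open>func_act\<close> on functions, which
  extends by zero.\<close>

lemma coeff_act_zero:
  assumes f: "f \<in> injections n" and h: "inj h" and v: "v \<in> carrier V" and "\<not> f ` {1..n} \<subseteq> range h"
  shows "coeff n f (act h v) = \<zero>\<^bsub>V\<^esub>"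
proof -
  obtain i where i: "i \<in> {1..n}" "f i \<notin> range h" using assms(4) by blast
  obtain g where g: "inj g" "\<And>i. i \<in> {1..n} \<Longrightarrow> g (f i) = i" using injection_retract[OF f] by blast
  have "i \<notin> range (g \<circ> h)" using g(2)[OF i(1)] i(2) g(1) by (auto dest: injD)
  then have "Dn n (act (g \<circ> h) v) = \<zero>\<^bsub>V\<^esub>" using i g h v by (intro D_zero_range) (auto simp: inj_compose)
  then show ?thesis using coeff_eq[OF f g, of "act h v"] g h v by (simp add: act_comp act_closed)
qed

text \<open>Bounds the injections with nonzero coefficient, so that the function attached to
  \<open>v\<close> has finite support.\<close>

lemma coeff_supported:
  assumes f: "f \<in> injections n" and v: "v \<in> carrier V" "supported X v" and "\<not> f ` {1..n} \<subseteq> X"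
  shows "coeff n f v = \<zero>\<^bsub>V\<^esub>"
proof -
  obtain i where i: "i \<in> {1..n}" "f i \<notin> X" using assms by blast
  obtain g where g: "inj g" "\<And>i. i \<in> {1..n} \<Longrightarrow> g (f i) = i" using injection_retract[OF f] by blast
  have "i \<notin> g ` X"
  proof
    assume "i \<in> g ` X"
    then obtain x where "x \<in> X" "g (f i) = g x" using g(2)[OF i(1)] by auto
    then show False using i(2) g(1) by (simp add: inj_eq)
  qed
  then have "Dn n (act g v) = \<zero>\<^bsub>V\<^esub>"
    using D_zero_off[OF supported_act[OF v(2,1) g(1)] act_closed[OF g(1) v(1)]] i(1) by (simp del: upt_Suc)
  then show ?thesis using coeff_eq[OF f g v(1)] by metis
qed

text \<open>If \<open>g\<close> inverts \<open>f\<close>, then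
  \<open>inv' \<sigma> \<circ> g\<close> inverts \<open>f \<circ> \<sigma>\<close>; this is the
  origin of the inverse in the equivariance condition of \<open>func\<close>.\<close>

lemma coeff_permute:
  assumes f: "f \<in> injections n" and v: "v \<in> carrier V" and \<sigma>: "\<sigma> permutes {1..n}"
  shows "coeff n (f \<circ> \<sigma>) v = act (dup (inv' \<sigma>)) (coeff n f v)"
proof -
  obtain g where g: "inj g" "\<And>i. i \<in> {1..n} \<Longrightarrow> g (f i) = i" using injection_retract[OF f] by blast
  have \<tau>: "inv' \<sigma> permutes {1..n}" using \<sigma> by (rule permutes_inv)
  have "coeff n (f \<circ> \<sigma>) v = Dn n (act (inv' \<sigma> \<circ> g) v)"
  proof (rule coeff_eq)
    show "(inv' \<sigma> \<circ> g) ((f \<circ> \<sigma>) i) = i" if "i \<in> {1..n}" for i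
      using g(2)[of "\<sigma> i"] permutes_in_image[OF \<sigma>] that permutes_inverses[OF \<sigma>] by simp
  qed (use injection_permute f \<sigma> g v permutes_inj[OF \<tau>] inj_compose in auto)
  also have "\<dots> = act (dup (inv' \<sigma>)) (Dn n (act g v))"
    using Dn_permute[OF _ \<tau>, of "act g v"] permutes_inj[OF \<tau>] g v by (simp add: act_comp act_closed del: upt_Suc)
  finally show ?thesis using coeff_eq[OF f g v] by simp
qed

lemma coeff_std: "v \<in> carrier V \<Longrightarrow> coeff n (std n) v = Dn n v"
  using coeff_eq[OF std_injection, of id v] by (simp add: act_id std_def)

lemma coeff_closed: "v \<in> carrier V \<Longrightarrow> f \<in> injections n \<Longrightarrow> coeff n f v \<in> Dn n ` carrier V"
  using injection_retract coeff_eq act_closed by (metis imageI)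

lemma coeff_add: "f \<in> injections n \<Longrightarrow> v \<in> carrier V \<Longrightarrow> w \<in> carrier V \<Longrightarrow>
    coeff n f (v \<oplus>\<^bsub>V\<^esub> w) = coeff n f v \<oplus>\<^bsub>V\<^esub> coeff n f w"
  using injection_retract[of f n] coeff_eq[of f] by (metis D_add M.a_closed act_add act_closed)

lemma coeff_smult: "f \<in> injections n \<Longrightarrow> v \<in> carrier V \<Longrightarrow> a \<in> carrier K \<Longrightarrow>
    coeff n f (a \<odot>\<^bsub>V\<^esub> v) = a \<odot>\<^bsub>V\<^esub> coeff n f v"
  using injection_retract[of f n] coeff_eq[of f] by (metis D_smult act_smult smult_closed act_closed)

end

end

section \<open>Representations induced from symmetric groups\<close>

declare One_nat_def [simp del] upt_Suc [simp del]

text \<open>A module over the group algebra in another guise: a \<open>K\<close>-module with an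
  action of the permutations. The arguments about induced representations use this form, and the
  group algebra enters only through a dictionary.\<close>

locale perm_rep = left_module K E
  for K :: "('k, 'x) ring_scheme" and n :: nat and E :: "('k, 'v) module"
    and \<rho> :: "(nat \<Rightarrow> nat) \<Rightarrow> 'v \<Rightarrow> 'v" +
  assumes \<rho>_closed: "\<sigma> permutes {1..n} \<Longrightarrow> x \<in> carrier E \<Longrightarrow> \<rho> \<sigma> x \<in> carrier E"
    and \<rho>_add: "\<sigma> permutes {1..n} \<Longrightarrow> x \<in> carrier E \<Longrightarrow> y \<in> carrier E \<Longrightarrow> \<rho> \<sigma> (x \<oplus>\<^bsub>E\<^esub> y) = \<rho> \<sigma> x \<oplus>\<^bsub>E\<^esub> \<rho> \<sigma> y"
    and \<rho>_smult: "\<sigma> permutes {1..n} \<Longrightarrow> a \<in> carrier K \<Longrightarrow> x \<in> carrier E \<Longrightarrow> \<rho> \<sigma> (a \<odot>\<^bsub>E\<^esub> x) = a \<odot>\<^bsub>E\<^esub> \<rho> \<sigma> x"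
    and \<rho>_id: "x \<in> carrier E \<Longrightarrow> \<rho> id x = x"
    and \<rho>_comp: "\<sigma> permutes {1..n} \<Longrightarrow> \<tau> permutes {1..n} \<Longrightarrow> x \<in> carrier E \<Longrightarrow> \<rho> (\<sigma> \<circ> \<tau>) x = \<rho> \<sigma> (\<rho> \<tau> x)"

definition perm_sub where
  "perm_sub K n E \<rho> H \<longleftrightarrow> submodule H K E \<and> (\<forall>\<sigma>. \<sigma> permutes {1..n} \<longrightarrow> (\<forall>x\<in>H. \<rho> \<sigma> x \<in> H))"

definition simple_perm_rep where
  "simple_perm_rep K n E \<rho> \<longleftrightarrow> perm_rep K n E \<rho> \<and> carrier E \<noteq> {\<zero>\<^bsub>E\<^esub>} \<and>
     (\<forall>H. perm_sub K n E \<rho> H \<longrightarrow> H = {\<zero>\<^bsub>E\<^esub>} \<or> H = carrier E)"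

definition perm_maps where
  "perm_maps K n E \<rho> E' \<rho>' = {h \<in> lin_maps K E E'. \<forall>\<sigma>. \<sigma> permutes {1..n} \<longrightarrow> (\<forall>x\<in>carrier E. h (\<rho> \<sigma> x) = \<rho>' \<sigma> (h x))}"

text \<open>
  The representation induced from \<open>E\<close>: a finitely supported function \<open>\<phi>\<close> on the injections
  \<open>{1..n} \<rightarrow> \<nat>\<close>, equivariant for the symmetric group, is a choice of an element in the copy of \<open>E\<close>
  attached to each of finitely many subsets with \<open>n\<close> elements.
\<close>

definition func :: "nat \<Rightarrow> ('k, 'v) module \<Rightarrow> ((nat \<Rightarrow> nat) \<Rightarrow> 'v \<Rightarrow> 'v) \<Rightarrow> ('k, (nat \<Rightarrow> nat) \<Rightarrow> 'v) module" where
  "func n E \<rho> = \<lparr>carrier = {\<phi> \<in> injections n \<rightarrow>\<^sub>E carrier E.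
       (\<forall>\<sigma>. \<sigma> permutes {1..n} \<longrightarrow> (\<forall>f\<in>injections n. \<phi> (f \<circ> \<sigma>) = \<rho> (inv' \<sigma>) (\<phi> f))) \<and>
       (\<exists>X. finite X \<and> (\<forall>f\<in>injections n. \<not> f ` {1..n} \<subseteq> X \<longrightarrow> \<phi> f = \<zero>\<^bsub>E\<^esub>))},
     mult = undefined, one = undefined,
     zero = (\<lambda>f\<in>injections n. \<zero>\<^bsub>E\<^esub>), add = (\<lambda>\<phi> \<psi>. \<lambda>f\<in>injections n. \<phi> f \<oplus>\<^bsub>E\<^esub> \<psi> f),
     smult = (\<lambda>a \<phi>. \<lambda>f\<in>injections n. a \<odot>\<^bsub>E\<^esub> \<phi> f)\<rparr>"

text \<open>Push-forward of functions along \<open>g\<close>: the value at the composite of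
  \<open>g\<close> with an injection is the old value there, and injections not landing in the range
  of \<open>g\<close> get zero.\<close>

definition func_act :: "nat \<Rightarrow> ('k, 'v) module \<Rightarrow> ((nat \<Rightarrow> nat) \<Rightarrow> 'v \<Rightarrow> 'v) \<Rightarrow> (nat \<Rightarrow> nat) \<Rightarrow> ((nat \<Rightarrow> nat) \<Rightarrow> 'v) \<Rightarrow> (nat \<Rightarrow> nat) \<Rightarrow> 'v" where
  "func_act n E \<rho> g = (\<lambda>\<phi>\<in>carrier (func n E \<rho>). \<lambda>f\<in>injections n.
     if f ` {1..n} \<subseteq> range g then \<phi> (compose {1..n} (inv' g) f) else \<zero>\<^bsub>E\<^esub>)"

text \<open>Injections are \<open>undefined\<close> outside \<open>{1..n}\<close>, whereas
  \<open>permutes\<close> wants the identity there.\<close>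

definition to_perm :: "nat \<Rightarrow> (nat \<Rightarrow> nat) \<Rightarrow> nat \<Rightarrow> nat" where
  "to_perm n f i = (if i \<in> {1..n} then f i else i)"

lemma injection_factor:
  assumes "f \<in> injections n" "inj g" "f ` {1..n} \<subseteq> range g"
  shows "compose {1..n} (inv' g) f \<in> injections n" "compose {1..n} g (compose {1..n} (inv' g) f) = f"
proof -
  have g: "g (inv' g (f i)) = f i" if "i \<in> {1..n}" for i using assms that by (meson f_inv_into_f image_subset_iff)
  show "compose {1..n} (inv' g) f \<in> injections n"
    unfolding injections_def
  proof (intro CollectI conjI inj_onI)
    fix i j assume ij: "i \<in> {1..n}" "j \<in> {1..n}" "compose {1..n} (inv' g) f i = compose {1..n} (inv' g) f j"
    then have "inv' g (f i) = inv' g (f j)" by (simp add: compose_eq)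
    then have "f i = f j" using g ij by metis
    then show "i = j" using assms(1) ij unfolding injections_def inj_on_def by blast
  qed (simp add: compose_extensional)
  show "compose {1..n} g (compose {1..n} (inv' g) f) = f"
  proof
    show "compose {1..n} g (compose {1..n} (inv' g) f) i = f i" for i
    proof (cases "i \<in> {1..n}")
      case True
      then show ?thesis using g by (simp add: compose_eq)
    next
      case False
      then show ?thesis using assms(1) unfolding compose_def injections_def extensional_def by auto
    qed
  qed
qed

lemma injection_cancel:
  assumes "f \<in> injections n" "inj g" shows "compose {1..n} (inv' g) (compose {1..n} g f) = f"
  using assms by (intro ext) (auto simp: compose_def injections_def extensional_def)

lemma compose_permute: "\<sigma> permutes {1..n} \<Longrightarrow> compose {1..n} g (f \<circ> \<sigma>) = compose {1..n} g f \<circ> \<sigma>"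
proof
  fix i assume \<sigma>: "\<sigma> permutes {1..n}"
  show "compose {1..n} g (f \<circ> \<sigma>) i = (compose {1..n} g f \<circ> \<sigma>) i"
    using permutes_in_image[OF \<sigma>, of i] by (simp add: compose_def)
qed

lemma compose_assoc': "compose {1..n} g (compose {1..n} h f) = compose {1..n} (g \<circ> h) (f :: nat \<Rightarrow> nat)"
  by (auto simp: compose_def)

lemma image_compose: "compose A g f ` A = g ` f ` A"
  by (auto simp: compose_def)

lemma image_permute: "\<sigma> permutes A \<Longrightarrow> (f \<circ> \<sigma>) ` A = f ` A"
  using permutes_image[of \<sigma> A] by (metis image_comp)

lemma to_perm_permutes:
  assumes "f \<in> injections n" "f ` {1..n} = {1..n}" shows "to_perm n f permutes {1..n}"
proof (rule bij_imp_permutes)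
  show "bij_betw (to_perm n f) {1..n} {1..n}"
    using assms bij_betw_cong[of "{1..n}" "to_perm n f" f "{1..n}"] by (simp add: bij_betw_def injections_def to_perm_def)
qed (auto simp: to_perm_def)

lemma std_to_perm: "f \<in> injections n \<Longrightarrow> f ` {1..n} \<subseteq> {1..n} \<Longrightarrow> std n \<circ> to_perm n f = f"
  unfolding fun_eq_iff std_def to_perm_def injections_def extensional_def
  by (auto simp: image_subset_iff)

lemma to_perm_comp:
  assumes "\<sigma> permutes {1..n}" shows "to_perm n (f \<circ> \<sigma>) = to_perm n f \<circ> \<sigma>"
  using permutes_in_image[OF assms] permutes_not_in[OF assms] by (auto simp: fun_eq_iff to_perm_def)

lemma to_perm_std: "to_perm n (std n) = id"
  by (auto simp: to_perm_def std_def)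

context perm_rep
begin

abbreviation "V \<equiv> func n E \<rho>"
abbreviation "act \<equiv> func_act n E \<rho>"

abbreviation "vanishes_off X \<phi> \<equiv> \<forall>f\<in>injections n. \<not> f ` {1..n} \<subseteq> X \<longrightarrow> \<phi> f = \<zero>\<^bsub>E\<^esub>"

lemma func_simps:
  "f \<in> injections n \<Longrightarrow> \<zero>\<^bsub>V\<^esub> f = \<zero>\<^bsub>E\<^esub>"
  "f \<in> injections n \<Longrightarrow> (\<phi> \<oplus>\<^bsub>V\<^esub> \<psi>) f = \<phi> f \<oplus>\<^bsub>E\<^esub> \<psi> f"
  "f \<in> injections n \<Longrightarrow> (a \<odot>\<^bsub>V\<^esub> \<phi>) f = a \<odot>\<^bsub>E\<^esub> \<phi> f"
  by (auto simp: func_def)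

lemma func_closed: "\<phi> \<in> carrier V \<Longrightarrow> f \<in> injections n \<Longrightarrow> \<phi> f \<in> carrier E"
  by (auto simp: func_def)

lemma func_permute: "\<phi> \<in> carrier V \<Longrightarrow> f \<in> injections n \<Longrightarrow> \<sigma> permutes {1..n} \<Longrightarrow> \<phi> (f \<circ> \<sigma>) = \<rho> (inv' \<sigma>) (\<phi> f)"
  by (auto simp: func_def)

lemma func_finite: "\<phi> \<in> carrier V \<Longrightarrow> \<exists>X. finite X \<and> (vanishes_off X \<phi>)"
  by (auto simp: func_def)

lemma funcI:
  assumes "\<phi> \<in> extensional (injections n)" "\<And>f. f \<in> injections n \<Longrightarrow> \<phi> f \<in> carrier E"
    "\<And>f \<sigma>. f \<in> injections n \<Longrightarrow> \<sigma> permutes {1..n} \<Longrightarrow> \<phi> (f \<circ> \<sigma>) = \<rho> (inv' \<sigma>) (\<phi> f)"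
    "finite X" "\<And>f. f \<in> injections n \<Longrightarrow> \<not> f ` {1..n} \<subseteq> X \<Longrightarrow> \<phi> f = \<zero>\<^bsub>E\<^esub>"
  shows "\<phi> \<in> carrier V"
proof -
  have "\<exists>X. finite X \<and> (vanishes_off X \<phi>)" using assms(4,5) by blast
  then show ?thesis using assms(1-3) unfolding func_def by (simp add: PiE_def Pi_def)
qed

lemma func_eqI:
  assumes "\<phi> \<in> carrier V" "\<psi> \<in> carrier V" "\<And>f. f \<in> injections n \<Longrightarrow> \<phi> f = \<psi> f" shows "\<phi> = \<psi>"
proof (rule extensionalityI)
  show "\<phi> \<in> extensional (injections n)" "\<psi> \<in> extensional (injections n)"
    using assms by (auto simp: func_def PiE_def)
qed (rule assms(3))

lemma \<rho>_zero: "\<sigma> permutes {1..n} \<Longrightarrow> \<rho> \<sigma> \<zero>\<^bsub>E\<^esub> = \<zero>\<^bsub>E\<^esub>"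
  by (metis M.zero_closed R.zero_closed \<rho>_closed \<rho>_smult smult_l_null)

lemma func_zero: "\<zero>\<^bsub>V\<^esub> \<in> carrier V"
  by (rule funcI[where X = "{}"]) (auto simp: func_simps injection_permute \<rho>_zero permutes_inv, simp add: func_def)

lemma func_add:
  assumes "\<phi> \<in> carrier V" "\<psi> \<in> carrier V" shows "\<phi> \<oplus>\<^bsub>V\<^esub> \<psi> \<in> carrier V"
proof -
  obtain X Y where X: "finite X" "vanishes_off X \<phi>"
      and Y: "finite Y" "vanishes_off Y \<psi>"
    using func_finite[OF assms(1)] func_finite[OF assms(2)] by blast
  show ?thesis
  proof (rule funcI[where X = "X \<union> Y"])
    show "\<phi> \<oplus>\<^bsub>V\<^esub> \<psi> \<in> extensional (injections n)" by (simp add: func_def)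
    show "(\<phi> \<oplus>\<^bsub>V\<^esub> \<psi>) (f \<circ> \<sigma>) = \<rho> (inv' \<sigma>) ((\<phi> \<oplus>\<^bsub>V\<^esub> \<psi>) f)" if "f \<in> injections n" "\<sigma> permutes {1..n}" for f \<sigma>
      using that assms by (simp add: func_simps func_closed injection_permute func_permute \<rho>_add permutes_inv)
    show "(\<phi> \<oplus>\<^bsub>V\<^esub> \<psi>) f = \<zero>\<^bsub>E\<^esub>" if f: "f \<in> injections n" "\<not> f ` {1..n} \<subseteq> X \<union> Y" for f
    proof -
      have "\<phi> f = \<zero>\<^bsub>E\<^esub>" "\<psi> f = \<zero>\<^bsub>E\<^esub>" using X Y f by blast+
      then show ?thesis using f(1) by (simp add: func_simps)
    qed
  qed (use X Y assms in \<open>simp_all add: func_simps func_closed\<close>)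
qed

lemma func_smult:
  assumes "\<phi> \<in> carrier V" "a \<in> carrier K" shows "a \<odot>\<^bsub>V\<^esub> \<phi> \<in> carrier V"
proof -
  obtain X where X: "finite X" "vanishes_off X \<phi>"
    using func_finite[OF assms(1)] by blast
  show ?thesis
  proof (rule funcI[where X = X])
    show "a \<odot>\<^bsub>V\<^esub> \<phi> \<in> extensional (injections n)" by (simp add: func_def)
    show "(a \<odot>\<^bsub>V\<^esub> \<phi>) (f \<circ> \<sigma>) = \<rho> (inv' \<sigma>) ((a \<odot>\<^bsub>V\<^esub> \<phi>) f)" if "f \<in> injections n" "\<sigma> permutes {1..n}" for f \<sigma>
      using that assms by (simp add: func_simps func_closed injection_permute func_permute \<rho>_smult permutes_inv)
    show "(a \<odot>\<^bsub>V\<^esub> \<phi>) f = \<zero>\<^bsub>E\<^esub>" if f: "f \<in> injections n" "\<not> f ` {1..n} \<subseteq> X" for f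
    proof -
      have "\<phi> f = \<zero>\<^bsub>E\<^esub>" using X f by blast
      then show ?thesis using f(1) assms by (simp add: func_simps smult_r_null)
    qed
  qed (use X assms in \<open>simp_all add: func_simps func_closed smult_closed\<close>)
qed

lemma func_module: "left_module K V"
proof (rule left_moduleI)
  show "\<exists>\<psi>\<in>carrier V. \<psi> \<oplus>\<^bsub>V\<^esub> \<phi> = \<zero>\<^bsub>V\<^esub>" if \<phi>: "\<phi> \<in> carrier V" for \<phi>
  proof
    show *: "(\<ominus>\<^bsub>K\<^esub> \<one>\<^bsub>K\<^esub>) \<odot>\<^bsub>V\<^esub> \<phi> \<in> carrier V" using \<phi> by (intro func_smult) auto
    show "(\<ominus>\<^bsub>K\<^esub> \<one>\<^bsub>K\<^esub>) \<odot>\<^bsub>V\<^esub> \<phi> \<oplus>\<^bsub>V\<^esub> \<phi> = \<zero>\<^bsub>V\<^esub>"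
      by (rule func_eqI) (use \<phi> * in \<open>auto simp: func_simps func_zero func_add smult_minus_one func_closed M.l_neg\<close>)
  qed
qed (auto intro!: func_eqI simp: func_add func_zero func_smult func_simps func_closed M.a_ac smult_closed
      smult_l_distr smult_r_distr smult_assoc smult_one R.ring_axioms)

lemma eval_map:
  assumes "f \<in> injections n" shows "lin_map K V E (\<lambda>\<phi>\<in>carrier V. \<phi> f)"
  unfolding lin_map_iff
  by (intro conjI func_module left_module_axioms lin_mapsI)
    (auto simp: assms func_closed func_simps func_add func_smult)

lemma func_diff: "\<phi> \<in> carrier V \<Longrightarrow> \<psi> \<in> carrier V \<Longrightarrow> f \<in> injections n \<Longrightarrow> (\<phi> \<ominus>\<^bsub>V\<^esub> \<psi>) f = \<phi> f \<ominus>\<^bsub>E\<^esub> \<psi> f"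
proof -
  assume *: "\<phi> \<in> carrier V" "\<psi> \<in> carrier V" "f \<in> injections n"
  interpret VV: left_module K V by (rule func_module)
  show ?thesis using lin_map.diff[OF eval_map[OF *(3)] *(1,2)] * by simp
qed

lemma act_range: "\<phi> \<in> carrier V \<Longrightarrow> f \<in> injections n \<Longrightarrow> inj g \<Longrightarrow> act g \<phi> (compose {1..n} g f) = \<phi> f"
  using compose_injection[of g f n] injection_cancel[of f n g] by (auto simp: func_act_def image_compose)

lemma act_not_range: "\<phi> \<in> carrier V \<Longrightarrow> f \<in> injections n \<Longrightarrow> \<not> f ` {1..n} \<subseteq> range g \<Longrightarrow> act g \<phi> f = \<zero>\<^bsub>E\<^esub>"
  by (auto simp: func_act_def)

lemma act_cases:
  assumes "f \<in> injections n" "inj g"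
  obtains f' where "f' \<in> injections n" "f = compose {1..n} g f'" | "\<not> f ` {1..n} \<subseteq> range g"
  using injection_factor[OF assms] by metis

lemma act_support:
  assumes \<phi>: "\<phi> \<in> carrier V" and X: "vanishes_off X \<phi>"
    and f: "f \<in> injections n" and g: "inj g" and "\<not> f ` {1..n} \<subseteq> g ` X"
  shows "act g \<phi> f = \<zero>\<^bsub>E\<^esub>"
proof (cases rule: act_cases[OF f g])
  case (1 f')
  then have "\<not> f' ` {1..n} \<subseteq> X" using assms(5) by (auto simp: image_compose)
  then show ?thesis using 1 X act_range[OF \<phi> _ g] by simp
qed (use act_not_range \<phi> f in blast)

lemma act_closed:
  assumes \<phi>: "\<phi> \<in> carrier V" and g: "inj g" shows "act g \<phi> \<in> carrier V"
proof -
  obtain X where X: "finite X" "vanishes_off X \<phi>"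
    using func_finite[OF \<phi>] by blast
  show ?thesis
  proof (rule funcI[where X = "g ` X"])
    show "act g \<phi> \<in> extensional (injections n)" using \<phi> by (simp add: func_act_def)
    show "act g \<phi> f \<in> carrier E" if f: "f \<in> injections n" for f
      by (cases rule: act_cases[OF f g]) (use \<phi> f g in \<open>auto simp: act_range act_not_range func_closed\<close>)
    show "act g \<phi> (f \<circ> \<sigma>) = \<rho> (inv' \<sigma>) (act g \<phi> f)" if f: "f \<in> injections n" and \<sigma>: "\<sigma> permutes {1..n}" for f \<sigma>
    proof (cases rule: act_cases[OF f g])
      case (1 f')
      then have "f \<circ> \<sigma> = compose {1..n} g (f' \<circ> \<sigma>)" using compose_permute[OF \<sigma>, of g f'] by simp
      then show ?thesis using 1 \<phi> g \<sigma> by (simp add: act_range injection_permute func_permute)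
    next
      case 2
      then have "\<not> (f \<circ> \<sigma>) ` {1..n} \<subseteq> range g" by (simp only: image_permute[OF \<sigma>] not_False_eq_True)
      then show ?thesis using 2 \<phi> \<sigma> f act_not_range injection_permute by (simp add: \<rho>_zero permutes_inv)
    qed
    show "finite (g ` X)" using X by simp
    show "act g \<phi> f = \<zero>\<^bsub>E\<^esub>" if "f \<in> injections n" "\<not> f ` {1..n} \<subseteq> g ` X" for f
      using act_support[OF \<phi> X(2) _ g] that by blast
  qed
qed

lemma func_supported:
  assumes \<phi>: "\<phi> \<in> carrier V" and X: "vanishes_off X \<phi>"
    and g: "inj g" "inj h" "\<forall>x\<in>X. g x = h x"
  shows "act g \<phi> = act h \<phi>"
proof (rule func_eqI)
  fix f assume f: "f \<in> injections n"
  show "act g \<phi> f = act h \<phi> f"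
  proof (cases "f ` {1..n} \<subseteq> g ` X")
    case True
    then have r: "f ` {1..n} \<subseteq> range g" by auto
    let ?f = "compose {1..n} (inv' g) f"
    note F = injection_factor[OF f g(1) r]
    have "?f ` {1..n} \<subseteq> X" using True g(1) by (auto simp: image_compose)
    then have "compose {1..n} g ?f = compose {1..n} h ?f" using g(3) by (auto simp: compose_def fun_eq_iff image_subset_iff)
    then show ?thesis using act_range[OF \<phi> F(1) g(1)] act_range[OF \<phi> F(1) g(2)] F(2) by simp
  next
    case False
    moreover have "g ` X = h ` X" using g(3) by (intro image_cong) auto
    ultimately show ?thesis using act_support[OF \<phi> X f g(1)] act_support[OF \<phi> X f g(2)] by simp
  qed
qed (use \<phi> g act_closed in auto)

lemma func_rep: "inj_rep K V act"
proof (intro inj_rep.intro inj_rep_axioms.intro)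
  show "left_module K V" by (rule func_module)
  fix g :: "nat \<Rightarrow> nat" assume g: "inj g"
  show "act g \<in> lin_maps K V V"
  proof (rule lin_mapsI)
    show "act g \<in> extensional (carrier V)" by (simp add: func_act_def)
    show "act g (\<phi> \<oplus>\<^bsub>V\<^esub> \<psi>) = act g \<phi> \<oplus>\<^bsub>V\<^esub> act g \<psi>" if *: "\<phi> \<in> carrier V" "\<psi> \<in> carrier V" for \<phi> \<psi>
    proof (rule func_eqI)
      show "act g (\<phi> \<oplus>\<^bsub>V\<^esub> \<psi>) f = (act g \<phi> \<oplus>\<^bsub>V\<^esub> act g \<psi>) f" if f: "f \<in> injections n" for f
        by (cases rule: act_cases[OF f g]) (use * f g in \<open>auto simp: func_simps act_range act_not_range func_add compose_injection\<close>)
    qed (use * g act_closed func_add in auto)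
    show "act g (a \<odot>\<^bsub>V\<^esub> \<phi>) = a \<odot>\<^bsub>V\<^esub> act g \<phi>" if *: "a \<in> carrier K" "\<phi> \<in> carrier V" for a \<phi>
    proof (rule func_eqI)
      show "act g (a \<odot>\<^bsub>V\<^esub> \<phi>) f = (a \<odot>\<^bsub>V\<^esub> act g \<phi>) f" if f: "f \<in> injections n" for f
        by (cases rule: act_cases[OF f g]) (use * f g in \<open>auto simp: func_simps act_range act_not_range func_smult compose_injection smult_r_null\<close>)
    qed (use * g act_closed func_smult in auto)
  qed (use g act_closed in auto)
next
  fix \<phi> assume \<phi>: "\<phi> \<in> carrier V"
  show "act id \<phi> = \<phi>"
  proof (rule func_eqI)
    show "act id \<phi> f = \<phi> f" if "f \<in> injections n" for f
    proof -
      have "compose {1..n} id f = f" using that by (auto simp: compose_def injections_def extensional_def)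
      then show ?thesis using act_range[OF \<phi> that, of id] by simp
    qed
  qed (use \<phi> act_closed in auto)
  obtain X where X: "finite X" "vanishes_off X \<phi>"
    using func_finite[OF \<phi>] by blast
  show "\<exists>X. finite X \<and> (\<forall>g h. inj g \<longrightarrow> inj h \<longrightarrow> (\<forall>x\<in>X. g x = h x) \<longrightarrow> act g \<phi> = act h \<phi>)"
    using X(1) func_supported[OF \<phi> X(2)] by (intro exI[of _ X] conjI allI impI)
next
  fix g h :: "nat \<Rightarrow> nat" and \<phi> assume g: "inj g" and h: "inj h" and \<phi>: "\<phi> \<in> carrier V"
  show "act (g \<circ> h) \<phi> = act g (act h \<phi>)"
  proof (rule func_eqI)
    fix f assume f: "f \<in> injections n"
    have gh: "inj (g \<circ> h)" using g h by (rule inj_compose)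
    show "act (g \<circ> h) \<phi> f = act g (act h \<phi>) f"
    proof (cases rule: act_cases[OF f gh])
      case (1 f')
      then have "f = compose {1..n} g (compose {1..n} h f')" by (simp add: compose_assoc')
      then show ?thesis using 1 \<phi> g h gh by (metis act_closed act_range compose_injection)
    next
      case 2
      have "act g (act h \<phi>) f = \<zero>\<^bsub>E\<^esub>"
      proof (cases rule: act_cases[OF f g])
        case (1 f')
        then have "\<not> f' ` {1..n} \<subseteq> range h" using 2 by (auto simp: image_compose)
        then show ?thesis using 1 \<phi> g h by (simp add: act_range act_not_range act_closed)
      qed (use \<phi> f h act_closed act_not_range in blast)
      then show ?thesis using 2 \<phi> f act_not_range by simp
    qed
  qed (use \<phi> g h act_closed inj_compose in auto)
qed

lemma act_tr:
  assumes "\<phi> \<in> carrier V" "f \<in> injections n" shows "act (tr a) \<phi> f = \<phi> (compose {1..n} (tr a) f)"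
proof -
  have "compose {1..n} (tr a) (compose {1..n} (tr a) f) = f"
    using assms(2) by (auto simp: compose_def tr_tr injections_def extensional_def)
  then show ?thesis using act_range[OF assms(1) compose_injection[OF inj_tr assms(2), of a] inj_tr, of a] by simp
qed

sublocale func: inj_rep K V act by (rule func_rep)

lemma D_tr:
  assumes "\<phi> \<in> carrier V" "f \<in> injections n"
  shows "func.D (a # xs) \<phi> f = func.D xs \<phi> f \<ominus>\<^bsub>E\<^esub> func.D xs \<phi> (compose {1..n} (tr a) f)"
  using assms by (simp add: func_diff func.D_closed act_closed act_tr)

lemma div2_tr: "(\<lambda>x. x div 2) ` compose {1..n} (tr a) f ` {1..n} = (\<lambda>x. x div 2) ` f ` {1..n}"
  by (auto simp: image_image compose_eq tr_div2)

text \<open>If \<open>f\<close> meets neither letter of the pair over \<open>a\<close>, then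
  \<open>tr a\<close> fixes \<open>f\<close> and the factor at \<open>a\<close> gives zero at
  \<open>f\<close>. The other swaps preserve this situation, since they do not change
  halves.\<close>

lemma D_missed:
  assumes "\<phi> \<in> carrier V" "f \<in> injections n" "a \<in> set xs" "a \<notin> (\<lambda>x. x div 2) ` f ` {1..n}"
  shows "func.D xs \<phi> f = \<zero>\<^bsub>E\<^esub>"
  using assms(2-)
proof (induction xs arbitrary: f)
  case (Cons b xs)
  note cl = func_closed[OF func.D_closed[OF assms(1)]]
  have f: "compose {1..n} (tr b) f \<in> injections n" using Cons.prems by (simp add: compose_injection)
  show ?case
  proof (cases "a \<in> set xs")
    case True
    have "a \<notin> (\<lambda>x. x div 2) ` compose {1..n} (tr b) f ` {1..n}" unfolding div2_tr by (rule Cons.prems(3))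
    then have "func.D xs \<phi> (compose {1..n} (tr b) f) = \<zero>\<^bsub>E\<^esub>" using Cons.IH[OF f True] by simp
    moreover have "func.D xs \<phi> f = \<zero>\<^bsub>E\<^esub>" using Cons True by blast
    ultimately show ?thesis unfolding D_tr[OF assms(1) Cons.prems(1)] by (simp add: M.diff_zero)
  next
    case False
    then have "a = b" using Cons.prems by simp
    have "compose {1..n} (tr b) f = f"
    proof
      fix i show "compose {1..n} (tr b) f i = f i"
        using Cons.prems \<open>a = b\<close> by (cases "i \<in> {1..n}") (auto simp: compose_def injections_def extensional_def intro!: tr_other)
    qed
    then show ?thesis
      unfolding D_tr[OF assms(1) Cons.prems(1)] using cl[OF Cons.prems(1)] by (simp add: M.diff_eq_zero_iff)
  qed
qed simp

text \<open>An injection of \<open>{1..n}\<close> meets at most \<open>n\<close> pairs, so more than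
  \<open>n\<close> distinct letters include one whose pair is missed.\<close>

lemma func_vanishes_above: "func.vanishes_above n"
  unfolding func.vanishes_above_def
proof (intro allI impI func_eqI)
  fix xs :: "nat list" and \<phi> f assume xs: "distinct xs" "n < length xs" and \<phi>: "\<phi> \<in> carrier V" and f: "f \<in> injections n"
  have "card ((\<lambda>x. x div 2) ` f ` {1..n}) \<le> n"
    using card_image_le[of "f ` {1..n}" "\<lambda>x. x div 2"] card_image_le[of "{1..n}" f] by simp
  then have "\<not> set xs \<subseteq> (\<lambda>x. x div 2) ` f ` {1..n}"
    using xs card_mono[of "(\<lambda>x. x div 2) ` f ` {1..n}" "set xs"] by (auto simp: distinct_card)
  then obtain a where "a \<in> set xs" "a \<notin> (\<lambda>x. x div 2) ` f ` {1..n}" by blast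
  then show "func.D xs \<phi> f = \<zero>\<^bsub>V\<^esub> f" using D_missed[OF \<phi> f] f by (simp add: func_simps)
qed (auto simp: func.D_closed)

lemma func_perm:
  assumes "\<phi> \<in> carrier V" "f \<in> injections n" "f ` {1..n} = {1..n}"
  shows "\<phi> f = \<rho> (inv' (to_perm n f)) (\<phi> (std n))"
  using func_permute[OF assms(1) std_injection to_perm_permutes[OF assms(2,3)]] std_to_perm[of f n] assms by simp

text \<open>Only injections that meet every pair over \<open>{1..n}\<close> matter, and they meet
  each exactly once. Unfolding the product, the surviving values of \<open>\<phi>\<close> are taken
  at permutations of \<open>{1..n}\<close>, hence lie in the orbit of
  \<open>\<phi> (std n)\<close>.\<close>

lemma Dn_mem:
  assumes H: "perm_sub K n E \<rho> H" and \<phi>: "\<phi> \<in> carrier V" "\<phi> (std n) \<in> H" and f: "f \<in> injections n"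
  shows "func.Dn n \<phi> f \<in> H"
proof (cases "{1..n} \<subseteq> (\<lambda>x. x div 2) ` f ` {1..n}")
  case False
  then obtain a where "a \<in> {1..n}" "a \<notin> (\<lambda>x. x div 2) ` f ` {1..n}" by blast
  then have "func.Dn n \<phi> f = \<zero>\<^bsub>E\<^esub>" using D_missed[OF \<phi>(1) f, of a "[1..<Suc n]"] by auto
  then show ?thesis using H submoduleD(2) by (auto simp: perm_sub_def)
next
  case True
  have sub: "submodule H K E" using H by (simp add: perm_sub_def)
  have "func.D xs \<phi> f \<in> H" if "f \<in> injections n" "{1..n} \<subseteq> (\<lambda>x. x div 2) ` f ` {1..n}" for xs f
    using that
  proof (induction xs arbitrary: f)
    case (Cons a xs)
    have "func.D xs \<phi> (compose {1..n} (tr a) f) \<in> H"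
      using Cons by (intro Cons.IH) (auto simp only: div2_tr compose_injection inj_tr)
    then show ?case unfolding D_tr[OF \<phi>(1) Cons.prems(1)] using Cons submoduleD(7)[OF sub] by blast
  next
    case Nil
    \<comment> \<open>The \<open>n\<close> values of \<open>f\<close> have at most \<open>n\<close>
      halves, so covering \<open>{1..n}\<close> leaves no room for others.\<close>
    have c: "(\<lambda>x. x div 2) ` f ` {1..n} = {1..n}"
      using Nil(2) card_image_le[of "f ` {1..n}" "\<lambda>x. x div 2"] card_image_le[of "{1..n}" f]
      by (intro card_seteq[symmetric]) auto
    show ?case
    proof (cases rule: act_cases[OF Nil(1) inj_dbl])
      case (1 f')
      then have "f' ` {1..n} = {1..n}" using c by (simp add: image_compose image_image dbl_def)
      then have "\<phi> f' \<in> H" using func_perm[OF \<phi>(1) 1(1)] H \<phi>(2) to_perm_permutes[OF 1(1)]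
        by (simp add: perm_sub_def permutes_inv)
      then show ?thesis using 1 act_range[OF \<phi>(1)] by simp
    next
      case 2
      then show ?thesis using act_not_range[OF \<phi>(1) Nil(1)] submoduleD(2)[OF sub] by simp
    qed
  qed
  then show ?thesis using True f by blast
qed

text \<open>\<open>act dbl\<close> gives functions vanishing at injections with an odd value, and
  \<open>Suc (2 * a)\<close> is moved only by the swap \<open>tr a\<close>, which does not
  occur.\<close>

lemma D_odd_zero:
  assumes "\<phi> \<in> carrier V" "f \<in> injections n" "a \<notin> set xs" "Suc (2 * a) \<in> f ` {1..n}"
  shows "func.D xs \<phi> f = \<zero>\<^bsub>E\<^esub>"
  using assms(2-)
proof (induction xs arbitrary: f)
  case Nil
  have "Suc (2 * a) \<notin> range dbl" by (auto simp: dbl_def) presburger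
  then have "\<not> f ` {1..n} \<subseteq> range dbl" using Nil by blast
  then show ?case using act_not_range[OF assms(1) Nil(1)] by simp
next
  case (Cons b xs)
  have "tr b (Suc (2 * a)) = Suc (2 * a)" using Cons.prems by (intro tr_other) auto
  then have "Suc (2 * a) \<in> compose {1..n} (tr b) f ` {1..n}"
    using Cons.prems(3) by (simp only: image_compose) (metis imageI)
  then have "func.D xs \<phi> (compose {1..n} (tr b) f) = \<zero>\<^bsub>E\<^esub>"
    using Cons.prems by (intro Cons.IH) (auto simp: compose_injection)
  moreover have "func.D xs \<phi> f = \<zero>\<^bsub>E\<^esub>" using Cons by simp
  ultimately show ?case unfolding D_tr[OF assms(1) Cons.prems(1)] by (simp add: M.diff_zero)
qed

text \<open>At the doubled standard injection only the identity term of the expanded product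
  survives: every swap produces an odd value that no remaining factor can remove.\<close>

lemma D_dbl:
  assumes "\<phi> \<in> carrier V" "distinct xs" "set xs \<subseteq> {1..n}"
  shows "func.D xs \<phi> (compose {1..n} dbl (std n)) = \<phi> (std n)"
  using assms(2-)
proof (induction xs)
  case Nil
  then show ?case using act_range[OF assms(1) std_injection inj_dbl] by simp
next
  case (Cons a xs)
  let ?f = "compose {1..n} dbl (std n)"
  have f: "?f \<in> injections n" by (simp add: compose_injection std_injection)
  have "Suc (2 * a) \<in> compose {1..n} (tr a) ?f ` {1..n}"
    using Cons.prems by (intro image_eqI[of _ _ a]) (auto simp: compose_eq std_def dbl_def tr_def)
  then have "func.D xs \<phi> (compose {1..n} (tr a) ?f) = \<zero>\<^bsub>E\<^esub>"
    using Cons.prems f assms(1) by (intro D_odd_zero) (auto simp: compose_injection)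
  then show ?case unfolding D_tr[OF assms(1) f] using Cons func_closed[OF assms(1) std_injection] by (simp add: M.diff_zero)
qed

lemma Dn_dbl: "\<phi> \<in> carrier V \<Longrightarrow> func.Dn n \<phi> (compose {1..n} dbl (std n)) = \<phi> (std n)"
  by (rule D_dbl) auto

lemma zero_perm_sub: "perm_sub K n E \<rho> {\<zero>\<^bsub>E\<^esub>}"
  by (auto simp: perm_sub_def zero_submodule \<rho>_zero)

text \<open>The operator \<open>Dn n\<close> and evaluation at \<open>std n\<close> have the same
  kernel: the evaluation can be read off from \<open>Dn n \<phi>\<close> by \<open>Dn_dbl\<close>,
  and conversely \<open>Dn_mem\<close> applies to the zero submodule. So the evaluation kernel is
  intrinsic to the representation.\<close>

lemma Dn_zero_iff:
  assumes \<phi>: "\<phi> \<in> carrier V" shows "func.Dn n \<phi> = \<zero>\<^bsub>V\<^esub> \<longleftrightarrow> \<phi> (std n) = \<zero>\<^bsub>E\<^esub>"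
proof
  assume "func.Dn n \<phi> = \<zero>\<^bsub>V\<^esub>"
  then show "\<phi> (std n) = \<zero>\<^bsub>E\<^esub>"
    using Dn_dbl[OF \<phi>] func_simps(1)[OF compose_injection[OF inj_dbl std_injection]] by simp
next
  assume "\<phi> (std n) = \<zero>\<^bsub>E\<^esub>"
  then have "func.Dn n \<phi> f = \<zero>\<^bsub>E\<^esub>" if "f \<in> injections n" for f
    using Dn_mem[OF zero_perm_sub \<phi>] that by blast
  then show "func.Dn n \<phi> = \<zero>\<^bsub>V\<^esub>" using \<phi> by (intro func_eqI) (auto simp: func_simps func_zero func.D_closed simp del: upt_Suc)
qed

text \<open>The function concentrated on the subset \<open>{1..n}\<close> with value
  \<open>e\<close> at \<open>std n\<close>; equivariance forces the other values. It will be the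
  unit of the induction adjunction.\<close>

definition embed :: "'v \<Rightarrow> (nat \<Rightarrow> nat) \<Rightarrow> 'v" where
  "embed e = (\<lambda>f\<in>injections n. if f ` {1..n} = {1..n} then \<rho> (inv' (to_perm n f)) e else \<zero>\<^bsub>E\<^esub>)"

lemma embed_closed:
  assumes e: "e \<in> carrier E" shows "embed e \<in> carrier V"
proof (rule funcI[where X = "{1..n}"])
  fix f assume f: "f \<in> injections n"
  show "embed e f \<in> carrier E"
    using f e to_perm_permutes[OF f] by (auto simp: embed_def \<rho>_closed permutes_inv)
  show "embed e f = \<zero>\<^bsub>E\<^esub>" if "\<not> f ` {1..n} \<subseteq> {1..n}" using that f by (auto simp: embed_def)
  fix \<sigma> :: "nat \<Rightarrow> nat" assume \<sigma>: "\<sigma> permutes {1..n}"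
  show "embed e (f \<circ> \<sigma>) = \<rho> (inv' \<sigma>) (embed e f)"
  proof (cases "f ` {1..n} = {1..n}")
    case True
    note p = to_perm_permutes[OF f True]
    have "inv' (to_perm n f \<circ> \<sigma>) = inv' \<sigma> \<circ> inv' (to_perm n f)"
      using p \<sigma> by (simp add: o_inv_distrib permutes_bij)
    then show ?thesis using True f \<sigma> p e injection_permute[OF f \<sigma>] image_permute[OF \<sigma>, of f]
      by (simp add: embed_def to_perm_comp \<rho>_comp permutes_inv)
  next
    case False
    then show ?thesis using f \<sigma> injection_permute[OF f \<sigma>] image_permute[OF \<sigma>, of f]
      by (simp add: embed_def \<rho>_zero permutes_inv)
  qed
qed (auto simp: embed_def)

lemma embed_std: "e \<in> carrier E \<Longrightarrow> embed e (std n) = e"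
  using std_injection by (simp add: embed_def to_perm_std \<rho>_id) (simp add: std_def)

lemma act_std:
  assumes \<phi>: "\<phi> \<in> carrier V" and \<sigma>: "\<sigma> permutes {1..n}"
  shows "act \<sigma> \<phi> (std n) = \<rho> \<sigma> (\<phi> (std n))"
proof -
  have inv: "inv' \<sigma> permutes {1..n}" using \<sigma> by (rule permutes_inv)
  let ?f = "std n \<circ> inv' \<sigma>"
  have f: "?f \<in> injections n" by (rule injection_permute[OF std_injection inv])
  have "compose {1..n} \<sigma> ?f = std n"
    using permutes_in_image[OF inv] permutes_inverses[OF \<sigma>] by (auto simp: std_def compose_def fun_eq_iff)
  then have "act \<sigma> \<phi> (std n) = \<phi> ?f"
    using act_range[OF \<phi> f permutes_inj[OF \<sigma>]] by simp
  also have "\<dots> = \<rho> \<sigma> (\<phi> (std n))"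
    using func_permute[OF \<phi> std_injection inv] permutes_bij[OF \<sigma>] by (simp add: inv_inv_eq)
  finally show ?thesis .
qed

lemma image_perm_sub:
  assumes W: "subrep K V act W" shows "perm_sub K n E \<rho> ((\<lambda>\<phi>. \<phi> (std n)) ` W)"
proof -
  have sub: "submodule W K V" using W by (simp add: subrep_def)
  have Wc: "W \<subseteq> carrier V" using func.submoduleD[OF sub] by blast
  interpret ev: lin_map K V E "\<lambda>\<phi>\<in>carrier V. \<phi> (std n)" by (rule eval_map[OF std_injection])
  have eq: "(\<lambda>\<phi>\<in>carrier V. \<phi> (std n)) ` W = (\<lambda>\<phi>. \<phi> (std n)) ` W" using Wc by (intro image_cong) auto
  have "\<rho> \<sigma> (\<phi> (std n)) \<in> (\<lambda>\<phi>. \<phi> (std n)) ` W" if \<sigma>: "\<sigma> permutes {1..n}" and \<phi>: "\<phi> \<in> W" for \<sigma> \<phi>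
  proof -
    have "act \<sigma> \<phi> \<in> W" using W \<phi> permutes_inj[OF \<sigma>] by (simp add: subrep_def)
    then show ?thesis using act_std[OF _ \<sigma>, of \<phi>] \<phi> Wc by (intro image_eqI[of _ _ "act \<sigma> \<phi>"]) auto
  qed
  then show ?thesis using ev.image[OF sub] eq by (auto simp: perm_sub_def)
qed

lemma values_subrep:
  assumes H: "perm_sub K n E \<rho> H"
  shows "subrep K V act {\<phi> \<in> carrier V. \<forall>f\<in>injections n. \<phi> f \<in> H}" (is "subrep K V act ?W")
proof -
  have sub: "submodule H K E" using H by (simp add: perm_sub_def)
  note h = submoduleD[OF sub]
  have "submodule ?W K V"
    by (rule func.submoduleI) (use h in \<open>auto simp: func_zero func_add func_smult func_simps\<close>)
  moreover have "act g \<phi> f \<in> H" if g: "inj g" and \<phi>: "\<phi> \<in> ?W" and f: "f \<in> injections n" for g \<phi> f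
    by (cases rule: act_cases[OF f g]) (use \<phi> f g h(2) in \<open>simp_all add: act_range act_not_range\<close>)
  ultimately show ?thesis by (simp add: subrep_def act_closed)
qed

text \<open>A nonzero value at some \<open>f\<close> is moved to \<open>std n\<close> by an
  injection that inverts \<open>f\<close>.\<close>

lemma subrep_std_nonzero:
  assumes W: "subrep K V act W" "W \<noteq> {\<zero>\<^bsub>V\<^esub>}"
  shows "\<exists>\<phi>\<in>W. \<phi> (std n) \<noteq> \<zero>\<^bsub>E\<^esub>"
proof -
  have sub: "submodule W K V" using W by (simp add: subrep_def)
  have Wc: "W \<subseteq> carrier V" "\<zero>\<^bsub>V\<^esub> \<in> W" using func.submoduleD[OF sub] by blast+
  then obtain \<phi> where \<phi>: "\<phi> \<in> W" "\<phi> \<noteq> \<zero>\<^bsub>V\<^esub>" using W by blast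
  have "\<not> (\<forall>f\<in>injections n. \<phi> f = \<zero>\<^bsub>E\<^esub>)"
  proof
    assume z: "\<forall>f\<in>injections n. \<phi> f = \<zero>\<^bsub>E\<^esub>"
    have "\<phi> = \<zero>\<^bsub>V\<^esub>" by (rule func_eqI) (use \<phi> Wc z in \<open>auto simp: func_simps\<close>)
    then show False using \<phi> by simp
  qed
  then obtain f where f: "f \<in> injections n" "\<phi> f \<noteq> \<zero>\<^bsub>E\<^esub>" by blast
  obtain g where g: "inj g" "\<And>i. i \<in> {1..n} \<Longrightarrow> g (f i) = i" using injection_retract[OF f(1)] by blast
  have "compose {1..n} g f = std n" using g by (auto simp: compose_def std_def)
  then have "act g \<phi> (std n) = \<phi> f" using act_range[of \<phi> f g] f g \<phi> Wc by auto
  moreover have "act g \<phi> \<in> W" using W(1) g(1) \<phi>(1) by (simp add: subrep_def)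
  ultimately show ?thesis using f(2) by (intro bexI[of _ "act g \<phi>"]) simp_all
qed

lemma subrep_std_surj:
  assumes s: "simple_perm_rep K n E \<rho>" and W: "subrep K V act W" "W \<noteq> {\<zero>\<^bsub>V\<^esub>}"
  shows "(\<lambda>\<phi>. \<phi> (std n)) ` W = carrier E"
  using subrep_std_nonzero[OF W] image_perm_sub[OF W(1)] s unfolding simple_perm_rep_def by blast

text \<open>Simplicity of \<open>E\<close> provides some \<open>\<psi>\<close> in \<open>W\<close>
  with the same value as \<open>\<phi>\<close> at \<open>std n\<close>. The difference is killed by
  \<open>Dn n\<close>, so \<open>Dn n \<phi>\<close> equals \<open>Dn n \<psi>\<close>, which lies
  in \<open>W\<close>.\<close>

lemma Dn_in_subrep:
  assumes s: "simple_perm_rep K n E \<rho>" and W: "subrep K V act W" "W \<noteq> {\<zero>\<^bsub>V\<^esub>}" and \<phi>: "\<phi> \<in> carrier V"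
  shows "func.Dn n \<phi> \<in> W"
proof -
  have "\<phi> (std n) \<in> (\<lambda>\<phi>. \<phi> (std n)) ` W"
    using subrep_std_surj[OF s W] func_closed[OF \<phi> std_injection] by simp
  then obtain \<psi> where \<psi>: "\<psi> \<in> W" "\<psi> (std n) = \<phi> (std n)" by auto
  then have \<psi>c: "\<psi> \<in> carrier V" using W func.submoduleD(3) by (auto simp: subrep_def)
  have "(\<phi> \<ominus>\<^bsub>V\<^esub> \<psi>) (std n) = \<zero>\<^bsub>E\<^esub>"
    using \<psi> \<psi>c \<phi> func_closed std_injection by (simp add: func_diff M.diff_eq_zero_iff)
  then have "func.Dn n (\<phi> \<ominus>\<^bsub>V\<^esub> \<psi>) = \<zero>\<^bsub>V\<^esub>" using Dn_zero_iff \<phi> \<psi>c by simp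
  then have "func.Dn n \<phi> = func.Dn n \<psi>"
    using \<phi> \<psi>c func.D_diff func.M.diff_eq_zero_iff func.D_closed by metis
  then show ?thesis using func.D_subrep[OF W(1) \<psi>(1)] by metis
qed

text \<open>The intersection of all nonzero subrepresentations is nonzero because each contains the
  image of \<open>Dn n\<close>; a nonzero intersection of this kind is simple.\<close>

lemma socle:
  assumes s: "simple_perm_rep K n E \<rho>"
  shows "\<exists>W. subrep K V act W \<and> simple_rep K (V\<lparr>carrier := W\<rparr>) (\<lambda>g. restrict (act g) W)"
proof -
  let ?S = "{W. subrep K V act W \<and> W \<noteq> {\<zero>\<^bsub>V\<^esub>}}"
  \<comment> \<open>The factor \<open>carrier V\<close> keeps \<open>W\<close> inside the module
    without first showing that the family is nonempty.\<close>
  define W where "W = carrier V \<inter> \<Inter>?S"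
  have memS: "func.Dn n \<phi> \<in> W" if "\<phi> \<in> carrier V" for \<phi>
    using that Dn_in_subrep[OF s] func.D_closed unfolding W_def by blast
  have W: "subrep K V act W"
    unfolding subrep_def
  proof (intro conjI allI impI ballI)
    have S: "submodule U K V" if "U \<in> ?S" for U using that by (simp add: subrep_def)
    show "submodule W K V"
    proof (rule func.submoduleI)
      show "x \<oplus>\<^bsub>V\<^esub> y \<in> W" if "x \<in> W" "y \<in> W" for x y
        using that func.submoduleD(4)[OF S] func_add unfolding W_def by blast
      show "a \<odot>\<^bsub>V\<^esub> x \<in> W" if "a \<in> carrier K" "x \<in> W" for a x
        using that func.submoduleD(5)[OF S] func_smult unfolding W_def by blast
      show "\<zero>\<^bsub>V\<^esub> \<in> W" using func.submoduleD(2)[OF S] func_zero unfolding W_def by blast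
    qed (auto simp: W_def)
    show "act g v \<in> W" if "inj g" "v \<in> W" for g v
      using that act_closed by (auto simp: W_def subrep_def)
  qed
  \<comment> \<open>The function \<open>embed e\<close> has the nonzero value \<open>e\<close> at
    \<open>std n\<close>, so \<open>Dn n\<close> does not kill it and the intersection is not
    zero.\<close>
  obtain e where e: "e \<in> carrier E" "e \<noteq> \<zero>\<^bsub>E\<^esub>"
    using s M.zero_closed unfolding simple_perm_rep_def by blast
  have "func.Dn n (embed e) \<noteq> \<zero>\<^bsub>V\<^esub>" using Dn_zero_iff embed_closed embed_std e by metis
  then have W0: "W \<noteq> {\<zero>\<^bsub>V\<^esub>}" using memS[OF embed_closed[OF e(1)]] by blast
  have "simple_rep K (V\<lparr>carrier := W\<rparr>) (\<lambda>g. restrict (act g) W)"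
    unfolding simple_rep_def
  proof (intro conjI allI impI)
    show "inj_rep K (V\<lparr>carrier := W\<rparr>) (\<lambda>g. restrict (act g) W)" by (rule func.inj_rep_subrep[OF W])
    show "carrier (V\<lparr>carrier := W\<rparr>) \<noteq> {\<zero>\<^bsub>V\<lparr>carrier := W\<rparr>\<^esub>}" using W0 by simp
    fix U assume U: "subrep K (V\<lparr>carrier := W\<rparr>) (\<lambda>g. restrict (act g) W) U"
    interpret W: inj_rep K "V\<lparr>carrier := W\<rparr>" "\<lambda>g. restrict (act g) W" by (rule func.inj_rep_subrep[OF W])
    have UW: "submodule U K (V\<lparr>carrier := W\<rparr>)" using U by (simp add: subrep_def)
    note u = W.submoduleD[OF UW]
    have "W \<subseteq> carrier V" by (auto simp: W_def)
    then have "subrep K V act U"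
      unfolding subrep_def
    proof (intro conjI allI impI ballI)
      show "submodule U K V" if "W \<subseteq> carrier V" using u that by (intro func.submoduleI) auto
      show "act g v \<in> U" if "inj g" "v \<in> U" for g v using U that u(3)[of v] by (force simp: subrep_def)
    qed
    then show "U = {\<zero>\<^bsub>V\<lparr>carrier := W\<rparr>\<^esub>} \<or> U = carrier (V\<lparr>carrier := W\<rparr>)"
      using u(1) by (auto simp: W_def)
  qed
  then show ?thesis using W by blast
qed

end

lemma dup_id: "dup id = id"
  by (auto simp: dup_def fun_eq_iff)

lemma dup_comp: "dup (g \<circ> h) = dup g \<circ> dup h"
  by (auto simp: dup_def fun_eq_iff)

theorem (in inj_rep) simple_rep_embeds:
  assumes s: "simple_rep K V act"
  shows "\<exists>n E \<rho> F. simple_perm_rep K n (E :: ('k, 'w) module) \<rho> \<and>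
    F \<in> rep_maps K V act (func n E \<rho>) (func_act n E \<rho>) \<and> inj_on F (carrier V)"
proof -
  obtain n v1 where T: "vanishes_above n" and v1: "v1 \<in> carrier V" "Dn n v1 \<noteq> \<zero>\<^bsub>V\<^esub>"
    using top_degree_ex[OF s] by blast
  define E where "E = V\<lparr>carrier := Dn n ` carrier V\<rparr>"
  \<comment> \<open>The letters of vectors in the image of \<open>Dn n\<close> come in pairs over
    \<open>{1..n}\<close>, so permutations act through \<open>dup\<close>; by
    \<open>Dn_permute\<close> this is the action induced from \<open>V\<close>.\<close>
  define \<rho> where "\<rho> = (\<lambda>\<sigma>. act (dup \<sigma>))"
  interpret d: lin_map K V V "restrict (Dn n) (carrier V)"
    using D_lin left_module_axioms by (simp add: lin_map_iff)
  have sub: "submodule (Dn n ` carrier V) K V" using d.image[OF carrier_submodule] by simp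
  have E_simps [simp]: "carrier E = Dn n ` carrier V" "\<zero>\<^bsub>E\<^esub> = \<zero>\<^bsub>V\<^esub>" "add E = add V" "smult E = smult V"
    by (auto simp: E_def)
  have cE: "x \<in> carrier V" if "x \<in> Dn n ` carrier V" for x using that D_closed by blast
  interpret E: perm_rep K n E \<rho>
  proof (intro perm_rep.intro perm_rep_axioms.intro)
    show "left_module K E" unfolding E_def by (rule left_module_submodule[OF sub])
    fix \<sigma> :: "nat \<Rightarrow> nat" assume \<sigma>: "\<sigma> permutes {1..n}"
    have i: "inj (dup \<sigma>)" using \<sigma> by (simp add: inj_dup permutes_inj)
    show "\<rho> \<sigma> x \<in> carrier E" if x: "x \<in> carrier E" for x
    proof -
      obtain v where v: "v \<in> carrier V" "x = Dn n v" using x by auto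
      then have "\<rho> \<sigma> x = Dn n (act \<sigma> v)" using Dn_permute[OF v(1) \<sigma>] by (simp add: \<rho>_def)
      then show ?thesis using v act_closed[OF permutes_inj[OF \<sigma>]] by simp
    qed
    show "\<rho> \<sigma> (x \<oplus>\<^bsub>E\<^esub> y) = \<rho> \<sigma> x \<oplus>\<^bsub>E\<^esub> \<rho> \<sigma> y" if "x \<in> carrier E" "y \<in> carrier E" for x y
      using that i cE by (simp add: \<rho>_def act_add)
    show "\<rho> \<sigma> (a \<odot>\<^bsub>E\<^esub> x) = a \<odot>\<^bsub>E\<^esub> \<rho> \<sigma> x" if "a \<in> carrier K" "x \<in> carrier E" for a x
      using that i cE by (simp add: \<rho>_def act_smult)
    show "\<rho> (\<sigma> \<circ> \<tau>) x = \<rho> \<sigma> (\<rho> \<tau> x)" if "\<tau> permutes {1..n}" "x \<in> carrier E" for \<tau> x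
      using that i cE by (simp add: \<rho>_def dup_comp act_comp inj_dup permutes_inj)
  next
    show "\<rho> id x = x" if "x \<in> carrier E" for x using that cE by (simp add: \<rho>_def dup_id act_id)
  qed
  define F where "F = (\<lambda>v\<in>carrier V. \<lambda>f\<in>injections n. coeff n f v)"
  have F: "F v f = coeff n f v" if "v \<in> carrier V" "f \<in> injections n" for v f using that by (simp add: F_def)
  have Fc: "F v \<in> carrier E.V" if v: "v \<in> carrier V" for v
  proof -
    obtain X where X: "finite X" "supported X v" using supported_ex v by blast
    show ?thesis
    proof (rule E.funcI[where X = X])
      show "F v \<in> extensional (injections n)" using v by (simp add: F_def)
      fix f assume f: "f \<in> injections n"
      show "F v f \<in> carrier E" using coeff_closed[OF T v f] by (simp add: F v f)
      show "F v f = \<zero>\<^bsub>E\<^esub>" if "\<not> f ` {1..n} \<subseteq> X" using coeff_supported[OF T f v X(2) that] by (simp add: F v f)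
      fix \<sigma> :: "nat \<Rightarrow> nat" assume "\<sigma> permutes {1..n}"
      then show "F v (f \<circ> \<sigma>) = \<rho> (inv' \<sigma>) (F v f)"
        using coeff_permute[OF T f v] injection_permute[OF f] by (simp add: F v f \<rho>_def)
    qed (use X in simp)
  qed
  have rep: "F \<in> rep_maps K V act E.V E.act"
    unfolding rep_maps_def
  proof (intro CollectI conjI allI impI ballI lin_mapsI)
    show "F \<in> extensional (carrier V)" by (simp add: F_def)
    show "F (v \<oplus>\<^bsub>V\<^esub> w) = F v \<oplus>\<^bsub>E.V\<^esub> F w" if "v \<in> carrier V" "w \<in> carrier V" for v w
      by (rule E.func_eqI) (use that Fc E.func_add in \<open>auto simp: F E.func_simps coeff_add[OF T]\<close>)
    show "F (a \<odot>\<^bsub>V\<^esub> v) = a \<odot>\<^bsub>E.V\<^esub> F v" if "a \<in> carrier K" "v \<in> carrier V" for a v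
      by (rule E.func_eqI) (use that Fc E.func_smult in \<open>auto simp: F E.func_simps coeff_smult[OF T] smult_closed\<close>)
    fix g :: "nat \<Rightarrow> nat" and v assume g: "inj g" and v: "v \<in> carrier V"
    note gv = act_closed[OF g v]
    show "F (act g v) = E.act g (F v)"
    proof (rule E.func_eqI)
      fix f assume f: "f \<in> injections n"
      show "F (act g v) f = E.act g (F v) f"
      proof (cases rule: E.act_cases[OF f g])
        case (1 f')
        then show ?thesis using E.act_range[OF Fc[OF v] 1(1) g] coeff_act[OF T 1(1) g v] f
          by (simp add: F v gv)
      next
        case 2
        then show ?thesis using E.act_not_range[OF Fc[OF v] f 2] coeff_act_zero[OF T f g v 2] by (simp add: F f gv)
      qed
    qed (use Fc gv E.act_closed g v in auto)
  qed (use Fc in auto)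
  interpret F: rep_map K V act E.V E.act F
    using rep E.func_rep inj_rep_axioms by (simp add: rep_map_iff)
  have Fstd: "F v (std n) = Dn n v" if "v \<in> carrier V" for v
    using that coeff_std[OF T that] by (simp add: F std_injection)
  \<comment> \<open>The value of \<open>F v1\<close> at \<open>std n\<close> is
    \<open>Dn n v1\<close>, which is nonzero by the choice of \<open>n\<close>.\<close>
  have "F v1 \<noteq> \<zero>\<^bsub>E.V\<^esub>" using v1 Fstd E.func_simps(1)[OF std_injection] by (metis E_simps(2))
  then have injF: "inj_on F (carrier V)" using F.inj_if_simple[OF s v1(1)] by blast
  have "simple_perm_rep K n E \<rho>"
    unfolding simple_perm_rep_def
  proof (intro conjI allI impI)
    show "perm_rep K n E \<rho>" by (rule E.perm_rep_axioms)
    show "carrier E \<noteq> {\<zero>\<^bsub>E\<^esub>}" using v1 by auto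
    fix H assume H: "perm_sub K n E \<rho> H"
    have subH: "submodule H K E" using H by (simp add: perm_sub_def)
    show "H = {\<zero>\<^bsub>E\<^esub>} \<or> H = carrier E"
    proof (rule disjCI)
      assume "H \<noteq> carrier E"
      show "H = {\<zero>\<^bsub>E\<^esub>}"
      proof (rule ccontr)
        assume "H \<noteq> {\<zero>\<^bsub>E\<^esub>}"
        then obtain e0 where "e0 \<in> H" "e0 \<noteq> \<zero>\<^bsub>E\<^esub>" using E.submoduleD(2)[OF subH] by blast
        moreover from this obtain v0 where v0: "v0 \<in> carrier V" "e0 = Dn n v0" using E.submoduleD(3)[OF subH] by auto
        ultimately have e0: "Dn n v0 \<in> H" "Dn n v0 \<noteq> \<zero>\<^bsub>V\<^esub>" by auto
        \<comment> \<open>The vectors all of whose coefficients lie in \<open>H\<close>. This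
          subrepresentation contains the nonzero vector \<open>Dn n v0\<close> by
          \<open>Dn_mem\<close>, so it is everything, and the coefficients at \<open>std n\<close>
          put all of \<open>E\<close> into \<open>H\<close>.\<close>
        let ?W = "{v \<in> carrier V. F v \<in> {\<phi> \<in> carrier E.V. \<forall>f\<in>injections n. \<phi> f \<in> H}}"
        have W: "subrep K V act ?W" by (rule F.vimage_subrep[OF E.values_subrep[OF H]])
        have "F (Dn n v0) f \<in> H" if "f \<in> injections n" for f
          using E.Dn_mem[OF H Fc[OF v0(1)] _ that] Fstd[OF v0(1)] e0(1) F.F_D[OF v0(1)] by simp
        then have "Dn n v0 \<in> ?W" using v0 Fc D_closed by blast
        then have "?W = carrier V" using s W e0(2) unfolding simple_rep_def by blast
        then have "Dn n v \<in> H" if "v \<in> carrier V" for v using Fstd[OF that] std_injection that by force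
        then have "carrier E \<subseteq> H" by auto
        then show False using \<open>H \<noteq> carrier E\<close> E.submoduleD(1)[OF subH] by blast
      qed
    qed
  qed
  then show ?thesis using rep injF by blast
qed

text \<open>Both targets are the quotient of \<open>V\<close> by the common kernel. Comparing them
  directly avoids forming that quotient, whose elements would be sets.\<close>

lemma lin_maps_same_kernel:
  assumes "lin_map K V E p" "lin_map K V E' p'" "p ` carrier V = carrier E" "p' ` carrier V = carrier E'"
    and ker: "\<And>v. v \<in> carrier V \<Longrightarrow> p v = \<zero>\<^bsub>E\<^esub> \<longleftrightarrow> p' v = \<zero>\<^bsub>E'\<^esub>"
  shows "\<exists>h\<in>lin_maps K E E'. bij_betw h (carrier E) (carrier E') \<and> (\<forall>v\<in>carrier V. h (p v) = p' v)"
proof -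
  interpret p: lin_map K V E p by fact
  interpret p': lin_map K V E' p' by fact
  define h where "h = (\<lambda>e\<in>carrier E. p' (inv_into (carrier V) p e))"
  have hp: "h (p v) = p' v" if v: "v \<in> carrier V" for v
  proof -
    let ?w = "inv_into (carrier V) p (p v)"
    have w: "?w \<in> carrier V" "p ?w = p v" using v by (auto simp: inv_into_into f_inv_into_f)
    then have "p (?w \<ominus>\<^bsub>V\<^esub> v) = \<zero>\<^bsub>E\<^esub>" using v p.closed by (simp add: p.diff p.N.M.diff_eq_zero_iff)
    then have "p' (?w \<ominus>\<^bsub>V\<^esub> v) = \<zero>\<^bsub>E'\<^esub>" using ker w v by simp
    then show ?thesis using w v p.closed p'.closed by (simp add: h_def p'.diff p'.N.M.diff_eq_zero_iff)
  qed
  have ex: "\<exists>v\<in>carrier V. e = p v" if "e \<in> carrier E" for e using that assms(3) by blast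
  have lin: "h \<in> lin_maps K E E'"
  proof (rule lin_mapsI)
    show "h \<in> extensional (carrier E)" by (simp add: h_def)
    fix x assume "x \<in> carrier E"
    then obtain v where v: "v \<in> carrier V" "x = p v" using ex by blast
    then show "h x \<in> carrier E'" using hp p'.closed by simp
    show "h (a \<odot>\<^bsub>E\<^esub> x) = a \<odot>\<^bsub>E'\<^esub> h x" if "a \<in> carrier K" for a
      using that v hp[OF v(1)] hp[of "a \<odot>\<^bsub>V\<^esub> v"] by (simp add: p.smult p'.smult p.M.smult_closed)
    fix y assume "y \<in> carrier E"
    then obtain w where w: "w \<in> carrier V" "y = p w" using ex by blast
    then show "h (x \<oplus>\<^bsub>E\<^esub> y) = h x \<oplus>\<^bsub>E'\<^esub> h y"
      using v hp[OF v(1)] hp[OF w(1)] hp[of "v \<oplus>\<^bsub>V\<^esub> w"] by (simp add: p.add p'.add)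
  qed
  interpret h: lin_map K E E' h
    using lin p.N.left_module_axioms p'.N.left_module_axioms by (simp add: lin_map_iff)
  have "inj_on h (carrier E)"
    unfolding h.inj_iff
  proof (intro ballI impI)
    fix e assume "e \<in> carrier E" "h e = \<zero>\<^bsub>E'\<^esub>"
    moreover then obtain v where "v \<in> carrier V" "e = p v" using ex by blast
    ultimately show "e = \<zero>\<^bsub>E\<^esub>" using hp ker by simp
  qed
  moreover have "h ` carrier E = carrier E'"
    using hp by (simp add: assms(3)[symmetric] assms(4)[symmetric] image_image)
  ultimately show ?thesis using lin hp by (auto simp: bij_betw_def)
qed

section \<open>Recovering the symmetric group module, and comparing two embeddings\<close>

locale func_embedding = rep_map K V act "func n E \<rho>" "func_act n E \<rho>" F
  for K :: "('k, 'x) ring_scheme" and V :: "('k, 'v) module" and act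
    and n and E :: "('k, 'w) module" and \<rho> and F +
  assumes simple: "simple_perm_rep K n E \<rho>" and inj: "inj_on F (carrier V)"
    and nonzero: "carrier V \<noteq> {\<zero>\<^bsub>V\<^esub>}"
begin

sublocale E: perm_rep K n E \<rho> using simple by (simp add: simple_perm_rep_def)

lemma F_zero_iff: "v \<in> carrier V \<Longrightarrow> F v = \<zero>\<^bsub>E.V\<^esub> \<longleftrightarrow> v = \<zero>\<^bsub>V\<^esub>"
  using inj lin.inj_iff lin.zero by auto

lemma carrier_subrep: "subrep K V act (carrier V)"
  by (simp add: subrep_def V.carrier_submodule V.act_closed)

lemma image: "subrep K E.V E.act (F ` carrier V)" by (rule image_subrep[OF carrier_subrep])

lemma image_nonzero: "F ` carrier V \<noteq> {\<zero>\<^bsub>E.V\<^esub>}"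
proof
  assume *: "F ` carrier V = {\<zero>\<^bsub>E.V\<^esub>}"
  have "v = \<zero>\<^bsub>V\<^esub>" if "v \<in> carrier V" for v using * that F_zero_iff[OF that] by blast
  then show False using nonzero V.M.zero_closed by blast
qed

definition p where "p = (\<lambda>v\<in>carrier V. F v (std n))"

lemma p_lin: "lin_map K V E p"
proof -
  have "compose (carrier V) (\<lambda>\<phi>\<in>carrier E.V. \<phi> (std n)) F = p"
    by (auto simp: compose_def p_def fun_eq_iff lin.closed)
  then show ?thesis
    using lin_maps_compose[OF V.left_module_axioms lin.lin, of "\<lambda>\<phi>\<in>carrier E.V. \<phi> (std n)" E]
      E.eval_map[OF std_injection] V.left_module_axioms by (simp add: lin_map_iff)
qed

lemma p_surj: "p ` carrier V = carrier E"
  using E.subrep_std_surj[OF simple image image_nonzero] by (simp add: p_def image_image)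

text \<open>The kernel of evaluation at \<open>std n\<close> is expressed through the action on
  \<open>V\<close> alone, with no trace of \<open>E\<close> or \<open>F\<close>. Two embeddings of
  \<open>V\<close> in the same degree therefore give the same kernel.\<close>

lemma p_zero_iff: "v \<in> carrier V \<Longrightarrow> p v = \<zero>\<^bsub>E\<^esub> \<longleftrightarrow> V.Dn n v = \<zero>\<^bsub>V\<^esub>"
  using E.Dn_zero_iff[of "F v"] F_zero_iff[OF V.D_closed, of v "[1..<Suc n]"] F_D[of v "[1..<Suc n]"] lin.closed[of v]
  by (simp add: p_def)

lemma p_act: "v \<in> carrier V \<Longrightarrow> \<sigma> permutes {1..n} \<Longrightarrow> p (act \<sigma> v) = \<rho> \<sigma> (p v)"
  using E.act_std[of "F v" \<sigma>] by (simp add: p_def V.act_closed permutes_inj equivariant lin.closed)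

lemma vanishes_above: "V.vanishes_above n"
  unfolding V.vanishes_above_def
proof (intro allI impI)
  fix xs :: "nat list" and v assume *: "distinct xs" "n < length xs" "v \<in> carrier V"
  then have "F (V.D xs v) = \<zero>\<^bsub>E.V\<^esub>"
    using E.func_vanishes_above lin.closed F_D by (simp add: V'.vanishes_above_def)
  then show "V.D xs v = \<zero>\<^bsub>V\<^esub>" using F_zero_iff V.D_closed * by simp
qed

lemma Dn_nonzero: "\<exists>v\<in>carrier V. V.Dn n v \<noteq> \<zero>\<^bsub>V\<^esub>"
proof -
  obtain e where "e \<in> carrier E" "e \<noteq> \<zero>\<^bsub>E\<^esub>"
    using simple E.M.zero_closed unfolding simple_perm_rep_def by blast
  then show ?thesis using p_surj p_zero_iff by (metis imageE)
qed

end

theorem func_embedding_unique: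
  assumes "func_embedding K V act n E \<rho> F" "func_embedding K V act n' E' \<rho>' F'"
  shows "n = n' \<and> (\<exists>h\<in>perm_maps K n E \<rho> E' \<rho>'. bij_betw h (carrier E) (carrier E'))"
proof -
  interpret F: func_embedding K V act n E \<rho> F by fact
  interpret F': func_embedding K V act n' E' \<rho>' F' by fact
  \<comment> \<open>Each embedding shows that its degree is the largest one in which the difference
    operators do not vanish on \<open>V\<close>, so the two degrees agree.\<close>
  have "\<not> n < n'" using F.vanishes_above F'.Dn_nonzero by (auto simp: F.V.vanishes_above_def)
  moreover have "\<not> n' < n" using F'.vanishes_above F.Dn_nonzero by (auto simp: F.V.vanishes_above_def)
  ultimately have n: "n' = n" by simp
  have "\<exists>h\<in>lin_maps K E E'. bij_betw h (carrier E) (carrier E') \<and> (\<forall>v\<in>carrier V. h (F.p v) = F'.p v)"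
    by (rule lin_maps_same_kernel[OF F.p_lin F'.p_lin F.p_surj F'.p_surj])
      (use F.p_zero_iff F'.p_zero_iff n in auto)
  then obtain h where h: "h \<in> lin_maps K E E'" "bij_betw h (carrier E) (carrier E')"
      and hp: "\<And>v. v \<in> carrier V \<Longrightarrow> h (F.p v) = F'.p v" by blast
  have "h (\<rho> \<sigma> e) = \<rho>' \<sigma> (h e)" if \<sigma>: "\<sigma> permutes {1..n}" and e: "e \<in> carrier E" for \<sigma> e
  proof -
    obtain v where v: "v \<in> carrier V" "e = F.p v" using e F.p_surj by blast
    have "act \<sigma> v \<in> carrier V" using v \<sigma> by (simp add: F.V.act_closed permutes_inj)
    then have "h (\<rho> \<sigma> e) = F'.p (act \<sigma> v)" using hp[of "act \<sigma> v"] F.p_act[OF v(1) \<sigma>] v(2) by simp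
    also have "\<dots> = \<rho>' \<sigma> (h e)" using F'.p_act[OF v(1), of \<sigma>] \<sigma> n hp[OF v(1)] v(2) by simp
    finally show ?thesis .
  qed
  then show ?thesis using h n by (auto simp: perm_maps_def)
qed

lemma rep_maps_same_image:
  assumes "rep_map K V act U act'' F" "rep_map K V' act' U act'' F'"
    and inj: "inj_on F (carrier V)" "inj_on F' (carrier V')" and im: "F ` carrier V = F' ` carrier V'"
  shows "\<exists>G\<in>rep_maps K V act V' act'. bij_betw G (carrier V) (carrier V')"
proof -
  interpret F: rep_map K V act U act'' F by fact
  interpret F': rep_map K V' act' U act'' F' by fact
  define G where "G = (\<lambda>v\<in>carrier V. inv_into (carrier V') F' (F v))"
  have Gc: "G v \<in> carrier V'" and FG: "F' (G v) = F v" if "v \<in> carrier V" for v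
    using that im by (auto simp: G_def intro!: inv_into_into f_inv_into_f)
  have Geq: "G v = w" if "v \<in> carrier V" "w \<in> carrier V'" "F' w = F v" for v w
    using that FG Gc inj(2) by (metis inj_onD)
  have rep: "G \<in> rep_maps K V act V' act'"
    unfolding rep_maps_def
  proof (intro CollectI conjI allI impI ballI lin_mapsI)
    show "G \<in> extensional (carrier V)" by (simp add: G_def)
    show "G (v \<oplus>\<^bsub>V\<^esub> w) = G v \<oplus>\<^bsub>V'\<^esub> G w" if "v \<in> carrier V" "w \<in> carrier V" for v w
      using that by (intro Geq) (simp_all add: Gc FG F'.lin.add F.lin.add)
    show "G (a \<odot>\<^bsub>V\<^esub> v) = a \<odot>\<^bsub>V'\<^esub> G v" if "a \<in> carrier K" "v \<in> carrier V" for a v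
      using that by (intro Geq) (simp_all add: Gc FG F'.lin.smult F.lin.smult F.V.smult_closed F'.V.smult_closed)
    show "G (act g v) = act' g (G v)" if "inj g" "v \<in> carrier V" for g v
      using that by (intro Geq) (simp_all add: Gc FG F'.equivariant F.equivariant F.V.act_closed F'.V.act_closed)
  qed (use Gc in auto)
  have "inj_on G (carrier V)"
  proof (rule inj_onI)
    fix v w assume *: "v \<in> carrier V" "w \<in> carrier V" "G v = G w"
    then have "F v = F w" using FG by metis
    then show "v = w" using inj(1) * by (auto dest: inj_onD)
  qed
  moreover have "G ` carrier V = carrier V'"
  proof
    show "carrier V' \<subseteq> G ` carrier V"
    proof
      fix w assume w: "w \<in> carrier V'"
      then obtain v where v: "v \<in> carrier V" "F' w = F v" using im by (metis imageE imageI)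
      then show "w \<in> G ` carrier V" using Geq[OF v(1) w v(2)] by blast
    qed
  qed (use Gc in auto)
  ultimately show ?thesis using rep by (auto simp: bij_betw_def)
qed

text \<open>Any nonzero vector in the image of \<open>Dn n\<close> lies in both embedded copies. Two
  simple subrepresentations that share a nonzero vector coincide.\<close>

theorem func_embedding_iso:
  assumes "func_embedding K V act n E \<rho> F" "func_embedding K V' act' n E \<rho> F'"
    and "simple_rep K V act" "simple_rep K V' act'"
  shows "\<exists>G\<in>rep_maps K V act V' act'. bij_betw G (carrier V) (carrier V')"
proof -
  interpret F: func_embedding K V act n E \<rho> F by fact
  interpret F': func_embedding K V' act' n E \<rho> F' by fact
  obtain \<phi> where \<phi>: "\<phi> \<in> carrier F.E.V" "F.V'.Dn n \<phi> \<noteq> \<zero>\<^bsub>F.E.V\<^esub>"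
    using F.Dn_nonzero F.F_D F.F_zero_iff F.V.D_closed F.lin.closed by metis
  let ?d = "F.V'.Dn n \<phi>"
  have d: "?d \<in> F ` carrier V" "?d \<in> F' ` carrier V'"
    using F.E.Dn_in_subrep[OF F.simple F.image F.image_nonzero \<phi>(1)]
      F.E.Dn_in_subrep[OF F.simple F'.image F'.image_nonzero \<phi>(1)] by auto
  \<comment> \<open>The preimage of the other copy is a subrepresentation of \<open>V\<close>
    containing a nonzero vector, so it is all of \<open>V\<close>; the symmetric argument gives
    equality of the images.\<close>
  have "{v \<in> carrier V. F v \<in> F' ` carrier V'} = carrier V"
  proof -
    obtain v where v: "v \<in> carrier V" "F v = ?d" using d(1) by force
    then have "v \<in> {v \<in> carrier V. F v \<in> F' ` carrier V'}" "v \<noteq> \<zero>\<^bsub>V\<^esub>" using d(2) \<phi>(2) F.F_zero_iff[of v] by auto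
    then show ?thesis using assms(3) F.vimage_subrep[OF F'.image] unfolding simple_rep_def by blast
  qed
  moreover have "{v \<in> carrier V'. F' v \<in> F ` carrier V} = carrier V'"
  proof -
    obtain v where v: "v \<in> carrier V'" "F' v = ?d" using d(2) by force
    then have "v \<in> {v \<in> carrier V'. F' v \<in> F ` carrier V}" "v \<noteq> \<zero>\<^bsub>V'\<^esub>" using d(1) \<phi>(2) F'.F_zero_iff[of v] by auto
    then show ?thesis using assms(4) F'.vimage_subrep[OF F.image] unfolding simple_rep_def by blast
  qed
  ultimately have "F ` carrier V = F' ` carrier V'" by blast
  then show ?thesis
    using rep_maps_same_image[OF F.rep_map_axioms F'.rep_map_axioms F.inj F'.inj] by blast
qed

text \<open>Composing functions with \<open>h\<close> makes induction functorial; since values are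
  changed pointwise, injectivity is preserved.\<close>

lemma func_map:
  assumes "perm_rep K n E \<rho>" "perm_rep K n E' \<rho>'" "h \<in> perm_maps K n E \<rho> E' \<rho>'" "inj_on h (carrier E)"
  shows "\<exists>G\<in>rep_maps K (func n E \<rho>) (func_act n E \<rho>) (func n E' \<rho>') (func_act n E' \<rho>').
    inj_on G (carrier (func n E \<rho>))"
proof -
  interpret E: perm_rep K n E \<rho> by fact
  interpret E': perm_rep K n E' \<rho>' by fact
  have h: "h \<in> lin_maps K E E'" and hp: "\<And>\<sigma> x. \<sigma> permutes {1..n} \<Longrightarrow> x \<in> carrier E \<Longrightarrow> h (\<rho> \<sigma> x) = \<rho>' \<sigma> (h x)"
    using assms(3) by (auto simp: perm_maps_def)
  interpret h: lin_map K E E' h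
    using h E.left_module_axioms E'.left_module_axioms by (simp add: lin_map_iff)
  define G where "G = (\<lambda>\<phi>\<in>carrier E.V. \<lambda>f\<in>injections n. h (\<phi> f))"
  have G: "G \<phi> f = h (\<phi> f)" if "\<phi> \<in> carrier E.V" "f \<in> injections n" for \<phi> f using that by (simp add: G_def)
  have Gc: "G \<phi> \<in> carrier E'.V" if \<phi>: "\<phi> \<in> carrier E.V" for \<phi>
  proof -
    obtain X where X: "finite X" "\<forall>f\<in>injections n. \<not> f ` {1..n} \<subseteq> X \<longrightarrow> \<phi> f = \<zero>\<^bsub>E\<^esub>"
      using E.func_finite[OF \<phi>] by blast
    show ?thesis
    proof (rule E'.funcI[where X = X])
      show "G \<phi> \<in> extensional (injections n)" using \<phi> by (simp add: G_def)
    qed (use X \<phi> in \<open>simp_all add: G E.func_closed h.closed h.zero injection_permute E.func_permute hp permutes_inv\<close>)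
  qed
  have "G \<in> rep_maps K E.V E.act E'.V E'.act"
    unfolding rep_maps_def
  proof (intro CollectI conjI allI impI ballI lin_mapsI)
    show "G \<in> extensional (carrier E.V)" by (simp add: G_def)
    show "G (\<phi> \<oplus>\<^bsub>E.V\<^esub> \<psi>) = G \<phi> \<oplus>\<^bsub>E'.V\<^esub> G \<psi>" if "\<phi> \<in> carrier E.V" "\<psi> \<in> carrier E.V" for \<phi> \<psi>
      by (rule E'.func_eqI) (use that in \<open>simp_all add: Gc E'.func_add E.func_add G E'.func_simps E.func_simps E.func_closed h.add\<close>)
    show "G (a \<odot>\<^bsub>E.V\<^esub> \<phi>) = a \<odot>\<^bsub>E'.V\<^esub> G \<phi>" if "a \<in> carrier K" "\<phi> \<in> carrier E.V" for a \<phi>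
      by (rule E'.func_eqI) (use that in \<open>simp_all add: Gc E'.func_smult E.func_smult G E'.func_simps E.func_simps E.func_closed h.smult\<close>)
    fix g :: "nat \<Rightarrow> nat" and \<phi> assume g: "inj g" and \<phi>: "\<phi> \<in> carrier E.V"
    show "G (E.act g \<phi>) = E'.act g (G \<phi>)"
    proof (rule E'.func_eqI)
      show "G (E.act g \<phi>) f = E'.act g (G \<phi>) f" if f: "f \<in> injections n" for f
        by (cases rule: E.act_cases[OF f g])
          (use f g \<phi> in \<open>simp_all add: G Gc E.act_closed E.act_range E'.act_range E.act_not_range E'.act_not_range h.zero\<close>)
    qed (use g \<phi> in \<open>simp_all add: Gc E.act_closed E'.act_closed\<close>)
  qed (use Gc in auto)
  moreover have "inj_on G (carrier E.V)"
  proof (rule inj_onI)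
    fix \<phi> \<psi> assume *: "\<phi> \<in> carrier E.V" "\<psi> \<in> carrier E.V" "G \<phi> = G \<psi>"
    show "\<phi> = \<psi>"
    proof (rule E.func_eqI)
      show "\<phi> f = \<psi> f" if "f \<in> injections n" for f
        using * that G assms(4) E.func_closed by (metis inj_onD)
    qed (use * in auto)
  qed
  ultimately show ?thesis by blast
qed

section \<open>Modules over the group algebra\<close>

lemma (in abelian_monoid) finsum_swap:
  assumes "finite A" "finite B" "\<And>a b. a \<in> A \<Longrightarrow> b \<in> B \<Longrightarrow> f a b \<in> carrier G"
  shows "(\<Oplus>a\<in>A. \<Oplus>b\<in>B. f a b) = (\<Oplus>b\<in>B. \<Oplus>a\<in>A. f a b)"
  using assms(1,3)
proof (induction A)
  case (insert a A)
  then have "(\<Oplus>a\<in>insert a A. \<Oplus>b\<in>B. f a b) = (\<Oplus>b\<in>B. f a b) \<oplus> (\<Oplus>b\<in>B. \<Oplus>a\<in>A. f a b)"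
    by (subst finsum_insert) (auto intro!: finsum_closed)
  also have "\<dots> = (\<Oplus>b\<in>B. f a b \<oplus> (\<Oplus>a\<in>A. f a b))"
    using insert by (intro finsum_addf[symmetric]) (auto intro!: finsum_closed)
  also have "\<dots> = (\<Oplus>b\<in>B. \<Oplus>a\<in>insert a A. f a b)"
    using insert by (intro finsum_cong') (auto intro!: finsum_closed)
  finally show ?case .
qed simp

lemma (in lin_map) finsum:
  assumes "finite A" "\<And>i. i \<in> A \<Longrightarrow> g i \<in> carrier M"
  shows "f (\<Oplus>\<^bsub>M\<^esub>i\<in>A. g i) = (\<Oplus>\<^bsub>N\<^esub>i\<in>A. f (g i))"
  using assms
proof (induction A)
  case (insert i A)
  have "f (\<Oplus>\<^bsub>M\<^esub>i\<in>insert i A. g i) = f (g i \<oplus>\<^bsub>M\<^esub> (\<Oplus>\<^bsub>M\<^esub>i\<in>A. g i))"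
    using insert by (subst M.M.finsum_insert) auto
  also have "\<dots> = f (g i) \<oplus>\<^bsub>N\<^esub> (\<Oplus>\<^bsub>N\<^esub>i\<in>A. f (g i))"
    using insert by (simp add: add Pi_def)
  also have "\<dots> = (\<Oplus>\<^bsub>N\<^esub>i\<in>insert i A. f (g i))"
    using insert closed by (subst N.M.finsum_insert) auto
  finally show ?case .
qed (simp add: zero)

context left_module
begin

lemma finsum_smult:
  assumes "finite A" "\<And>i. i \<in> A \<Longrightarrow> a i \<in> carrier R" "x \<in> carrier M"
  shows "(\<Oplus>\<^bsub>R\<^esub>i\<in>A. a i) \<odot>\<^bsub>M\<^esub> x = (\<Oplus>\<^bsub>M\<^esub>i\<in>A. a i \<odot>\<^bsub>M\<^esub> x)"
  using assms(1,2)
proof (induction A)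
  case (insert i A)
  then show ?case using assms(3) by (simp add: smult_l_distr smult_closed Pi_def)
qed (simp add: smult_l_null assms)

lemma smult_finsum:
  assumes "finite A" "\<And>i. i \<in> A \<Longrightarrow> g i \<in> carrier M" "a \<in> carrier R"
  shows "a \<odot>\<^bsub>M\<^esub> (\<Oplus>\<^bsub>M\<^esub>i\<in>A. g i) = (\<Oplus>\<^bsub>M\<^esub>i\<in>A. a \<odot>\<^bsub>M\<^esub> g i)"
  using assms(1,2)
proof (induction A)
  case (insert i A)
  then show ?case using assms(3) by (simp add: smult_r_distr smult_closed Pi_def)
qed (simp add: smult_r_null assms)

lemma finsum_submodule:
  assumes H: "submodule H R M" and "finite A" "\<And>i. i \<in> A \<Longrightarrow> g i \<in> H"
  shows "(\<Oplus>\<^bsub>M\<^esub>i\<in>A. g i) \<in> H"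
  using assms(2,3)
proof (induction A)
  case (insert i A)
  then show ?case using submoduleD[OF H] by (simp add: Pi_def)
qed (simp add: submoduleD(2)[OF H])

lemma finsum_single:
  assumes "finite A" "j \<in> A" "y \<in> carrier M" "\<And>i. i \<in> A \<Longrightarrow> i \<noteq> j \<Longrightarrow> g i = \<zero>\<^bsub>M\<^esub>" "g j = y"
  shows "(\<Oplus>\<^bsub>M\<^esub>i\<in>A. g i) = y"
proof -
  have "(\<Oplus>\<^bsub>M\<^esub>i\<in>A. g i) = (\<Oplus>\<^bsub>M\<^esub>i\<in>A. if j = i then y else \<zero>\<^bsub>M\<^esub>)"
    using assms by (intro M.finsum_cong') auto
  also have "\<dots> = y" using M.finsum_singleton[of j A "\<lambda>_. y"] assms by simp
  finally show ?thesis .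
qed

end

section \<open>The dictionary between group algebra modules and permutation actions\<close>

abbreviation "perms n \<equiv> carrier (sym_group n)"

abbreviation "alg K n \<equiv> group_algebra K (sym_group n)"

definition alg_module :: "nat \<Rightarrow> ('k, 'v) module \<Rightarrow> ((nat \<Rightarrow> nat) \<Rightarrow> 'v \<Rightarrow> 'v) \<Rightarrow> ((nat \<Rightarrow> nat) \<Rightarrow> 'k, 'v) module" where
  "alg_module n V \<rho> = \<lparr>carrier = carrier V, mult = undefined, one = undefined, zero = zero V, add = add V,
     smult = (\<lambda>a x. \<Oplus>\<^bsub>V\<^esub>\<sigma>\<in>perms n. a \<sigma> \<odot>\<^bsub>V\<^esub> \<rho> \<sigma> x)\<rparr>"

text \<open>The multiple by \<open>a\<close> of the basis element \<open>\<sigma>\<close> of the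
  group algebra.\<close>

definition single :: "('k, 'x) ring_scheme \<Rightarrow> nat \<Rightarrow> (nat \<Rightarrow> nat) \<Rightarrow> 'k \<Rightarrow> (nat \<Rightarrow> nat) \<Rightarrow> 'k" where
  "single K n \<sigma> a = (\<lambda>\<tau>\<in>perms n. if \<tau> = \<sigma> then a else \<zero>\<^bsub>K\<^esub>)"

text \<open>Restriction of scalars along the inclusion of \<open>K\<close> in the group algebra as
  multiples of the identity permutation.\<close>

definition base_module :: "('k, 'x) ring_scheme \<Rightarrow> nat \<Rightarrow> ((nat \<Rightarrow> nat) \<Rightarrow> 'k, 'v) module \<Rightarrow> ('k, 'v) module" where
  "base_module K n E = \<lparr>carrier = carrier E, mult = undefined, one = undefined, zero = zero E, add = add E,
     smult = (\<lambda>a x. single K n id a \<odot>\<^bsub>E\<^esub> x)\<rparr>"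

definition base_action where "base_action K n E \<sigma> x = single K n \<sigma> \<one>\<^bsub>K\<^esub> \<odot>\<^bsub>E\<^esub> x"

lemma finite_perms [simp]: "finite (perms n)"
  by (simp add: sym_group_def finite_permutations)

lemma perms_iff: "\<sigma> \<in> perms n \<longleftrightarrow> \<sigma> permutes {1..n}" by (rule sym_group_carrier)

lemma alg_simps:
  "carrier (alg K n) = perms n \<rightarrow>\<^sub>E carrier K"
  "\<one>\<^bsub>alg K n\<^esub> = single K n id \<one>\<^bsub>K\<^esub>"
  "\<zero>\<^bsub>alg K n\<^esub> = (\<lambda>\<sigma>\<in>perms n. \<zero>\<^bsub>K\<^esub>)"
  "a \<oplus>\<^bsub>alg K n\<^esub> b = (\<lambda>\<sigma>\<in>perms n. a \<sigma> \<oplus>\<^bsub>K\<^esub> b \<sigma>)"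
  by (auto simp: group_algebra_def single_def sym_group_one)

lemma perms_quotient: "\<tau> \<in> perms n \<Longrightarrow> \<sigma> \<in> perms n \<Longrightarrow> inv' \<tau> \<circ> \<sigma> \<in> perms n"
  by (simp add: perms_iff permutes_compose permutes_inv)

lemma alg_mult:
  assumes "ring K" "a \<in> perms n \<rightarrow>\<^sub>E carrier K" "b \<in> perms n \<rightarrow>\<^sub>E carrier K" "\<sigma> \<in> perms n"
  shows "(a \<otimes>\<^bsub>alg K n\<^esub> b) \<sigma> = (\<Oplus>\<^bsub>K\<^esub>\<tau>\<in>perms n. a \<tau> \<otimes>\<^bsub>K\<^esub> b (inv' \<tau> \<circ> \<sigma>))"
proof -
  interpret ring K by fact
  have "(a \<otimes>\<^bsub>alg K n\<^esub> b) \<sigma> =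
      (\<Oplus>\<^bsub>K\<^esub>\<tau>\<in>perms n. a \<tau> \<otimes>\<^bsub>K\<^esub> b (inv\<^bsub>sym_group n\<^esub> \<tau> \<otimes>\<^bsub>sym_group n\<^esub> \<sigma>))"
    using assms(4) by (simp add: group_algebra_def)
  also have "\<dots> = (\<Oplus>\<^bsub>K\<^esub>\<tau>\<in>perms n. a \<tau> \<otimes>\<^bsub>K\<^esub> b (inv' \<tau> \<circ> \<sigma>))"
  proof (rule finsum_cong'[OF refl])
    show "(\<lambda>\<tau>. a \<tau> \<otimes>\<^bsub>K\<^esub> b (inv' \<tau> \<circ> \<sigma>)) \<in> perms n \<rightarrow> carrier K"
      using PiE_mem[OF assms(2)] PiE_mem[OF assms(3)] perms_quotient[OF _ assms(4)] by simp
  qed (simp add: sym_group_mult)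
  finally show ?thesis .
qed

context perm_rep
begin

definition perm_sum :: "((nat \<Rightarrow> nat) \<Rightarrow> 'k) \<Rightarrow> 'v \<Rightarrow> 'v" where
  "perm_sum a x = (\<Oplus>\<^bsub>E\<^esub>\<sigma>\<in>perms n. a \<sigma> \<odot>\<^bsub>E\<^esub> \<rho> \<sigma> x)"

lemma perm_term_closed: "a \<in> perms n \<rightarrow>\<^sub>E carrier K \<Longrightarrow> x \<in> carrier E \<Longrightarrow> \<sigma> \<in> perms n \<Longrightarrow> a \<sigma> \<odot>\<^bsub>E\<^esub> \<rho> \<sigma> x \<in> carrier E"
  by (intro smult_closed \<rho>_closed) (auto simp: perms_iff)

lemma perm_sum_closed: "a \<in> perms n \<rightarrow>\<^sub>E carrier K \<Longrightarrow> x \<in> carrier E \<Longrightarrow> perm_sum a x \<in> carrier E"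
  unfolding perm_sum_def by (rule M.finsum_closed) (auto simp: perm_term_closed)

lemma perm_sum_single:
  assumes "\<sigma> \<in> perms n" "a \<in> carrier K" "x \<in> carrier E"
  shows "perm_sum (single K n \<sigma> a) x = a \<odot>\<^bsub>E\<^esub> \<rho> \<sigma> x"
  unfolding perm_sum_def
  using assms by (intro finsum_single[where j = \<sigma>])
    (auto simp: single_def perms_iff smult_closed smult_l_null \<rho>_closed)

lemma perm_sum_add:
  assumes "a \<in> perms n \<rightarrow>\<^sub>E carrier K" "x \<in> carrier E" "y \<in> carrier E"
  shows "perm_sum a (x \<oplus>\<^bsub>E\<^esub> y) = perm_sum a x \<oplus>\<^bsub>E\<^esub> perm_sum a y"
proof -
  have "perm_sum a (x \<oplus>\<^bsub>E\<^esub> y) = (\<Oplus>\<^bsub>E\<^esub>\<sigma>\<in>perms n. a \<sigma> \<odot>\<^bsub>E\<^esub> \<rho> \<sigma> x \<oplus>\<^bsub>E\<^esub> a \<sigma> \<odot>\<^bsub>E\<^esub> \<rho> \<sigma> y)"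
    unfolding perm_sum_def using assms PiE_mem[OF assms(1)]
    by (intro M.finsum_cong') (auto simp: perms_iff \<rho>_add \<rho>_closed smult_r_distr smult_closed)
  then show ?thesis unfolding perm_sum_def
    using assms perm_term_closed by (subst (asm) M.finsum_addf) auto
qed

lemma perm_sum_add_left:
  assumes "a \<in> perms n \<rightarrow>\<^sub>E carrier K" "b \<in> perms n \<rightarrow>\<^sub>E carrier K" "x \<in> carrier E"
  shows "perm_sum (a \<oplus>\<^bsub>alg K n\<^esub> b) x = perm_sum a x \<oplus>\<^bsub>E\<^esub> perm_sum b x"
proof -
  have "perm_sum (a \<oplus>\<^bsub>alg K n\<^esub> b) x = (\<Oplus>\<^bsub>E\<^esub>\<sigma>\<in>perms n. a \<sigma> \<odot>\<^bsub>E\<^esub> \<rho> \<sigma> x \<oplus>\<^bsub>E\<^esub> b \<sigma> \<odot>\<^bsub>E\<^esub> \<rho> \<sigma> x)"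
    unfolding perm_sum_def using assms PiE_mem[OF assms(1)] PiE_mem[OF assms(2)]
    by (intro M.finsum_cong') (auto simp: alg_simps perms_iff \<rho>_closed smult_l_distr smult_closed)
  then show ?thesis unfolding perm_sum_def
    using assms perm_term_closed by (subst (asm) M.finsum_addf) auto
qed

text \<open>Expand the convolution, interchange the two sums and substitute the composite of
  \<open>\<tau>\<close> with a new variable for \<open>\<sigma>\<close>; then linearity of
  \<open>\<rho> \<tau>\<close> collects the inner sum.\<close>

lemma perm_sum_mult:
  assumes a: "a \<in> perms n \<rightarrow>\<^sub>E carrier K" and b: "b \<in> perms n \<rightarrow>\<^sub>E carrier K" and x: "x \<in> carrier E"
  shows "perm_sum (a \<otimes>\<^bsub>alg K n\<^esub> b) x = perm_sum a (perm_sum b x)"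
proof -
  let ?t = "\<lambda>\<tau> \<sigma>. (a \<tau> \<otimes>\<^bsub>K\<^esub> b (inv' \<tau> \<circ> \<sigma>)) \<odot>\<^bsub>E\<^esub> \<rho> \<sigma> x"
  have aK: "a \<sigma> \<in> carrier K" and bK: "b \<sigma> \<in> carrier K" if "\<sigma> \<in> perms n" for \<sigma> using a b that by auto
  have pc: "inv' \<tau> \<circ> \<sigma> \<in> perms n" if "\<tau> \<in> perms n" "\<sigma> \<in> perms n" for \<tau> \<sigma>
    using that by (simp add: perms_iff permutes_compose permutes_inv)
  have \<rho>x: "\<rho> \<sigma> y \<in> carrier E" if "\<sigma> \<in> perms n" "y \<in> carrier E" for \<sigma> y using that by (simp add: perms_iff \<rho>_closed)
  have tc: "?t \<tau> \<sigma> \<in> carrier E" if "\<tau> \<in> perms n" "\<sigma> \<in> perms n" for \<tau> \<sigma>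
    using that by (intro smult_closed R.m_closed aK bK pc \<rho>x x)
  have "perm_sum (a \<otimes>\<^bsub>alg K n\<^esub> b) x = (\<Oplus>\<^bsub>E\<^esub>\<sigma>\<in>perms n. \<Oplus>\<^bsub>E\<^esub>\<tau>\<in>perms n. ?t \<tau> \<sigma>)"
    unfolding perm_sum_def
  proof (rule M.finsum_cong'[OF refl])
    fix \<sigma> assume \<sigma>: "\<sigma> \<in> perms n"
    have "(a \<otimes>\<^bsub>alg K n\<^esub> b) \<sigma> = (\<Oplus>\<^bsub>K\<^esub>\<tau>\<in>perms n. a \<tau> \<otimes>\<^bsub>K\<^esub> b (inv' \<tau> \<circ> \<sigma>))"
      using alg_mult[OF R.ring_axioms a b \<sigma>] .
    then show "(a \<otimes>\<^bsub>alg K n\<^esub> b) \<sigma> \<odot>\<^bsub>E\<^esub> \<rho> \<sigma> x = (\<Oplus>\<^bsub>E\<^esub>\<tau>\<in>perms n. ?t \<tau> \<sigma>)"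
      using \<sigma> x by (simp add: finsum_smult aK bK pc \<rho>x)
  qed (auto intro!: M.finsum_closed tc)
  also have "\<dots> = (\<Oplus>\<^bsub>E\<^esub>\<tau>\<in>perms n. \<Oplus>\<^bsub>E\<^esub>\<sigma>\<in>perms n. ?t \<tau> \<sigma>)"
    by (rule M.finsum_swap) (auto intro: tc)
  also have "\<dots> = perm_sum a (perm_sum b x)"
    unfolding perm_sum_def[of a]
  proof (rule M.finsum_cong'[OF refl])
    fix \<tau> assume \<tau>: "\<tau> \<in> perms n"
    have p\<tau>: "\<tau> permutes {1..n}" using \<tau> by (simp add: perms_iff)
    have inj: "inj_on ((\<circ>) \<tau>) (perms n)"
      using permutes_inj[OF p\<tau>] by (auto simp: inj_on_def fun_eq_iff dest: injD)
    have im: "(\<circ>) \<tau> ` perms n = perms n"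
    proof
      show "(\<circ>) \<tau> ` perms n \<subseteq> perms n" using p\<tau> by (auto simp: perms_iff permutes_compose)
      show "perms n \<subseteq> (\<circ>) \<tau> ` perms n"
      proof
        fix \<sigma> assume "\<sigma> \<in> perms n"
        then have "\<sigma> = \<tau> \<circ> (inv' \<tau> \<circ> \<sigma>)" "inv' \<tau> \<circ> \<sigma> \<in> perms n"
          using permutes_inverses(1)[OF p\<tau>] pc[OF \<tau>] by (auto simp: fun_eq_iff)
        then show "\<sigma> \<in> (\<circ>) \<tau> ` perms n" by blast
      qed
    qed
    interpret r: lin_map K E E "restrict (\<rho> \<tau>) (carrier E)"
      unfolding lin_map_iff
      by (intro conjI left_module_axioms lin_mapsI) (auto simp: p\<tau> \<rho>_closed \<rho>_add \<rho>_smult smult_closed)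
    \<comment> \<open>Left multiplication by \<open>\<tau>\<close> permutes the group; the
      substitution turns \<open>inv' \<tau> \<circ> \<sigma>\<close> into the plain summation
      variable.\<close>
    have "(\<Oplus>\<^bsub>E\<^esub>\<sigma>\<in>perms n. ?t \<tau> \<sigma>) = (\<Oplus>\<^bsub>E\<^esub>\<sigma>\<in>(\<circ>) \<tau> ` perms n. ?t \<tau> \<sigma>)" by (simp only: im)
    also have "\<dots> = (\<Oplus>\<^bsub>E\<^esub>\<sigma>\<in>perms n. ?t \<tau> (\<tau> \<circ> \<sigma>))"
      using inj tc[OF \<tau>] im by (intro M.finsum_reindex) auto
    also have "\<dots> = (\<Oplus>\<^bsub>E\<^esub>\<sigma>\<in>perms n. a \<tau> \<odot>\<^bsub>E\<^esub> \<rho> \<tau> (b \<sigma> \<odot>\<^bsub>E\<^esub> \<rho> \<sigma> x))"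
    proof (rule M.finsum_cong'[OF refl])
      fix \<sigma> assume \<sigma>: "\<sigma> \<in> perms n"
      have "inv' \<tau> \<circ> (\<tau> \<circ> \<sigma>) = \<sigma>" using permutes_inverses(2)[OF p\<tau>] by (auto simp: fun_eq_iff)
      then show "?t \<tau> (\<tau> \<circ> \<sigma>) = a \<tau> \<odot>\<^bsub>E\<^esub> \<rho> \<tau> (b \<sigma> \<odot>\<^bsub>E\<^esub> \<rho> \<sigma> x)"
        using \<sigma> \<tau> x by (simp add: smult_assoc aK bK \<rho>x \<rho>_smult \<rho>_comp perms_iff[symmetric] perms_iff[THEN iffD1])
    qed (use \<tau> x in \<open>auto intro!: smult_closed \<rho>x aK bK\<close>)
    also have "\<dots> = a \<tau> \<odot>\<^bsub>E\<^esub> (\<Oplus>\<^bsub>E\<^esub>\<sigma>\<in>perms n. \<rho> \<tau> (b \<sigma> \<odot>\<^bsub>E\<^esub> \<rho> \<sigma> x))"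
      using \<tau> x by (intro smult_finsum[symmetric]) (auto intro!: smult_closed \<rho>x aK bK)
    also have "(\<Oplus>\<^bsub>E\<^esub>\<sigma>\<in>perms n. \<rho> \<tau> (b \<sigma> \<odot>\<^bsub>E\<^esub> \<rho> \<sigma> x)) = \<rho> \<tau> (perm_sum b x)"
    proof -
      have "(\<Oplus>\<^bsub>E\<^esub>\<sigma>\<in>perms n. \<rho> \<tau> (b \<sigma> \<odot>\<^bsub>E\<^esub> \<rho> \<sigma> x)) =
            (\<Oplus>\<^bsub>E\<^esub>\<sigma>\<in>perms n. restrict (\<rho> \<tau>) (carrier E) (b \<sigma> \<odot>\<^bsub>E\<^esub> \<rho> \<sigma> x))"
        using \<tau> x by (intro M.finsum_cong') (auto intro!: smult_closed \<rho>x aK bK)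
      also have "\<dots> = restrict (\<rho> \<tau>) (carrier E) (perm_sum b x)"
        unfolding perm_sum_def using perm_term_closed[OF b x] by (intro r.finsum[symmetric]) auto
      finally show ?thesis using perm_sum_closed[OF b x] by simp
    qed
    finally show "(\<Oplus>\<^bsub>E\<^esub>\<sigma>\<in>perms n. ?t \<tau> \<sigma>) = a \<tau> \<odot>\<^bsub>E\<^esub> \<rho> \<tau> (perm_sum b x)" .
  qed (use perm_sum_closed[OF b x] in \<open>auto intro!: smult_closed \<rho>x aK\<close>)
  finally show ?thesis .
qed

lemma alg_module_simps [simp]:
  "carrier (alg_module n E \<rho>) = carrier E" "\<zero>\<^bsub>alg_module n E \<rho>\<^esub> = \<zero>\<^bsub>E\<^esub>" "add (alg_module n E \<rho>) = add E"
  "a \<odot>\<^bsub>alg_module n E \<rho>\<^esub> x = perm_sum a x"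
  by (auto simp: alg_module_def perm_sum_def)

text \<open>The ring laws appear as a premise because they are themselves derived from the
  identities for \<open>perm_sum\<close>, applied to the regular representation.\<close>

lemma alg_module_left_module:
  assumes "ring (alg K n)" shows "left_module (alg K n) (alg_module n E \<rho>)"
proof (rule left_moduleI[OF assms])
  show "\<exists>y\<in>carrier (alg_module n E \<rho>). y \<oplus>\<^bsub>alg_module n E \<rho>\<^esub> x = \<zero>\<^bsub>alg_module n E \<rho>\<^esub>"
    if "x \<in> carrier (alg_module n E \<rho>)" for x
    using that by (intro bexI[of _ "\<ominus>\<^bsub>E\<^esub> x"]) (auto simp: M.l_neg)
  show "\<one>\<^bsub>alg K n\<^esub> \<odot>\<^bsub>alg_module n E \<rho>\<^esub> x = x" if "x \<in> carrier (alg_module n E \<rho>)" for x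
    using that by (simp add: alg_simps(2) perm_sum_single perms_iff permutes_id \<rho>_id smult_one)
qed (auto simp: M.a_ac perm_sum_closed perm_sum_add perm_sum_add_left perm_sum_mult alg_simps(1))

end

text \<open>In the regular representation \<open>B\<close>, the sum \<open>perm_sum a b\<close> is
  the product of \<open>a\<close> and \<open>b\<close>. Associativity and both distributive laws are
  then the identities already proved for permutation actions.\<close>

lemma ring_group_algebra:
  fixes K :: "('k, 'x) ring_scheme"
  assumes "ring K" shows "ring (alg K n)"
proof -
  interpret K: ring K by fact
  define B :: "('k, (nat \<Rightarrow> nat) \<Rightarrow> 'k) module" where "B = \<lparr>carrier = perms n \<rightarrow>\<^sub>E carrier K, mult = undefined, one = undefined,
    zero = \<zero>\<^bsub>alg K n\<^esub>, add = add (alg K n), smult = (\<lambda>a b. \<lambda>\<sigma>\<in>perms n. a \<otimes>\<^bsub>K\<^esub> b \<sigma>)\<rparr>"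
  define \<rho> where "\<rho> \<tau> b = (\<lambda>\<sigma>\<in>perms n. b (inv' \<tau> \<circ> \<sigma>))" for \<tau> and b :: "(nat \<Rightarrow> nat) \<Rightarrow> 'k"
  have B [simp]: "carrier B = perms n \<rightarrow>\<^sub>E carrier K" "\<zero>\<^bsub>B\<^esub> = \<zero>\<^bsub>alg K n\<^esub>" "add B = add (alg K n)"
    "a \<odot>\<^bsub>B\<^esub> b = (\<lambda>\<sigma>\<in>perms n. a \<otimes>\<^bsub>K\<^esub> b \<sigma>)" for a b by (auto simp: B_def)
  have mem: "b \<sigma> \<in> carrier K" if "b \<in> perms n \<rightarrow>\<^sub>E carrier K" "\<sigma> \<in> perms n" for b \<sigma> using that by auto
  have eqI: "a = b" if "a \<in> perms n \<rightarrow>\<^sub>E carrier K" "b \<in> perms n \<rightarrow>\<^sub>E carrier K" "\<And>\<sigma>. \<sigma> \<in> perms n \<Longrightarrow> a \<sigma> = b \<sigma>" for a b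
    using that by (rule PiE_ext)
  have B_mod: "left_module K B"
  proof (rule left_moduleI[OF assms])
    show "\<exists>y\<in>carrier B. y \<oplus>\<^bsub>B\<^esub> x = \<zero>\<^bsub>B\<^esub>" if x: "x \<in> carrier B" for x
      by (rule bexI[of _ "\<lambda>\<sigma>\<in>perms n. \<ominus>\<^bsub>K\<^esub> x \<sigma>"])
        (use x mem[of x] in \<open>auto simp: alg_simps K.l_neg intro!: restrict_ext\<close>)
    show "x \<oplus>\<^bsub>B\<^esub> y \<in> carrier B" if "x \<in> carrier B" "y \<in> carrier B" for x y
      using mem[of x] mem[of y] that by (simp add: alg_simps)
    show z: "\<zero>\<^bsub>B\<^esub> \<in> carrier B" by (simp add: alg_simps)
    show "x \<oplus>\<^bsub>B\<^esub> y \<oplus>\<^bsub>B\<^esub> z = x \<oplus>\<^bsub>B\<^esub> (y \<oplus>\<^bsub>B\<^esub> z)" if "x \<in> carrier B" "y \<in> carrier B" "z \<in> carrier B" for x y z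
      using mem[of x] mem[of y] mem[of z] that by (simp add: alg_simps K.a_assoc cong: restrict_cong)
    show "x \<oplus>\<^bsub>B\<^esub> y = y \<oplus>\<^bsub>B\<^esub> x" if "x \<in> carrier B" "y \<in> carrier B" for x y
      using mem[of x] mem[of y] that by (simp add: alg_simps K.a_comm cong: restrict_cong)
    show "\<zero>\<^bsub>B\<^esub> \<oplus>\<^bsub>B\<^esub> x = x" if "x \<in> carrier B" for x
      using mem[of x] that z by (intro eqI) (simp_all add: alg_simps)
    show "a \<odot>\<^bsub>B\<^esub> x \<in> carrier B" if "a \<in> carrier K" "x \<in> carrier B" for a x
      using mem[of x] that by simp
    show "(a \<oplus>\<^bsub>K\<^esub> b) \<odot>\<^bsub>B\<^esub> x = a \<odot>\<^bsub>B\<^esub> x \<oplus>\<^bsub>B\<^esub> b \<odot>\<^bsub>B\<^esub> x" if "a \<in> carrier K" "b \<in> carrier K" "x \<in> carrier B" for a b x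
      using mem[of x] that by (simp add: alg_simps K.l_distr cong: restrict_cong)
    show "a \<odot>\<^bsub>B\<^esub> (x \<oplus>\<^bsub>B\<^esub> y) = a \<odot>\<^bsub>B\<^esub> x \<oplus>\<^bsub>B\<^esub> a \<odot>\<^bsub>B\<^esub> y" if "a \<in> carrier K" "x \<in> carrier B" "y \<in> carrier B" for a x y
      using mem[of x] mem[of y] that by (simp add: alg_simps K.r_distr cong: restrict_cong)
    show "(a \<otimes>\<^bsub>K\<^esub> b) \<odot>\<^bsub>B\<^esub> x = a \<odot>\<^bsub>B\<^esub> (b \<odot>\<^bsub>B\<^esub> x)" if "a \<in> carrier K" "b \<in> carrier K" "x \<in> carrier B" for a b x
      using mem[of x] that by (simp add: K.m_assoc cong: restrict_cong)
    show "\<one>\<^bsub>K\<^esub> \<odot>\<^bsub>B\<^esub> x = x" if "x \<in> carrier B" for x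
      using mem[of x] that by (intro eqI) simp_all
  qed
  interpret B: perm_rep K n B \<rho>
  proof (intro perm_rep.intro perm_rep_axioms.intro B_mod)
    fix \<sigma> :: "nat \<Rightarrow> nat" assume "\<sigma> permutes {1..n}"
    then have \<sigma>: "\<sigma> \<in> perms n" by (simp add: perms_iff)
    note q = perms_quotient[OF \<sigma>]
    show "\<rho> \<sigma> x \<in> carrier B" if "x \<in> carrier B" for x
      using that q by (auto simp: \<rho>_def mem)
    show "\<rho> \<sigma> (x \<oplus>\<^bsub>B\<^esub> y) = \<rho> \<sigma> x \<oplus>\<^bsub>B\<^esub> \<rho> \<sigma> y" if "x \<in> carrier B" "y \<in> carrier B" for x y
      using q by (auto simp: \<rho>_def alg_simps intro!: restrict_ext)
    show "\<rho> \<sigma> (a \<odot>\<^bsub>B\<^esub> x) = a \<odot>\<^bsub>B\<^esub> \<rho> \<sigma> x" if "a \<in> carrier K" "x \<in> carrier B" for a x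
      using q by (auto simp: \<rho>_def intro!: restrict_ext)
    show "\<rho> (\<sigma> \<circ> \<tau>) x = \<rho> \<sigma> (\<rho> \<tau> x)" if \<tau>: "\<tau> permutes {1..n}" and "x \<in> carrier B" for \<tau> x
    proof -
      have "inv' (\<sigma> \<circ> \<tau>) = inv' \<tau> \<circ> inv' \<sigma>"
        using \<sigma> \<tau> by (simp add: o_inv_distrib permutes_bij perms_iff)
      then show ?thesis using q by (auto simp: \<rho>_def comp_assoc intro!: restrict_ext)
    qed
  next
    show "\<rho> id x = x" if "x \<in> carrier B" for x
      using that by (intro eqI) (auto simp: \<rho>_def mem perms_iff permutes_compose)
  qed
  have mult: "a \<otimes>\<^bsub>alg K n\<^esub> b = B.perm_sum a b"
    if a: "a \<in> perms n \<rightarrow>\<^sub>E carrier K" and b: "b \<in> perms n \<rightarrow>\<^sub>E carrier K" for a b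
  proof (rule eqI)
    show s: "B.perm_sum a b \<in> perms n \<rightarrow>\<^sub>E carrier K" using B.perm_sum_closed[OF a] b by simp
    show "a \<otimes>\<^bsub>alg K n\<^esub> b \<in> perms n \<rightarrow>\<^sub>E carrier K"
    proof (rule PiE_I)
      show "(a \<otimes>\<^bsub>alg K n\<^esub> b) \<sigma> \<in> carrier K" if "\<sigma> \<in> perms n" for \<sigma>
        unfolding alg_mult[OF assms a b that]
        by (rule K.finsum_closed) (use mem[OF a] mem[OF b] perms_quotient[OF _ that] in simp)
    qed (simp add: group_algebra_def)
    fix \<sigma> assume \<sigma>: "\<sigma> \<in> perms n"
    \<comment> \<open>Sums of functions are computed pointwise, which reduces the claim to the
      convolution formula in \<open>K\<close>.\<close>
    have ev: "finsum B h S \<sigma> = (\<Oplus>\<^bsub>K\<^esub>\<tau>\<in>S. h \<tau> \<sigma>)" if "finite S" "h \<in> S \<rightarrow> carrier B" for h S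
      using that
    proof induction
      case (insert \<tau> S)
      then have "finsum B h (insert \<tau> S) = h \<tau> \<oplus>\<^bsub>B\<^esub> finsum B h S" by (intro B.M.finsum_insert) auto
      then show ?case using insert \<sigma> by (subst K.finsum_insert) (auto simp: alg_simps)
    qed (simp add: alg_simps \<sigma>)
    have tc: "a \<tau> \<odot>\<^bsub>B\<^esub> \<rho> \<tau> b \<in> carrier B" if "\<tau> \<in> perms n" for \<tau>
      using B.perm_term_closed[OF a _ that] b by simp
    have "B.perm_sum a b \<sigma> = (\<Oplus>\<^bsub>K\<^esub>\<tau>\<in>perms n. (a \<tau> \<odot>\<^bsub>B\<^esub> \<rho> \<tau> b) \<sigma>)"
      unfolding B.perm_sum_def by (rule ev) (use tc in auto)
    also have "\<dots> = (\<Oplus>\<^bsub>K\<^esub>\<tau>\<in>perms n. a \<tau> \<otimes>\<^bsub>K\<^esub> b (inv' \<tau> \<circ> \<sigma>))"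
    proof (rule K.finsum_cong'[OF refl])
      fix \<tau> assume \<tau>: "\<tau> \<in> perms n"
      show "(a \<tau> \<odot>\<^bsub>B\<^esub> \<rho> \<tau> b) \<sigma> = a \<tau> \<otimes>\<^bsub>K\<^esub> b (inv' \<tau> \<circ> \<sigma>)"
        using tc[OF \<tau>] \<sigma> by (simp add: \<rho>_def)
    qed (use a b mem perms_quotient[OF _ \<sigma>] in auto)
    finally show "(a \<otimes>\<^bsub>alg K n\<^esub> b) \<sigma> = B.perm_sum a b \<sigma>" using alg_mult[OF assms a b \<sigma>] by simp
  qed
  have cA: "carrier (alg K n) = perms n \<rightarrow>\<^sub>E carrier K" by (rule alg_simps(1))
  have one_c: "\<one>\<^bsub>alg K n\<^esub> \<in> carrier (alg K n)" by (auto simp: alg_simps single_def)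
  have mc: "a \<otimes>\<^bsub>alg K n\<^esub> b \<in> carrier (alg K n)" if "a \<in> carrier (alg K n)" "b \<in> carrier (alg K n)" for a b
    using that mult B.perm_sum_closed by (simp add: cA)
  show ?thesis
  proof (rule ringI)
    show "abelian_group (alg K n)"
      by (rule abelian_groupI) (use B.M.add.l_inv_ex B.M.a_closed B.M.zero_closed B.M.a_assoc B.M.a_comm B.M.l_zero in \<open>simp_all add: cA[symmetric]\<close>)
    show "Group.monoid (alg K n)"
    proof (rule monoidI)
      show "a \<otimes>\<^bsub>alg K n\<^esub> b \<otimes>\<^bsub>alg K n\<^esub> c = a \<otimes>\<^bsub>alg K n\<^esub> (b \<otimes>\<^bsub>alg K n\<^esub> c)"
        if "a \<in> carrier (alg K n)" "b \<in> carrier (alg K n)" "c \<in> carrier (alg K n)" for a b c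
        using that mc mult B.perm_sum_mult[of a b c] by (simp add: cA)
      show "\<one>\<^bsub>alg K n\<^esub> \<otimes>\<^bsub>alg K n\<^esub> a = a" if a: "a \<in> carrier (alg K n)" for a
      proof -
        have "\<one>\<^bsub>alg K n\<^esub> \<otimes>\<^bsub>alg K n\<^esub> a = B.perm_sum (single K n id \<one>\<^bsub>K\<^esub>) a"
          using mult one_c a by (simp add: alg_simps(1,2))
        also have "\<dots> = a" using a by (subst B.perm_sum_single) (auto simp: perms_iff permutes_id cA B.\<rho>_id B.smult_one[simplified])
        finally show ?thesis .
      qed
      \<comment> \<open>Module laws say nothing about the right unit, so it is computed from the
        convolution: only the summand at \<open>\<tau> = \<sigma>\<close> survives.\<close>
      show "a \<otimes>\<^bsub>alg K n\<^esub> \<one>\<^bsub>alg K n\<^esub> = a" if a: "a \<in> carrier (alg K n)" for a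
      proof (rule eqI)
        fix \<sigma> assume \<sigma>: "\<sigma> \<in> perms n"
        interpret KK: left_module K B by (rule B_mod)
        have "(a \<otimes>\<^bsub>alg K n\<^esub> \<one>\<^bsub>alg K n\<^esub>) \<sigma> = (\<Oplus>\<^bsub>K\<^esub>\<tau>\<in>perms n. a \<tau> \<otimes>\<^bsub>K\<^esub> \<one>\<^bsub>alg K n\<^esub> (inv' \<tau> \<circ> \<sigma>))"
          using alg_mult[OF assms _ _ \<sigma>] a one_c by (simp add: cA)
        also have "\<dots> = (\<Oplus>\<^bsub>K\<^esub>\<tau>\<in>perms n. if \<sigma> = \<tau> then a \<tau> else \<zero>\<^bsub>K\<^esub>)"
        proof (rule K.finsum_cong'[OF refl])
          fix \<tau> assume \<tau>: "\<tau> \<in> perms n"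
          then have "\<tau> permutes {1..n}" by (simp add: perms_iff)
          then have "inv' \<tau> \<circ> \<sigma> = id \<longleftrightarrow> \<sigma> = \<tau>"
            by (metis comp_id fun.map_comp id_comp permutes_inv_o)
          then show "a \<tau> \<otimes>\<^bsub>K\<^esub> \<one>\<^bsub>alg K n\<^esub> (inv' \<tau> \<circ> \<sigma>) = (if \<sigma> = \<tau> then a \<tau> else \<zero>\<^bsub>K\<^esub>)"
            using a \<tau> perms_quotient[OF \<tau> \<sigma>] by (auto simp: alg_simps single_def mem)
        qed (use a mem in \<open>auto simp: cA\<close>)
        also have "\<dots> = a \<sigma>" using a \<sigma> mem by (intro K.finsum_singleton) (auto simp: cA)
        finally show "(a \<otimes>\<^bsub>alg K n\<^esub> \<one>\<^bsub>alg K n\<^esub>) \<sigma> = a \<sigma>" .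
      qed (use a mc one_c in \<open>auto simp: cA\<close>)
    qed (use mc one_c in auto)
    show "(a \<oplus>\<^bsub>alg K n\<^esub> b) \<otimes>\<^bsub>alg K n\<^esub> c = a \<otimes>\<^bsub>alg K n\<^esub> c \<oplus>\<^bsub>alg K n\<^esub> b \<otimes>\<^bsub>alg K n\<^esub> c"
      if "a \<in> carrier (alg K n)" "b \<in> carrier (alg K n)" "c \<in> carrier (alg K n)" for a b c
      using that mult B.perm_sum_add_left[of a b c] B.M.a_closed[of a b] by (simp add: cA)
    show "c \<otimes>\<^bsub>alg K n\<^esub> (a \<oplus>\<^bsub>alg K n\<^esub> b) = c \<otimes>\<^bsub>alg K n\<^esub> a \<oplus>\<^bsub>alg K n\<^esub> c \<otimes>\<^bsub>alg K n\<^esub> b"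
      if "a \<in> carrier (alg K n)" "b \<in> carrier (alg K n)" "c \<in> carrier (alg K n)" for a b c
      using that mult B.perm_sum_add[of c a b] B.M.a_closed[of a b] by (simp add: cA)
  qed
qed

text \<open>Restricting the scalars to single basis elements gives the action; conversely an element
  of the group algebra is the sum of its \<open>single\<close> parts, so the action determines the
  scalar multiplication.\<close>

lemma module_over_alg:
  fixes E :: "((nat \<Rightarrow> nat) \<Rightarrow> 'k, 'v) module"
  assumes K: "ring K" and E: "left_module (alg K n) E"
  shows "perm_rep K n (base_module K n E) (base_action K n E)"
    and "a \<in> carrier (alg K n) \<Longrightarrow> x \<in> carrier E \<Longrightarrow>
      a \<odot>\<^bsub>E\<^esub> x = perm_rep.perm_sum n (base_module K n E) (base_action K n E) a x"
proof -
  interpret K: ring K by fact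
  interpret E: left_module "alg K n" E by fact
  let ?B = "base_module K n E" and ?\<rho> = "base_action K n E"
  have id: "id \<in> perms n" by (simp add: perms_iff permutes_id)
  have sc: "single K n \<sigma> a \<in> carrier (alg K n)" if "a \<in> carrier K" for \<sigma> a
    using that by (auto simp: alg_simps single_def)
  have sadd: "single K n \<sigma> (a \<oplus>\<^bsub>K\<^esub> b) = single K n \<sigma> a \<oplus>\<^bsub>alg K n\<^esub> single K n \<sigma> b"
    if "a \<in> carrier K" "b \<in> carrier K" for \<sigma> a b
    using that by (auto simp: alg_simps single_def intro!: restrict_ext)
  have smul: "single K n \<sigma> a \<otimes>\<^bsub>alg K n\<^esub> single K n \<tau> b = single K n (\<sigma> \<circ> \<tau>) (a \<otimes>\<^bsub>K\<^esub> b)"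
    if a: "a \<in> carrier K" and b: "b \<in> carrier K" and \<sigma>: "\<sigma> \<in> perms n" and \<tau>: "\<tau> \<in> perms n" for \<sigma> \<tau> a b
  proof (rule PiE_ext)
    show "single K n \<sigma> a \<otimes>\<^bsub>alg K n\<^esub> single K n \<tau> b \<in> perms n \<rightarrow>\<^sub>E carrier K"
      using E.R.m_closed[OF sc[OF a] sc[OF b]] by (simp add: alg_simps(1))
    show "single K n (\<sigma> \<circ> \<tau>) (a \<otimes>\<^bsub>K\<^esub> b) \<in> perms n \<rightarrow>\<^sub>E carrier K"
      using sc[of "a \<otimes>\<^bsub>K\<^esub> b"] a b by (simp add: alg_simps(1))
    fix \<pi> assume \<pi>: "\<pi> \<in> perms n"
    have eq: "inv' \<sigma> \<circ> \<pi> = \<tau> \<longleftrightarrow> \<pi> = \<sigma> \<circ> \<tau>"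
      using permutes_inv_o[OF \<sigma>[unfolded perms_iff]] by (metis comp_id fun.map_comp id_comp)
    have "(single K n \<sigma> a \<otimes>\<^bsub>alg K n\<^esub> single K n \<tau> b) \<pi> =
        (\<Oplus>\<^bsub>K\<^esub>\<upsilon>\<in>perms n. single K n \<sigma> a \<upsilon> \<otimes>\<^bsub>K\<^esub> single K n \<tau> b (inv' \<upsilon> \<circ> \<pi>))"
      using alg_mult[OF K _ _ \<pi>] sc a b by (simp add: alg_simps(1))
    also have "\<dots> = (\<Oplus>\<^bsub>K\<^esub>\<upsilon>\<in>perms n. if \<sigma> = \<upsilon> then single K n (\<sigma> \<circ> \<tau>) (a \<otimes>\<^bsub>K\<^esub> b) \<pi> else \<zero>\<^bsub>K\<^esub>)"
    proof (rule K.finsum_cong'[OF refl])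
      fix \<upsilon> assume \<upsilon>: "\<upsilon> \<in> perms n"
      have "single K n \<tau> b (inv' \<upsilon> \<circ> \<pi>) \<in> carrier K"
        using perms_quotient[OF \<upsilon> \<pi>] b by (simp add: single_def)
      then show "single K n \<sigma> a \<upsilon> \<otimes>\<^bsub>K\<^esub> single K n \<tau> b (inv' \<upsilon> \<circ> \<pi>) =
          (if \<sigma> = \<upsilon> then single K n (\<sigma> \<circ> \<tau>) (a \<otimes>\<^bsub>K\<^esub> b) \<pi> else \<zero>\<^bsub>K\<^esub>)"
        using \<upsilon> a b \<pi> eq perms_quotient[OF \<sigma> \<pi>] by (auto simp: single_def)
    qed (use a b \<pi> in \<open>auto simp: single_def\<close>)
    also have "\<dots> = single K n (\<sigma> \<circ> \<tau>) (a \<otimes>\<^bsub>K\<^esub> b) \<pi>"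
      using \<sigma> \<pi> a b K.finsum_singleton[OF \<sigma>, of "\<lambda>_. single K n (\<sigma> \<circ> \<tau>) (a \<otimes>\<^bsub>K\<^esub> b) \<pi>"]
      by (simp add: single_def)
    finally show "(single K n \<sigma> a \<otimes>\<^bsub>alg K n\<^esub> single K n \<tau> b) \<pi> = single K n (\<sigma> \<circ> \<tau>) (a \<otimes>\<^bsub>K\<^esub> b) \<pi>" .
  qed
  have B [simp]: "carrier ?B = carrier E" "\<zero>\<^bsub>?B\<^esub> = \<zero>\<^bsub>E\<^esub>" "add ?B = add E" "a \<odot>\<^bsub>?B\<^esub> x = single K n id a \<odot>\<^bsub>E\<^esub> x" for a x
    by (auto simp: base_module_def)
  have B_mod: "left_module K ?B"
  proof (rule left_moduleI[OF K])
    show "\<exists>y\<in>carrier ?B. y \<oplus>\<^bsub>?B\<^esub> x = \<zero>\<^bsub>?B\<^esub>" if "x \<in> carrier ?B" for x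
      using that by (intro bexI[of _ "\<ominus>\<^bsub>E\<^esub> x"]) (auto simp: E.M.l_neg)
    show "(a \<otimes>\<^bsub>K\<^esub> b) \<odot>\<^bsub>?B\<^esub> x = a \<odot>\<^bsub>?B\<^esub> (b \<odot>\<^bsub>?B\<^esub> x)" if "a \<in> carrier K" "b \<in> carrier K" "x \<in> carrier ?B" for a b x
      using that smul[of a b id id] id by (simp add: E.smult_assoc[symmetric] sc)
    show "\<one>\<^bsub>K\<^esub> \<odot>\<^bsub>?B\<^esub> x = x" if "x \<in> carrier ?B" for x
      using that E.smult_one[of x] by (simp add: alg_simps(2))
  qed (auto simp: E.M.a_ac sc sadd E.smult_closed E.smult_l_distr E.smult_r_distr)
  show P: "perm_rep K n ?B ?\<rho>"
  proof (intro perm_rep.intro perm_rep_axioms.intro B_mod)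
    fix \<sigma> :: "nat \<Rightarrow> nat" assume "\<sigma> permutes {1..n}"
    then have \<sigma>: "\<sigma> \<in> perms n" by (simp add: perms_iff)
    show "?\<rho> \<sigma> x \<in> carrier ?B" if "x \<in> carrier ?B" for x
      using that by (simp add: base_action_def E.smult_closed sc)
    show "?\<rho> \<sigma> (x \<oplus>\<^bsub>?B\<^esub> y) = ?\<rho> \<sigma> x \<oplus>\<^bsub>?B\<^esub> ?\<rho> \<sigma> y" if "x \<in> carrier ?B" "y \<in> carrier ?B" for x y
      using that by (simp add: base_action_def E.smult_r_distr sc)
    show "?\<rho> \<sigma> (a \<odot>\<^bsub>?B\<^esub> x) = a \<odot>\<^bsub>?B\<^esub> ?\<rho> \<sigma> x" if "a \<in> carrier K" "x \<in> carrier ?B" for a x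
      using that \<sigma> id by (simp add: base_action_def E.smult_assoc[symmetric] sc smul)
    show "?\<rho> (\<sigma> \<circ> \<tau>) x = ?\<rho> \<sigma> (?\<rho> \<tau> x)" if "\<tau> permutes {1..n}" "x \<in> carrier ?B" for \<tau> x
      using that \<sigma> by (simp add: base_action_def E.smult_assoc[symmetric] sc smul perms_iff)
  next
    show "?\<rho> id x = x" if "x \<in> carrier ?B" for x
      using that E.smult_one[of x] by (simp add: base_action_def alg_simps(2))
  qed
  interpret P: perm_rep K n ?B ?\<rho> by (rule P)
  assume a: "a \<in> carrier (alg K n)" and x: "x \<in> carrier E"
  have aK: "a \<sigma> \<in> carrier K" if "\<sigma> \<in> perms n" for \<sigma> using a that by (auto simp: alg_simps(1))
  \<comment> \<open>Partial sums are the truncations of \<open>a\<close> to \<open>S\<close>; the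
    full sum then returns \<open>a\<close>.\<close>
  have fin: "(\<Oplus>\<^bsub>alg K n\<^esub>\<sigma>\<in>S. single K n \<sigma> (a \<sigma>)) = (\<lambda>\<sigma>\<in>perms n. if \<sigma> \<in> S then a \<sigma> else \<zero>\<^bsub>K\<^esub>)"
    if "finite S" "S \<subseteq> perms n" for S
    using that
  proof (induction S)
    case empty
    then show ?case by (auto simp: alg_simps)
  next
    case (insert \<sigma> S)
    have "(\<Oplus>\<^bsub>alg K n\<^esub>\<sigma>\<in>insert \<sigma> S. single K n \<sigma> (a \<sigma>)) =
        single K n \<sigma> (a \<sigma>) \<oplus>\<^bsub>alg K n\<^esub> (\<Oplus>\<^bsub>alg K n\<^esub>\<sigma>\<in>S. single K n \<sigma> (a \<sigma>))"
      using insert by (intro E.R.finsum_insert) (auto intro!: sc aK)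
    also have "\<dots> = single K n \<sigma> (a \<sigma>) \<oplus>\<^bsub>alg K n\<^esub> (\<lambda>\<sigma>\<in>perms n. if \<sigma> \<in> S then a \<sigma> else \<zero>\<^bsub>K\<^esub>)"
      by (subst insert.IH) (use insert.prems in auto)
    also have "\<dots> = (\<lambda>\<tau>\<in>perms n. if \<tau> \<in> insert \<sigma> S then a \<tau> else \<zero>\<^bsub>K\<^esub>)"
      using insert.hyps insert.prems aK by (auto simp: alg_simps single_def intro!: restrict_ext)
    finally show ?case .
  qed
  have "(\<Oplus>\<^bsub>alg K n\<^esub>\<sigma>\<in>perms n. single K n \<sigma> (a \<sigma>)) = a"
    unfolding fin[OF finite_perms subset_refl]
    by (rule PiE_ext[of _ "perms n" "\<lambda>_. carrier K"]) (use a aK in \<open>auto simp: alg_simps(1)\<close>)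
  then have "a \<odot>\<^bsub>E\<^esub> x = (\<Oplus>\<^bsub>alg K n\<^esub>\<sigma>\<in>perms n. single K n \<sigma> (a \<sigma>)) \<odot>\<^bsub>E\<^esub> x" by simp
  also have "\<dots> = (\<Oplus>\<^bsub>E\<^esub>\<sigma>\<in>perms n. single K n \<sigma> (a \<sigma>) \<odot>\<^bsub>E\<^esub> x)"
    by (rule E.finsum_smult) (auto simp: sc aK x)
  also have "\<dots> = (\<Oplus>\<^bsub>E\<^esub>\<sigma>\<in>perms n. a \<sigma> \<odot>\<^bsub>?B\<^esub> ?\<rho> \<sigma> x)"
  proof (rule E.M.finsum_cong'[OF refl])
    fix \<sigma> assume \<sigma>: "\<sigma> \<in> perms n"
    then show "single K n \<sigma> (a \<sigma>) \<odot>\<^bsub>E\<^esub> x = a \<sigma> \<odot>\<^bsub>?B\<^esub> ?\<rho> \<sigma> x"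
      using smul[of "a \<sigma>" "\<one>\<^bsub>K\<^esub>" id \<sigma>] aK[OF \<sigma>] id x by (simp add: base_action_def E.smult_assoc[symmetric] sc)
  qed (use x aK in \<open>auto simp: base_action_def intro!: E.smult_closed sc\<close>)
  \<comment> \<open>The base module shares carrier, addition and zero with \<open>E\<close>, and a
    finite sum depends on nothing else.\<close>
  also have "\<dots> = P.perm_sum a x"
    by (simp add: P.perm_sum_def finsum_def finprod_def)
  finally show "a \<odot>\<^bsub>E\<^esub> x = P.perm_sum a x" .
qed

text \<open>Going to the group algebra and back restores the operations, but only on the carrier;
  the records need not be equal.\<close>

lemma (in perm_rep) base_alg_module:
  assumes x: "x \<in> carrier E"
  shows "a \<in> carrier K \<Longrightarrow> a \<odot>\<^bsub>base_module K n (alg_module n E \<rho>)\<^esub> x = a \<odot>\<^bsub>E\<^esub> x"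
    and "\<sigma> permutes {1..n} \<Longrightarrow> base_action K n (alg_module n E \<rho>) \<sigma> x = \<rho> \<sigma> x"
  using x by (simp_all add: base_module_def base_action_def perm_sum_single perms_iff permutes_id \<rho>_id
      \<rho>_closed smult_one)

lemma base_module_simps [simp]:
  "carrier (base_module K n E) = carrier E" "\<zero>\<^bsub>base_module K n E\<^esub> = \<zero>\<^bsub>E\<^esub>" "add (base_module K n E) = add E"
  by (auto simp: base_module_def)

lemma submodule_alg_iff:
  assumes K: "ring K" and E: "left_module (alg K n) E"
  shows "submodule H (alg K n) E \<longleftrightarrow> perm_sub K n (base_module K n E) (base_action K n E) H"
proof -
  interpret E: left_module "alg K n" E by fact
  interpret K: ring K by fact
  interpret P: perm_rep K n "base_module K n E" "base_action K n E" by (rule module_over_alg[OF K E])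
  have sc: "single K n \<sigma> a \<in> carrier (alg K n)" if "a \<in> carrier K" for \<sigma> a
    using that by (auto simp: alg_simps single_def)
  show ?thesis
  proof
    assume H: "submodule H (alg K n) E"
    note h = E.submoduleD[OF H]
    have "submodule H K (base_module K n E)"
      by (rule P.submoduleI) (use h sc in \<open>auto simp: base_module_def\<close>)
    then show "perm_sub K n (base_module K n E) (base_action K n E) H"
      using h(5) sc by (simp add: perm_sub_def base_action_def)
  next
    assume H: "perm_sub K n (base_module K n E) (base_action K n E) H"
    then have sub: "submodule H K (base_module K n E)" by (simp add: perm_sub_def)
    note h = P.submoduleD[OF sub]
    show "submodule H (alg K n) E"
    proof (rule E.submoduleI)
      fix a x assume a: "a \<in> carrier (alg K n)" and x: "x \<in> H"
      have "P.perm_sum a x \<in> H"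
        unfolding P.perm_sum_def
        using a x H by (intro P.finsum_submodule[OF sub] finite_perms h(5)) (auto simp: alg_simps(1) perm_sub_def perms_iff[symmetric])
      then show "a \<odot>\<^bsub>E\<^esub> x \<in> H" using module_over_alg(2)[OF K E a, of x] h(3)[OF x] by simp
    qed (use h in auto)
  qed
qed

lemma simple_alg_iff:
  assumes K: "ring K" and E: "left_module (alg K n) E"
  shows "simple_module (alg K n) E \<longleftrightarrow> simple_perm_rep K n (base_module K n E) (base_action K n E)"
  using module_over_alg(1)[OF K E] E
  by (simp add: simple_module_def simple_perm_rep_def submodule_alg_iff[OF K E])

text \<open>Since scalars of the group algebra act by finite sums over permutations, linearity over
  it is linearity over \<open>K\<close> together with equivariance.\<close>

lemma lin_maps_alg:
  assumes K: "ring K" and E: "left_module (alg K n) E" and E': "left_module (alg K n) E'"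
  shows "lin_maps (alg K n) E E' =
    perm_maps K n (base_module K n E) (base_action K n E) (base_module K n E') (base_action K n E')"
proof -
  interpret K: ring K by fact
  interpret P: perm_rep K n "base_module K n E" "base_action K n E" by (rule module_over_alg[OF K E])
  interpret P': perm_rep K n "base_module K n E'" "base_action K n E'" by (rule module_over_alg[OF K E'])
  interpret E: left_module "alg K n" E by fact
  have sc: "single K n \<sigma> a \<in> carrier (alg K n)" if "a \<in> carrier K" for \<sigma> a
    using that by (auto simp: alg_simps single_def)
  show ?thesis
  proof (intro equalityI subsetI)
    fix h assume "h \<in> lin_maps (alg K n) E E'"
    then show "h \<in> perm_maps K n (base_module K n E) (base_action K n E) (base_module K n E') (base_action K n E')"
      using sc unfolding perm_maps_def
      by (auto intro!: lin_mapsI simp: base_module_def base_action_def lin_mapsD)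
  next
    fix h assume h: "h \<in> perm_maps K n (base_module K n E) (base_action K n E) (base_module K n E') (base_action K n E')"
    then interpret h: lin_map K "base_module K n E" "base_module K n E'" h
      by (simp add: lin_map_iff perm_maps_def P.left_module_axioms P'.left_module_axioms)
    have hp: "h (base_action K n E \<sigma> x) = base_action K n E' \<sigma> (h x)" if "\<sigma> \<in> perms n" "x \<in> carrier E" for \<sigma> x
      using h that by (simp add: perm_maps_def perms_iff)
    show "h \<in> lin_maps (alg K n) E E'"
    proof (rule lin_mapsI)
      fix a x assume a: "a \<in> carrier (alg K n)" and x: "x \<in> carrier E"
      have a': "a \<in> perms n \<rightarrow>\<^sub>E carrier K" using a by (simp add: alg_simps(1))
      have hx: "h x \<in> carrier E'" using h.closed[of x] x by simp
      have "h (a \<odot>\<^bsub>E\<^esub> x) = h (P.perm_sum a x)" using module_over_alg(2)[OF K E a x] by simp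
      also have "\<dots> = (\<Oplus>\<^bsub>base_module K n E'\<^esub>\<sigma>\<in>perms n. h (a \<sigma> \<odot>\<^bsub>base_module K n E\<^esub> base_action K n E \<sigma> x))"
        unfolding P.perm_sum_def using P.perm_term_closed[OF a'] x by (intro h.finsum) auto
      also have "\<dots> = P'.perm_sum a (h x)"
        unfolding P'.perm_sum_def
      proof (rule P'.M.finsum_cong'[OF refl])
        fix \<sigma> assume \<sigma>: "\<sigma> \<in> perms n"
        then have "a \<sigma> \<in> carrier K" "base_action K n E \<sigma> x \<in> carrier E"
          using a' P.\<rho>_closed[of \<sigma> x] x by (auto simp: perms_iff)
        then show "h (a \<sigma> \<odot>\<^bsub>base_module K n E\<^esub> base_action K n E \<sigma> x) = a \<sigma> \<odot>\<^bsub>base_module K n E'\<^esub> base_action K n E' \<sigma> (h x)"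
          using h.smult hp[OF \<sigma> x] by simp
      qed (use P'.perm_term_closed[OF a'] hx in auto)
      also have "\<dots> = a \<odot>\<^bsub>E'\<^esub> h x" using module_over_alg(2)[OF K E' a hx] by simp
      finally show "h (a \<odot>\<^bsub>E\<^esub> x) = a \<odot>\<^bsub>E'\<^esub> h x" .
    qed (use h.closed h.ext h.add in auto)
  qed
qed

section \<open>Colimits of FI-modules\<close>

lemma FI_simps [simp]:
  "X \<in> Ob FI \<longleftrightarrow> finite X" "f \<in> Hom FI X Y \<longleftrightarrow> f \<in> X \<rightarrow>\<^sub>E Y \<and> inj_on f X"
  "Idn FI X = (\<lambda>x\<in>X. x)" "Comp FI X Y Z g f = compose X g f"
  by (auto simp: FI_def)

lemma FI_moduleI:
  assumes mod: "\<And>X. finite X \<Longrightarrow> left_module K (FOb M X)"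
    and lin: "\<And>X Y f. finite X \<Longrightarrow> finite Y \<Longrightarrow> f \<in> Hom FI X Y \<Longrightarrow> FMap M X Y f \<in> lin_maps K (FOb M X) (FOb M Y)"
    and id: "\<And>X x. finite X \<Longrightarrow> x \<in> carrier (FOb M X) \<Longrightarrow> FMap M X X (\<lambda>x\<in>X. x) x = x"
    and comp: "\<And>X Y Z f g x. finite X \<Longrightarrow> finite Y \<Longrightarrow> finite Z \<Longrightarrow> f \<in> Hom FI X Y \<Longrightarrow> g \<in> Hom FI Y Z \<Longrightarrow>
      x \<in> carrier (FOb M X) \<Longrightarrow> FMap M X Z (compose X g f) x = FMap M Y Z g (FMap M X Y f x)"
  shows "FI_module K M"
  unfolding FI_module_def is_functor_def
proof (intro conjI ballI)
  fix X assume "X \<in> Ob FI"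
  then have X: "finite X" by simp
  show "FOb M X \<in> Ob (LMod K)" using mod[OF X] by simp
  have "(\<lambda>x\<in>X. x) \<in> Hom FI X X" by (auto simp: inj_on_def)
  from lin_maps_eqI[OF lin[OF X X this] lin_maps_id[OF mod[OF X]]]
  show "FMap M X X (Idn FI X) = Idn (LMod K) (FOb M X)" using id[OF X] by simp
  fix Y f assume "Y \<in> Ob FI" and f: "f \<in> Hom FI X Y"
  then have Y: "finite Y" by simp
  show "FMap M X Y f \<in> Hom (LMod K) (FOb M X) (FOb M Y)" using lin[OF X Y f] by simp
  fix Z g assume "Z \<in> Ob FI" and g: "g \<in> Hom FI Y Z"
  then have Z: "finite Z" by simp
  have "compose X g f \<in> Hom FI X Z" using f g by (auto simp: compose_def inj_on_def PiE_iff)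
  from lin_maps_eqI[OF lin[OF X Z this] lin_maps_compose[OF mod[OF X] lin[OF X Y f] lin[OF Y Z g]]]
  show "FMap M X Z (Comp FI X Y Z g f) = Comp (LMod K) (FOb M X) (FOb M Y) (FOb M Z) (FMap M Y Z g) (FMap M X Y f)"
    using comp[OF X Y Z f g] by (simp add: compose_eq)
qed

locale fi =
  fixes K :: "('k, 'x) ring_scheme" and M :: "('k, 'v) fi_mod"
  assumes FI: "FI_module K M"
begin

abbreviation "C X \<equiv> carrier (FOb M X)"
abbreviation "inc X Y \<equiv> FMap M X Y (\<lambda>x\<in>X. x)"

lemma mod: "finite X \<Longrightarrow> left_module K (FOb M X)"
  using FI by (auto simp: FI_module_def is_functor_def)

lemma map_lin: "finite X \<Longrightarrow> finite Y \<Longrightarrow> f \<in> Hom FI X Y \<Longrightarrow> FMap M X Y f \<in> lin_maps K (FOb M X) (FOb M Y)"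
  using FI unfolding FI_module_def is_functor_def by simp

lemma lin: "finite X \<Longrightarrow> finite Y \<Longrightarrow> f \<in> Hom FI X Y \<Longrightarrow> lin_map K (FOb M X) (FOb M Y) (FMap M X Y f)"
  using mod map_lin by (simp add: lin_map_iff)

lemmas map_closed = lin_mapsD(1)[OF map_lin]

lemma map_comp:
  assumes "finite X" "finite Y" "finite Z" "f \<in> Hom FI X Y" "g \<in> Hom FI Y Z" "x \<in> C X"
  shows "FMap M X Z (compose X g f) x = FMap M Y Z g (FMap M X Y f x)"
proof -
  have "FMap M X Z (compose X g f) = compose (C X) (FMap M Y Z g) (FMap M X Y f)"
    using FI assms(1-5) unfolding FI_module_def is_functor_def by simp
  then show ?thesis using assms(6) by (simp add: compose_eq)
qed

lemma inc_id: "finite X \<Longrightarrow> x \<in> C X \<Longrightarrow> inc X X x = x"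
  using FI unfolding FI_module_def is_functor_def by simp

lemma inc_hom: "X \<subseteq> Y \<Longrightarrow> (\<lambda>x\<in>X. x) \<in> Hom FI X Y"
  by auto

lemma inc_closed: "X \<subseteq> Y \<Longrightarrow> finite Y \<Longrightarrow> x \<in> C X \<Longrightarrow> inc X Y x \<in> C Y"
  using map_closed[OF _ _ inc_hom, of X Y x] finite_subset[of X Y] by simp

lemma inc_inc:
  assumes "X \<subseteq> Y" "Y \<subseteq> Z" "finite Z" "x \<in> C X" shows "inc Y Z (inc X Y x) = inc X Z x"
proof -
  have f: "finite X" "finite Y" using assms finite_subset[of X Y] finite_subset[of Y Z] by simp_all
  have "compose X (\<lambda>x\<in>Y. x) (\<lambda>x\<in>X. x) = (\<lambda>x\<in>X. x)" using assms(1) by (auto simp: compose_def restrict_def fun_eq_iff)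
  then show ?thesis using map_comp[OF f assms(3) inc_hom[OF assms(1)] inc_hom[OF assms(2)] assms(4)] by simp
qed

lemma inc_lin: "X \<subseteq> Y \<Longrightarrow> finite Y \<Longrightarrow> lin_map K (FOb M X) (FOb M Y) (inc X Y)"
  using lin[OF _ _ inc_hom, of X Y] finite_subset[of X Y] by simp

lemma inc_map:
  assumes "finite X" "finite Y" "finite Z" "f \<in> Hom FI X Y" "Y \<subseteq> Z" "x \<in> C X"
  shows "inc Y Z (FMap M X Y f x) = FMap M X Z f x"
proof -
  have "compose X (\<lambda>x\<in>Y. x) f = f" using assms by (auto simp: compose_def fun_eq_iff extensional_def PiE_def)
  then show ?thesis using map_comp[OF assms(1-4) inc_hom[OF assms(5)] assms(6)] by simp
qed

lemma map_inc:
  assumes "finite Y" "finite Z" "g \<in> Hom FI Y Z" "X \<subseteq> Y" "x \<in> C X"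
  shows "FMap M Y Z g (inc X Y x) = FMap M X Z (restrict g X) x"
proof -
  have f: "finite X" using finite_subset[OF assms(4,1)] .
  have "compose X g (\<lambda>x\<in>X. x) = restrict g X" by (auto simp: compose_def)
  then show ?thesis using map_comp[OF f assms(1,2) inc_hom[OF assms(4)] assms(3,5)] by simp
qed

text \<open>Equality in the colimit over the finite sets of natural numbers, ordered by
  inclusion.\<close>

definition germ :: "nat set \<Rightarrow> 'v \<Rightarrow> nat set \<Rightarrow> 'v \<Rightarrow> bool" where
  "germ X x Y y \<longleftrightarrow> (\<exists>Z. finite Z \<and> X \<subseteq> Z \<and> Y \<subseteq> Z \<and> inc X Z x = inc Y Z y)"

lemma germ_up:
  assumes "inc X Z x = inc Y Z y" "X \<subseteq> Z" "Y \<subseteq> Z" "Z \<subseteq> Z'" "finite Z'" "x \<in> C X" "y \<in> C Y"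
  shows "inc X Z' x = inc Y Z' y"
  using inc_inc[of X Z Z' x] inc_inc[of Y Z Z' y] assms by simp

lemma germ_sym: "germ X x Y y \<Longrightarrow> germ Y y X x" unfolding germ_def by metis

lemma germ_trans:
  assumes "germ X x Y y" "germ Y y Z z" "x \<in> C X" "y \<in> C Y" "z \<in> C Z" shows "germ X x Z z"
proof -
  obtain P where P: "finite P" "X \<subseteq> P" "Y \<subseteq> P" "inc X P x = inc Y P y" using assms(1) unfolding germ_def by blast
  obtain Q where Q: "finite Q" "Y \<subseteq> Q" "Z \<subseteq> Q" "inc Y Q y = inc Z Q z" using assms(2) unfolding germ_def by blast
  have "inc X (P \<union> Q) x = inc Z (P \<union> Q) z"
    using germ_up[OF P(4,2,3), of "P \<union> Q"] germ_up[OF Q(4,2,3), of "P \<union> Q"] P Q assms by simp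
  then show ?thesis unfolding germ_def using P Q by (intro exI[of _ "P \<union> Q"]) auto
qed

lemma germ_inc: "X \<subseteq> Y \<Longrightarrow> finite Y \<Longrightarrow> x \<in> C X \<Longrightarrow> germ X x Y (inc X Y x)"
  unfolding germ_def using inc_inc[of X Y Y x] by (intro exI[of _ Y]) auto

end

text \<open>
  \<open>V\<close> is the colimit of \<open>M\<close> over the finite sets of natural numbers and their inclusions, and \<open>\<iota>\<close>
  the colimit cocone.  The elements of \<open>V\<close> may live in another universe.
\<close>

locale fi_colim = fi K M + inj_rep K V act
  for K :: "('k, 'x) ring_scheme" and M :: "('k, 'v) fi_mod" and V :: "('k, 'w) module" and act +
  fixes \<iota> :: "nat set \<Rightarrow> 'v \<Rightarrow> 'w"
  assumes \<iota>_closed: "finite X \<Longrightarrow> x \<in> C X \<Longrightarrow> \<iota> X x \<in> carrier V"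
    and \<iota>_add: "finite X \<Longrightarrow> x \<in> C X \<Longrightarrow> y \<in> C X \<Longrightarrow> \<iota> X (x \<oplus>\<^bsub>FOb M X\<^esub> y) = \<iota> X x \<oplus>\<^bsub>V\<^esub> \<iota> X y"
    and \<iota>_smult: "finite X \<Longrightarrow> a \<in> carrier K \<Longrightarrow> x \<in> C X \<Longrightarrow> \<iota> X (a \<odot>\<^bsub>FOb M X\<^esub> x) = a \<odot>\<^bsub>V\<^esub> \<iota> X x"
    and \<iota>_map: "finite X \<Longrightarrow> finite Y \<Longrightarrow> f \<in> Hom FI X Y \<Longrightarrow> inj g \<Longrightarrow> (\<And>x. x \<in> X \<Longrightarrow> g x = f x) \<Longrightarrow> u \<in> C X \<Longrightarrow>
        \<iota> Y (FMap M X Y f u) = act g (\<iota> X u)"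
    and \<iota>_kernel: "finite X \<Longrightarrow> x \<in> C X \<Longrightarrow> \<iota> X x = \<zero>\<^bsub>V\<^esub> \<Longrightarrow>
        \<exists>Y f. finite Y \<and> f \<in> Hom FI X Y \<and> FMap M X Y f x = \<zero>\<^bsub>FOb M Y\<^esub>"
    and \<iota>_surj: "v \<in> carrier V \<Longrightarrow> \<exists>X x. finite X \<and> x \<in> C X \<and> v = \<iota> X x"
begin

lemma \<iota>_inc: "X \<subseteq> Y \<Longrightarrow> finite Y \<Longrightarrow> x \<in> C X \<Longrightarrow> \<iota> Y (inc X Y x) = \<iota> X x"
  using \<iota>_map[of X Y "\<lambda>x\<in>X. x" id x] inc_hom[of X Y] finite_subset[of X Y] \<iota>_closed act_id by simp

lemma \<iota>_zero: "finite X \<Longrightarrow> \<iota> X \<zero>\<^bsub>FOb M X\<^esub> = \<zero>\<^bsub>V\<^esub>"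
proof -
  assume X: "finite X"
  interpret X: left_module K "FOb M X" by (rule mod[OF X])
  show ?thesis
    using \<iota>_smult[OF X R.zero_closed X.M.zero_closed] \<iota>_closed[OF X X.M.zero_closed]
    by (simp add: smult_l_null X.smult_l_null)
qed

lemma \<iota>_diff: "finite X \<Longrightarrow> x \<in> C X \<Longrightarrow> y \<in> C X \<Longrightarrow> \<iota> X (x \<ominus>\<^bsub>FOb M X\<^esub> y) = \<iota> X x \<ominus>\<^bsub>V\<^esub> \<iota> X y"
proof -
  assume *: "finite X" "x \<in> C X" "y \<in> C X"
  interpret X: left_module K "FOb M X" by (rule mod[OF *(1)])
  have "\<iota> X (\<ominus>\<^bsub>FOb M X\<^esub> y) = \<ominus>\<^bsub>V\<^esub> \<iota> X y"
    using \<iota>_smult[OF *(1), of "\<ominus>\<^bsub>K\<^esub> \<one>\<^bsub>K\<^esub>" y] * \<iota>_closed by (simp add: X.smult_minus_one smult_minus_one)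
  then show ?thesis using * by (simp add: a_minus_def \<iota>_add)
qed

text \<open>An arbitrary FI-morphism may do the killing, not just an inclusion: extended to all
  natural numbers it acts injectively on the colimit.\<close>

lemma \<iota>_zero_iff:
  assumes "finite X" "x \<in> C X"
  shows "\<iota> X x = \<zero>\<^bsub>V\<^esub> \<longleftrightarrow> (\<exists>Y f. finite Y \<and> f \<in> Hom FI X Y \<and> FMap M X Y f x = \<zero>\<^bsub>FOb M Y\<^esub>)"
proof
  assume "\<exists>Y f. finite Y \<and> f \<in> Hom FI X Y \<and> FMap M X Y f x = \<zero>\<^bsub>FOb M Y\<^esub>"
  then obtain Y f where Y: "finite Y" "f \<in> Hom FI X Y" "FMap M X Y f x = \<zero>\<^bsub>FOb M Y\<^esub>" by blast
  obtain g where g: "inj g" "\<And>x. x \<in> X \<Longrightarrow> g x = f x" using inj_extend[OF assms(1), of f] Y(2) by auto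
  have "act g (\<iota> X x) = \<zero>\<^bsub>V\<^esub>" using \<iota>_map[OF assms(1) Y(1,2) g assms(2)] Y(3) \<iota>_zero[OF Y(1)] by simp
  then show "\<iota> X x = \<zero>\<^bsub>V\<^esub>" using act_eq_zero_iff[OF g(1)] \<iota>_closed assms by simp
qed (rule \<iota>_kernel[OF assms])

lemma \<iota>_eq_ex:
  assumes "finite X" "x \<in> C X" "y \<in> C X" "\<iota> X x = \<iota> X y"
  shows "\<exists>Y f. finite Y \<and> f \<in> Hom FI X Y \<and> FMap M X Y f x = FMap M X Y f y"
proof -
  interpret X: left_module K "FOb M X" by (rule mod[OF assms(1)])
  have "\<iota> X (x \<ominus>\<^bsub>FOb M X\<^esub> y) = \<zero>\<^bsub>V\<^esub>" using assms \<iota>_closed by (simp add: \<iota>_diff M.diff_eq_zero_iff)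
  then obtain Y f where Y: "finite Y" "f \<in> Hom FI X Y" "FMap M X Y f (x \<ominus>\<^bsub>FOb M X\<^esub> y) = \<zero>\<^bsub>FOb M Y\<^esub>"
    using \<iota>_kernel[OF assms(1), of "x \<ominus>\<^bsub>FOb M X\<^esub> y"] assms by auto
  interpret f: lin_map K "FOb M X" "FOb M Y" "FMap M X Y f" by (rule lin[OF assms(1) Y(1,2)])
  have "FMap M X Y f x = FMap M X Y f y"
    using Y(3) assms f.closed by (simp add: f.diff f.N.M.diff_eq_zero_iff)
  then show ?thesis using Y by blast
qed

lemma \<iota>_up:
  assumes "v \<in> carrier V" "finite Z"
  shows "\<exists>X x. finite X \<and> Z \<subseteq> X \<and> x \<in> C X \<and> v = \<iota> X x"
proof -
  obtain X x where "finite X" "x \<in> C X" "v = \<iota> X x" using \<iota>_surj[OF assms(1)] by blast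
  then show ?thesis
    using assms(2) \<iota>_inc[of X "X \<union> Z" x] inc_closed[of X "X \<union> Z" x]
    by (intro exI[of _ "X \<union> Z"] exI[of _ "inc X (X \<union> Z) x"]) auto
qed

end

text \<open>The classes of germs would be sets. To stay in \<open>'v\<close>, each class is
  represented by a chosen germ over an initial segment, which is a pair of a number and an element,
  and pairs are coded by an injection into \<open>'v\<close>.\<close>

lemma (in fi) colim_ex:
  assumes inf: "infinite (UNIV :: 'v set)" and K: "ring K"
  shows "\<exists>(V :: ('k, 'v) module) act \<iota>. fi_colim K M V act \<iota>"
proof -
  obtain p :: "nat \<times> 'v \<Rightarrow> 'v" where p: "inj p" using nat_times_inj[OF inf] .
  \<comment> \<open>Initial segments are cofinal among the finite sets, so this set of candidates is
    never empty; it depends only on the class of the germ.\<close>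
  define R where "R X x = {(N, y). y \<in> C {..<N} \<and> germ {..<N} y X x}" for X x
  define q where "q X x = p (SOME z. z \<in> R X x)" for X x
  have R_ne: "R X x \<noteq> {}" if X: "finite X" "x \<in> C X" for X x
  proof -
    obtain N where N: "X \<subseteq> {..<N}" using finite_nat_set_iff_bounded[of X] X(1) by auto
    have "(N, inc X {..<N} x) \<in> R X x"
      using inc_closed[OF N _ X(2)] germ_sym[OF germ_inc[OF N _ X(2)]] by (simp add: R_def)
    then show ?thesis by blast
  qed
  have q_eq: "q X x = q Y y \<longleftrightarrow> germ X x Y y" if XY: "finite X" "x \<in> C X" "finite Y" "y \<in> C Y" for X x Y y
  proof
    assume "germ X x Y y"
    then have "germ {..<N} z X x \<longleftrightarrow> germ {..<N} z Y y" if "z \<in> C {..<N}" for N z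
      using XY that germ_trans[of "{..<N}" z X x Y y] germ_trans[of "{..<N}" z Y y X x] germ_sym[of X x Y y] by blast
    then have "R X x = R Y y" by (auto simp: R_def)
    then show "q X x = q Y y" by (simp add: q_def)
  next
    assume "q X x = q Y y"
    then have "(SOME z. z \<in> R X x) = (SOME z. z \<in> R Y y)" using p by (auto simp: q_def dest: injD)
    moreover have "(SOME z. z \<in> R X x) \<in> R X x" "(SOME z. z \<in> R Y y) \<in> R Y y"
      using R_ne XY some_in_eq by blast+
    ultimately obtain N z where "(N, z) \<in> R X x" "(N, z) \<in> R Y y" by (metis surj_pair)
    then have "z \<in> C {..<N}" "germ {..<N} z X x" "germ {..<N} z Y y" by (simp_all add: R_def)
    then show "germ X x Y y" using germ_trans[OF germ_sym] XY by blast
  qed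
  have q_inc: "q Y (inc X Y x) = q X x" if "X \<subseteq> Y" "finite Y" "x \<in> C X" for X Y x
    using that q_eq[of Y "inc X Y x" X x] finite_subset[of X Y] inc_closed[of X Y x] germ_sym[OF germ_inc[of X Y x]] by simp
  have q_up: "\<exists>Z. finite Z \<and> X \<subseteq> Z \<and> Y \<subseteq> Z \<and> inc X Z x = inc Y Z y" if "q X x = q Y y" "finite X" "x \<in> C X" "finite Y" "y \<in> C Y" for X x Y y
    using that q_eq[of X x Y y] by (auto simp: germ_def)
  define A where "A = {q X x | X x. finite X \<and> x \<in> C X}"
  have A_up: "\<exists>X x. finite X \<and> Z \<subseteq> X \<and> x \<in> C X \<and> v = q X x" if v: "v \<in> A" and Z: "finite Z" for v Z
  proof -
    obtain X x where "finite X" "x \<in> C X" "v = q X x" using v by (auto simp: A_def)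
    then show ?thesis using Z q_inc[of X "X \<union> Z" x] inc_closed[of X "X \<union> Z" x]
      by (intro exI[of _ "X \<union> Z"] exI[of _ "inc X (X \<union> Z) x"]) auto
  qed
  have A_common: "\<exists>X x y z. finite X \<and> x \<in> C X \<and> y \<in> C X \<and> z \<in> C X \<and> u = q X x \<and> v = q X y \<and> w = q X z"
    if uvw: "u \<in> A" "v \<in> A" "w \<in> A" for u v w
  proof -
    obtain X x where X: "finite X" "x \<in> C X" "u = q X x" using A_up[OF uvw(1), of "{}"] by auto
    obtain Y y where Y: "finite Y" "X \<subseteq> Y" "y \<in> C Y" "v = q Y y" using A_up[OF uvw(2) X(1)] by auto
    obtain Z z where Z: "finite Z" "Y \<subseteq> Z" "z \<in> C Z" "w = q Z z" using A_up[OF uvw(3) Y(1)] by auto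
    have XZ: "X \<subseteq> Z" using Y Z by blast
    show ?thesis
      using X Y Z XZ q_inc[OF XZ Z(1) X(2)] q_inc[OF Z(2,1) Y(3)] inc_closed[OF XZ Z(1) X(2)] inc_closed[OF Z(2,1) Y(3)]
      by (intro exI[of _ Z] exI[of _ "inc X Z x"] exI[of _ "inc Y Z y"] exI[of _ z]) simp
  qed
  have q_in: "q X x \<in> A" if "finite X" "x \<in> C X" for X x using that by (auto simp: A_def)
  \<comment> \<open>The operations are defined through some choice of representatives on a common
    level; the facts \<open>ad\<close>, \<open>sm\<close> and \<open>ac\<close> below show that
    every choice gives the same result.\<close>
  define ad where "ad u v = (SOME w. \<exists>Z x y. finite Z \<and> x \<in> C Z \<and> y \<in> C Z \<and> u = q Z x \<and> v = q Z y \<and> w = q Z (x \<oplus>\<^bsub>FOb M Z\<^esub> y))" for u v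
  define sm where "sm a u = (SOME w. \<exists>Z x. finite Z \<and> x \<in> C Z \<and> u = q Z x \<and> w = q Z (a \<odot>\<^bsub>FOb M Z\<^esub> x))" for a u
  define ac where "ac g = (\<lambda>u\<in>A. SOME w. \<exists>Z x. finite Z \<and> x \<in> C Z \<and> u = q Z x \<and> w = q (g ` Z) (FMap M Z (g ` Z) (restrict g Z) x))" for g
  have ad: "ad (q X x) (q X y) = q X (x \<oplus>\<^bsub>FOb M X\<^esub> y)" if X: "finite X" "x \<in> C X" "y \<in> C X" for X x y
    unfolding ad_def
  proof (rule some_equality)
    show "\<exists>Z x' y'. finite Z \<and> x' \<in> C Z \<and> y' \<in> C Z \<and> q X x = q Z x' \<and> q X y = q Z y' \<and> q X (x \<oplus>\<^bsub>FOb M X\<^esub> y) = q Z (x' \<oplus>\<^bsub>FOb M Z\<^esub> y')"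
      using X by blast
    fix w assume "\<exists>Z x' y'. finite Z \<and> x' \<in> C Z \<and> y' \<in> C Z \<and> q X x = q Z x' \<and> q X y = q Z y' \<and> w = q Z (x' \<oplus>\<^bsub>FOb M Z\<^esub> y')"
    then obtain Z x' y' where Z: "finite Z" "x' \<in> C Z" "y' \<in> C Z" "q X x = q Z x'" "q X y = q Z y'" "w = q Z (x' \<oplus>\<^bsub>FOb M Z\<^esub> y')" by blast
    obtain P where P: "finite P" "X \<subseteq> P" "Z \<subseteq> P" "inc X P x = inc Z P x'" using q_up[OF Z(4)] X Z by blast
    obtain Q where Q: "finite Q" "X \<subseteq> Q" "Z \<subseteq> Q" "inc X Q y = inc Z Q y'" using q_up[OF Z(5)] X Z by blast
    let ?T = "P \<union> Q"
    have T: "finite ?T" "X \<subseteq> ?T" "Z \<subseteq> ?T" using P Q by auto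
    have e: "inc X ?T x = inc Z ?T x'" "inc X ?T y = inc Z ?T y'"
      using germ_up[OF P(4,2,3), of ?T] germ_up[OF Q(4,2,3), of ?T] P Q X Z by simp_all
    interpret iX: lin_map K "FOb M X" "FOb M ?T" "inc X ?T" by (rule inc_lin[OF T(2,1)])
    interpret iZ: lin_map K "FOb M Z" "FOb M ?T" "inc Z ?T" by (rule inc_lin[OF T(3,1)])
    have "q ?T (inc X ?T (x \<oplus>\<^bsub>FOb M X\<^esub> y)) = q ?T (inc Z ?T (x' \<oplus>\<^bsub>FOb M Z\<^esub> y'))"
      using e X Z by (simp add: iX.add iZ.add)
    then show "w = q X (x \<oplus>\<^bsub>FOb M X\<^esub> y)"
      using q_inc[OF T(2,1)] q_inc[OF T(3,1)] X Z by simp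
  qed
  have sm: "sm a (q X x) = q X (a \<odot>\<^bsub>FOb M X\<^esub> x)" if a: "a \<in> carrier K" and X: "finite X" "x \<in> C X" for a X x
    unfolding sm_def
  proof (rule some_equality)
    show "\<exists>Z x'. finite Z \<and> x' \<in> C Z \<and> q X x = q Z x' \<and> q X (a \<odot>\<^bsub>FOb M X\<^esub> x) = q Z (a \<odot>\<^bsub>FOb M Z\<^esub> x')" using X by blast
    fix w assume "\<exists>Z x'. finite Z \<and> x' \<in> C Z \<and> q X x = q Z x' \<and> w = q Z (a \<odot>\<^bsub>FOb M Z\<^esub> x')"
    then obtain Z x' where Z: "finite Z" "x' \<in> C Z" "q X x = q Z x'" "w = q Z (a \<odot>\<^bsub>FOb M Z\<^esub> x')" by blast
    obtain T where T: "finite T" "X \<subseteq> T" "Z \<subseteq> T" "inc X T x = inc Z T x'" using q_up[OF Z(3)] X Z by blast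
    interpret iX: lin_map K "FOb M X" "FOb M T" "inc X T" by (rule inc_lin[OF T(2,1)])
    interpret iZ: lin_map K "FOb M Z" "FOb M T" "inc Z T" by (rule inc_lin[OF T(3,1)])
    have "q T (inc X T (a \<odot>\<^bsub>FOb M X\<^esub> x)) = q T (inc Z T (a \<odot>\<^bsub>FOb M Z\<^esub> x'))"
      using T a X Z by (simp add: iX.smult iZ.smult)
    then show "w = q X (a \<odot>\<^bsub>FOb M X\<^esub> x)"
      using q_inc[OF T(2,1)] q_inc[OF T(3,1)] a X Z by (simp add: iX.M.smult_closed iZ.M.smult_closed)
  qed
  have rh: "restrict g X \<in> Hom FI X Y" if "inj g" "g ` X \<subseteq> Y" for g :: "nat \<Rightarrow> nat" and X Y
    using that by (auto simp: inj_on_def dest: injD)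
  have ac: "ac g (q X x) = q (g ` X) (FMap M X (g ` X) (restrict g X) x)" if g: "inj g" and X: "finite X" "x \<in> C X" for g X x
  proof -
    have "(SOME w. \<exists>Z x'. finite Z \<and> x' \<in> C Z \<and> q X x = q Z x' \<and> w = q (g ` Z) (FMap M Z (g ` Z) (restrict g Z) x')) =
        q (g ` X) (FMap M X (g ` X) (restrict g X) x)"
    proof (rule some_equality)
      show "\<exists>Z x'. finite Z \<and> x' \<in> C Z \<and> q X x = q Z x' \<and>
          q (g ` X) (FMap M X (g ` X) (restrict g X) x) = q (g ` Z) (FMap M Z (g ` Z) (restrict g Z) x')" using X by blast
      fix w assume "\<exists>Z x'. finite Z \<and> x' \<in> C Z \<and> q X x = q Z x' \<and> w = q (g ` Z) (FMap M Z (g ` Z) (restrict g Z) x')"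
      then obtain Z x' where Z: "finite Z" "x' \<in> C Z" "q X x = q Z x'" "w = q (g ` Z) (FMap M Z (g ` Z) (restrict g Z) x')" by blast
      obtain T where T: "finite T" "X \<subseteq> T" "Z \<subseteq> T" "inc X T x = inc Z T x'" using q_up[OF Z(3)] X Z by blast
      \<comment> \<open>Enlarging \<open>Y\<close> to \<open>T\<close> before applying
        \<open>g\<close> does not change the class, so two representatives can be compared on the
        level \<open>T\<close> where they become equal.\<close>
      have key: "q (g ` T) (FMap M T (g ` T) (restrict g T) (inc Y T y)) = q (g ` Y) (FMap M Y (g ` Y) (restrict g Y) y)"
        if Y: "Y \<subseteq> T" "y \<in> C Y" for Y y
      proof -
        have fY: "finite Y" by (rule finite_subset[OF Y(1) T(1)])
        have r: "restrict (restrict g T) Y = restrict g Y" using Y(1) by (auto simp: restrict_def fun_eq_iff)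
        have sub: "g ` Y \<subseteq> g ` T" using Y(1) by blast
        have h1: "restrict g T \<in> Hom FI T (g ` T)" and h2: "restrict g Y \<in> Hom FI Y (g ` Y)" by (rule rh[OF g subset_refl])+
        have "FMap M T (g ` T) (restrict g T) (inc Y T y) = FMap M Y (g ` T) (restrict g Y) y"
          using map_inc[OF T(1) _ h1 Y] T(1) r by simp
        also have "\<dots> = inc (g ` Y) (g ` T) (FMap M Y (g ` Y) (restrict g Y) y)"
          using inc_map[OF fY _ _ h2 sub Y(2)] fY T(1) by simp
        finally show ?thesis using q_inc[OF sub] T(1) fY map_closed[OF fY _ h2 Y(2)] by simp
      qed
      show "w = q (g ` X) (FMap M X (g ` X) (restrict g X) x)"
        using key[OF T(2) X(2)] key[OF T(3) Z(2)] T(4) Z(4) by simp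
    qed
    then show ?thesis using q_in[OF X] by (simp add: ac_def)
  qed
  have ac_map: "q Y (FMap M X Y f u) = ac g (q X u)"
    if X: "finite X" "finite Y" "f \<in> Hom FI X Y" and g: "inj g" "\<And>x. x \<in> X \<Longrightarrow> g x = f x" and u: "u \<in> C X" for X Y f g u
  proof -
    have r: "restrict g X = f" using X(3) g(2) by (auto simp: restrict_def fun_eq_iff PiE_def extensional_def)
    have sub: "g ` X \<subseteq> Y" using X(3) g(2) by auto
    have h: "f \<in> Hom FI X (g ` X)" using rh[OF g(1) subset_refl, of X] r by simp
    show ?thesis
      using ac[OF g(1) X(1) u] r inc_map[OF X(1) _ X(2) h sub u] q_inc[OF sub X(2) map_closed[OF X(1) _ h u]] X(1) by simp
  qed
  define V :: "('k, 'v) module" where "V = \<lparr>carrier = A, mult = undefined, one = undefined, zero = q {} \<zero>\<^bsub>FOb M {}\<^esub>, add = ad, smult = sm\<rparr>"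
  have V [simp]: "carrier V = A" "\<zero>\<^bsub>V\<^esub> = q {} \<zero>\<^bsub>FOb M {}\<^esub>" "add V = ad" "smult V = sm" by (auto simp: V_def)
  have q0: "q X \<zero>\<^bsub>FOb M X\<^esub> = q {} \<zero>\<^bsub>FOb M {}\<^esub>" if X: "finite X" for X
  proof -
    interpret i: lin_map K "FOb M {}" "FOb M X" "inc {} X" by (rule inc_lin) (use X in auto)
    show ?thesis using q_inc[of "{}" X "\<zero>\<^bsub>FOb M {}\<^esub>"] X i.zero by simp
  qed
  have V_mod: "left_module K V"
  proof (rule left_moduleI[OF K])
    fix u v w assume u: "u \<in> carrier V" and v: "v \<in> carrier V" and w: "w \<in> carrier V"
    obtain X x y z where X: "finite X" "x \<in> C X" "y \<in> C X" "z \<in> C X" and e: "u = q X x" "v = q X y" "w = q X z"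
      using A_common[of u v w] u v w by auto
    interpret X: left_module K "FOb M X" by (rule mod[OF X(1)])
    show "u \<oplus>\<^bsub>V\<^esub> v \<oplus>\<^bsub>V\<^esub> w = u \<oplus>\<^bsub>V\<^esub> (v \<oplus>\<^bsub>V\<^esub> w)" using X by (simp add: e ad X.M.a_assoc)
  next
    fix u v assume u: "u \<in> carrier V" and v: "v \<in> carrier V"
    obtain X x y where X: "finite X" "x \<in> C X" "y \<in> C X" and e: "u = q X x" "v = q X y"
      using A_common[of u v v] u v by auto
    interpret X: left_module K "FOb M X" by (rule mod[OF X(1)])
    show "u \<oplus>\<^bsub>V\<^esub> v \<in> carrier V" "u \<oplus>\<^bsub>V\<^esub> v = v \<oplus>\<^bsub>V\<^esub> u" using X q_in by (simp_all add: e ad X.M.a_comm)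
    show "a \<odot>\<^bsub>V\<^esub> (u \<oplus>\<^bsub>V\<^esub> v) = a \<odot>\<^bsub>V\<^esub> u \<oplus>\<^bsub>V\<^esub> a \<odot>\<^bsub>V\<^esub> v" if "a \<in> carrier K" for a
      using X that by (simp add: e ad sm X.smult_closed X.smult_r_distr)
  next
    interpret E: left_module K "FOb M {}" by (rule mod) simp
    show "\<zero>\<^bsub>V\<^esub> \<in> carrier V" using q_in by simp
    fix u assume u: "u \<in> carrier V"
    then obtain X x where X: "finite X" "x \<in> C X" and e: "u = q X x" using A_up[of u "{}"] by auto
    interpret X: left_module K "FOb M X" by (rule mod[OF X(1)])
    show "\<zero>\<^bsub>V\<^esub> \<oplus>\<^bsub>V\<^esub> u = u" using X by (simp add: e q0[OF X(1), symmetric] ad)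
    show "\<exists>v\<in>carrier V. v \<oplus>\<^bsub>V\<^esub> u = \<zero>\<^bsub>V\<^esub>"
      using X q_in by (intro bexI[of _ "q X (\<ominus>\<^bsub>FOb M X\<^esub> x)"]) (simp_all add: e q0[OF X(1), symmetric] ad X.M.l_neg)
    show "\<one>\<^bsub>K\<^esub> \<odot>\<^bsub>V\<^esub> u = u" using X by (simp add: e sm X.smult_one)
    fix a assume a: "a \<in> carrier K"
    show "a \<odot>\<^bsub>V\<^esub> u \<in> carrier V" using X a q_in by (simp add: e sm X.smult_closed)
    fix b assume b: "b \<in> carrier K"
    show "(a \<oplus>\<^bsub>K\<^esub> b) \<odot>\<^bsub>V\<^esub> u = a \<odot>\<^bsub>V\<^esub> u \<oplus>\<^bsub>V\<^esub> b \<odot>\<^bsub>V\<^esub> u"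
      using X a b by (simp add: e sm ad X.smult_closed X.smult_l_distr)
    show "(a \<otimes>\<^bsub>K\<^esub> b) \<odot>\<^bsub>V\<^esub> u = a \<odot>\<^bsub>V\<^esub> (b \<odot>\<^bsub>V\<^esub> u)"
      using X a b by (simp add: e sm X.smult_closed X.smult_assoc)
  qed
  have V_rep: "inj_rep K V ac"
  proof (intro inj_rep.intro inj_rep_axioms.intro V_mod)
    fix g :: "nat \<Rightarrow> nat" assume g: "inj g"
    show "ac g \<in> lin_maps K V V"
    proof (rule lin_mapsI)
      show "ac g \<in> extensional (carrier V)" by (simp add: ac_def)
      fix u assume u: "u \<in> carrier V"
      then obtain X x where X: "finite X" "x \<in> C X" and e: "u = q X x" using A_up[of u "{}"] by auto
      interpret f: lin_map K "FOb M X" "FOb M (g ` X)" "FMap M X (g ` X) (restrict g X)"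
        by (rule lin) (use X rh[OF g subset_refl] in simp_all)
      show "ac g u \<in> carrier V" using X g q_in f.closed by (simp add: e ac)
      show "ac g (a \<odot>\<^bsub>V\<^esub> u) = a \<odot>\<^bsub>V\<^esub> ac g u" if "a \<in> carrier K" for a
        using X g that f.closed by (simp add: e ac sm f.M.smult_closed f.smult)
    next
      fix u v assume u: "u \<in> carrier V" and v: "v \<in> carrier V"
      obtain X x y where X: "finite X" "x \<in> C X" "y \<in> C X" and e: "u = q X x" "v = q X y"
        using A_common[of u v v] u v by auto
      interpret f: lin_map K "FOb M X" "FOb M (g ` X)" "FMap M X (g ` X) (restrict g X)"
        by (rule lin) (use X rh[OF g subset_refl] in simp_all)
      show "ac g (u \<oplus>\<^bsub>V\<^esub> v) = ac g u \<oplus>\<^bsub>V\<^esub> ac g v"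
        using X g f.closed by (simp add: e ac ad f.add)
    qed
  next
    fix u assume "u \<in> carrier V"
    then obtain X x where X: "finite X" "x \<in> C X" and e: "u = q X x" using A_up[of u "{}"] by auto
    have fin: "ac g u = q Y (FMap M X Y f x)" if "finite Y" "f \<in> Hom FI X Y" "inj g" "\<And>z. z \<in> X \<Longrightarrow> g z = f z" for Y f g
      using ac_map[OF X(1) that(1,2) that(3) that(4) X(2)] e by simp
    show "ac id u = u" using fin[of X "\<lambda>x\<in>X. x" id] X inc_hom[of X X] inc_id[OF X] e by simp
    show "\<exists>X. finite X \<and> (\<forall>g h. inj g \<longrightarrow> inj h \<longrightarrow> (\<forall>x\<in>X. g x = h x) \<longrightarrow> ac g u = ac h u)"
    proof (intro exI[of _ X] conjI allI impI X(1))
      fix g h :: "nat \<Rightarrow> nat" assume gh: "inj g" "inj h" "\<forall>x\<in>X. g x = h x"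
      have "restrict g X = restrict h X" "g ` X = h ` X" using gh(3) by (auto simp: restrict_def fun_eq_iff)
      then show "ac g u = ac h u" using ac[OF gh(1) X] ac[OF gh(2) X] e by simp
    qed
  next
    fix g h :: "nat \<Rightarrow> nat" and u assume g: "inj g" and h: "inj h" and "u \<in> carrier V"
    then obtain X x where X: "finite X" "x \<in> C X" and e: "u = q X x" using A_up[of u "{}"] by auto
    have h1: "restrict h X \<in> Hom FI X (h ` X)" and h2: "restrict g (h ` X) \<in> Hom FI (h ` X) (g ` h ` X)"
      using rh[OF h subset_refl] rh[OF g subset_refl] by blast+
    have r: "compose X (restrict g (h ` X)) (restrict h X) = restrict (g \<circ> h) X" by (auto simp: compose_def)
    have fx: "FMap M X (h ` X) (restrict h X) x \<in> C (h ` X)" using map_closed[OF X(1) _ h1 X(2)] X(1) by simp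
    show "ac (g \<circ> h) u = ac g (ac h u)"
      using ac[OF inj_compose[OF g h] X] ac[OF h X] ac[OF g _ fx] X(1) r
        map_comp[OF X(1) _ _ h1 h2 X(2)] e by (simp add: image_comp)
  qed
  have "fi_colim K M V ac q"
  proof (intro fi_colim.intro fi_colim_axioms.intro V_rep fi_axioms)
    show "\<exists>Y f. finite Y \<and> f \<in> Hom FI X Y \<and> FMap M X Y f x = \<zero>\<^bsub>FOb M Y\<^esub>"
      if X: "finite X" "x \<in> C X" and z: "q X x = \<zero>\<^bsub>V\<^esub>" for X x
    proof -
      interpret X: left_module K "FOb M X" by (rule mod[OF X(1)])
      have "q X x = q X \<zero>\<^bsub>FOb M X\<^esub>" using z q0[OF X(1)] by simp
      then obtain Z where Z: "finite Z" "X \<subseteq> Z" "inc X Z x = inc X Z \<zero>\<^bsub>FOb M X\<^esub>"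
        using q_up[of X x X "\<zero>\<^bsub>FOb M X\<^esub>"] X by auto
      interpret i: lin_map K "FOb M X" "FOb M Z" "inc X Z" by (rule inc_lin[OF Z(2,1)])
      show ?thesis using Z i.zero inc_hom[OF Z(2)] by metis
    qed
    show "q X (x \<oplus>\<^bsub>FOb M X\<^esub> y) = q X x \<oplus>\<^bsub>V\<^esub> q X y" if "finite X" "x \<in> C X" "y \<in> C X" for X x y
      using that ad by simp
    show "q X (a \<odot>\<^bsub>FOb M X\<^esub> x) = a \<odot>\<^bsub>V\<^esub> q X x" if "finite X" "a \<in> carrier K" "x \<in> C X" for X a x
      using that sm by simp
  qed (use q_in ac_map A_up[of _ "{}"] in auto)
  then show ?thesis by blast
qed

section \<open>Generic FI-modules as representations\<close>

context left_module
begin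

lemma coset_mem:
  assumes H: "submodule H R M" and x: "x \<in> carrier M"
  shows "y \<in> H +>\<^bsub>M\<^esub> x \<longleftrightarrow> y \<in> carrier M \<and> y \<ominus>\<^bsub>M\<^esub> x \<in> H"
proof -
  note h = submoduleD[OF H]
  show ?thesis
  proof
    assume "y \<in> H +>\<^bsub>M\<^esub> x"
    then obtain z where z: "z \<in> H" "y = z \<oplus>\<^bsub>M\<^esub> x" by (auto simp: a_r_coset_def')
    then show "y \<in> carrier M \<and> y \<ominus>\<^bsub>M\<^esub> x \<in> H"
      using h(3) x by (simp add: a_minus_def M.a_assoc M.r_neg)
  next
    assume y: "y \<in> carrier M \<and> y \<ominus>\<^bsub>M\<^esub> x \<in> H"
    then have "y = (y \<ominus>\<^bsub>M\<^esub> x) \<oplus>\<^bsub>M\<^esub> x" using x by (simp add: a_minus_def M.a_assoc M.l_neg)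
    then show "y \<in> H +>\<^bsub>M\<^esub> x" using y unfolding a_r_coset_def' by blast
  qed
qed

lemma coset_self: "submodule H R M \<Longrightarrow> x \<in> carrier M \<Longrightarrow> x \<in> H +>\<^bsub>M\<^esub> x"
  using submoduleD(2) by (auto simp: coset_mem a_minus_def M.r_neg)

lemma diff_diff:
  assumes "x \<in> carrier M" "y \<in> carrier M" "z \<in> carrier M"
  shows "z \<ominus>\<^bsub>M\<^esub> y = (z \<ominus>\<^bsub>M\<^esub> x) \<ominus>\<^bsub>M\<^esub> (y \<ominus>\<^bsub>M\<^esub> x)"
proof -
  have "(z \<ominus>\<^bsub>M\<^esub> x) \<ominus>\<^bsub>M\<^esub> (y \<ominus>\<^bsub>M\<^esub> x) = (z \<ominus>\<^bsub>M\<^esub> y) \<oplus>\<^bsub>M\<^esub> (x \<oplus>\<^bsub>M\<^esub> \<ominus>\<^bsub>M\<^esub> x)"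
    using assms by (simp add: a_minus_def M.minus_add M.a_ac)
  then show ?thesis using assms by (simp add: M.r_neg)
qed

lemma coset_eq:
  assumes H: "submodule H R M" and x: "x \<in> carrier M" and y: "y \<in> H +>\<^bsub>M\<^esub> x"
  shows "H +>\<^bsub>M\<^esub> y = H +>\<^bsub>M\<^esub> x"
proof -
  note h = submoduleD[OF H]
  have yc: "y \<in> carrier M" and yx: "y \<ominus>\<^bsub>M\<^esub> x \<in> H" using y coset_mem[OF H x] by auto
  have "z \<ominus>\<^bsub>M\<^esub> y \<in> H \<longleftrightarrow> z \<ominus>\<^bsub>M\<^esub> x \<in> H" if z: "z \<in> carrier M" for z
  proof
    have "z \<ominus>\<^bsub>M\<^esub> x = (z \<ominus>\<^bsub>M\<^esub> y) \<oplus>\<^bsub>M\<^esub> (y \<ominus>\<^bsub>M\<^esub> x)"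
      using z x yc by (simp add: a_minus_def M.a_assoc) (simp add: M.a_assoc[symmetric] M.l_neg)
    then show "z \<ominus>\<^bsub>M\<^esub> y \<in> H \<Longrightarrow> z \<ominus>\<^bsub>M\<^esub> x \<in> H" using h(4) yx by simp
    show "z \<ominus>\<^bsub>M\<^esub> x \<in> H \<Longrightarrow> z \<ominus>\<^bsub>M\<^esub> y \<in> H" using h(7)[OF _ yx, of "z \<ominus>\<^bsub>M\<^esub> x"] diff_diff[OF x yc z] by simp
  qed
  then show ?thesis using coset_mem[OF H x] coset_mem[OF H yc] by blast
qed

lemma coset_zero: "submodule H R M \<Longrightarrow> H +>\<^bsub>M\<^esub> \<zero>\<^bsub>M\<^esub> = H"
proof -
  assume H: "submodule H R M"
  show ?thesis using coset_mem[OF H M.zero_closed] submoduleD(1)[OF H] by (auto simp: M.diff_zero)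
qed

lemma coset_of_mem: "submodule H R M \<Longrightarrow> x \<in> H \<Longrightarrow> H +>\<^bsub>M\<^esub> x = H"
  using coset_eq[of H "\<zero>\<^bsub>M\<^esub>" x] coset_zero[of H] by simp

lemma set_add_iff: "z \<in> A <+>\<^bsub>M\<^esub> B \<longleftrightarrow> (\<exists>a\<in>A. \<exists>b\<in>B. z = a \<oplus>\<^bsub>M\<^esub> b)"
  by (auto simp: set_add_defs)

lemma coset_add:
  assumes H: "submodule H R M" and x: "x \<in> carrier M" and y: "y \<in> carrier M"
  shows "(H +>\<^bsub>M\<^esub> x) <+>\<^bsub>M\<^esub> (H +>\<^bsub>M\<^esub> y) = H +>\<^bsub>M\<^esub> (x \<oplus>\<^bsub>M\<^esub> y)"
proof -
  note h = submoduleD[OF H]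
  show ?thesis
  proof (intro equalityI subsetI)
    fix z assume "z \<in> (H +>\<^bsub>M\<^esub> x) <+>\<^bsub>M\<^esub> (H +>\<^bsub>M\<^esub> y)"
    then obtain a b where ab: "a \<in> H +>\<^bsub>M\<^esub> x" "b \<in> H +>\<^bsub>M\<^esub> y" "z = a \<oplus>\<^bsub>M\<^esub> b" unfolding set_add_iff by blast
    then have c: "a \<in> carrier M" "a \<ominus>\<^bsub>M\<^esub> x \<in> H" "b \<in> carrier M" "b \<ominus>\<^bsub>M\<^esub> y \<in> H"
      using coset_mem[OF H x] coset_mem[OF H y] by auto
    then have "z \<ominus>\<^bsub>M\<^esub> (x \<oplus>\<^bsub>M\<^esub> y) \<in> H" using ab x y h(4) by (simp add: M.add_diff_add)
    then show "z \<in> H +>\<^bsub>M\<^esub> (x \<oplus>\<^bsub>M\<^esub> y)" using coset_mem[OF H] x y ab c by simp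
  next
    fix z assume "z \<in> H +>\<^bsub>M\<^esub> (x \<oplus>\<^bsub>M\<^esub> y)"
    then have z: "z \<in> carrier M" "z \<ominus>\<^bsub>M\<^esub> (x \<oplus>\<^bsub>M\<^esub> y) \<in> H" using coset_mem[OF H] x y by auto
    have "z \<ominus>\<^bsub>M\<^esub> y \<ominus>\<^bsub>M\<^esub> x = z \<ominus>\<^bsub>M\<^esub> (x \<oplus>\<^bsub>M\<^esub> y)" using z x y by (simp add: a_minus_def M.minus_add M.a_ac)
    then have "z \<ominus>\<^bsub>M\<^esub> y \<in> H +>\<^bsub>M\<^esub> x" using coset_mem[OF H x] z x y by simp
    moreover have "z = (z \<ominus>\<^bsub>M\<^esub> y) \<oplus>\<^bsub>M\<^esub> y" using z y by (simp add: a_minus_def M.a_assoc M.l_neg)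
    ultimately show "z \<in> (H +>\<^bsub>M\<^esub> x) <+>\<^bsub>M\<^esub> (H +>\<^bsub>M\<^esub> y)"
      unfolding set_add_iff using coset_self[OF H y] by blast
  qed
qed

lemma coset_absorb:
  assumes H: "submodule H R M" and H': "submodule H' R M" and "H \<subseteq> H'" and x: "x \<in> carrier M"
  shows "H' <+>\<^bsub>M\<^esub> (H +>\<^bsub>M\<^esub> x) = H' +>\<^bsub>M\<^esub> x"
proof (intro equalityI subsetI)
  note h = submoduleD[OF H'] submoduleD(2)[OF H]
  fix z assume "z \<in> H' <+>\<^bsub>M\<^esub> (H +>\<^bsub>M\<^esub> x)"
  then obtain a b where ab: "a \<in> H'" "b \<in> H +>\<^bsub>M\<^esub> x" "z = a \<oplus>\<^bsub>M\<^esub> b" unfolding set_add_iff by blast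
  then have c: "a \<in> carrier M" "b \<in> carrier M" "b \<ominus>\<^bsub>M\<^esub> x \<in> H'" using coset_mem[OF H x] h(3) assms(3) by auto
  have "z \<ominus>\<^bsub>M\<^esub> x = a \<oplus>\<^bsub>M\<^esub> (b \<ominus>\<^bsub>M\<^esub> x)" using c x ab by (simp add: a_minus_def M.a_assoc)
  then show "z \<in> H' +>\<^bsub>M\<^esub> x" using coset_mem[OF H' x] ab c h(4) by simp
next
  fix z assume "z \<in> H' +>\<^bsub>M\<^esub> x"
  then have z: "z \<in> carrier M" "z \<ominus>\<^bsub>M\<^esub> x \<in> H'" using coset_mem[OF H' x] by auto
  have "z = (z \<ominus>\<^bsub>M\<^esub> x) \<oplus>\<^bsub>M\<^esub> x" using z x by (simp add: a_minus_def M.a_assoc M.l_neg)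
  then show "z \<in> H' <+>\<^bsub>M\<^esub> (H +>\<^bsub>M\<^esub> x)" unfolding set_add_iff using z coset_self[OF H x] by blast
qed

lemma a_rcosets_iff: "A \<in> a_rcosets\<^bsub>M\<^esub> H \<longleftrightarrow> (\<exists>x\<in>carrier M. A = H +>\<^bsub>M\<^esub> x)"
  by (auto simp: A_RCOSETS_def')

lemma coset_smult:
  assumes H: "submodule H R M" and x: "x \<in> carrier M" and a: "a \<in> carrier R"
  shows "(\<Union>z\<in>H +>\<^bsub>M\<^esub> x. H +>\<^bsub>M\<^esub> (a \<odot>\<^bsub>M\<^esub> z)) = H +>\<^bsub>M\<^esub> (a \<odot>\<^bsub>M\<^esub> x)"
proof -
  have "H +>\<^bsub>M\<^esub> (a \<odot>\<^bsub>M\<^esub> z) = H +>\<^bsub>M\<^esub> (a \<odot>\<^bsub>M\<^esub> x)" if "z \<in> H +>\<^bsub>M\<^esub> x" for z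
  proof (rule coset_eq[OF H])
    have z: "z \<in> carrier M" "z \<ominus>\<^bsub>M\<^esub> x \<in> H" using that coset_mem[OF H x] by auto
    have "a \<odot>\<^bsub>M\<^esub> z \<ominus>\<^bsub>M\<^esub> a \<odot>\<^bsub>M\<^esub> x = a \<odot>\<^bsub>M\<^esub> (z \<ominus>\<^bsub>M\<^esub> x)"
      using z x a by (simp add: a_minus_def smult_r_distr smult_minus)
    then show "a \<odot>\<^bsub>M\<^esub> z \<in> H +>\<^bsub>M\<^esub> (a \<odot>\<^bsub>M\<^esub> x)"
      using coset_mem[OF H] submoduleD(5)[OF H] z x a smult_closed by simp
  qed (use x a smult_closed in simp)
  then show ?thesis using coset_self[OF H x] by blast
qed

end

lemma (in lin_map) coset_image:
  assumes H: "submodule H R M" and H': "submodule H' R N" and "f ` H \<subseteq> H'" and x: "x \<in> carrier M"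
  shows "(\<Union>z\<in>H +>\<^bsub>M\<^esub> x. H' +>\<^bsub>N\<^esub> f z) = H' +>\<^bsub>N\<^esub> f x"
proof -
  have "H' +>\<^bsub>N\<^esub> f z = H' +>\<^bsub>N\<^esub> f x" if "z \<in> H +>\<^bsub>M\<^esub> x" for z
  proof (rule N.coset_eq[OF H' closed[OF x]])
    have z: "z \<in> carrier M" "z \<ominus>\<^bsub>M\<^esub> x \<in> H" using that M.coset_mem[OF H x] by auto
    then have "f z \<ominus>\<^bsub>N\<^esub> f x \<in> H'" using assms(3) x diff[of z x] by auto
    then show "f z \<in> H' +>\<^bsub>N\<^esub> f x" using N.coset_mem[OF H' closed[OF x]] closed z by simp
  qed
  then show ?thesis using M.coset_self[OF H x] by blast
qed

lemma sub_FI_D: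
  assumes "sub_FI K M U" "finite X"
  shows "submodule (U X) K (FOb M X)"
    and "finite Y \<Longrightarrow> f \<in> Hom FI X Y \<Longrightarrow> x \<in> U X \<Longrightarrow> FMap M X Y f x \<in> U Y"
proof -
  show "submodule (U X) K (FOb M X)" using assms by (simp add: sub_FI_def)
  assume *: "finite Y" "f \<in> Hom FI X Y" "x \<in> U X"
  have "FMap M X Y f ` U X \<subseteq> U Y"
    using assms *(1,2) unfolding sub_FI_def by (meson FI_simps(1))
  then show "FMap M X Y f x \<in> U Y" using *(3) by blast
qed

lemma (in fi) sub_closed:
  assumes U: "sub_FI K M U" and X: "finite X" and x: "x \<in> U X" shows "x \<in> C X"
proof -
  interpret X: left_module K "FOb M X" by (rule mod[OF X])
  show ?thesis using X.submoduleD(3)[OF sub_FI_D(1)[OF U X] x] .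
qed

lemma (in fi) sub_FI_I:
  assumes "\<And>X x. finite X \<Longrightarrow> x \<in> U X \<Longrightarrow> x \<in> C X" "\<And>X. finite X \<Longrightarrow> \<zero>\<^bsub>FOb M X\<^esub> \<in> U X"
    and "\<And>X x y. finite X \<Longrightarrow> x \<in> U X \<Longrightarrow> y \<in> U X \<Longrightarrow> x \<oplus>\<^bsub>FOb M X\<^esub> y \<in> U X"
    and "\<And>X a x. finite X \<Longrightarrow> a \<in> carrier K \<Longrightarrow> x \<in> U X \<Longrightarrow> a \<odot>\<^bsub>FOb M X\<^esub> x \<in> U X"
    and "\<And>X Y f x. finite X \<Longrightarrow> finite Y \<Longrightarrow> f \<in> Hom FI X Y \<Longrightarrow> x \<in> U X \<Longrightarrow> FMap M X Y f x \<in> U Y"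
  shows "sub_FI K M U"
proof -
  have "submodule (U X) K (FOb M X)" if "finite X" for X
    by (rule left_module.submoduleI[OF mod[OF that]]) (use assms(1-4)[OF that] in auto)
  then show ?thesis using assms(5) unfolding sub_FI_def by (auto simp del: FI_simps(2))
qed

text \<open>Removes cosets from the torsion condition on a quotient: a coset is killed exactly when
  its representative is moved into \<open>U\<close>.\<close>

lemma (in fi) torsion_quot_iff:
  assumes U: "sub_FI K M U"
  shows "torsion (quot_FI M U) \<longleftrightarrow> (\<forall>X x. finite X \<longrightarrow> x \<in> C X \<longrightarrow>
    (\<exists>Y f. finite Y \<and> f \<in> Hom FI X Y \<and> FMap M X Y f x \<in> U Y))"
proof -
  have quot: "FMap (quot_FI M U) X Y f (U X +>\<^bsub>FOb M X\<^esub> x) = \<zero>\<^bsub>FOb (quot_FI M U) Y\<^esub> \<longleftrightarrow> FMap M X Y f x \<in> U Y"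
    if X: "finite X" "finite Y" "f \<in> Hom FI X Y" and x: "x \<in> C X" for X Y f x
  proof -
    interpret f: lin_map K "FOb M X" "FOb M Y" "FMap M X Y f" by (rule lin[OF X])
    note UX = sub_FI_D(1)[OF U X(1)] and UY = sub_FI_D(1)[OF U X(2)]
    have "U X +>\<^bsub>FOb M X\<^esub> x \<in> a_rcosets\<^bsub>FOb M X\<^esub> (U X)" using f.M.a_rcosets_iff x by blast
    then have "FMap (quot_FI M U) X Y f (U X +>\<^bsub>FOb M X\<^esub> x) = (\<Union>z\<in>U X +>\<^bsub>FOb M X\<^esub> x. U Y +>\<^bsub>FOb M Y\<^esub> FMap M X Y f z)"
      by (simp add: quot_FI_def)
    also have "\<dots> = U Y +>\<^bsub>FOb M Y\<^esub> FMap M X Y f x"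
      by (rule f.coset_image[OF UX UY _ x]) (use sub_FI_D(2)[OF U X(1) X(2) X(3)] in blast)
    finally show ?thesis
      using f.N.coset_of_mem[OF UY] f.N.coset_self[OF UY f.closed[OF x]] by (auto simp: quot_FI_def quot_module_def)
  qed
  have rc: "A \<in> carrier (FOb (quot_FI M U) X) \<longleftrightarrow> (\<exists>x\<in>C X. A = U X +>\<^bsub>FOb M X\<^esub> x)" if "finite X" for X A
    using left_module.a_rcosets_iff[OF mod[OF that]] by (simp add: quot_FI_def quot_module_def)
  show ?thesis
  proof
    assume t: "torsion (quot_FI M U)"
    show "\<forall>X x. finite X \<longrightarrow> x \<in> C X \<longrightarrow> (\<exists>Y f. finite Y \<and> f \<in> Hom FI X Y \<and> FMap M X Y f x \<in> U Y)"
    proof (intro allI impI)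
      fix X x assume X: "finite X" and x: "x \<in> C X"
      have "\<exists>Y\<in>Ob FI. \<exists>f\<in>Hom FI X Y. FMap (quot_FI M U) X Y f (U X +>\<^bsub>FOb M X\<^esub> x) = \<zero>\<^bsub>FOb (quot_FI M U) Y\<^esub>"
        using t[unfolded torsion_def] FI_simps(1)[THEN iffD2, OF X] rc[OF X] x by blast
      then obtain Y f where Y: "finite Y" "f \<in> Hom FI X Y"
          "FMap (quot_FI M U) X Y f (U X +>\<^bsub>FOb M X\<^esub> x) = \<zero>\<^bsub>FOb (quot_FI M U) Y\<^esub>"
        by (auto simp del: FI_simps(2))
      then show "\<exists>Y f. finite Y \<and> f \<in> Hom FI X Y \<and> FMap M X Y f x \<in> U Y"
        using quot[OF X Y(1,2) x] by blast
    qed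
  next
    assume s: "\<forall>X x. finite X \<longrightarrow> x \<in> C X \<longrightarrow> (\<exists>Y f. finite Y \<and> f \<in> Hom FI X Y \<and> FMap M X Y f x \<in> U Y)"
    show "torsion (quot_FI M U)"
      unfolding torsion_def
    proof (intro ballI)
      fix X A assume "X \<in> Ob FI" and A: "A \<in> carrier (FOb (quot_FI M U) X)"
      then have X: "finite X" by simp
      obtain x where x: "x \<in> C X" "A = U X +>\<^bsub>FOb M X\<^esub> x" using A rc[OF X] by blast
      obtain Y f where Y: "finite Y" "f \<in> Hom FI X Y" "FMap M X Y f x \<in> U Y" using s X x(1) by blast
      then show "\<exists>Y\<in>Ob FI. \<exists>f\<in>Hom FI X Y. FMap (quot_FI M U) X Y f A = \<zero>\<^bsub>FOb (quot_FI M U) Y\<^esub>"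
        using FI_simps(1)[THEN iffD2, OF Y(1)] quot[OF X Y(1,2) x(1)] x(2) by blast
    qed
  qed
qed

context fi_colim
begin

text \<open>The largest subobject of \<open>M\<close> whose image in the colimit lies in
  \<open>W\<close>. It makes subrepresentations of the colimit visible as FI-modules with elements
  of the same type.\<close>

definition sub_of :: "'w set \<Rightarrow> nat set \<Rightarrow> 'v set" where
  "sub_of W X = {x \<in> C X. \<iota> X x \<in> W}"

lemma sub_of_sub_FI:
  assumes W: "subrep K V act W" shows "sub_FI K M (sub_of W)"
proof (rule sub_FI_I)
  have sub: "submodule W K V" using W by (simp add: subrep_def)
  note w = submoduleD[OF sub]
  fix X :: "nat set" assume X: "finite X"
  interpret X: left_module K "FOb M X" by (rule mod[OF X])
  show "\<zero>\<^bsub>FOb M X\<^esub> \<in> sub_of W X" using w(2) by (simp add: sub_of_def \<iota>_zero[OF X])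
  show "x \<oplus>\<^bsub>FOb M X\<^esub> y \<in> sub_of W X" if "x \<in> sub_of W X" "y \<in> sub_of W X" for x y
    using that w(4) by (simp add: sub_of_def \<iota>_add[OF X])
  show "a \<odot>\<^bsub>FOb M X\<^esub> x \<in> sub_of W X" if "a \<in> carrier K" "x \<in> sub_of W X" for a x
    using that w(5) by (simp add: sub_of_def \<iota>_smult[OF X] X.smult_closed)
  fix Y f x assume Y: "finite Y" and f: "f \<in> Hom FI X Y" and x: "x \<in> sub_of W X"
  obtain g where g: "inj g" "\<And>x. x \<in> X \<Longrightarrow> g x = f x" using inj_extend[OF X, of f] f by auto
  have xc: "x \<in> C X" using x by (simp add: sub_of_def)
  have "\<iota> Y (FMap M X Y f x) = act g (\<iota> X x)" by (rule \<iota>_map[OF X Y f g xc])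
  then show "FMap M X Y f x \<in> sub_of W Y" using x map_closed[OF X Y f, of x] W g(1) by (simp add: sub_of_def subrep_def)
qed (simp add: sub_of_def)

text \<open>The kernel of the colimit cocone is the largest torsion subobject.\<close>

lemma tors_sub: "sub_FI K M (\<lambda>X. {x \<in> C X. \<iota> X x = \<zero>\<^bsub>V\<^esub>})"
proof -
  have "subrep K V act {\<zero>\<^bsub>V\<^esub>}" by (auto simp: subrep_def zero_submodule act_zero)
  then show ?thesis using sub_of_sub_FI[of "{\<zero>\<^bsub>V\<^esub>}"] by (simp add: sub_of_def[abs_def])
qed

lemma torsion_sub_iff:
  assumes W: "sub_FI K M W"
  shows "torsion (restrict_FI M W) \<longleftrightarrow> (\<forall>X w. finite X \<longrightarrow> w \<in> W X \<longrightarrow> \<iota> X w = \<zero>\<^bsub>V\<^esub>)"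
proof -
  have "(\<exists>Y\<in>Ob FI. \<exists>f\<in>Hom FI X Y. FMap (restrict_FI M W) X Y f w = \<zero>\<^bsub>FOb (restrict_FI M W) Y\<^esub>) \<longleftrightarrow> \<iota> X w = \<zero>\<^bsub>V\<^esub>"
    if X: "finite X" "w \<in> W X" for X w
    using \<iota>_zero_iff[OF X(1) sub_closed[OF W X]] X by (auto simp: restrict_FI_def simp del: FI_simps(2))
  then show ?thesis unfolding torsion_def by (auto simp: restrict_FI_def)
qed

text \<open>A subobject has torsion quotient exactly when it has the same colimit. Being moved into
  \<open>U\<close> by some FI-morphism is enough, because that morphism can be undone by another
  injection, under which \<open>U\<close> is stable.\<close>

lemma cotorsion_iff:
  assumes U: "sub_FI K M U"
  shows "torsion (quot_FI M U) \<longleftrightarrow> (\<forall>v\<in>carrier V. \<exists>X u. finite X \<and> u \<in> U X \<and> v = \<iota> X u)"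
  unfolding torsion_quot_iff[OF U]
proof
  assume t: "\<forall>X x. finite X \<longrightarrow> x \<in> C X \<longrightarrow> (\<exists>Y f. finite Y \<and> f \<in> Hom FI X Y \<and> FMap M X Y f x \<in> U Y)"
  show "\<forall>v\<in>carrier V. \<exists>X u. finite X \<and> u \<in> U X \<and> v = \<iota> X u"
  proof
    fix v assume v: "v \<in> carrier V"
    obtain X x where X: "finite X" "x \<in> C X" "v = \<iota> X x" using \<iota>_surj[OF v] by blast
    obtain Y f where Y: "finite Y" "f \<in> Hom FI X Y" and fx: "FMap M X Y f x \<in> U Y" using t X(1,2) by blast
    obtain g where g: "inj g" "\<And>x. x \<in> X \<Longrightarrow> g x = f x" using inj_extend[OF X(1), of f] Y(2) by auto
    \<comment> \<open>Applying \<open>h\<close> to the element of \<open>U\<close> gives an element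
      of \<open>U\<close> again, now with the original class \<open>v\<close>.\<close>
    obtain h where h: "inj h" "\<And>x. x \<in> X \<Longrightarrow> h (g x) = id x" using inj_divide[OF X(1) g(1), of id] by auto
    have hr: "restrict h Y \<in> Hom FI Y (h ` Y)" using h(1) by (auto simp: inj_on_def dest: injD)
    have e: "\<iota> Y (FMap M X Y f x) = act g v"
      unfolding X(3) by (rule \<iota>_map[OF X(1) Y(1) Y(2) g(1) _ X(2)]) (rule g(2))
    have "\<iota> (h ` Y) (FMap M Y (h ` Y) (restrict h Y) (FMap M X Y f x)) = act h (\<iota> Y (FMap M X Y f x))"
      by (rule \<iota>_map[OF Y(1) _ hr h(1) _ sub_closed[OF U Y(1) fx]]) (use Y(1) in simp_all)
    also have "\<dots> = act h (act g v)" by (simp only: e)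
    also have "\<dots> = act (h \<circ> g) (\<iota> X x)" unfolding X(3)[symmetric] by (rule act_comp[OF h(1) g(1) v, symmetric])
    also have "\<dots> = \<iota> X (FMap M X X (\<lambda>x\<in>X. x) x)"
      using \<iota>_map[OF X(1) X(1) inc_hom[OF subset_refl] inj_compose[OF h(1) g(1)]] h(2) X(2) by simp
    also have "\<dots> = v" using inc_id[OF X(1,2)] X(3) by simp
    finally show "\<exists>X u. finite X \<and> u \<in> U X \<and> v = \<iota> X u"
      using sub_FI_D(2)[OF U Y(1) _ hr fx] Y(1) by (metis finite_imageI)
  qed
next
  assume s: "\<forall>v\<in>carrier V. \<exists>X u. finite X \<and> u \<in> U X \<and> v = \<iota> X u"
  show "\<forall>X x. finite X \<longrightarrow> x \<in> C X \<longrightarrow> (\<exists>Y f. finite Y \<and> f \<in> Hom FI X Y \<and> FMap M X Y f x \<in> U Y)"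
  proof (intro allI impI)
    fix X x assume X: "finite X" and x1: "x \<in> C X"
    obtain X' u where u: "finite X'" "u \<in> U X'" "\<iota> X x = \<iota> X' u" using s \<iota>_closed[OF X x1] by blast
    let ?Z = "X \<union> X'"
    have Z: "finite ?Z" "X \<subseteq> ?Z" "X' \<subseteq> ?Z" using X u by auto
    note uc = sub_closed[OF U u(1,2)]
    \<comment> \<open>Elements with the same class are identified by some FI-morphism, which thus
      carries \<open>x\<close> to where it carries an element of \<open>U\<close>.\<close>
    have "\<iota> ?Z (inc X ?Z x) = \<iota> ?Z (inc X' ?Z u)" using \<iota>_inc[OF Z(2,1) x1] \<iota>_inc[OF Z(3,1) uc] u(3) by simp
    then obtain Y f where Y: "finite Y" "f \<in> Hom FI ?Z Y" "FMap M ?Z Y f (inc X ?Z x) = FMap M ?Z Y f (inc X' ?Z u)"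
      using \<iota>_eq_ex[OF Z(1) inc_closed[OF Z(2,1) x1] inc_closed[OF Z(3,1) uc]] by blast
    have fX: "restrict f X \<in> Hom FI X Y" using Y(2) by (auto simp: inj_on_def)
    have "inc X' ?Z u \<in> U ?Z" by (rule sub_FI_D(2)[OF U u(1) Z(1) inc_hom[OF Z(3)] u(2)])
    then have "FMap M ?Z Y f (inc X' ?Z u) \<in> U Y" by (rule sub_FI_D(2)[OF U Z(1) Y(1,2)])
    then have "FMap M X Y (restrict f X) x \<in> U Y"
      using Y(3) map_inc[OF Z(1) Y(1,2) Z(2) x1] by simp
    then show "\<exists>Y f. finite Y \<and> f \<in> Hom FI X Y \<and> FMap M X Y f x \<in> U Y" using Y(1) fX by blast
  qed
qed

end

text \<open>A map into a quotient is handled from here on as the relation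
  \<open>y \<in> f X x\<close>. Its compatibility with cosets becomes closure of this relation under
  addition, scalars and FI-morphisms.\<close>

lemma gen_repD:
  assumes M: "FI_module K M" and N: "FI_module K N" and r: "(U, W, f) \<in> gen_rep K M N"
  shows "cotorsion_sub K M U" "torsion_sub K N W"
    and "finite X \<Longrightarrow> x \<in> U X \<Longrightarrow> \<exists>y\<in>carrier (FOb N X). f X x = W X +>\<^bsub>FOb N X\<^esub> y"
    and "finite X \<Longrightarrow> x \<in> U X \<Longrightarrow> x' \<in> U X \<Longrightarrow> y \<in> f X x \<Longrightarrow> y' \<in> f X x' \<Longrightarrow>
        y \<oplus>\<^bsub>FOb N X\<^esub> y' \<in> f X (x \<oplus>\<^bsub>FOb M X\<^esub> x')"
    and "finite X \<Longrightarrow> x \<in> U X \<Longrightarrow> a \<in> carrier K \<Longrightarrow> y \<in> f X x \<Longrightarrow> a \<odot>\<^bsub>FOb N X\<^esub> y \<in> f X (a \<odot>\<^bsub>FOb M X\<^esub> x)"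
    and "finite X \<Longrightarrow> finite Y \<Longrightarrow> x \<in> U X \<Longrightarrow> h \<in> Hom FI X Y \<Longrightarrow> y \<in> f X x \<Longrightarrow> FMap N X Y h y \<in> f Y (FMap M X Y h x)"
proof -
  interpret M: fi K M by (rule fi.intro[OF M])
  interpret N: fi K N by (rule fi.intro[OF N])
  show U: "cotorsion_sub K M U" and W: "torsion_sub K N W" using r by (auto simp: gen_rep_def)
  have subU: "sub_FI K M U" and subW: "sub_FI K N W" using U W by (auto simp: cotorsion_sub_def torsion_sub_def)
  have f: "f \<in> FI_maps K (restrict_FI M U) (quot_FI N W)" using r by (auto simp: gen_rep_def)
  then have lin: "f X \<in> lin_maps K ((FOb M X)\<lparr>carrier := U X\<rparr>) (quot_module (FOb N X) (W X))" if "finite X" for X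
    using that by (auto simp: FI_maps_def restrict_FI_def quot_FI_def)
  have nat: "f Y (FMap M X Y h x) = FMap (quot_FI N W) X Y h (f X x)"
    if "finite X" "finite Y" "h \<in> Hom FI X Y" "x \<in> U X" for X Y h x
    using f that by (auto simp: FI_maps_def restrict_FI_def simp del: FI_simps(2))
  show ex: "\<exists>y\<in>carrier (FOb N X). f X x = W X +>\<^bsub>FOb N X\<^esub> y" if X: "finite X" "x \<in> U X" for X x
  proof -
    interpret NX: left_module K "FOb N X" by (rule N.mod[OF X(1)])
    show ?thesis using lin_mapsD(1)[OF lin[OF X(1)], of x] X(2) NX.a_rcosets_iff by (simp add: quot_module_def)
  qed
  show "y \<oplus>\<^bsub>FOb N X\<^esub> y' \<in> f X (x \<oplus>\<^bsub>FOb M X\<^esub> x')"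
    if X: "finite X" and x: "x \<in> U X" "x' \<in> U X" and y: "y \<in> f X x" "y' \<in> f X x'" for X x x' y y'
  proof -
    interpret NX: left_module K "FOb N X" by (rule N.mod[OF X(1)])
    have "f X (x \<oplus>\<^bsub>FOb M X\<^esub> x') = f X x <+>\<^bsub>FOb N X\<^esub> f X x'"
      using lin_mapsD(3)[OF lin[OF X(1)], of x x'] x by (simp add: quot_module_def)
    then show ?thesis using y NX.set_add_iff by blast
  qed
  show "a \<odot>\<^bsub>FOb N X\<^esub> y \<in> f X (a \<odot>\<^bsub>FOb M X\<^esub> x)"
    if X: "finite X" and x: "x \<in> U X" and a: "a \<in> carrier K" and y: "y \<in> f X x" for X x a y
  proof -
    interpret NX: left_module K "FOb N X" by (rule N.mod[OF X(1)])
    have WX: "submodule (W X) K (FOb N X)" by (rule sub_FI_D(1)[OF subW X])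
    obtain z where z: "z \<in> carrier (FOb N X)" "f X x = W X +>\<^bsub>FOb N X\<^esub> z" using ex[OF X x] by blast
    then have yc: "y \<in> carrier (FOb N X)" using y NX.coset_mem[OF WX z(1)] by simp
    have "f X (a \<odot>\<^bsub>FOb M X\<^esub> x) = (\<Union>z\<in>f X x. W X +>\<^bsub>FOb N X\<^esub> (a \<odot>\<^bsub>FOb N X\<^esub> z))"
      using lin_mapsD(4)[OF lin[OF X(1)], of a x] x a by (simp add: quot_module_def)
    then show ?thesis using y NX.coset_self[OF WX, of "a \<odot>\<^bsub>FOb N X\<^esub> y"] NX.smult_closed[OF a yc] by blast
  qed
  show "FMap N X Y h y \<in> f Y (FMap M X Y h x)"
    if X: "finite X" "finite Y" and x: "x \<in> U X" and h: "h \<in> Hom FI X Y" and y: "y \<in> f X x" for X Y x h y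
  proof -
    interpret NX: left_module K "FOb N X" by (rule N.mod[OF X(1)])
    interpret NY: left_module K "FOb N Y" by (rule N.mod[OF X(2)])
    have WX: "submodule (W X) K (FOb N X)" and WY: "submodule (W Y) K (FOb N Y)" by (rule sub_FI_D(1)[OF subW X(1)], rule sub_FI_D(1)[OF subW X(2)])
    obtain z where z: "z \<in> carrier (FOb N X)" "f X x = W X +>\<^bsub>FOb N X\<^esub> z" using ex[OF X(1) x] by blast
    then have yc: "y \<in> carrier (FOb N X)" using y NX.coset_mem[OF WX z(1)] by simp
    have "f X x \<in> a_rcosets\<^bsub>FOb N X\<^esub> (W X)" using z NX.a_rcosets_iff by blast
    then have "f Y (FMap M X Y h x) = (\<Union>z\<in>f X x. W Y +>\<^bsub>FOb N Y\<^esub> FMap N X Y h z)"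
      using nat[OF X h x] by (simp add: quot_FI_def)
    then show ?thesis using y NY.coset_self[OF WY N.map_closed[OF X h yc]] by blast
  qed
qed

text \<open>The converse of \<open>gen_repD\<close>: since every \<open>f X x\<close> is a coset,
  one common element suffices to identify the two sides of each equation between cosets.\<close>

lemma gen_repI:
  assumes M: "FI_module K M" and N: "FI_module K N"
    and U: "cotorsion_sub K M U" and W: "torsion_sub K N W"
    and ext: "f \<in> extensional (Ob FI)" "\<And>X. finite X \<Longrightarrow> f X \<in> extensional (U X)"
    and ex: "\<And>X x. finite X \<Longrightarrow> x \<in> U X \<Longrightarrow> \<exists>y\<in>carrier (FOb N X). f X x = W X +>\<^bsub>FOb N X\<^esub> y"
    and add: "\<And>X x x' y y'. finite X \<Longrightarrow> x \<in> U X \<Longrightarrow> x' \<in> U X \<Longrightarrow> y \<in> f X x \<Longrightarrow> y' \<in> f X x' \<Longrightarrow>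
        y \<oplus>\<^bsub>FOb N X\<^esub> y' \<in> f X (x \<oplus>\<^bsub>FOb M X\<^esub> x')"
    and sm: "\<And>X x a y. finite X \<Longrightarrow> x \<in> U X \<Longrightarrow> a \<in> carrier K \<Longrightarrow> y \<in> f X x \<Longrightarrow> a \<odot>\<^bsub>FOb N X\<^esub> y \<in> f X (a \<odot>\<^bsub>FOb M X\<^esub> x)"
    and nat: "\<And>X Y x h y. finite X \<Longrightarrow> finite Y \<Longrightarrow> x \<in> U X \<Longrightarrow> h \<in> Hom FI X Y \<Longrightarrow> y \<in> f X x \<Longrightarrow>
        FMap N X Y h y \<in> f Y (FMap M X Y h x)"
  shows "(U, W, f) \<in> gen_rep K M N"
proof -
  interpret M: fi K M by (rule fi.intro[OF M])
  interpret N: fi K N by (rule fi.intro[OF N])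
  have subU: "sub_FI K M U" and subW: "sub_FI K N W" using U W by (auto simp: cotorsion_sub_def torsion_sub_def)
  have eq: "f X x = W X +>\<^bsub>FOb N X\<^esub> y \<and> y \<in> carrier (FOb N X)" if X: "finite X" and x: "x \<in> U X" and y: "y \<in> f X x" for X x y
  proof -
    interpret NX: left_module K "FOb N X" by (rule N.mod[OF X(1)])
    note WX = sub_FI_D(1)[OF subW X]
    obtain z where "z \<in> carrier (FOb N X)" "f X x = W X +>\<^bsub>FOb N X\<^esub> z" using ex[OF X x] by blast
    then show ?thesis using NX.coset_eq[OF WX] NX.coset_mem[OF WX] y by auto
  qed
  have ne: "\<exists>y. y \<in> f X x" if X: "finite X" and x: "x \<in> U X" for X x
  proof -
    interpret NX: left_module K "FOb N X" by (rule N.mod[OF X(1)])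
    show ?thesis using ex[OF X x] NX.coset_self[OF sub_FI_D(1)[OF subW X]] by auto
  qed
  have "f X \<in> lin_maps K (FOb (restrict_FI M U) X) (FOb (quot_FI N W) X)" if X: "finite X" for X
  proof -
    interpret NX: left_module K "FOb N X" by (rule N.mod[OF X])
    interpret MX: left_module K "FOb M X" by (rule M.mod[OF X])
    note WX = sub_FI_D(1)[OF subW X] and UX = MX.submoduleD[OF sub_FI_D(1)[OF subU X]]
    have "f X \<in> lin_maps K ((FOb M X)\<lparr>carrier := U X\<rparr>) (quot_module (FOb N X) (W X))"
    proof (rule lin_mapsI)
      show "f X \<in> extensional (carrier ((FOb M X)\<lparr>carrier := U X\<rparr>))" using ext(2)[OF X] by simp
      fix x assume "x \<in> carrier ((FOb M X)\<lparr>carrier := U X\<rparr>)"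
      then have x: "x \<in> U X" by simp
      obtain y where y: "y \<in> f X x" using ne[OF X x] by blast
      note ey = eq[OF X x y]
      show "f X x \<in> carrier (quot_module (FOb N X) (W X))" using ex[OF X x] NX.a_rcosets_iff by (simp add: quot_module_def)
      show "f X (a \<odot>\<^bsub>(FOb M X)\<lparr>carrier := U X\<rparr>\<^esub> x) = a \<odot>\<^bsub>quot_module (FOb N X) (W X)\<^esub> f X x" if a: "a \<in> carrier K" for a
        using eq[OF X UX(5)[OF a x] sm[OF X x a y]] NX.coset_smult[OF WX _ a, of y] ey by (simp add: quot_module_def)
      fix x' assume "x' \<in> carrier ((FOb M X)\<lparr>carrier := U X\<rparr>)"
      then have x': "x' \<in> U X" by simp
      obtain y' where y': "y' \<in> f X x'" using ne[OF X x'] by blast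
      show "f X (x \<oplus>\<^bsub>(FOb M X)\<lparr>carrier := U X\<rparr>\<^esub> x') = f X x \<oplus>\<^bsub>quot_module (FOb N X) (W X)\<^esub> f X x'"
        using eq[OF X UX(4)[OF x x'] add[OF X x x' y y']] NX.coset_add[OF WX, of y y'] ey eq[OF X x' y']
        by (simp add: quot_module_def)
    qed
    then show ?thesis by (simp add: restrict_FI_def quot_FI_def)
  qed
  moreover have "f Y (FMap (restrict_FI M U) X Y h x) = FMap (quot_FI N W) X Y h (f X x)"
    if X: "finite X" "finite Y" and h: "h \<in> Hom FI X Y" and "x \<in> carrier (FOb (restrict_FI M U) X)" for X Y h x
  proof -
    have x: "x \<in> U X" using that by (simp add: restrict_FI_def)
    interpret h: lin_map K "FOb N X" "FOb N Y" "FMap N X Y h" by (rule N.lin[OF X h])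
    note WX = sub_FI_D(1)[OF subW X(1)] and WY = sub_FI_D(1)[OF subW X(2)]
    obtain y where y: "y \<in> f X x" using ne[OF X(1) x] by blast
    note ey = eq[OF X(1) x y]
    have "f X x \<in> a_rcosets\<^bsub>FOb N X\<^esub> (W X)" using ey h.M.a_rcosets_iff by blast
    then have "FMap (quot_FI N W) X Y h (f X x) = (\<Union>z\<in>W X +>\<^bsub>FOb N X\<^esub> y. W Y +>\<^bsub>FOb N Y\<^esub> FMap N X Y h z)"
      using ey by (simp add: quot_FI_def)
    also have "\<dots> = W Y +>\<^bsub>FOb N Y\<^esub> FMap N X Y h y"
      by (rule h.coset_image[OF WX WY]) (use sub_FI_D(2)[OF subW X h] ey in auto)
    also have "\<dots> = f Y (FMap M X Y h x)"
      using eq[OF X(2) sub_FI_D(2)[OF subU X h x] nat[OF X x h y]] by simp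
    finally show ?thesis using x by (simp add: restrict_FI_def)
  qed
  ultimately have "f \<in> FI_maps K (restrict_FI M U) (quot_FI N W)"
    using ext(1) by (auto simp: FI_maps_def PiE_def simp del: FI_simps(2))
  then show ?thesis using U W by (simp add: gen_rep_def)
qed

section \<open>Generic arrows as graphs of maps between colimits\<close>

definition map_graph :: "('k, 'v) module \<Rightarrow> ('v \<Rightarrow> 'w) \<Rightarrow> ('v \<times> 'w) set" where
  "map_graph V F = {(v, F v) | v. v \<in> carrier V}"

lemma map_graph_iff: "(v, w) \<in> map_graph V F \<longleftrightarrow> v \<in> carrier V \<and> w = F v"
  by (auto simp: map_graph_def)

lemma map_graph_eqD:
  assumes "F \<in> rep_maps K V act V' act'" "F' \<in> rep_maps K V act V' act'" "map_graph V F \<subseteq> map_graph V F'"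
  shows "F = F'"
proof -
  have "F v = F' v" if "v \<in> carrier V" for v using assms(3) that by (auto simp: map_graph_def)
  moreover have "F \<in> lin_maps K V V'" "F' \<in> lin_maps K V V'" using assms(1,2) by (auto simp: rep_maps_def)
  ultimately show ?thesis using lin_maps_eqI[of F K V V' F' V'] by blast
qed

text \<open>For an additive relation, single-valuedness needs checking only over zero, because the
  difference of two values over the same vector is a value over zero.\<close>

lemma graph_rep_map:
  assumes "inj_rep K V act" "inj_rep K V' act'"
    and closed: "\<And>v w. (v, w) \<in> \<Gamma> \<Longrightarrow> v \<in> carrier V \<and> w \<in> carrier V'"
    and total: "\<And>v. v \<in> carrier V \<Longrightarrow> \<exists>w. (v, w) \<in> \<Gamma>"
    and add: "\<And>v w v' w'. (v, w) \<in> \<Gamma> \<Longrightarrow> (v', w') \<in> \<Gamma> \<Longrightarrow> (v \<oplus>\<^bsub>V\<^esub> v', w \<oplus>\<^bsub>V'\<^esub> w') \<in> \<Gamma>"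
    and smult: "\<And>a v w. a \<in> carrier K \<Longrightarrow> (v, w) \<in> \<Gamma> \<Longrightarrow> (a \<odot>\<^bsub>V\<^esub> v, a \<odot>\<^bsub>V'\<^esub> w) \<in> \<Gamma>"
    and act: "\<And>g v w. inj g \<Longrightarrow> (v, w) \<in> \<Gamma> \<Longrightarrow> (act g v, act' g w) \<in> \<Gamma>"
    and zero: "\<And>w. (\<zero>\<^bsub>V\<^esub>, w) \<in> \<Gamma> \<Longrightarrow> w = \<zero>\<^bsub>V'\<^esub>"
  shows "\<exists>F\<in>rep_maps K V act V' act'. \<Gamma> = map_graph V F"
proof -
  interpret V: inj_rep K V act by fact
  interpret V': inj_rep K V' act' by fact
  have unique: "w = w'" if "(v, w) \<in> \<Gamma>" "(v, w') \<in> \<Gamma>" for v w w'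
  proof -
    have c: "v \<in> carrier V" "w \<in> carrier V'" "w' \<in> carrier V'" using closed that by blast+
    have "(\<ominus>\<^bsub>V\<^esub> v, \<ominus>\<^bsub>V'\<^esub> w') \<in> \<Gamma>"
      using smult[of "\<ominus>\<^bsub>K\<^esub> \<one>\<^bsub>K\<^esub>", OF _ that(2)] c by (simp add: V.smult_minus_one V'.smult_minus_one)
    then have "(\<zero>\<^bsub>V\<^esub>, w \<ominus>\<^bsub>V'\<^esub> w') \<in> \<Gamma>" using add[OF that(1)] c by (fastforce simp: a_minus_def V.M.r_neg)
    then show ?thesis using zero V'.M.diff_eq_zero_iff c by blast
  qed
  define F where "F = (\<lambda>v\<in>carrier V. THE w. (v, w) \<in> \<Gamma>)"
  have F: "(v, w) \<in> \<Gamma> \<longleftrightarrow> v \<in> carrier V \<and> w = F v" for v w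
  proof
    assume *: "(v, w) \<in> \<Gamma>"
    then have "(THE w. (v, w) \<in> \<Gamma>) = w" using unique by blast
    then show "v \<in> carrier V \<and> w = F v" using * closed by (auto simp: F_def)
  next
    assume *: "v \<in> carrier V \<and> w = F v"
    then obtain w' where w': "(v, w') \<in> \<Gamma>" using total by blast
    then have "(THE w. (v, w) \<in> \<Gamma>) = w'" using unique by blast
    then show "(v, w) \<in> \<Gamma>" using * w' by (simp add: F_def)
  qed
  have "F \<in> rep_maps K V act V' act'"
    unfolding rep_maps_def
  proof (intro CollectI conjI allI impI ballI lin_mapsI)
    show "F v \<in> carrier V'" if "v \<in> carrier V" for v using closed[of v "F v"] F[of v "F v"] that by simp
    show "F \<in> extensional (carrier V)" by (simp add: F_def)
    show "F (v \<oplus>\<^bsub>V\<^esub> w) = F v \<oplus>\<^bsub>V'\<^esub> F w" if "v \<in> carrier V" "w \<in> carrier V" for v w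
      using add[of v "F v" w "F w"] F[of v "F v"] F[of w "F w"] F[of "v \<oplus>\<^bsub>V\<^esub> w" "F v \<oplus>\<^bsub>V'\<^esub> F w"] that by simp
    show "F (a \<odot>\<^bsub>V\<^esub> v) = a \<odot>\<^bsub>V'\<^esub> F v" if "a \<in> carrier K" "v \<in> carrier V" for a v
      using smult[of a v "F v"] F[of v "F v"] F[of "a \<odot>\<^bsub>V\<^esub> v" "a \<odot>\<^bsub>V'\<^esub> F v"] that by simp
    show "F (act g v) = act' g (F v)" if "inj g" "v \<in> carrier V" for g v
      using act[of g v "F v"] F[of v "F v"] F[of "act g v" "act' g (F v)"] that by simp
  qed
  moreover have "\<Gamma> = map_graph V F" by (auto simp: F map_graph_def)
  ultimately show ?thesis by blast
qed

text \<open>The image in the colimits of the relation \<open>y \<in> f X x\<close>. A relation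
  avoids choosing representatives of vectors and of cosets before they are known to be
  irrelevant.\<close>

definition gen_graph :: "(nat set \<Rightarrow> 'v \<Rightarrow> 'a) \<Rightarrow> (nat set \<Rightarrow> 'v \<Rightarrow> 'b) \<Rightarrow> 'v gen_arrow \<Rightarrow> ('a \<times> 'b) set" where
  "gen_graph \<iota> \<iota>' r = {(\<iota> X x, \<iota>' X y) | X x y. finite X \<and> x \<in> fst r X \<and> y \<in> snd (snd r) X x}"

locale gen_arrow =
  M: fi_colim K M V act \<iota> + N: fi_colim K N V' act' \<iota>'
  for K :: "('k, 'x) ring_scheme" and M :: "('k, 'v) fi_mod" and V :: "('k, 'a) module" and act and \<iota>
    and N :: "('k, 'v) fi_mod" and V' :: "('k, 'b) module" and act' and \<iota>' +
  fixes U W f assumes rep: "(U, W, f) \<in> gen_rep K M N"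
begin

lemmas repD = gen_repD[OF M.FI N.FI rep]

lemma sub: "sub_FI K M U" "sub_FI K N W"
  using repD(1,2) by (auto simp: cotorsion_sub_def torsion_sub_def)

lemma U_surj: "v \<in> carrier V \<Longrightarrow> \<exists>X u. finite X \<and> u \<in> U X \<and> v = \<iota> X u"
  using M.cotorsion_iff[OF sub(1)] repD(1) by (auto simp: cotorsion_sub_def)

lemma W_zero: "finite X \<Longrightarrow> w \<in> W X \<Longrightarrow> \<iota>' X w = \<zero>\<^bsub>V'\<^esub>"
  using N.torsion_sub_iff[OF sub(2)] repD(2) by (auto simp: torsion_sub_def)

lemma f_coset: "finite X \<Longrightarrow> x \<in> U X \<Longrightarrow> y \<in> f X x \<Longrightarrow> y \<in> N.C X \<and> f X x = W X +>\<^bsub>FOb N X\<^esub> y"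
proof -
  assume X: "finite X" and x: "x \<in> U X" and y: "y \<in> f X x"
  interpret NX: left_module K "FOb N X" by (rule N.mod[OF X])
  note WX = sub_FI_D(1)[OF sub(2) X]
  obtain z where "z \<in> N.C X" "f X x = W X +>\<^bsub>FOb N X\<^esub> z" using repD(3)[OF X x] by blast
  then show ?thesis using NX.coset_eq[OF WX] NX.coset_mem[OF WX] y by auto
qed

lemma f_mem: "finite X \<Longrightarrow> x \<in> U X \<Longrightarrow> y \<in> f X x \<Longrightarrow> z \<in> f X x \<longleftrightarrow> z \<in> N.C X \<and> z \<ominus>\<^bsub>FOb N X\<^esub> y \<in> W X"
  using f_coset[of X x y] left_module.coset_mem[OF N.mod sub_FI_D(1)[OF sub(2)], of X y z] by simp

lemma f_nonempty: "finite X \<Longrightarrow> x \<in> U X \<Longrightarrow> \<exists>y. y \<in> f X x"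
  using repD(3)[of X x] left_module.coset_self[OF N.mod sub_FI_D(1)[OF sub(2)], of X] by auto

lemma f_zero:
  assumes X: "finite X" shows "f X \<zero>\<^bsub>FOb M X\<^esub> = W X"
proof -
  interpret MX: left_module K "FOb M X" by (rule M.mod[OF X])
  interpret NX: left_module K "FOb N X" by (rule N.mod[OF X])
  have z: "\<zero>\<^bsub>FOb M X\<^esub> \<in> U X" using MX.submoduleD(2)[OF sub_FI_D(1)[OF sub(1) X]] .
  obtain y where y: "y \<in> f X \<zero>\<^bsub>FOb M X\<^esub>" using f_nonempty[OF X z] by blast
  have "\<zero>\<^bsub>FOb N X\<^esub> \<in> f X \<zero>\<^bsub>FOb M X\<^esub>"
    using repD(5)[OF X z M.R.zero_closed y] f_coset[OF X z y] by (simp add: MX.smult_r_null NX.smult_l_null)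
  then show ?thesis using f_coset[OF X z] NX.coset_zero[OF sub_FI_D(1)[OF sub(2) X]] by metis
qed

lemma f_diff:
  assumes X: "finite X" and x: "x \<in> U X" "x' \<in> U X" and y: "y \<in> f X x" "y' \<in> f X x'"
  shows "y \<ominus>\<^bsub>FOb N X\<^esub> y' \<in> f X (x \<ominus>\<^bsub>FOb M X\<^esub> x')"
proof -
  interpret MX: left_module K "FOb M X" by (rule M.mod[OF X])
  interpret NX: left_module K "FOb N X" by (rule N.mod[OF X])
  note u = MX.submoduleD[OF sub_FI_D(1)[OF sub(1) X]]
  have "\<ominus>\<^bsub>FOb N X\<^esub> y' \<in> f X (\<ominus>\<^bsub>FOb M X\<^esub> x')"
    using repD(5)[OF X x(2), of "\<ominus>\<^bsub>K\<^esub> \<one>\<^bsub>K\<^esub>" y'] y f_coset[OF X x(2) y(2)] u(3)[OF x(2)]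
    by (simp add: MX.smult_minus_one NX.smult_minus_one)
  then show ?thesis unfolding a_minus_def using repD(4)[OF X x(1) u(6)[OF x(2)] y(1)] by blast
qed

lemma graph_iff: "(v, w) \<in> gen_graph \<iota> \<iota>' (U, W, f) \<longleftrightarrow> (\<exists>X x y. finite X \<and> x \<in> U X \<and> y \<in> f X x \<and> v = \<iota> X x \<and> w = \<iota>' X y)"
  by (auto simp: gen_graph_def)

text \<open>A pair in the graph can be realized on arbitrarily large levels, so that two pairs can
  be added on a common one.\<close>

lemma graph_up:
  assumes "(v, w) \<in> gen_graph \<iota> \<iota>' (U, W, f)" and Z: "finite Z"
  shows "\<exists>X x y. finite X \<and> Z \<subseteq> X \<and> x \<in> U X \<and> y \<in> f X x \<and> v = \<iota> X x \<and> w = \<iota>' X y"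
proof -
  obtain X x y where X: "finite X" "x \<in> U X" "y \<in> f X x" "v = \<iota> X x" "w = \<iota>' X y" using assms(1) graph_iff by blast
  let ?Y = "X \<union> Z"
  have Y: "finite ?Y" "X \<subseteq> ?Y" using X Z by auto
  have "x \<in> M.C X" "y \<in> N.C X" using M.sub_closed[OF sub(1) X(1,2)] f_coset[OF X(1-3)] by auto
  then have "\<iota> ?Y (M.inc X ?Y x) = v" "\<iota>' ?Y (N.inc X ?Y y) = w"
    using M.\<iota>_inc[OF Y(2,1)] N.\<iota>_inc[OF Y(2,1)] X by auto
  moreover have "M.inc X ?Y x \<in> U ?Y" by (rule sub_FI_D(2)[OF sub(1) X(1) Y(1) M.inc_hom[OF Y(2)] X(2)])
  moreover have "N.inc X ?Y y \<in> f ?Y (M.inc X ?Y x)" by (rule repD(6)[OF X(1) Y(1) X(2) M.inc_hom[OF Y(2)] X(3)])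
  ultimately show ?thesis using Y by blast
qed

lemma graph_map: "\<exists>F\<in>rep_maps K V act V' act'. gen_graph \<iota> \<iota>' (U, W, f) = map_graph V F"
proof (rule graph_rep_map[OF M.inj_rep_axioms N.inj_rep_axioms])
  let ?\<Gamma> = "gen_graph \<iota> \<iota>' (U, W, f)"
  show "v \<in> carrier V \<and> w \<in> carrier V'" if "(v, w) \<in> ?\<Gamma>" for v w
    using that graph_iff M.\<iota>_closed N.\<iota>_closed M.sub_closed[OF sub(1)] f_coset by metis
  show "\<exists>w. (v, w) \<in> ?\<Gamma>" if v: "v \<in> carrier V" for v
  proof -
    obtain X u where X: "finite X" "u \<in> U X" "v = \<iota> X u" using U_surj[OF v] by blast
    then show ?thesis using f_nonempty[OF X(1,2)] graph_iff by blast
  qed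
  show "(v \<oplus>\<^bsub>V\<^esub> v', w \<oplus>\<^bsub>V'\<^esub> w') \<in> ?\<Gamma>" if vw: "(v, w) \<in> ?\<Gamma>" and vw': "(v', w') \<in> ?\<Gamma>" for v w v' w'
  proof -
    obtain X x y where X: "finite X" "x \<in> U X" "y \<in> f X x" "v = \<iota> X x" "w = \<iota>' X y" using vw graph_iff by blast
    obtain Y x' y' where Y: "finite Y" "X \<subseteq> Y" "x' \<in> U Y" "y' \<in> f Y x'" "v' = \<iota> Y x'" "w' = \<iota>' Y y'"
      using graph_up[OF vw' X(1)] by blast
    have xc: "x \<in> M.C X" "y \<in> N.C X" "x' \<in> M.C Y" "y' \<in> N.C Y"
      using M.sub_closed[OF sub(1)] f_coset X Y by auto
    let ?x = "M.inc X Y x" and ?y = "N.inc X Y y"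
    have i: "?x \<in> U Y" "?y \<in> f Y ?x"
      using sub_FI_D(2)[OF sub(1) X(1) Y(1) M.inc_hom[OF Y(2)] X(2)]
        repD(6)[OF X(1) Y(1) X(2) M.inc_hom[OF Y(2)] X(3)] by auto
    interpret MY: left_module K "FOb M Y" by (rule M.mod[OF Y(1)])
    have "?y \<oplus>\<^bsub>FOb N Y\<^esub> y' \<in> f Y (?x \<oplus>\<^bsub>FOb M Y\<^esub> x')" by (rule repD(4)[OF Y(1) i(1) Y(3) i(2) Y(4)])
    moreover have "?x \<oplus>\<^bsub>FOb M Y\<^esub> x' \<in> U Y" using MY.submoduleD(4)[OF sub_FI_D(1)[OF sub(1) Y(1)]] i(1) Y(3) by blast
    moreover have "\<iota> Y (?x \<oplus>\<^bsub>FOb M Y\<^esub> x') = v \<oplus>\<^bsub>V\<^esub> v'"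
      using M.\<iota>_add[OF Y(1) M.inc_closed[OF Y(2,1) xc(1)] xc(3)] M.\<iota>_inc[OF Y(2,1) xc(1)] X Y by simp
    moreover have "\<iota>' Y (?y \<oplus>\<^bsub>FOb N Y\<^esub> y') = w \<oplus>\<^bsub>V'\<^esub> w'"
      using N.\<iota>_add[OF Y(1) N.inc_closed[OF Y(2,1) xc(2)] xc(4)] N.\<iota>_inc[OF Y(2,1) xc(2)] X Y by simp
    ultimately show ?thesis unfolding graph_iff using Y(1) by metis
  qed
  show "(a \<odot>\<^bsub>V\<^esub> v, a \<odot>\<^bsub>V'\<^esub> w) \<in> ?\<Gamma>" if a: "a \<in> carrier K" and vw: "(v, w) \<in> ?\<Gamma>" for a v w
  proof -
    obtain X x y where X: "finite X" "x \<in> U X" "y \<in> f X x" "v = \<iota> X x" "w = \<iota>' X y" using vw graph_iff by blast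
    have xc: "x \<in> M.C X" "y \<in> N.C X" using M.sub_closed[OF sub(1)] f_coset X by auto
    interpret MX: left_module K "FOb M X" by (rule M.mod[OF X(1)])
    have "a \<odot>\<^bsub>FOb M X\<^esub> x \<in> U X" using MX.submoduleD(5)[OF sub_FI_D(1)[OF sub(1) X(1)] a X(2)] .
    then show ?thesis unfolding graph_iff
      using repD(5)[OF X(1,2) a X(3)] M.\<iota>_smult[OF X(1) a xc(1)] N.\<iota>_smult[OF X(1) a xc(2)] X by metis
  qed
  show "(act g v, act' g w) \<in> ?\<Gamma>" if g: "inj g" and vw: "(v, w) \<in> ?\<Gamma>" for g v w
  proof -
    obtain X x y where X: "finite X" "x \<in> U X" "y \<in> f X x" "v = \<iota> X x" "w = \<iota>' X y" using vw graph_iff by blast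
    have xc: "x \<in> M.C X" "y \<in> N.C X" using M.sub_closed[OF sub(1)] f_coset X by auto
    let ?h = "restrict g X"
    have h: "?h \<in> Hom FI X (g ` X)" using g by (auto simp: inj_on_def dest: injD)
    have Y: "finite (g ` X)" using X(1) by simp
    have "\<iota> (g ` X) (FMap M X (g ` X) ?h x) = act g v" unfolding X(4)
      by (rule M.\<iota>_map[OF X(1) Y h g _ xc(1)]) simp
    moreover have "\<iota>' (g ` X) (FMap N X (g ` X) ?h y) = act' g w" unfolding X(5)
      by (rule N.\<iota>_map[OF X(1) Y h g _ xc(2)]) simp
    ultimately show ?thesis unfolding graph_iff
      using repD(6)[OF X(1) Y X(2) h X(3)] sub_FI_D(2)[OF sub(1) X(1) Y h X(2)] Y by metis
  qed
  \<comment> \<open>Some FI-morphism kills \<open>x\<close> and therefore carries \<open>y\<close>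
    into the coset of zero, which is \<open>W\<close>. Since \<open>W\<close> is torsion, a further
    morphism kills \<open>y\<close>.\<close>
  show "w = \<zero>\<^bsub>V'\<^esub>" if zw: "(\<zero>\<^bsub>V\<^esub>, w) \<in> ?\<Gamma>" for w
  proof -
    obtain X x y where X: "finite X" "x \<in> U X" "y \<in> f X x" "\<iota> X x = \<zero>\<^bsub>V\<^esub>" "w = \<iota>' X y" using zw graph_iff by metis
    have xc: "x \<in> M.C X" "y \<in> N.C X" using M.sub_closed[OF sub(1)] f_coset X by auto
    obtain Y h where Y: "finite Y" "h \<in> Hom FI X Y" "FMap M X Y h x = \<zero>\<^bsub>FOb M Y\<^esub>" using M.\<iota>_kernel[OF X(1) xc(1) X(4)] by blast
    have "FMap N X Y h y \<in> W Y" using repD(6)[OF X(1) Y(1) X(2) Y(2) X(3)] Y(3) f_zero[OF Y(1)] by simp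
    then have "\<iota>' Y (FMap N X Y h y) = \<zero>\<^bsub>V'\<^esub>" by (rule W_zero[OF Y(1)])
    then obtain Z k where Z: "finite Z" "k \<in> Hom FI Y Z" "FMap N Y Z k (FMap N X Y h y) = \<zero>\<^bsub>FOb N Z\<^esub>"
      using N.\<iota>_kernel[OF Y(1) N.map_closed[OF X(1) Y(1,2) xc(2)]] by blast
    have "compose X k h \<in> Hom FI X Z" using Y(2) Z(2) by (auto simp: compose_def inj_on_def PiE_iff)
    then show ?thesis
      using N.\<iota>_zero_iff[OF X(1) xc(2)] N.map_comp[OF X(1) Y(1) Z(1) Y(2) Z(2) xc(2)] Z X(5) by metis
  qed
qed

end

locale gen_pair =
  M: fi_colim K M V act \<iota> + N: fi_colim K N V' act' \<iota>'
  for K :: "('k, 'x) ring_scheme" and M :: "('k, 'v) fi_mod" and V :: "('k, 'a) module" and act and \<iota>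
    and N :: "('k, 'v) fi_mod" and V' :: "('k, 'b) module" and act' and \<iota>'
begin

lemma arrow: "(U, W, f) \<in> gen_rep K M N \<Longrightarrow> gen_arrow K M V act \<iota> N V' act' \<iota>' U W f"
  by (intro gen_arrow.intro gen_arrow_axioms.intro M.fi_colim_axioms N.fi_colim_axioms)

lemma graph_map: "r \<in> gen_rep K M N \<Longrightarrow> \<exists>F\<in>rep_maps K V act V' act'. gen_graph \<iota> \<iota>' r = map_graph V F"
  using gen_arrow.graph_map[OF arrow] by (metis prod_cases3)

text \<open>Shrinking \<open>U\<close> to a cotorsion subobject still reaches every vector of the
  colimit, and enlarging \<open>W\<close> by torsion does not change values there, so the graph is a
  complete invariant of the arrow.\<close>

lemma gen_rel_iff:
  assumes r: "r \<in> gen_rep K M N" and r': "r' \<in> gen_rep K M N"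
  shows "(r, r') \<in> gen_rel K M N \<longleftrightarrow> gen_graph \<iota> \<iota>' r = gen_graph \<iota> \<iota>' r'"
proof -
  obtain U W f U' W' f' where e: "r = (U, W, f)" "r' = (U', W', f')" by (metis prod_cases3)
  interpret r: gen_arrow K M V act \<iota> N V' act' \<iota>' U W f using arrow r e by simp
  interpret r': gen_arrow K M V act \<iota> N V' act' \<iota>' U' W' f' using arrow r' e by simp
  obtain F where F: "F \<in> rep_maps K V act V' act'" "gen_graph \<iota> \<iota>' r = map_graph V F" using graph_map[OF r] by blast
  obtain F' where F': "F' \<in> rep_maps K V act V' act'" "gen_graph \<iota> \<iota>' r' = map_graph V F'" using graph_map[OF r'] by blast
  have Fx: "F (\<iota> X x) = \<iota>' X y" if "finite X" "x \<in> U X" "y \<in> f X x" for X x y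
    using that r.graph_iff F(2) e(1) map_graph_iff by metis
  have F'x: "F' (\<iota> X x) = \<iota>' X y" if "finite X" "x \<in> U' X" "y \<in> f' X x" for X x y
    using that r'.graph_iff F'(2) e(2) map_graph_iff by metis
  \<comment> \<open>The equality of enlarged cosets is translated into a condition on
    representatives, once for both directions.\<close>
  have eqv: "W'' <+>\<^bsub>FOb N X\<^esub> f X x = W'' <+>\<^bsub>FOb N X\<^esub> f' X x \<longleftrightarrow> y \<ominus>\<^bsub>FOb N X\<^esub> y' \<in> W''"
    if X: "finite X" and x: "x \<in> U X" "x \<in> U' X" and y: "y \<in> f X x" "y' \<in> f' X x"
      and W'': "submodule W'' K (FOb N X)" "W X \<subseteq> W''" "W' X \<subseteq> W''" for X x y y' W''
  proof -
    interpret NX: left_module K "FOb N X" by (rule N.mod[OF X])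
    have y1: "y \<in> N.C X" "f X x = W X +>\<^bsub>FOb N X\<^esub> y" and y2: "y' \<in> N.C X" "f' X x = W' X +>\<^bsub>FOb N X\<^esub> y'"
      using r.f_coset[OF X x(1) y(1)] r'.f_coset[OF X x(2) y(2)] by auto
    have "W'' <+>\<^bsub>FOb N X\<^esub> f X x = W'' +>\<^bsub>FOb N X\<^esub> y" "W'' <+>\<^bsub>FOb N X\<^esub> f' X x = W'' +>\<^bsub>FOb N X\<^esub> y'"
      using NX.coset_absorb[OF sub_FI_D(1)[OF r.sub(2) X] W''(1,2) y1(1)]
        NX.coset_absorb[OF sub_FI_D(1)[OF r'.sub(2) X] W''(1,3) y2(1)] y1 y2 by auto
    then show ?thesis
      using NX.coset_eq[OF W''(1) y2(1), of y] NX.coset_self[OF W''(1) y1(1)] NX.coset_mem[OF W''(1) y2(1), of y] y1(1) by metis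
  qed
  show ?thesis
  proof
    assume "(r, r') \<in> gen_rel K M N"
    then obtain U'' W'' where U'': "cotorsion_sub K M U''" and W'': "torsion_sub K N W''"
      and s: "\<And>X. finite X \<Longrightarrow> U'' X \<subseteq> U X \<inter> U' X \<and> W X \<union> W' X \<subseteq> W'' X"
      and eq: "\<And>X x. finite X \<Longrightarrow> x \<in> U'' X \<Longrightarrow> W'' X <+>\<^bsub>FOb N X\<^esub> f X x = W'' X <+>\<^bsub>FOb N X\<^esub> f' X x"
      unfolding gen_rel_def e by auto
    have sub: "sub_FI K M U''" "sub_FI K N W''" using U'' W'' by (auto simp: cotorsion_sub_def torsion_sub_def)
    have "F v = F' v" if v: "v \<in> carrier V" for v
    proof -
      obtain X x where X: "finite X" and x: "x \<in> U'' X" and vx: "v = \<iota> X x"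
        using M.cotorsion_iff[OF sub(1)] U'' v by (auto simp: cotorsion_sub_def)
      have xU: "x \<in> U X" "x \<in> U' X" using s[OF X] x by auto
      obtain y y' where y: "y \<in> f X x" "y' \<in> f' X x" using r.f_nonempty[OF X xU(1)] r'.f_nonempty[OF X xU(2)] by blast
      interpret NX: left_module K "FOb N X" by (rule N.mod[OF X])
      have "y \<ominus>\<^bsub>FOb N X\<^esub> y' \<in> W'' X"
        using eqv[OF X xU y sub_FI_D(1)[OF sub(2) X]] eq[OF X x] s[OF X] by simp
      then have "\<iota>' X (y \<ominus>\<^bsub>FOb N X\<^esub> y') = \<zero>\<^bsub>V'\<^esub>"
        using N.torsion_sub_iff[OF sub(2)] W'' X by (auto simp: torsion_sub_def)
      moreover have yc: "y \<in> N.C X" "y' \<in> N.C X" using r.f_coset[OF X xU(1) y(1)] r'.f_coset[OF X xU(2) y(2)] by auto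
      ultimately have "\<iota>' X y = \<iota>' X y'" using N.\<iota>_diff[OF X yc] N.\<iota>_closed[OF X] N.M.diff_eq_zero_iff by simp
      then show ?thesis using Fx[OF X xU(1) y(1)] F'x[OF X xU(2) y(2)] vx by simp
    qed
    then show "gen_graph \<iota> \<iota>' r = gen_graph \<iota> \<iota>' r'" unfolding F(2) F'(2) map_graph_def by auto
  next
    assume g: "gen_graph \<iota> \<iota>' r = gen_graph \<iota> \<iota>' r'"
    then have FF: "F = F'" using map_graph_eqD[OF F(1) F'(1)] F(2) F'(2) by simp
    \<comment> \<open>The witnesses are the common domain and the entire torsion subobject of
      \<open>N\<close>, the largest one allowed.\<close>
    let ?U = "\<lambda>X. U X \<inter> U' X" and ?W = "\<lambda>X. {y \<in> N.C X. \<iota>' X y = \<zero>\<^bsub>V'\<^esub>}"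
    have subU: "sub_FI K M ?U"
      by (rule M.sub_FI_I) (use left_module.submoduleD[OF M.mod sub_FI_D(1)[OF r.sub(1)]] sub_FI_D(2)[OF r.sub(1)]
        left_module.submoduleD[OF M.mod sub_FI_D(1)[OF r'.sub(1)]] sub_FI_D(2)[OF r'.sub(1)] in \<open>simp_all del: FI_simps(2)\<close>)
    have "\<exists>Y h. finite Y \<and> h \<in> Hom FI X Y \<and> FMap M X Y h x \<in> ?U Y" if X: "finite X" and x: "x \<in> M.C X" for X x
    proof -
      have t: "torsion (quot_FI M U)" "torsion (quot_FI M U')" using r.repD(1) r'.repD(1) by (auto simp: cotorsion_sub_def)
      obtain Y h where Y: "finite Y" "h \<in> Hom FI X Y" "FMap M X Y h x \<in> U Y"
        using M.torsion_quot_iff[OF r.sub(1)] t(1) X x by blast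
      obtain Z k where Z: "finite Z" "k \<in> Hom FI Y Z" "FMap M Y Z k (FMap M X Y h x) \<in> U' Z"
        using M.torsion_quot_iff[OF r'.sub(1)] t(2) Y(1) M.map_closed[OF X Y(1,2) x] by blast
      have "compose X k h \<in> Hom FI X Z" using Y(2) Z(2) by (auto simp: compose_def inj_on_def PiE_iff)
      then show ?thesis
        using M.map_comp[OF X Y(1) Z(1) Y(2) Z(2) x] sub_FI_D(2)[OF r.sub(1) Y(1) Z(1,2) Y(3)] Z by (metis IntI)
    qed
    then have cot: "cotorsion_sub K M ?U" using subU M.torsion_quot_iff[OF subU] by (simp add: cotorsion_sub_def)
    have subW: "sub_FI K N ?W" by (rule N.tors_sub)
    have tor: "torsion_sub K N ?W" using subW N.torsion_sub_iff[OF subW] by (simp add: torsion_sub_def)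
    have "\<forall>X\<in>Ob FI. ?U X \<subseteq> U X \<inter> U' X \<and> W X \<union> W' X \<subseteq> ?W X \<and>
        (\<forall>x\<in>?U X. ?W X <+>\<^bsub>FOb N X\<^esub> f X x = ?W X <+>\<^bsub>FOb N X\<^esub> f' X x)"
    proof (intro ballI conjI)
      fix X assume "X \<in> Ob FI"
      then have X: "finite X" by simp
      interpret NX: left_module K "FOb N X" by (rule N.mod[OF X])
      show WW: "W X \<union> W' X \<subseteq> ?W X"
        using r.W_zero[OF X] r'.W_zero[OF X] N.sub_closed[OF r.sub(2) X] N.sub_closed[OF r'.sub(2) X] by blast
      fix x assume x: "x \<in> ?U X"
      then have xU: "x \<in> U X" "x \<in> U' X" by auto
      obtain y y' where y: "y \<in> f X x" "y' \<in> f' X x" using r.f_nonempty[OF X xU(1)] r'.f_nonempty[OF X xU(2)] by blast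
      have yc: "y \<in> N.C X" "y' \<in> N.C X" using r.f_coset[OF X xU(1) y(1)] r'.f_coset[OF X xU(2) y(2)] by auto
      have "\<iota>' X y = \<iota>' X y'" using Fx[OF X xU(1) y(1)] F'x[OF X xU(2) y(2)] FF by simp
      then have "y \<ominus>\<^bsub>FOb N X\<^esub> y' \<in> ?W X" using N.\<iota>_diff[OF X yc] N.\<iota>_closed[OF X] N.M.diff_eq_zero_iff yc by simp
      then show "?W X <+>\<^bsub>FOb N X\<^esub> f X x = ?W X <+>\<^bsub>FOb N X\<^esub> f' X x"
        using eqv[OF X xU y sub_FI_D(1)[OF subW X]] WW by simp
    qed auto
    then show "(r, r') \<in> gen_rel K M N"
      unfolding gen_rel_def e using r r' cot tor e by blast
  qed
qed

text \<open>A map \<open>F\<close> of colimits is defined on those \<open>x\<close> for which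
  \<open>F (\<iota> X x)\<close> already comes from the level \<open>X\<close> of \<open>N\<close>.
  The lifts form a coset of the torsion subobject, so \<open>f X x\<close> can be taken as the set
  of all lifts.\<close>

lemma rep_ex:
  assumes F: "F \<in> rep_maps K V act V' act'"
  shows "\<exists>r\<in>gen_rep K M N. gen_graph \<iota> \<iota>' r = map_graph V F"
proof -
  interpret F: rep_map K V act V' act' F
    using F M.inj_rep_axioms N.inj_rep_axioms by (simp add: rep_map_iff)
  define U where "U X = {x \<in> M.C X. \<exists>y\<in>N.C X. F (\<iota> X x) = \<iota>' X y}" for X
  define W where "W X = {y \<in> N.C X. \<iota>' X y = \<zero>\<^bsub>V'\<^esub>}" for X
  define f where "f = (\<lambda>X\<in>Ob FI. \<lambda>x\<in>U X. {y \<in> N.C X. \<iota>' X y = F (\<iota> X x)})"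
  have f: "y \<in> f X x \<longleftrightarrow> y \<in> N.C X \<and> \<iota>' X y = F (\<iota> X x)" if "finite X" "x \<in> U X" for X x y
    using that by (simp add: f_def)
  have mapF: "\<iota>' Y (FMap N X Y h y) = F (\<iota> Y (FMap M X Y h x))"
    if X: "finite X" "finite Y" "h \<in> Hom FI X Y" and x: "x \<in> M.C X" "y \<in> N.C X" "\<iota>' X y = F (\<iota> X x)" for X Y h x y
  proof -
    obtain g where g: "inj g" "\<And>x. x \<in> X \<Longrightarrow> g x = h x" using inj_extend[OF X(1), of h] X(3) by auto
    have "\<iota>' Y (FMap N X Y h y) = act' g (\<iota>' X y)" by (rule N.\<iota>_map[OF X g x(2)])
    moreover have "\<iota> Y (FMap M X Y h x) = act g (\<iota> X x)" by (rule M.\<iota>_map[OF X g x(1)])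
    ultimately show ?thesis using F.equivariant[OF g(1) M.\<iota>_closed[OF X(1) x(1)]] x(3) by simp
  qed
  have subU: "sub_FI K M U"
  proof (rule M.sub_FI_I)
    show "x \<in> M.C X" if "x \<in> U X" for X x using that by (simp add: U_def)
    fix X :: "nat set" assume X: "finite X"
    interpret MX: left_module K "FOb M X" by (rule M.mod[OF X])
    interpret NX: left_module K "FOb N X" by (rule N.mod[OF X])
    show "\<zero>\<^bsub>FOb M X\<^esub> \<in> U X" using M.\<iota>_zero[OF X] N.\<iota>_zero[OF X] F.lin.zero by (auto simp: U_def intro!: bexI[of _ "\<zero>\<^bsub>FOb N X\<^esub>"])
    fix x assume xU: "x \<in> U X"
    then obtain y where y: "y \<in> N.C X" "F (\<iota> X x) = \<iota>' X y" unfolding U_def by blast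
    have x: "x \<in> M.C X" using xU by (auto simp: U_def)
    show "a \<odot>\<^bsub>FOb M X\<^esub> x \<in> U X" if a: "a \<in> carrier K" for a
    proof -
      have "F (\<iota> X (a \<odot>\<^bsub>FOb M X\<^esub> x)) = \<iota>' X (a \<odot>\<^bsub>FOb N X\<^esub> y)"
        using x y a by (simp add: M.\<iota>_smult[OF X] N.\<iota>_smult[OF X] F.lin.smult M.\<iota>_closed[OF X])
      then show ?thesis unfolding U_def using x y a MX.smult_closed NX.smult_closed by blast
    qed
    show "x \<oplus>\<^bsub>FOb M X\<^esub> x' \<in> U X" if x'U: "x' \<in> U X" for x'
    proof -
      obtain y' where y': "y' \<in> N.C X" "F (\<iota> X x') = \<iota>' X y'" using x'U unfolding U_def by blast
      have x': "x' \<in> M.C X" using x'U by (auto simp: U_def)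
      have "F (\<iota> X (x \<oplus>\<^bsub>FOb M X\<^esub> x')) = \<iota>' X (y \<oplus>\<^bsub>FOb N X\<^esub> y')"
        using x x' y y' by (simp add: M.\<iota>_add[OF X] N.\<iota>_add[OF X] F.lin.add M.\<iota>_closed[OF X])
      then show ?thesis unfolding U_def using x x' y y' by blast
    qed
    show "FMap M X Y h x \<in> U Y" if Y: "finite Y" and h: "h \<in> Hom FI X Y" for Y h
      unfolding U_def using mapF[OF X Y h x y(1)] M.map_closed[OF X Y h x] N.map_closed[OF X Y h y(1)] y(2)
      by (auto intro!: bexI[of _ "FMap N X Y h y"])
  qed
  \<comment> \<open>After enlarging the level, \<open>F v\<close> has a lift, so the domain reaches
    every vector of the colimit.\<close>
  have "\<exists>X u. finite X \<and> u \<in> U X \<and> v = \<iota> X u" if v: "v \<in> carrier V" for v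
  proof -
    obtain X x where X: "finite X" "x \<in> M.C X" "v = \<iota> X x" using M.\<iota>_surj[OF v] by blast
    obtain Y y where Y: "finite Y" "X \<subseteq> Y" "y \<in> N.C Y" "F v = \<iota>' Y y" using N.\<iota>_up[OF F.lin.closed[OF v] X(1)] by blast
    have "M.inc X Y x \<in> U Y" unfolding U_def using M.inc_closed[OF Y(2,1) X(2)] M.\<iota>_inc[OF Y(2,1) X(2)] X(3) Y by auto
    then show ?thesis using M.\<iota>_inc[OF Y(2,1) X(2)] X(3) Y(1) by metis
  qed
  then have cot: "cotorsion_sub K M U" using subU M.cotorsion_iff[OF subU] by (simp add: cotorsion_sub_def)
  have subW: "sub_FI K N W" unfolding W_def by (rule N.tors_sub)
  have tor: "torsion_sub K N W" using subW N.torsion_sub_iff[OF subW] by (simp add: torsion_sub_def W_def)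
  have rep: "(U, W, f) \<in> gen_rep K M N"
  proof (rule gen_repI[OF M.FI N.FI cot tor])
    show "f \<in> extensional (Ob FI)" by (simp add: f_def)
    show "f X \<in> extensional (U X)" if "finite X" for X using that by (simp add: f_def)
    show "\<exists>y\<in>N.C X. f X x = W X +>\<^bsub>FOb N X\<^esub> y" if X: "finite X" and x: "x \<in> U X" for X x
    proof -
      interpret NX: left_module K "FOb N X" by (rule N.mod[OF X])
      obtain y where y: "y \<in> N.C X" "F (\<iota> X x) = \<iota>' X y" using x unfolding U_def by blast
      have "z \<in> f X x \<longleftrightarrow> z \<in> W X +>\<^bsub>FOb N X\<^esub> y" for z
        using f[OF X x] NX.coset_mem[OF sub_FI_D(1)[OF subW X] y(1)] y N.\<iota>_diff[OF X] N.\<iota>_closed[OF X]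
        by (auto simp: W_def N.M.diff_eq_zero_iff)
      then show ?thesis using y by blast
    qed
    show "y \<oplus>\<^bsub>FOb N X\<^esub> y' \<in> f X (x \<oplus>\<^bsub>FOb M X\<^esub> x')"
      if X: "finite X" and x: "x \<in> U X" "x' \<in> U X" and y: "y \<in> f X x" "y' \<in> f X x'" for X x x' y y'
    proof -
      interpret MX: left_module K "FOb M X" by (rule M.mod[OF X])
      interpret NX: left_module K "FOb N X" by (rule N.mod[OF X])
      have xc: "x \<in> M.C X" "x' \<in> M.C X" using x by (auto simp: U_def)
      have "x \<oplus>\<^bsub>FOb M X\<^esub> x' \<in> U X" using MX.submoduleD(4)[OF sub_FI_D(1)[OF subU X] x] .
      then show ?thesis using f[OF X] x y xc by (simp add: N.\<iota>_add[OF X] M.\<iota>_add[OF X] F.lin.add M.\<iota>_closed[OF X])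
    qed
    show "a \<odot>\<^bsub>FOb N X\<^esub> y \<in> f X (a \<odot>\<^bsub>FOb M X\<^esub> x)"
      if X: "finite X" and x: "x \<in> U X" and a: "a \<in> carrier K" and y: "y \<in> f X x" for X x a y
    proof -
      interpret MX: left_module K "FOb M X" by (rule M.mod[OF X])
      interpret NX: left_module K "FOb N X" by (rule N.mod[OF X])
      have xc: "x \<in> M.C X" using x by (auto simp: U_def)
      have "a \<odot>\<^bsub>FOb M X\<^esub> x \<in> U X" using MX.submoduleD(5)[OF sub_FI_D(1)[OF subU X] a x] .
      then show ?thesis using f[OF X] x y xc a
        by (simp add: N.\<iota>_smult[OF X] M.\<iota>_smult[OF X] F.lin.smult M.\<iota>_closed[OF X] NX.smult_closed)
    qed
    show "FMap N X Y h y \<in> f Y (FMap M X Y h x)"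
      if X: "finite X" "finite Y" and x: "x \<in> U X" and h: "h \<in> Hom FI X Y" and y: "y \<in> f X x" for X Y x h y
    proof -
      have xc: "x \<in> M.C X" "y \<in> N.C X" "\<iota>' X y = F (\<iota> X x)" using x y f[OF X(1) x] by (auto simp: U_def)
      show ?thesis using f[OF X(2) sub_FI_D(2)[OF subU X h x]] mapF[OF X h xc] N.map_closed[OF X h xc(2)] by simp
    qed
  qed
  moreover have "gen_graph \<iota> \<iota>' (U, W, f) \<subseteq> map_graph V F"
  proof
    fix p assume "p \<in> gen_graph \<iota> \<iota>' (U, W, f)"
    then obtain X x y where X: "finite X" "x \<in> U X" "y \<in> f X x" "p = (\<iota> X x, \<iota>' X y)" by (auto simp: gen_graph_def)
    then have "x \<in> M.C X" "\<iota>' X y = F (\<iota> X x)" using f[OF X(1,2)] by (auto simp: U_def)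
    then show "p \<in> map_graph V F" using X M.\<iota>_closed by (simp add: map_graph_iff)
  qed
  then have "gen_graph \<iota> \<iota>' (U, W, f) = map_graph V F"
    using graph_map[OF rep] map_graph_eqD F by metis
  ultimately show ?thesis by blast
qed

end

text \<open>The relation of the composite representative is contained in the composite of the two
  graphs, hence equal to it because both are graphs of maps. The remaining work is to verify that
  \<open>gen_comp_rep\<close> yields a representative.\<close>

lemma gen_comp:
  assumes colims: "fi_colim K M V act \<iota>" "fi_colim K N V' act' \<iota>'" "fi_colim K P V'' act'' \<iota>''"
    and r: "r \<in> gen_rep K M N" and s: "s \<in> gen_rep K N P"
    and F: "gen_graph \<iota> \<iota>' r = map_graph V F" and G: "gen_graph \<iota>' \<iota>'' s = map_graph V' G"
    and Fr: "F \<in> rep_maps K V act V' act'" and Gr: "G \<in> rep_maps K V' act' V'' act''"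
  shows "gen_comp_rep s r \<in> gen_rep K M P"
    and "gen_graph \<iota> \<iota>'' (gen_comp_rep s r) = map_graph V (compose (carrier V) G F)"
proof -
  obtain U W f where e: "r = (U, W, f)" by (metis prod_cases3)
  obtain U' W' g where e': "s = (U', W', g)" by (metis prod_cases3)
  interpret r: gen_pair K M V act \<iota> N V' act' \<iota>' by (intro gen_pair.intro colims)
  interpret s: gen_pair K N V' act' \<iota>' P V'' act'' \<iota>'' by (intro gen_pair.intro colims)
  interpret t: gen_pair K M V act \<iota> P V'' act'' \<iota>'' by (intro gen_pair.intro colims)
  interpret f: gen_arrow K M V act \<iota> N V' act' \<iota>' U W f using r.arrow r e by simp
  interpret g: gen_arrow K N V' act' \<iota>' P V'' act'' \<iota>'' U' W' g using s.arrow s e' by simp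
  have Fx: "F (\<iota> X x) = \<iota>' X y" if "finite X" "x \<in> U X" "y \<in> f X x" for X x y
    using that f.graph_iff F e map_graph_iff by metis
  have Gx: "G (\<iota>' X x) = \<iota>'' X y" if "finite X" "x \<in> U' X" "y \<in> g X x" for X x y
    using that g.graph_iff G e' map_graph_iff by metis
  define U'' where "U'' = (\<lambda>X. {x \<in> U X. f X x \<inter> U' X \<noteq> {}})"
  define W'' where "W'' = (\<lambda>X. \<Union>y\<in>W X \<inter> U' X. g X y)"
  define c where "c = (\<lambda>X\<in>Ob FI. \<lambda>x\<in>U'' X. \<Union>y\<in>f X x \<inter> U' X. g X y)"
  have comp: "gen_comp_rep s r = (U'', W'', c)"
    by (simp add: gen_comp_rep_def e e' U''_def W''_def c_def Let_def)
  have U''_iff: "x \<in> U'' X \<longleftrightarrow> x \<in> U X \<and> (\<exists>y. y \<in> f X x \<and> y \<in> U' X)" for X x by (auto simp: U''_def)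
  have W''_iff: "z \<in> W'' X \<longleftrightarrow> (\<exists>y. y \<in> W X \<and> y \<in> U' X \<and> z \<in> g X y)" for X z by (auto simp: W''_def)
  have c_iff: "z \<in> c X x \<longleftrightarrow> (\<exists>y. y \<in> f X x \<and> y \<in> U' X \<and> z \<in> g X y)" if "finite X" "x \<in> U'' X" for X x z
    using that by (auto simp: c_def)
  note U'D = left_module.submoduleD[OF r.N.mod sub_FI_D(1)[OF g.sub(1)]]
  note UD = left_module.submoduleD[OF r.M.mod sub_FI_D(1)[OF f.sub(1)]]
  note WD = left_module.submoduleD[OF r.N.mod sub_FI_D(1)[OF f.sub(2)]]
  have subU: "sub_FI K M U''"
  proof (rule r.M.sub_FI_I)
    fix X :: "nat set" assume X: "finite X"
    show "\<zero>\<^bsub>FOb M X\<^esub> \<in> U'' X"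
      using UD(2)[OF X X] f.f_zero[OF X] WD(2)[OF X X] U'D(2)[OF X X] by (auto simp: U''_iff)
    fix x assume "x \<in> U'' X"
    then obtain y where y: "y \<in> f X x" "y \<in> U' X" and x: "x \<in> U X" unfolding U''_iff by blast
    show "x \<in> r.M.C X" by (rule UD(3)[OF X X x])
    show "a \<odot>\<^bsub>FOb M X\<^esub> x \<in> U'' X" if a: "a \<in> carrier K" for a
      unfolding U''_iff using f.repD(5)[OF X x a y(1)] U'D(5)[OF X X a y(2)] UD(5)[OF X X a x] by blast
    show "x \<oplus>\<^bsub>FOb M X\<^esub> x' \<in> U'' X" if "x' \<in> U'' X" for x'
      using that f.repD(4)[OF X x _ y(1)] U'D(4)[OF X X y(2)] UD(4)[OF X X x] unfolding U''_iff by blast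
    show "FMap M X Y h x \<in> U'' Y" if Y: "finite Y" and h: "h \<in> Hom FI X Y" for Y h
      unfolding U''_iff
      using f.repD(6)[OF X Y x h y(1)] sub_FI_D(2)[OF f.sub(1) X Y h x] sub_FI_D(2)[OF g.sub(1) X Y h y(2)] by blast
  qed
  have subW: "sub_FI K P W''"
  proof (rule s.N.sub_FI_I)
    fix X :: "nat set" assume X: "finite X"
    show "\<zero>\<^bsub>FOb P X\<^esub> \<in> W'' X"
      using WD(2)[OF X X] U'D(2)[OF X X] g.f_zero[OF X] left_module.submoduleD(2)[OF s.N.mod[OF X] sub_FI_D(1)[OF g.sub(2) X]]
      by (auto simp: W''_iff)
    fix x assume "x \<in> W'' X"
    then obtain y where y: "y \<in> W X" "y \<in> U' X" and x: "x \<in> g X y" unfolding W''_iff by blast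
    show "x \<in> s.N.C X" using g.f_coset[OF X y(2) x] by blast
    show "a \<odot>\<^bsub>FOb P X\<^esub> x \<in> W'' X" if a: "a \<in> carrier K" for a
      unfolding W''_iff using g.repD(5)[OF X y(2) a x] U'D(5)[OF X X a y(2)] WD(5)[OF X X a y(1)] by blast
    show "x \<oplus>\<^bsub>FOb P X\<^esub> x' \<in> W'' X" if "x' \<in> W'' X" for x'
      using that g.repD(4)[OF X y(2) _ x] U'D(4)[OF X X y(2)] WD(4)[OF X X y(1)] unfolding W''_iff by blast
    show "FMap P X Y h x \<in> W'' Y" if Y: "finite Y" and h: "h \<in> Hom FI X Y" for Y h
      unfolding W''_iff
      using g.repD(6)[OF X Y y(2) h x] sub_FI_D(2)[OF f.sub(2) X Y h y(1)] sub_FI_D(2)[OF g.sub(1) X Y h y(2)] by blast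
  qed
  \<comment> \<open>First \<open>x\<close> is moved into \<open>U\<close>; then some value
    \<open>y\<close> of it is moved into \<open>U'\<close>, and membership in \<open>U\<close>
    survives the second move.\<close>
  have "\<exists>Y h. finite Y \<and> h \<in> Hom FI X Y \<and> FMap M X Y h x \<in> U'' Y" if X: "finite X" and x: "x \<in> r.M.C X" for X x
  proof -
    have cU: "torsion (quot_FI M U)" "torsion (quot_FI N U')" using f.repD(1) g.repD(1) by (auto simp: cotorsion_sub_def)
    obtain Y h where Y: "finite Y" "h \<in> Hom FI X Y" "FMap M X Y h x \<in> U Y"
      using r.M.torsion_quot_iff[OF f.sub(1)] cU(1) X x by blast
    obtain y where y: "y \<in> f Y (FMap M X Y h x)" using f.f_nonempty[OF Y(1,3)] by blast
    have yc: "y \<in> r.N.C Y" using f.f_coset[OF Y(1,3) y] by blast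
    obtain Z k where Z: "finite Z" "k \<in> Hom FI Y Z" "FMap N Y Z k y \<in> U' Z"
      using r.N.torsion_quot_iff[OF g.sub(1)] cU(2) Y(1) yc by blast
    have "compose X k h \<in> Hom FI X Z" using Y(2) Z(2) by (auto simp: compose_def inj_on_def PiE_iff)
    moreover have "FMap M X Z (compose X k h) x \<in> U'' Z"
      unfolding r.M.map_comp[OF X Y(1) Z(1) Y(2) Z(2) x] U''_iff
      using sub_FI_D(2)[OF f.sub(1) Y(1) Z(1,2) Y(3)] f.repD(6)[OF Y(1) Z(1) Y(3) Z(2) y] Z(3) by blast
    ultimately show ?thesis using Z(1) by blast
  qed
  then have cot: "cotorsion_sub K M U''" using subU r.M.torsion_quot_iff[OF subU] by (simp add: cotorsion_sub_def)
  interpret G: rep_map K V' act' V'' act'' G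
    using Gr r.N.inj_rep_axioms s.N.inj_rep_axioms by (simp add: rep_map_iff)
  have "\<iota>'' X z = \<zero>\<^bsub>V''\<^esub>" if X: "finite X" and z: "z \<in> W'' X" for X z
  proof -
    obtain y where y: "y \<in> W X" "y \<in> U' X" "z \<in> g X y" using z W''_iff by blast
    show ?thesis using Gx[OF X y(2,3)] f.W_zero[OF X y(1)] G.lin.zero by simp
  qed
  then have tor: "torsion_sub K P W''" using subW s.N.torsion_sub_iff[OF subW] by (simp add: torsion_sub_def)
  have rep: "(U'', W'', c) \<in> gen_rep K M P"
  proof (rule gen_repI[OF r.M.FI s.N.FI cot tor])
    show "c \<in> extensional (Ob FI)" by (simp add: c_def)
    show "c X \<in> extensional (U'' X)" if "finite X" for X using that by (simp add: c_def)
    show "\<exists>z\<in>s.N.C X. c X x = W'' X +>\<^bsub>FOb P X\<^esub> z" if X: "finite X" and x: "x \<in> U'' X" for X x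
    proof -
      interpret NX: left_module K "FOb N X" by (rule r.N.mod[OF X])
      interpret PX: left_module K "FOb P X" by (rule s.N.mod[OF X])
      obtain y where y: "y \<in> f X x" "y \<in> U' X" and xU: "x \<in> U X" using x U''_iff by blast
      obtain z where z: "z \<in> g X y" using g.f_nonempty[OF X y(2)] by blast
      have zc: "z \<in> s.N.C X" using g.f_coset[OF X y(2) z] by blast
      have yc: "y \<in> r.N.C X" using f.f_coset[OF X xU y(1)] by blast
      \<comment> \<open>Two intermediate values in \<open>U'\<close> differ by an element of both
        \<open>W\<close> and \<open>U'\<close>, and \<open>W''\<close> consists of the values of
        \<open>g\<close> at such elements.\<close>
      have "z' \<in> c X x \<longleftrightarrow> z' \<in> W'' X +>\<^bsub>FOb P X\<^esub> z" for z'
        unfolding PX.coset_mem[OF sub_FI_D(1)[OF subW X] zc]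
      proof
        assume "z' \<in> c X x"
        then obtain y' where y': "y' \<in> f X x" "y' \<in> U' X" "z' \<in> g X y'" using c_iff[OF X x] by blast
        have "y' \<ominus>\<^bsub>FOb N X\<^esub> y \<in> W X" using f.f_mem[OF X xU y(1)] y'(1) by blast
        moreover have "y' \<ominus>\<^bsub>FOb N X\<^esub> y \<in> U' X" by (rule U'D(7)[OF X X y'(2) y(2)])
        moreover have "z' \<ominus>\<^bsub>FOb P X\<^esub> z \<in> g X (y' \<ominus>\<^bsub>FOb N X\<^esub> y)" by (rule g.f_diff[OF X y'(2) y(2) y'(3) z])
        ultimately show "z' \<in> s.N.C X \<and> z' \<ominus>\<^bsub>FOb P X\<^esub> z \<in> W'' X"
          using g.f_coset[OF X y'(2,3)] W''_iff by blast
      next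
        assume *: "z' \<in> s.N.C X \<and> z' \<ominus>\<^bsub>FOb P X\<^esub> z \<in> W'' X"
        then obtain y0 where y0: "y0 \<in> W X" "y0 \<in> U' X" "z' \<ominus>\<^bsub>FOb P X\<^esub> z \<in> g X y0" using W''_iff by blast
        have y0c: "y0 \<in> r.N.C X" using WD(3)[OF X X y0(1)] .
        have "(z' \<ominus>\<^bsub>FOb P X\<^esub> z) \<oplus>\<^bsub>FOb P X\<^esub> z = z'" using * zc by (simp add: a_minus_def PX.M.a_assoc PX.M.l_neg)
        then have "z' \<in> g X (y0 \<oplus>\<^bsub>FOb N X\<^esub> y)" using g.repD(4)[OF X y0(2) y(2) y0(3) z] by simp
        moreover have "y0 \<oplus>\<^bsub>FOb N X\<^esub> y \<in> U' X" by (rule U'D(4)[OF X X y0(2) y(2)])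
        moreover have "(y0 \<oplus>\<^bsub>FOb N X\<^esub> y) \<ominus>\<^bsub>FOb N X\<^esub> y = y0" using y0c yc by (simp add: a_minus_def NX.M.a_assoc NX.M.r_neg)
        then have "y0 \<oplus>\<^bsub>FOb N X\<^esub> y \<in> f X x" using f.f_mem[OF X xU y(1)] y0(1) y0c yc by simp
        ultimately show "z' \<in> c X x" using c_iff[OF X x] by blast
      qed
      then show ?thesis using zc by blast
    qed
    show "z \<oplus>\<^bsub>FOb P X\<^esub> z' \<in> c X (x \<oplus>\<^bsub>FOb M X\<^esub> x')"
      if X: "finite X" and x: "x \<in> U'' X" "x' \<in> U'' X" and z: "z \<in> c X x" "z' \<in> c X x'" for X x x' z z'
    proof -
      obtain y where y: "y \<in> f X x" "y \<in> U' X" "z \<in> g X y" using c_iff[OF X x(1)] z(1) by blast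
      obtain y' where y': "y' \<in> f X x'" "y' \<in> U' X" "z' \<in> g X y'" using c_iff[OF X x(2)] z(2) by blast
      have xU: "x \<in> U X" "x' \<in> U X" using x U''_iff by blast+
      have "x \<oplus>\<^bsub>FOb M X\<^esub> x' \<in> U'' X" by (rule left_module.submoduleD(4)[OF r.M.mod[OF X] sub_FI_D(1)[OF subU X] x])
      then show ?thesis
        using c_iff[OF X] f.repD(4)[OF X xU y(1) y'(1)] U'D(4)[OF X X y(2) y'(2)] g.repD(4)[OF X y(2) y'(2) y(3) y'(3)] by blast
    qed
    show "a \<odot>\<^bsub>FOb P X\<^esub> z \<in> c X (a \<odot>\<^bsub>FOb M X\<^esub> x)"
      if X: "finite X" and x: "x \<in> U'' X" and a: "a \<in> carrier K" and z: "z \<in> c X x" for X x a z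
    proof -
      obtain y where y: "y \<in> f X x" "y \<in> U' X" "z \<in> g X y" using c_iff[OF X x(1)] z(1) by blast
      have xU: "x \<in> U X" using x U''_iff by blast
      have "a \<odot>\<^bsub>FOb M X\<^esub> x \<in> U'' X" by (rule left_module.submoduleD(5)[OF r.M.mod[OF X] sub_FI_D(1)[OF subU X] a x])
      then show ?thesis
        using c_iff[OF X] f.repD(5)[OF X xU a y(1)] U'D(5)[OF X X a y(2)] g.repD(5)[OF X y(2) a y(3)] by blast
    qed
    show "FMap P X Y h z \<in> c Y (FMap M X Y h x)"
      if X: "finite X" "finite Y" and x: "x \<in> U'' X" and h: "h \<in> Hom FI X Y" and z: "z \<in> c X x" for X Y x h z
    proof -
      obtain y where y: "y \<in> f X x" "y \<in> U' X" "z \<in> g X y" using c_iff[OF X(1) x(1)] z(1) by blast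
      have xU: "x \<in> U X" using x U''_iff by blast
      have "FMap M X Y h x \<in> U'' Y" by (rule sub_FI_D(2)[OF subU X h x])
      then show ?thesis
        using c_iff[OF X(2)] f.repD(6)[OF X xU h y(1)] sub_FI_D(2)[OF g.sub(1) X h y(2)] g.repD(6)[OF X y(2) h y(3)] by blast
    qed
  qed
  then show "gen_comp_rep s r \<in> gen_rep K M P" by (simp add: comp)
  obtain H where H: "H \<in> rep_maps K V act V'' act''" "gen_graph \<iota> \<iota>'' (U'', W'', c) = map_graph V H"
    using t.graph_map[OF rep] by blast
  have "map_graph V H \<subseteq> map_graph V (compose (carrier V) G F)"
    unfolding H(2)[symmetric]
  proof
    fix p assume "p \<in> gen_graph \<iota> \<iota>'' (U'', W'', c)"
    then obtain X x z where X: "finite X" "x \<in> U'' X" "z \<in> c X x" "p = (\<iota> X x, \<iota>'' X z)" by (auto simp: gen_graph_def)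
    obtain y where y: "y \<in> f X x" "y \<in> U' X" "z \<in> g X y" using c_iff[OF X(1,2)] X(3) by blast
    have xU: "x \<in> U X" using X(2) U''_iff by blast
    have "\<iota> X x \<in> carrier V" using r.M.\<iota>_closed[OF X(1)] r.M.sub_closed[OF f.sub(1) X(1) xU] by blast
    then show "p \<in> map_graph V (compose (carrier V) G F)"
      using Fx[OF X(1) xU y(1)] Gx[OF X(1) y(2,3)] X(4) by (simp add: map_graph_iff compose_eq)
  qed
  then have "H = compose (carrier V) G F"
    using map_graph_eqD[OF H(1) rep_maps_compose[OF r.M.inj_rep_axioms Fr Gr]] by blast
  then show "gen_graph \<iota> \<iota>'' (gen_comp_rep s r) = map_graph V (compose (carrier V) G F)" using H(2) comp by simp
qed

lemma gen_id:
  assumes "fi_colim K M V act \<iota>"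
  shows "gen_id_rep M \<in> gen_rep K M M" "gen_graph \<iota> \<iota> (gen_id_rep M) = map_graph V (\<lambda>v\<in>carrier V. v)"
proof -
  interpret M: fi_colim K M V act \<iota> by fact
  let ?f = "\<lambda>X\<in>Ob FI. \<lambda>x\<in>M.C X. {x}"
  note X = left_module.carrier_submodule[OF M.mod] left_module.zero_submodule[OF M.mod]
  note cD = left_module.submoduleD[OF M.mod X(1)] left_module.submoduleD[OF M.mod X(2)]
  have subU: "sub_FI K M (\<lambda>X. M.C X)"
    by (rule M.sub_FI_I) (auto simp: M.map_closed cD simp del: FI_simps(2))
  have subW: "sub_FI K M (\<lambda>X. {\<zero>\<^bsub>FOb M X\<^esub>})"
    by (rule M.sub_FI_I) (use cD lin_map.zero[OF M.lin] in \<open>auto simp del: FI_simps(2)\<close>)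
  have cot: "cotorsion_sub K M (\<lambda>X. M.C X)"
    using subU M.cotorsion_iff[OF subU] M.\<iota>_surj by (simp add: cotorsion_sub_def)
  have tor: "torsion_sub K M (\<lambda>X. {\<zero>\<^bsub>FOb M X\<^esub>})"
    using subW M.torsion_sub_iff[OF subW] M.\<iota>_zero by (simp add: torsion_sub_def)
  show "gen_id_rep M \<in> gen_rep K M M"
    unfolding gen_id_rep_def
  proof (rule gen_repI[OF M.FI M.FI cot tor])
    show "\<exists>y\<in>M.C X. ?f X x = {\<zero>\<^bsub>FOb M X\<^esub>} +>\<^bsub>FOb M X\<^esub> y" if X: "finite X" and x: "x \<in> M.C X" for X x
    proof -
      interpret X: left_module K "FOb M X" by (rule M.mod[OF X])
      show ?thesis using X x by (intro bexI[of _ x]) (auto simp: a_r_coset_def')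
    qed
    show "y \<oplus>\<^bsub>FOb M X\<^esub> y' \<in> ?f X (x \<oplus>\<^bsub>FOb M X\<^esub> x')"
      if X: "finite X" and "x \<in> M.C X" "x' \<in> M.C X" and "y \<in> ?f X x" "y' \<in> ?f X x'" for X x x' y y'
    proof -
      interpret X: left_module K "FOb M X" by (rule M.mod[OF X])
      show ?thesis using that by simp
    qed
    show "a \<odot>\<^bsub>FOb M X\<^esub> y \<in> ?f X (a \<odot>\<^bsub>FOb M X\<^esub> x)"
      if X: "finite X" and "x \<in> M.C X" "a \<in> carrier K" "y \<in> ?f X x" for X x a y
    proof -
      interpret X: left_module K "FOb M X" by (rule M.mod[OF X])
      show ?thesis using that by (simp add: X.smult_closed)
    qed
    show "FMap M X Y h y \<in> ?f Y (FMap M X Y h x)"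
      if X: "finite X" "finite Y" and x: "x \<in> M.C X" and h: "h \<in> Hom FI X Y" and y: "y \<in> ?f X x" for X Y x h y
      using X x y M.map_closed[OF X h x] by simp
  qed auto
  show "gen_graph \<iota> \<iota> (gen_id_rep M) = map_graph V (\<lambda>v\<in>carrier V. v)"
  proof (intro equalityI subsetI)
    fix p assume "p \<in> gen_graph \<iota> \<iota> (gen_id_rep M)"
    then obtain X x where "finite X" "x \<in> M.C X" "p = (\<iota> X x, \<iota> X x)" by (auto simp: gen_graph_def gen_id_rep_def)
    then show "p \<in> map_graph V (\<lambda>v\<in>carrier V. v)" using M.\<iota>_closed by (simp add: map_graph_iff)
  next
    fix p assume "p \<in> map_graph V (\<lambda>v\<in>carrier V. v)"
    then obtain v where v: "v \<in> carrier V" "p = (v, v)" by (auto simp: map_graph_def)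
    obtain X x where "finite X" "x \<in> M.C X" "v = \<iota> X x" using M.\<iota>_surj[OF v(1)] by blast
    then show "p \<in> gen_graph \<iota> \<iota> (gen_id_rep M)" using v(2) by (auto simp: gen_graph_def gen_id_rep_def)
  qed
qed

lemma restrict_FI_module:
  assumes M: "FI_module K M" and U: "sub_FI K M U" shows "FI_module K (restrict_FI M U)"
proof (rule FI_moduleI)
  interpret M: fi K M by (rule fi.intro[OF M])
  have s: "FOb (restrict_FI M U) X = (FOb M X)\<lparr>carrier := U X\<rparr>" "FMap (restrict_FI M U) X Y f = restrict (FMap M X Y f) (U X)" for X Y f
    by (simp_all add: restrict_FI_def)
  fix X :: "nat set" assume X: "finite X"
  interpret X: left_module K "FOb M X" by (rule M.mod[OF X])
  note Uc = M.sub_closed[OF U X]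
  show "left_module K (FOb (restrict_FI M U) X)" using X.left_module_submodule[OF sub_FI_D(1)[OF U X]] by (simp add: s)
  show "FMap (restrict_FI M U) X X (\<lambda>x\<in>X. x) x = x" if "x \<in> carrier (FOb (restrict_FI M U) X)" for x
    using M.inc_id[OF X Uc] that by (simp add: s)
  fix Y f assume Y: "finite Y" and f: "f \<in> Hom FI X Y"
  interpret f: lin_map K "FOb M X" "FOb M Y" "FMap M X Y f" by (rule M.lin[OF X Y f])
  show "FMap (restrict_FI M U) X Y f \<in> lin_maps K (FOb (restrict_FI M U) X) (FOb (restrict_FI M U) Y)"
    unfolding s by (rule lin_mapsI) (use sub_FI_D(2)[OF U X Y f] X.submoduleD[OF sub_FI_D(1)[OF U X]] f.add f.smult in auto)
  show "FMap (restrict_FI M U) X Z (compose X g f) x = FMap (restrict_FI M U) Y Z g (FMap (restrict_FI M U) X Y f x)"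
    if "finite Z" "g \<in> Hom FI Y Z" "x \<in> carrier (FOb (restrict_FI M U) X)" for Z g x
    using M.map_comp[OF X Y that(1) f that(2) Uc] sub_FI_D(2)[OF U X Y f] that(3) by (simp add: s)
qed

context fi_colim
begin

text \<open>The colimit of the subobject cut out by \<open>W\<close> is \<open>W\<close> itself.
  Kernels and other subrepresentations thus become test objects in the generic category.\<close>

lemma restrict_colim:
  assumes W: "subrep K V act W"
  shows "fi_colim K (restrict_FI M (sub_of W)) (V\<lparr>carrier := W\<rparr>) (\<lambda>g. restrict (act g) W) \<iota>"
proof -
  have FM: "FI_module K (restrict_FI M (sub_of W))" by (rule restrict_FI_module[OF FI sub_of_sub_FI[OF W]])
  show ?thesis
  proof (intro fi_colim.intro fi_colim_axioms.intro fi.intro FM inj_rep_subrep[OF W])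
    show "\<iota> Y (FMap (restrict_FI M (sub_of W)) X Y f u) = restrict (act g) W (\<iota> X u)"
      if X: "finite X" "finite Y" and f: "f \<in> Hom FI X Y" and g: "inj g" "\<And>x. x \<in> X \<Longrightarrow> g x = f x"
        and u: "u \<in> carrier (FOb (restrict_FI M (sub_of W)) X)" for X Y f g u
    proof -
      have u': "u \<in> sub_of W X" "u \<in> C X" "\<iota> X u \<in> W" using u by (auto simp: restrict_FI_def sub_of_def)
      have "\<iota> Y (FMap M X Y f u) = act g (\<iota> X u)" by (rule \<iota>_map[OF X f g u'(2)])
      then show ?thesis using u' by (simp add: restrict_FI_def)
    qed
    show "\<exists>Y f. finite Y \<and> f \<in> Hom FI X Y \<and> FMap (restrict_FI M (sub_of W)) X Y f x = \<zero>\<^bsub>FOb (restrict_FI M (sub_of W)) Y\<^esub>"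
      if X: "finite X" and x: "x \<in> carrier (FOb (restrict_FI M (sub_of W)) X)" "\<iota> X x = \<zero>\<^bsub>V\<lparr>carrier := W\<rparr>\<^esub>" for X x
    proof -
      have x': "x \<in> sub_of W X" "x \<in> C X" using x by (auto simp: restrict_FI_def sub_of_def)
      show ?thesis using \<iota>_kernel[OF X x'(2)] x(2) x'(1) by (simp add: restrict_FI_def)
    qed
    show "\<exists>X x. finite X \<and> x \<in> carrier (FOb (restrict_FI M (sub_of W)) X) \<and> v = \<iota> X x"
      if v: "v \<in> carrier (V\<lparr>carrier := W\<rparr>)" for v
    proof -
      have "v \<in> W" "v \<in> carrier V" using v W submoduleD(3) by (auto simp: subrep_def)
      then show ?thesis using \<iota>_surj[of v] by (auto simp: restrict_FI_def sub_of_def)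
    qed
  qed (auto simp: restrict_FI_def sub_of_def \<iota>_add \<iota>_smult)
qed

end

section \<open>The generic category expressed through maps of representations\<close>

lemma Gen_simps [simp]:
  "M \<in> Ob (Gen K) \<longleftrightarrow> FI_module K M" "Hom (Gen K) M N = gen_rep K M N // gen_rel K M N"
  "Idn (Gen K) M = gen_rel K M M `` {gen_id_rep M}"
  "Comp (Gen K) M N P G F = gen_rel K M P `` {gen_comp_rep g f | g f. g \<in> G \<and> f \<in> F}"
  by (auto simp: Gen_def)

context gen_pair
begin

text \<open>For an equivariant \<open>F\<close> this is a full equivalence class of representatives.
  The assignment is a bijection onto the generic arrows, with \<open>hom_arr\<close> and
  \<open>arr_eqD\<close> giving the two halves.\<close>

definition arr :: "('a \<Rightarrow> 'b) \<Rightarrow> 'v gen_arrow set" where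
  "arr F = {r \<in> gen_rep K M N. gen_graph \<iota> \<iota>' r = map_graph V F}"

lemma gen_rel_class: "r \<in> gen_rep K M N \<Longrightarrow> gen_rel K M N `` {r} = {r' \<in> gen_rep K M N. gen_graph \<iota> \<iota>' r' = gen_graph \<iota> \<iota>' r}"
proof -
  assume r: "r \<in> gen_rep K M N"
  have "(r, r') \<in> gen_rel K M N \<Longrightarrow> r' \<in> gen_rep K M N" for r' by (auto simp: gen_rel_def)
  then show ?thesis using gen_rel_iff[OF r] by (simp only: Image_singleton set_eq_iff mem_Collect_eq) blast
qed

lemma arr_class: "r \<in> arr F \<Longrightarrow> gen_rel K M N `` {r} = arr F"
  by (auto simp: arr_def gen_rel_class)

lemma arr_nonempty: "F \<in> rep_maps K V act V' act' \<Longrightarrow> \<exists>r. r \<in> arr F"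
  using rep_ex unfolding arr_def by blast

lemma arr_hom: "F \<in> rep_maps K V act V' act' \<Longrightarrow> arr F \<in> Hom (Gen K) M N"
proof -
  assume "F \<in> rep_maps K V act V' act'"
  then obtain r where r: "r \<in> arr F" using arr_nonempty by blast
  then have "r \<in> gen_rep K M N" by (simp add: arr_def)
  then show ?thesis using arr_class[OF r] quotientI[of r "gen_rep K M N" "gen_rel K M N"] by simp
qed

lemma hom_arr:
  assumes "c \<in> Hom (Gen K) M N" obtains F where "F \<in> rep_maps K V act V' act'" "c = arr F"
proof -
  obtain r where r: "r \<in> gen_rep K M N" "c = gen_rel K M N `` {r}" using assms by (auto elim: quotientE)
  obtain F where F: "F \<in> rep_maps K V act V' act'" "gen_graph \<iota> \<iota>' r = map_graph V F" using graph_map[OF r(1)] by blast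
  then have "r \<in> arr F" using r by (simp add: arr_def)
  then show thesis using that[OF F(1)] arr_class r(2) by metis
qed

lemma arr_eqD:
  assumes "F \<in> rep_maps K V act V' act'" "G \<in> rep_maps K V act V' act'" "arr F = arr G" shows "F = G"
proof -
  obtain r where "r \<in> arr F" using arr_nonempty assms(1) by blast
  then have "map_graph V F = map_graph V G" using assms(3) by (auto simp: arr_def)
  then show ?thesis using map_graph_eqD[OF assms(1,2)] by simp
qed

end

lemma arr_comp:
  assumes colims: "fi_colim K M V act \<iota>" "fi_colim K N V' act' \<iota>'" "fi_colim K P V'' act'' \<iota>''"
    and F: "F \<in> rep_maps K V act V' act'" and G: "G \<in> rep_maps K V' act' V'' act''"
  shows "Comp (Gen K) M N P (gen_pair.arr K N V' \<iota>' P \<iota>'' G) (gen_pair.arr K M V \<iota> N \<iota>' F) =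
    gen_pair.arr K M V \<iota> P \<iota>'' (compose (carrier V) G F)"
proof -
  interpret r: gen_pair K M V act \<iota> N V' act' \<iota>' by (intro gen_pair.intro colims)
  interpret s: gen_pair K N V' act' \<iota>' P V'' act'' \<iota>'' by (intro gen_pair.intro colims)
  interpret t: gen_pair K M V act \<iota> P V'' act'' \<iota>'' by (intro gen_pair.intro colims)
  let ?S = "{gen_comp_rep g f | g f. g \<in> s.arr G \<and> f \<in> r.arr F}"
  have "x \<in> t.arr (compose (carrier V) G F)" if xS: "x \<in> ?S" for x
  proof -
    obtain g f where x: "x = gen_comp_rep g f" "g \<in> s.arr G" "f \<in> r.arr F" using xS by blast
    then show ?thesis
      using gen_comp[OF colims, of f g F G] F G by (simp add: r.arr_def s.arr_def t.arr_def)
  qed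
  \<comment> \<open>Every composite of representatives has the same class. As \<open>?S\<close> is
    not empty, the union of these classes is that class.\<close>
  then have eq: "\<forall>x\<in>?S. gen_rel K M P `` {x} = t.arr (compose (carrier V) G F)" by (intro ballI t.arr_class)
  obtain f where f: "f \<in> r.arr F" using r.arr_nonempty[OF F] ..
  obtain g where g: "g \<in> s.arr G" using s.arr_nonempty[OF G] ..
  have "gen_comp_rep g f \<in> ?S" by (rule CollectI, rule exI[of _ g], rule exI[of _ f]) (intro conjI refl f g)
  then have "gen_rel K M P `` ?S = t.arr (compose (carrier V) G F)"
    by (subst Image_eq_UN) (rule UN_constant_eq[OF _ eq])
  then show ?thesis by simp
qed

lemma arr_id:
  assumes "fi_colim K M V act \<iota>"
  shows "Idn (Gen K) M = gen_pair.arr K M V \<iota> M \<iota> (\<lambda>v\<in>carrier V. v)"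
proof -
  interpret r: gen_pair K M V act \<iota> M V act \<iota> by (intro gen_pair.intro assms)
  have "gen_id_rep M \<in> r.arr (\<lambda>v\<in>carrier V. v)" using gen_id[OF assms] by (simp add: r.arr_def)
  then show ?thesis using r.arr_class by simp
qed

context gen_pair
begin

lemma is_iso_arr:
  assumes F: "F \<in> rep_maps K V act V' act'"
  shows "is_iso (Gen K) M N (arr F) \<longleftrightarrow> bij_betw F (carrier V) (carrier V')"
proof -
  interpret op: gen_pair K N V' act' \<iota>' M V act \<iota> by (intro gen_pair.intro M.fi_colim_axioms N.fi_colim_axioms)
  interpret MM: gen_pair K M V act \<iota> M V act \<iota> by (intro gen_pair.intro M.fi_colim_axioms)
  interpret NN: gen_pair K N V' act' \<iota>' N V' act' \<iota>' by (intro gen_pair.intro N.fi_colim_axioms)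
  interpret F: rep_map K V act V' act' F using F M.inj_rep_axioms N.inj_rep_axioms by (simp add: rep_map_iff)
  note c1 = arr_comp[OF M.fi_colim_axioms N.fi_colim_axioms M.fi_colim_axioms F]
  note c2 = arr_comp[OF N.fi_colim_axioms M.fi_colim_axioms N.fi_colim_axioms _ F]
  show ?thesis
  proof
    assume "is_iso (Gen K) M N (arr F)"
    then obtain c where c: "c \<in> Hom (Gen K) N M" "Comp (Gen K) M N M c (arr F) = Idn (Gen K) M"
        "Comp (Gen K) N M N (arr F) c = Idn (Gen K) N"
      unfolding is_iso_def by blast
    obtain G where G: "G \<in> rep_maps K V' act' V act" "c = op.arr G" using op.hom_arr[OF c(1)] by blast
    have "compose (carrier V) G F = (\<lambda>v\<in>carrier V. v)"
      using c(2) c1[OF G(1)] G arr_id[OF M.fi_colim_axioms]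
      by (intro MM.arr_eqD rep_maps_compose[OF M.inj_rep_axioms F G(1)] rep_maps_id[OF M.inj_rep_axioms]) simp
    then have gf: "G (F v) = v" if "v \<in> carrier V" for v using that by (metis compose_eq restrict_apply')
    have "compose (carrier V') F G = (\<lambda>v\<in>carrier V'. v)"
      using c(3) c2[OF G(1)] G arr_id[OF N.fi_colim_axioms]
      by (intro NN.arr_eqD rep_maps_compose[OF N.inj_rep_axioms G(1) F] rep_maps_id[OF N.inj_rep_axioms]) simp
    then have fg: "F (G v) = v" if "v \<in> carrier V'" for v using that by (metis compose_eq restrict_apply')
    have "G v \<in> carrier V" if "v \<in> carrier V'" for v using G(1) that by (auto simp: rep_maps_def dest: lin_mapsD(1))
    then show "bij_betw F (carrier V) (carrier V')"
      using gf fg F.lin.closed by (intro bij_betw_byWitness[where f' = G]) auto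
  next
    assume b: "bij_betw F (carrier V) (carrier V')"
    define G where "G = restrict (inv_into (carrier V) F) (carrier V')"
    have G: "G \<in> rep_maps K V' act' V act" unfolding G_def by (rule F.inverse_rep[OF b])
    have "compose (carrier V) G F = (\<lambda>v\<in>carrier V. v)" "compose (carrier V') F G = (\<lambda>v\<in>carrier V'. v)"
      using b F.lin.closed by (auto simp: G_def compose_def fun_eq_iff bij_betw_def f_inv_into_f)
    then show "is_iso (Gen K) M N (arr F)"
      unfolding is_iso_def using arr_hom[OF F] op.arr_hom[OF G] c1[OF G] c2[OF G]
        arr_id[OF M.fi_colim_axioms] arr_id[OF N.fi_colim_axioms] by metis
  qed
qed

lemma is_iso_iff:
  "(\<exists>c. is_iso (Gen K) M N c) \<longleftrightarrow> (\<exists>F\<in>rep_maps K V act V' act'. bij_betw F (carrier V) (carrier V'))"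
proof
  assume "\<exists>c. is_iso (Gen K) M N c"
  then obtain c where c: "is_iso (Gen K) M N c" by blast
  then have "c \<in> Hom (Gen K) M N" by (simp add: is_iso_def)
  then obtain F where "F \<in> rep_maps K V act V' act'" "c = arr F" by (rule hom_arr)
  then show "\<exists>F\<in>rep_maps K V act V' act'. bij_betw F (carrier V) (carrier V')" using c is_iso_arr by blast
qed (use is_iso_arr in blast)

text \<open>As for modules, the kernel is the test object, realized by \<open>restrict_FI\<close>.
  For the converse every test object needs a colimit with elements in \<open>'v\<close>, which
  explains the assumption on the universe.\<close>

lemma is_mono_arr:
  assumes inf: "infinite (UNIV :: 'v set)" and F: "F \<in> rep_maps K V act V' act'"
  shows "is_mono (Gen K) M N (arr F) \<longleftrightarrow> inj_on F (carrier V)"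
proof
  interpret F: rep_map K V act V' act' F using F M.inj_rep_axioms N.inj_rep_axioms by (simp add: rep_map_iff)
  {
    assume m: "is_mono (Gen K) M N (arr F)"
    define W where "W = {v \<in> carrier V. F v = \<zero>\<^bsub>V'\<^esub>}"
    have W: "subrep K V act W" unfolding W_def by (rule F.kernel_subrep)
    let ?Z = "restrict_FI M (M.sub_of W)" and ?a = "\<lambda>g. restrict (act g) W" and ?VW = "V\<lparr>carrier := W\<rparr>"
    have colZ: "fi_colim K ?Z ?VW ?a \<iota>" by (rule M.restrict_colim[OF W])
    interpret Z: fi_colim K ?Z ?VW ?a \<iota> by (rule colZ)
    interpret ZM: gen_pair K ?Z ?VW ?a \<iota> M V act \<iota> by (intro gen_pair.intro colZ M.fi_colim_axioms)
    interpret ZN: gen_pair K ?Z ?VW ?a \<iota> N V' act' \<iota>' by (intro gen_pair.intro colZ N.fi_colim_axioms)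
    have i: "(\<lambda>v\<in>W. v) \<in> rep_maps K ?VW ?a V act" by (rule rep_maps_incl[OF M.inj_rep_axioms W])
    have z: "(\<lambda>v\<in>W. \<zero>\<^bsub>V\<^esub>) \<in> rep_maps K ?VW ?a V act"
      using rep_maps_zero[OF Z.inj_rep_axioms M.inj_rep_axioms] by simp
    have "compose W F (\<lambda>v\<in>W. v) = compose W F (\<lambda>v\<in>W. \<zero>\<^bsub>V\<^esub>)"
      by (auto simp: compose_def fun_eq_iff W_def F.lin.zero)
    then have "Comp (Gen K) ?Z M N (arr F) (ZM.arr (\<lambda>v\<in>W. v)) = Comp (Gen K) ?Z M N (arr F) (ZM.arr (\<lambda>v\<in>W. \<zero>\<^bsub>V\<^esub>))"
      using arr_comp[OF colZ M.fi_colim_axioms N.fi_colim_axioms i F] arr_comp[OF colZ M.fi_colim_axioms N.fi_colim_axioms z F]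
      by simp
    then have "ZM.arr (\<lambda>v\<in>W. v) = ZM.arr (\<lambda>v\<in>W. \<zero>\<^bsub>V\<^esub>)"
      using m ZM.arr_hom[OF i] ZM.arr_hom[OF z] Z.FI unfolding is_mono_def by (metis Gen_simps(1))
    then have "(\<lambda>v\<in>W. v) = (\<lambda>v\<in>W. \<zero>\<^bsub>V\<^esub>)" by (rule ZM.arr_eqD[OF i z])
    then have "v = \<zero>\<^bsub>V\<^esub>" if "v \<in> W" for v using that by (metis restrict_apply')
    then show "inj_on F (carrier V)" by (auto simp: F.lin.inj_iff W_def)
  }
  assume j: "inj_on F (carrier V)"
  show "is_mono (Gen K) M N (arr F)"
    unfolding is_mono_def
  proof (intro conjI ballI impI)
    show "arr F \<in> Hom (Gen K) M N" by (rule arr_hom[OF F])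
    fix Z :: "('k, 'v) fi_mod" and c d
    assume "Z \<in> Ob (Gen K)" and c: "c \<in> Hom (Gen K) Z M" and d: "d \<in> Hom (Gen K) Z M"
      and eq: "Comp (Gen K) Z M N (arr F) c = Comp (Gen K) Z M N (arr F) d"
    then have "fi K Z" by (simp add: fi_def)
    then obtain VZ :: "('k, 'v) module" and aZ \<iota>Z where colZ: "fi_colim K Z VZ aZ \<iota>Z"
      using fi.colim_ex[OF _ inf M.R.ring_axioms] by blast
    interpret Z: fi_colim K Z VZ aZ \<iota>Z by (rule colZ)
    interpret ZM: gen_pair K Z VZ aZ \<iota>Z M V act \<iota> by (intro gen_pair.intro colZ M.fi_colim_axioms)
    interpret ZN: gen_pair K Z VZ aZ \<iota>Z N V' act' \<iota>' by (intro gen_pair.intro colZ N.fi_colim_axioms)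
    obtain A where A: "A \<in> rep_maps K VZ aZ V act" "c = ZM.arr A" using ZM.hom_arr[OF c] by blast
    obtain B where B: "B \<in> rep_maps K VZ aZ V act" "d = ZM.arr B" using ZM.hom_arr[OF d] by blast
    have "compose (carrier VZ) F A = compose (carrier VZ) F B"
      using eq arr_comp[OF colZ M.fi_colim_axioms N.fi_colim_axioms A(1) F] arr_comp[OF colZ M.fi_colim_axioms N.fi_colim_axioms B(1) F] A B
      by (intro ZN.arr_eqD rep_maps_compose[OF Z.inj_rep_axioms _ F]) simp_all
    then have FF: "F (A v) = F (B v)" if "v \<in> carrier VZ" for v using that by (metis compose_eq)
    have AB: "A \<in> lin_maps K VZ V" "B \<in> lin_maps K VZ V" using A B by (auto simp: rep_maps_def)
    have "A = B"
      by (rule lin_maps_eqI[OF AB]) (use FF j lin_mapsD(1)[OF AB(1)] lin_mapsD(1)[OF AB(2)] in \<open>meson inj_onD\<close>)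
    then show "c = d" using A B by simp
  qed
qed

lemma is_mono_iff:
  assumes "infinite (UNIV :: 'v set)"
  shows "(\<exists>c. is_mono (Gen K) M N c) \<longleftrightarrow> (\<exists>F\<in>rep_maps K V act V' act'. inj_on F (carrier V))"
proof
  assume "\<exists>c. is_mono (Gen K) M N c"
  then obtain c where c: "is_mono (Gen K) M N c" by blast
  then have "c \<in> Hom (Gen K) M N" by (simp add: is_mono_def)
  then obtain F where "F \<in> rep_maps K V act V' act'" "c = arr F" by (rule hom_arr)
  then show "\<exists>F\<in>rep_maps K V act V' act'. inj_on F (carrier V)" using c is_mono_arr[OF assms] by blast
qed (use is_mono_arr[OF assms] in blast)

end

context fi_colim
begin

text \<open>Zero objects are the torsion modules, that is, those with zero colimit; identity and
  zero endomorphism are distinguished on the colimit.\<close>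

lemma zero_object_iff:
  assumes inf: "infinite (UNIV :: 'v set)"
  shows "zero_object (Gen K) M \<longleftrightarrow> carrier V = {\<zero>\<^bsub>V\<^esub>}"
proof
  interpret MM: gen_pair K M V act \<iota> M V act \<iota> by (intro gen_pair.intro fi_colim_axioms)
  note i = rep_maps_id[OF inj_rep_axioms] and z = rep_maps_zero[OF inj_rep_axioms inj_rep_axioms]
  assume "zero_object (Gen K) M"
  then have "\<exists>!c. c \<in> Hom (Gen K) M M" unfolding zero_object_def by blast
  then have "MM.arr (\<lambda>v\<in>carrier V. v) = MM.arr (\<lambda>v\<in>carrier V. \<zero>\<^bsub>V\<^esub>)"
    using MM.arr_hom[OF i] MM.arr_hom[OF z] by blast
  then have "(\<lambda>v\<in>carrier V. v) = (\<lambda>v\<in>carrier V. \<zero>\<^bsub>V\<^esub>)" by (rule MM.arr_eqD[OF i z])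
  then have "v = \<zero>\<^bsub>V\<^esub>" if "v \<in> carrier V" for v using that by (metis restrict_apply')
  then show "carrier V = {\<zero>\<^bsub>V\<^esub>}" by auto
next
  assume z: "carrier V = {\<zero>\<^bsub>V\<^esub>}"
  show "zero_object (Gen K) M"
    unfolding zero_object_def
  proof (intro conjI ballI)
    show "M \<in> Ob (Gen K)" using FI by simp
    fix N :: "('k, 'v) fi_mod" assume "N \<in> Ob (Gen K)"
    then have "fi K N" by (simp add: fi_def)
    then obtain V' :: "('k, 'v) module" and act' \<iota>' where colN: "fi_colim K N V' act' \<iota>'"
      using fi.colim_ex[OF _ inf R.ring_axioms] by blast
    interpret N: fi_colim K N V' act' \<iota>' by (rule colN)
    interpret MN: gen_pair K M V act \<iota> N V' act' \<iota>' by (intro gen_pair.intro colN fi_colim_axioms)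
    interpret NM: gen_pair K N V' act' \<iota>' M V act \<iota> by (intro gen_pair.intro colN fi_colim_axioms)
    have 1: "F = (\<lambda>v\<in>carrier V. \<zero>\<^bsub>V'\<^esub>)" if F: "F \<in> rep_maps K V act V' act'" for F
    proof -
      interpret F: rep_map K V act V' act' F using F inj_rep_axioms N.inj_rep_axioms by (simp add: rep_map_iff)
      show ?thesis using F.lin.zero F.lin.ext z by (auto simp: fun_eq_iff extensional_def)
    qed
    have 2: "F = (\<lambda>v\<in>carrier V'. \<zero>\<^bsub>V\<^esub>)" if F: "F \<in> rep_maps K V' act' V act" for F
    proof -
      interpret F: rep_map K V' act' V act F using F inj_rep_axioms N.inj_rep_axioms by (simp add: rep_map_iff)
      show ?thesis using F.lin.closed F.lin.ext z by (auto simp: fun_eq_iff extensional_def)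
    qed
    show "\<exists>!c. c \<in> Hom (Gen K) M N"
    proof (rule ex1I)
      show "MN.arr (\<lambda>v\<in>carrier V. \<zero>\<^bsub>V'\<^esub>) \<in> Hom (Gen K) M N"
        by (rule MN.arr_hom[OF rep_maps_zero[OF inj_rep_axioms N.inj_rep_axioms]])
      fix c assume "c \<in> Hom (Gen K) M N"
      then obtain F where "F \<in> rep_maps K V act V' act'" "c = MN.arr F" by (rule MN.hom_arr)
      then show "c = MN.arr (\<lambda>v\<in>carrier V. \<zero>\<^bsub>V'\<^esub>)" using 1 by simp
    qed
    show "\<exists>!c. c \<in> Hom (Gen K) N M"
    proof (rule ex1I)
      show "NM.arr (\<lambda>v\<in>carrier V'. \<zero>\<^bsub>V\<^esub>) \<in> Hom (Gen K) N M"
        by (rule NM.arr_hom[OF rep_maps_zero[OF N.inj_rep_axioms inj_rep_axioms]])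
      fix c assume "c \<in> Hom (Gen K) N M"
      then obtain F where "F \<in> rep_maps K V' act' V act" "c = NM.arr F" by (rule NM.hom_arr)
      then show "c = NM.arr (\<lambda>v\<in>carrier V'. \<zero>\<^bsub>V\<^esub>)" using 2 by simp
    qed
  qed
qed

text \<open>Subrepresentations of the colimit give subobjects of \<open>M\<close>, and the image of
  a monomorphism into \<open>M\<close> gives a subrepresentation, so irreducibility passes in both
  directions.\<close>

lemma irreducible_iff:
  assumes inf: "infinite (UNIV :: 'v set)"
  shows "irreducible_object (Gen K) M \<longleftrightarrow> simple_rep K V act"
proof
  assume irr: "irreducible_object (Gen K) M"
  show "simple_rep K V act"
    unfolding simple_rep_def
  proof (intro conjI allI impI)
    show "inj_rep K V act" by (rule inj_rep_axioms)
    show "carrier V \<noteq> {\<zero>\<^bsub>V\<^esub>}" using irr zero_object_iff[OF inf] by (simp add: irreducible_object_def)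
    fix W assume W: "subrep K V act W"
    let ?Z = "restrict_FI M (sub_of W)" and ?a = "\<lambda>g. restrict (act g) W" and ?VW = "V\<lparr>carrier := W\<rparr>"
    have colZ: "fi_colim K ?Z ?VW ?a \<iota>" by (rule restrict_colim[OF W])
    interpret Z: fi_colim K ?Z ?VW ?a \<iota> by (rule colZ)
    interpret ZM: gen_pair K ?Z ?VW ?a \<iota> M V act \<iota> by (intro gen_pair.intro colZ fi_colim_axioms)
    have i: "(\<lambda>v\<in>W. v) \<in> rep_maps K ?VW ?a V act" by (rule rep_maps_incl[OF inj_rep_axioms W])
    have "is_mono (Gen K) ?Z M (ZM.arr (\<lambda>v\<in>W. v))" using ZM.is_mono_arr[OF inf i] by (simp add: inj_on_def)
    then have "zero_object (Gen K) ?Z \<or> is_iso (Gen K) ?Z M (ZM.arr (\<lambda>v\<in>W. v))"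
      using irr Z.FI unfolding irreducible_object_def by (metis Gen_simps(1))
    then show "W = {\<zero>\<^bsub>V\<^esub>} \<or> W = carrier V"
      using Z.zero_object_iff[OF inf] ZM.is_iso_arr[OF i] by (auto simp: bij_betw_def)
  qed
next
  assume s: "simple_rep K V act"
  show "irreducible_object (Gen K) M"
    unfolding irreducible_object_def
  proof (intro conjI ballI allI impI)
    show "M \<in> Ob (Gen K)" using FI by simp
    show "\<not> zero_object (Gen K) M" using s zero_object_iff[OF inf] by (simp add: simple_rep_def)
    fix N :: "('k, 'v) fi_mod" and c assume "N \<in> Ob (Gen K)" and m: "is_mono (Gen K) N M c"
    then have "fi K N" by (simp add: fi_def)
    then obtain V' :: "('k, 'v) module" and act' \<iota>' where colN: "fi_colim K N V' act' \<iota>'"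
      using fi.colim_ex[OF _ inf R.ring_axioms] by blast
    interpret N: fi_colim K N V' act' \<iota>' by (rule colN)
    interpret NM: gen_pair K N V' act' \<iota>' M V act \<iota> by (intro gen_pair.intro colN fi_colim_axioms)
    have "c \<in> Hom (Gen K) N M" using m by (simp add: is_mono_def)
    then obtain F where F: "F \<in> rep_maps K V' act' V act" "c = NM.arr F" using NM.hom_arr by blast
    interpret F: rep_map K V' act' V act F using F inj_rep_axioms N.inj_rep_axioms by (simp add: rep_map_iff)
    have j: "inj_on F (carrier V')" using NM.is_mono_arr[OF inf F(1)] m F(2) by simp
    have "subrep K V' act' (carrier V')" by (simp add: subrep_def N.carrier_submodule N.act_closed)
    then have "F ` carrier V' = {\<zero>\<^bsub>V\<^esub>} \<or> F ` carrier V' = carrier V"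
      using s F.image_subrep unfolding simple_rep_def by blast
    then show "zero_object (Gen K) N \<or> is_iso (Gen K) N M c"
    proof
      assume "F ` carrier V' = {\<zero>\<^bsub>V\<^esub>}"
      then have "\<forall>v\<in>carrier V'. F v = \<zero>\<^bsub>V\<^esub>" by auto
      then have "carrier V' = {\<zero>\<^bsub>V'\<^esub>}" using j F.lin.inj_iff N.M.zero_closed by blast
      then show ?thesis using N.zero_object_iff[OF inf] by simp
    next
      assume "F ` carrier V' = carrier V"
      then show ?thesis using NM.is_iso_arr[OF F(1)] F(2) j by (simp add: bij_betw_def)
    qed
  qed
qed

end

section \<open>Induced FI-modules\<close>

lemma FI_mapsI:
  assumes "\<psi> \<in> extensional (Ob FI)" "\<And>X. finite X \<Longrightarrow> \<psi> X \<in> lin_maps K (FOb M X) (FOb N X)"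
    "\<And>X Y f x. finite X \<Longrightarrow> finite Y \<Longrightarrow> f \<in> Hom FI X Y \<Longrightarrow> x \<in> carrier (FOb M X) \<Longrightarrow>
      \<psi> Y (FMap M X Y f x) = FMap N X Y f (\<psi> X x)"
  shows "\<psi> \<in> FI_maps K M N"
  using assms by (auto simp: FI_maps_def PiE_def simp del: FI_simps(2))

lemma FI_mapsD:
  assumes "\<psi> \<in> FI_maps K M N"
  shows "\<psi> \<in> extensional (Ob FI)" "finite X \<Longrightarrow> \<psi> X \<in> lin_maps K (FOb M X) (FOb N X)"
    "finite X \<Longrightarrow> finite Y \<Longrightarrow> f \<in> Hom FI X Y \<Longrightarrow> x \<in> carrier (FOb M X) \<Longrightarrow>
      \<psi> Y (FMap M X Y f x) = FMap N X Y f (\<psi> X x)"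
  using assms by (auto simp: FI_maps_def PiE_def simp del: FI_simps(2))

lemma FI_maps_eqI:
  assumes \<psi>: "\<psi> \<in> FI_maps K M N" and \<theta>: "\<theta> \<in> FI_maps K M N"
    and e: "\<And>X x. finite X \<Longrightarrow> x \<in> carrier (FOb M X) \<Longrightarrow> \<psi> X x = \<theta> X x"
  shows "\<psi> = \<theta>"
proof (rule extensionalityI[OF FI_mapsD(1)[OF \<psi>] FI_mapsD(1)[OF \<theta>]])
  fix X assume "X \<in> Ob FI"
  then have X: "finite X" by simp
  show "\<psi> X = \<theta> X" by (rule lin_maps_eqI[OF FI_mapsD(2)[OF \<psi> X] FI_mapsD(2)[OF \<theta> X] e[OF X]])
qed

definition FI_comp where
  "FI_comp M \<psi> \<theta> = (\<lambda>X\<in>Ob FI. compose (carrier (FOb M X)) (\<psi> X) (\<theta> X))"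

lemma FI_comp_apply: "finite X \<Longrightarrow> x \<in> carrier (FOb M X) \<Longrightarrow> FI_comp M \<psi> \<theta> X x = \<psi> X (\<theta> X x)"
  by (simp add: FI_comp_def compose_eq)

lemma FI_comp_maps:
  assumes M: "FI_module K M" and \<theta>: "\<theta> \<in> FI_maps K M N" and \<psi>: "\<psi> \<in> FI_maps K N P"
  shows "FI_comp M \<psi> \<theta> \<in> FI_maps K M P"
proof (rule FI_mapsI)
  interpret M: fi K M by (rule fi.intro[OF M])
  show "FI_comp M \<psi> \<theta> \<in> extensional (Ob FI)" by (simp add: FI_comp_def)
  show "FI_comp M \<psi> \<theta> X \<in> lin_maps K (FOb M X) (FOb P X)" if "finite X" for X
    using lin_maps_compose[OF M.mod[OF that] FI_mapsD(2)[OF \<theta> that] FI_mapsD(2)[OF \<psi> that]] that by (simp add: FI_comp_def)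
  show "FI_comp M \<psi> \<theta> Y (FMap M X Y f x) = FMap P X Y f (FI_comp M \<psi> \<theta> X x)"
    if "finite X" "finite Y" "f \<in> Hom FI X Y" "x \<in> M.C X" for X Y f x
    using that FI_mapsD(3)[OF \<theta> that] FI_mapsD(3)[OF \<psi> that(1-3)] lin_mapsD(1)[OF FI_mapsD(2)[OF \<theta> that(1)] that(4)]
      M.map_closed[OF that] by (simp add: FI_comp_apply)
qed

definition FI_id where "FI_id M = (\<lambda>X\<in>Ob FI. \<lambda>x\<in>carrier (FOb M X). x)"

lemma FI_id_maps: "FI_module K M \<Longrightarrow> FI_id M \<in> FI_maps K M M"
proof (rule FI_mapsI)
  assume M: "FI_module K M"
  interpret M: fi K M by (rule fi.intro[OF M])
  show "FI_id M X \<in> lin_maps K (FOb M X) (FOb M X)" if "finite X" for X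
    using lin_maps_id[OF M.mod[OF that]] that by (simp add: FI_id_def)
  show "FI_id M Y (FMap M X Y f x) = FMap M X Y f (FI_id M X x)"
    if "finite X" "finite Y" "f \<in> Hom FI X Y" "x \<in> M.C X" for X Y f x
    using that M.map_closed[OF that] by (simp add: FI_id_def)
qed (simp add: FI_id_def)

lemma FI_id_apply: "finite X \<Longrightarrow> x \<in> carrier (FOb M X) \<Longrightarrow> FI_id M X x = x"
  by (simp add: FI_id_def)

text \<open>An isomorphism on all levels carries over the whole colimit cocone without changing the
  representation.\<close>

lemma fi_colim_iso:
  assumes colim: "fi_colim K M V act \<iota>" and N: "FI_module K N" and \<theta>: "\<theta> \<in> FI_maps K N M"
    and bij: "\<And>X. finite X \<Longrightarrow> bij_betw (\<theta> X) (carrier (FOb N X)) (carrier (FOb M X))"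
  shows "fi_colim K N V act (\<lambda>X x. \<iota> X (\<theta> X x))"
proof -
  interpret M: fi_colim K M V act \<iota> by fact
  interpret N: fi K N by (rule fi.intro[OF N])
  have lin: "lin_map K (FOb N X) (FOb M X) (\<theta> X)" if "finite X" for X
    using FI_mapsD(2)[OF \<theta> that] N.mod[OF that] M.mod[OF that] by (simp add: lin_map_iff)
  note cl = lin_map.closed[OF lin]
  show ?thesis
  proof (intro fi_colim.intro fi_colim_axioms.intro M.inj_rep_axioms N.fi_axioms)
    show "\<iota> Y (\<theta> Y (FMap N X Y f u)) = act g (\<iota> X (\<theta> X u))"
      if X: "finite X" "finite Y" and f: "f \<in> Hom FI X Y" and g: "inj g" "\<And>x. x \<in> X \<Longrightarrow> g x = f x" and u: "u \<in> N.C X" for X Y f g u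
      unfolding FI_mapsD(3)[OF \<theta> X f u] by (rule M.\<iota>_map[OF X f g cl[OF X(1) u]])
    show "\<exists>Y f. finite Y \<and> f \<in> Hom FI X Y \<and> FMap N X Y f x = \<zero>\<^bsub>FOb N Y\<^esub>"
      if X: "finite X" and x: "x \<in> N.C X" "\<iota> X (\<theta> X x) = \<zero>\<^bsub>V\<^esub>" for X x
    proof -
      obtain Y f where Y: "finite Y" "f \<in> Hom FI X Y" "FMap M X Y f (\<theta> X x) = \<zero>\<^bsub>FOb M Y\<^esub>"
        using M.\<iota>_kernel[OF X cl[OF X x(1)] x(2)] by blast
      interpret Y: lin_map K "FOb N Y" "FOb M Y" "\<theta> Y" by (rule lin[OF Y(1)])
      have "\<theta> Y (FMap N X Y f x) = \<theta> Y \<zero>\<^bsub>FOb N Y\<^esub>" using Y(3) FI_mapsD(3)[OF \<theta> X Y(1,2) x(1)] Y.zero by simp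
      then have "FMap N X Y f x = \<zero>\<^bsub>FOb N Y\<^esub>"
        using bij[OF Y(1)] N.map_closed[OF X Y(1,2) x(1)] Y.M.M.zero_closed by (auto simp: bij_betw_def dest: inj_onD)
      then show ?thesis using Y by blast
    qed
    show "\<exists>X x. finite X \<and> x \<in> N.C X \<and> v = \<iota> X (\<theta> X x)" if v: "v \<in> carrier V" for v
    proof -
      obtain X x where X: "finite X" "x \<in> M.C X" "v = \<iota> X x" using M.\<iota>_surj[OF v] by blast
      have "x \<in> \<theta> X ` N.C X" using bij[OF X(1)] X(2) by (simp add: bij_betw_def)
      then show ?thesis using X by blast
    qed
  qed (auto simp: cl M.\<iota>_closed M.\<iota>_add M.\<iota>_smult lin_map.add[OF lin] lin_map.smult[OF lin])
qed

text \<open>Transport of structure along a coding \<open>e\<close>. It moves the concrete model of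
  the induced module, whose elements are functions, into the type \<open>'v\<close> demanded by
  \<open>induced_FI\<close>.\<close>

definition transport :: "('w \<Rightarrow> 'v) \<Rightarrow> ('k, 'w) module \<Rightarrow> ('k, 'v) module" where
  "transport e V = \<lparr>carrier = e ` carrier V, mult = undefined, one = undefined, zero = e \<zero>\<^bsub>V\<^esub>,
     add = (\<lambda>x y. e (inv_into (carrier V) e x \<oplus>\<^bsub>V\<^esub> inv_into (carrier V) e y)),
     smult = (\<lambda>a x. e (a \<odot>\<^bsub>V\<^esub> inv_into (carrier V) e x))\<rparr>"

lemma transport_module:
  assumes V: "left_module K V" and e: "inj_on e (carrier V)"
  shows "left_module K (transport e V)" "restrict e (carrier V) \<in> lin_maps K V (transport e V)"
    "bij_betw (restrict e (carrier V)) (carrier V) (carrier (transport e V))"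
proof -
  interpret V: left_module K V by fact
  have d: "inv_into (carrier V) e (e x) = x" if "x \<in> carrier V" for x using that e by simp
  have c: "carrier (transport e V) = e ` carrier V" by (simp add: transport_def)
  have ops: "\<zero>\<^bsub>transport e V\<^esub> = e \<zero>\<^bsub>V\<^esub>" "x \<in> carrier V \<Longrightarrow> y \<in> carrier V \<Longrightarrow> e x \<oplus>\<^bsub>transport e V\<^esub> e y = e (x \<oplus>\<^bsub>V\<^esub> y)"
    "x \<in> carrier V \<Longrightarrow> a \<odot>\<^bsub>transport e V\<^esub> e x = e (a \<odot>\<^bsub>V\<^esub> x)" for a x y
    by (auto simp: transport_def d)
  show "left_module K (transport e V)"
  proof (rule left_moduleI[OF V.R.ring_axioms])
    show "\<exists>y\<in>carrier (transport e V). y \<oplus>\<^bsub>transport e V\<^esub> x = \<zero>\<^bsub>transport e V\<^esub>" if x: "x \<in> carrier (transport e V)" for x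
    proof -
      obtain u where "u \<in> carrier V" "x = e u" using x c by auto
      then show ?thesis by (intro bexI[of _ "e (\<ominus>\<^bsub>V\<^esub> u)"]) (auto simp: c ops V.M.l_neg)
    qed
  qed (auto simp: c ops V.M.a_ac V.smult_closed V.smult_l_distr V.smult_r_distr V.smult_assoc V.smult_one)
  show "restrict e (carrier V) \<in> lin_maps K V (transport e V)"
    by (rule lin_mapsI) (auto simp: c ops V.smult_closed)
  show "bij_betw (restrict e (carrier V)) (carrier V) (carrier (transport e V))"
    using e by (auto simp: bij_betw_def c inj_on_def)
qed

definition transport_FI :: "(nat set \<Rightarrow> 'w \<Rightarrow> 'v) \<Rightarrow> ('k, 'w) fi_mod \<Rightarrow> ('k, 'v) fi_mod" where
  "transport_FI e M = \<lparr>FOb = (\<lambda>X. transport (e X) (FOb M X)),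
     FMap = (\<lambda>X Y f. \<lambda>x\<in>e X ` carrier (FOb M X). e Y (FMap M X Y f (inv_into (carrier (FOb M X)) (e X) x)))\<rparr>"

lemma transport_FI:
  assumes M: "FI_module K M" and e: "\<And>X. finite X \<Longrightarrow> inj_on (e X) (carrier (FOb M X))"
  shows "FI_module K (transport_FI e M)"
    "(\<lambda>X\<in>Ob FI. restrict (e X) (carrier (FOb M X))) \<in> FI_maps K M (transport_FI e M)"
    "(\<lambda>X\<in>Ob FI. restrict (inv_into (carrier (FOb M X)) (e X)) (carrier (FOb (transport_FI e M) X))) \<in> FI_maps K (transport_FI e M) M"
proof -
  interpret M: fi K M by (rule fi.intro[OF M])
  let ?N = "transport_FI e M" and ?d = "\<lambda>X. inv_into (M.C X) (e X)"
  have d: "?d X (e X x) = x" if "finite X" "x \<in> M.C X" for X x using that e by simp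
  have c: "carrier (FOb ?N X) = e X ` M.C X" for X by (simp add: transport_FI_def transport_def)
  have F: "FOb ?N X = transport (e X) (FOb M X)" for X by (simp add: transport_FI_def)
  have map: "FMap ?N X Y f (e X x) = e Y (FMap M X Y f x)" if "finite X" "x \<in> M.C X" for X Y f x
    using that d by (simp add: transport_FI_def)
  have mapx: "FMap ?N X Y f \<in> extensional (e X ` M.C X)" for X Y f by (simp add: transport_FI_def)
  note T = transport_module[OF M.mod e]
  have el: "restrict (e X) (M.C X) \<in> lin_maps K (FOb M X) (FOb ?N X)" if "finite X" for X using T(2) that F by simp
  have ea: "e X x \<oplus>\<^bsub>FOb ?N X\<^esub> e X y = e X (x \<oplus>\<^bsub>FOb M X\<^esub> y)" if "finite X" "x \<in> M.C X" "y \<in> M.C X" for X x y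
    using that d F by (simp add: transport_def)
  have es: "a \<odot>\<^bsub>FOb ?N X\<^esub> e X x = e X (a \<odot>\<^bsub>FOb M X\<^esub> x)" if "finite X" "x \<in> M.C X" for X a x
    using that d F by (simp add: transport_def)
  show "FI_module K ?N"
  proof (rule FI_moduleI)
    fix X :: "nat set" assume X: "finite X"
    interpret X: left_module K "FOb M X" by (rule M.mod[OF X])
    show "left_module K (FOb ?N X)" using T(1)[OF X X] F by simp
    show "FMap ?N X X (\<lambda>x\<in>X. x) u = u" if "u \<in> carrier (FOb ?N X)" for u
      using that map[OF X] M.inc_id[OF X] by (auto simp: c)
    fix Y f assume Y: "finite Y" and f: "f \<in> Hom FI X Y"
    interpret f: lin_map K "FOb M X" "FOb M Y" "FMap M X Y f" by (rule M.lin[OF X Y f])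
    show "FMap ?N X Y f \<in> lin_maps K (FOb ?N X) (FOb ?N Y)"
    proof (rule lin_mapsI)
      show "FMap ?N X Y f \<in> extensional (carrier (FOb ?N X))" using mapx c by simp
    qed (auto simp: c ea[OF X] es[OF X] map[OF X] ea[OF Y] es[OF Y] f.closed f.add f.smult X.smult_closed)
    show "FMap ?N X Z (compose X g f) u = FMap ?N Y Z g (FMap ?N X Y f u)"
      if "finite Z" "g \<in> Hom FI Y Z" "u \<in> carrier (FOb ?N X)" for Z g u
      using M.map_comp[OF X Y that(1) f that(2)] f.closed that(3) by (auto simp: c map[OF X] map[OF Y])
  qed
  show "(\<lambda>X\<in>Ob FI. restrict (e X) (M.C X)) \<in> FI_maps K M ?N"
    by (rule FI_mapsI) (use el map M.map_closed in \<open>simp_all del: FI_simps(2)\<close>)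
  show "(\<lambda>X\<in>Ob FI. restrict (?d X) (carrier (FOb ?N X))) \<in> FI_maps K ?N M"
  proof (rule FI_mapsI)
    show "(\<lambda>X\<in>Ob FI. restrict (?d X) (carrier (FOb ?N X))) X \<in> lin_maps K (FOb ?N X) (FOb M X)" if X: "finite X" for X
    proof -
      interpret E: lin_map K "FOb M X" "FOb ?N X" "restrict (e X) (M.C X)"
        using M.mod[OF X] T(1)[OF X X] F el[OF X] by (simp add: lin_map_iff)
      have "restrict (inv_into (M.C X) (restrict (e X) (M.C X))) (carrier (FOb ?N X)) = restrict (?d X) (carrier (FOb ?N X))"
      proof (rule restrict_ext)
        fix u assume "u \<in> carrier (FOb ?N X)"
        then obtain x where "x \<in> M.C X" "u = e X x" using c by auto
        then show "inv_into (M.C X) (restrict (e X) (M.C X)) u = ?d X u"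
          using d[OF X] e[OF X] inv_into_f_f[of "restrict (e X) (M.C X)" "M.C X" x] by (simp add: inj_on_restrict_eq)
      qed
      then show ?thesis using E.inverse T(3)[OF X X] F X by simp
    qed
    show "(\<lambda>X\<in>Ob FI. restrict (?d X) (carrier (FOb ?N X))) Y (FMap ?N X Y f u) =
        FMap M X Y f ((\<lambda>X\<in>Ob FI. restrict (?d X) (carrier (FOb ?N X))) X u)"
      if X: "finite X" "finite Y" and f: "f \<in> Hom FI X Y" and u: "u \<in> carrier (FOb ?N X)" for X Y f u
    proof -
      obtain x where "x \<in> M.C X" "u = e X x" using u c by auto
      then show ?thesis using X M.map_closed[OF X f] d by (simp add: map c)
    qed
  qed simp
qed

section \<open>Evaluation at \<open>{1..n}\<close> as a permutation representation\<close>

abbreviation "perm_act n M \<equiv> (\<lambda>\<sigma>. FMap M {1..n} {1..n} (restrict \<sigma> {1..n}))"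

lemma eval_at_perm_rep:
  assumes "FI_module K M"
  shows "perm_rep K n (FOb M {1..n}) (perm_act n M)"
proof -
  interpret M: fi K M by (rule fi.intro[OF assms])
  have h: "restrict \<sigma> {1..n} \<in> Hom FI {1..n} {1..n}" if "\<sigma> permutes {1..n}" for \<sigma>
    using permutes_in_image[OF that] permutes_inj[OF that] by (auto simp: inj_on_def dest: injD)
  have lin: "lin_map K (FOb M {1..n}) (FOb M {1..n}) (FMap M {1..n} {1..n} (restrict \<sigma> {1..n}))"
    if "\<sigma> permutes {1..n}" for \<sigma> using M.lin[OF _ _ h[OF that]] by simp
  show ?thesis
  proof (intro perm_rep.intro perm_rep_axioms.intro)
    show "left_module K (FOb M {1..n})" by (rule M.mod) simp
    show "FMap M {1..n} {1..n} (restrict id {1..n}) x = x" if "x \<in> M.C {1..n}" for x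
      using M.inc_id[OF _ that] by (simp add: id_def)
    show "FMap M {1..n} {1..n} (restrict (\<sigma> \<circ> \<tau>) {1..n}) x =
        FMap M {1..n} {1..n} (restrict \<sigma> {1..n}) (FMap M {1..n} {1..n} (restrict \<tau> {1..n}) x)"
      if s: "\<sigma> permutes {1..n}" and t: "\<tau> permutes {1..n}" and x: "x \<in> M.C {1..n}" for \<sigma> \<tau> x
    proof -
      have "compose {1..n} (restrict \<sigma> {1..n}) (restrict \<tau> {1..n}) = restrict (\<sigma> \<circ> \<tau>) {1..n}"
        using permutes_in_image[OF t] by (auto simp: compose_def restrict_def fun_eq_iff)
      then show ?thesis using M.map_comp[OF _ _ _ h[OF t] h[OF s] x] by simp
    qed
  qed (simp_all add: lin_map.closed[OF lin] lin_map.add[OF lin] lin_map.smult[OF lin])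
qed

lemma eval_at_alg_module: "eval_at n M = alg_module n (FOb M {1..n}) (perm_act n M)"
  by (simp add: eval_at_def alg_module_def Let_def)

text \<open>Needed because a module recovered from the group algebra agrees with the original one
  only on its carrier.\<close>

lemma perm_maps_cong:
  assumes "perm_rep K n E' \<rho>'" and "carrier E'' = carrier E'" "add E'' = add E'"
    "\<And>a x. a \<in> carrier K \<Longrightarrow> x \<in> carrier E' \<Longrightarrow> a \<odot>\<^bsub>E''\<^esub> x = a \<odot>\<^bsub>E'\<^esub> x"
    "\<And>\<sigma> x. \<sigma> permutes {1..n} \<Longrightarrow> x \<in> carrier E' \<Longrightarrow> \<rho>'' \<sigma> x = \<rho>' \<sigma> x"
  shows "perm_maps K n E \<rho> E'' \<rho>'' = perm_maps K n E \<rho> E' \<rho>'"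
  unfolding perm_maps_def lin_maps_def assms(2,3)
proof (rule Collect_cong)
  fix h
  have "h x \<in> carrier E'" if "h \<in> carrier E \<rightarrow>\<^sub>E carrier E'" "x \<in> carrier E" for x using that by auto
  then show "(h \<in> {f \<in> carrier E \<rightarrow>\<^sub>E carrier E'.
        (\<forall>x\<in>carrier E. \<forall>y\<in>carrier E. f (x \<oplus>\<^bsub>E\<^esub> y) = f x \<oplus>\<^bsub>E'\<^esub> f y) \<and>
        (\<forall>a\<in>carrier K. \<forall>x\<in>carrier E. f (a \<odot>\<^bsub>E\<^esub> x) = a \<odot>\<^bsub>E''\<^esub> f x)} \<and>
      (\<forall>\<sigma>. \<sigma> permutes {1..n} \<longrightarrow> (\<forall>x\<in>carrier E. h (\<rho> \<sigma> x) = \<rho>'' \<sigma> (h x)))) \<longleftrightarrow>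
      (h \<in> {f \<in> carrier E \<rightarrow>\<^sub>E carrier E'.
        (\<forall>x\<in>carrier E. \<forall>y\<in>carrier E. f (x \<oplus>\<^bsub>E\<^esub> y) = f x \<oplus>\<^bsub>E'\<^esub> f y) \<and>
        (\<forall>a\<in>carrier K. \<forall>x\<in>carrier E. f (a \<odot>\<^bsub>E\<^esub> x) = a \<odot>\<^bsub>E'\<^esub> f x)} \<and>
      (\<forall>\<sigma>. \<sigma> permutes {1..n} \<longrightarrow> (\<forall>x\<in>carrier E. h (\<rho> \<sigma> x) = \<rho>' \<sigma> (h x))))"
    using assms(4,5) by auto
qed

lemma eval_at_lin_maps:
  assumes K: "ring K" and E: "left_module (alg K n) E" and M: "FI_module K M"
  shows "lin_maps (alg K n) E (eval_at n M) =
    perm_maps K n (base_module K n E) (base_action K n E) (FOb M {1..n}) (perm_act n M)"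
proof -
  interpret P: perm_rep K n "FOb M {1..n}" "\<lambda>\<sigma>. FMap M {1..n} {1..n} (restrict \<sigma> {1..n})"
    by (rule eval_at_perm_rep[OF M])
  show ?thesis
    unfolding eval_at_alg_module lin_maps_alg[OF K E P.alg_module_left_module[OF ring_group_algebra[OF K]]]
    by (rule perm_maps_cong[OF P.perm_rep_axioms]) (simp_all add: P.base_alg_module)
qed

context perm_rep
begin

text \<open>The value at \<open>X\<close> of the induced FI-module: one copy of \<open>E\<close> for
  each subset of \<open>X\<close> with \<open>n\<close> elements.\<close>

definition sections :: "nat set \<Rightarrow> ((nat \<Rightarrow> nat) \<Rightarrow> 'v) set" where
  "sections X = {\<phi> \<in> carrier V. vanishes_off X \<phi>}"

text \<open>Only injections of all natural numbers act on functions. On \<open>sections X\<close>,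
  for finite \<open>X\<close>, the choice of an extension has no effect: see
  \<open>sec_map\<close>.\<close>

definition extend :: "nat set \<Rightarrow> (nat \<Rightarrow> nat) \<Rightarrow> nat \<Rightarrow> nat" where
  "extend X f = (SOME g. inj g \<and> (\<forall>x\<in>X. g x = f x))"

definition sec_FI :: "('k, (nat \<Rightarrow> nat) \<Rightarrow> 'v) fi_mod" where
  "sec_FI = \<lparr>FOb = (\<lambda>X. V\<lparr>carrier := sections X\<rparr>), FMap = (\<lambda>X Y f. restrict (act (extend X f)) (sections X))\<rparr>"

lemma extend:
  assumes "finite X" "f \<in> Hom FI X Y" shows "inj (extend X f)" "x \<in> X \<Longrightarrow> extend X f x = f x"
proof -
  have "\<exists>g. inj g \<and> (\<forall>x\<in>X. g x = f x)" using inj_extend[OF assms(1), of f] assms(2) by (metis FI_simps(2))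
  then have "inj (extend X f) \<and> (\<forall>x\<in>X. extend X f x = f x)" unfolding extend_def by (rule someI_ex)
  then show "inj (extend X f)" "x \<in> X \<Longrightarrow> extend X f x = f x" by auto
qed

lemma sections_D: "\<phi> \<in> sections X \<Longrightarrow> \<phi> \<in> carrier V"
  "\<phi> \<in> sections X \<Longrightarrow> vanishes_off X \<phi>"
  by (auto simp: sections_def)

lemma sections_submodule: "submodule (sections X) K V"
  by (rule func.submoduleI) (auto simp: sections_def func_zero func_add func_smult func_simps smult_r_null)

lemma act_sections:
  assumes "inj g" "g ` X \<subseteq> Y" "\<phi> \<in> sections X" shows "act g \<phi> \<in> sections Y"
proof -
  note \<phi> = sections_D[OF assms(3)]
  have "act g \<phi> f = \<zero>\<^bsub>E\<^esub>" if "f \<in> injections n" "\<not> f ` {1..n} \<subseteq> Y" for f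
    using act_support[OF \<phi> that(1) assms(1)] that(2) assms(2) by blast
  then show ?thesis using act_closed[OF \<phi>(1) assms(1)] by (simp add: sections_def)
qed

lemma sec_FI_simps:
  "FOb sec_FI X = V\<lparr>carrier := sections X\<rparr>" "FMap sec_FI X Y f = restrict (act (extend X f)) (sections X)"
  by (simp_all add: sec_FI_def)

lemma sec_map:
  assumes "finite X" "f \<in> Hom FI X Y" "inj g" "\<And>x. x \<in> X \<Longrightarrow> g x = f x" "\<phi> \<in> sections X"
  shows "FMap sec_FI X Y f \<phi> = act g \<phi>"
  using func_supported[OF sections_D[OF assms(5)] extend(1)[OF assms(1,2)] assms(3)] extend(2)[OF assms(1,2)] assms(4,5)
  by (simp add: sec_FI_simps)

lemma hom_image: "f \<in> Hom FI X Y \<Longrightarrow> (\<And>x. x \<in> X \<Longrightarrow> g x = f x) \<Longrightarrow> g ` X \<subseteq> Y"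
  by auto

lemma sec_FI_module: "FI_module K sec_FI"
proof (rule FI_moduleI)
  fix X :: "nat set" assume X: "finite X"
  interpret SX: left_module K "V\<lparr>carrier := sections X\<rparr>" by (rule func.left_module_submodule[OF sections_submodule])
  show "left_module K (FOb sec_FI X)" using SX.left_module_axioms by (simp add: sec_FI_simps(1))
  show "FMap sec_FI X X (\<lambda>x\<in>X. x) \<phi> = \<phi>" if "\<phi> \<in> carrier (FOb sec_FI X)" for \<phi>
  proof -
    have \<phi>: "\<phi> \<in> sections X" using that by (simp add: sec_FI_simps(1))
    have "FMap sec_FI X X (\<lambda>x\<in>X. x) \<phi> = act id \<phi>" by (rule sec_map[OF X _ _ _ \<phi>]) (auto simp: inj_on_def)
    then show ?thesis using func.act_id sections_D[OF \<phi>] by simp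
  qed
  fix Y f assume Y: "finite Y" and f: "f \<in> Hom FI X Y"
  note e = extend[OF X f]
  have im: "extend X f ` X \<subseteq> Y" using hom_image[OF f e(2)] .
  show "FMap sec_FI X Y f \<in> lin_maps K (FOb sec_FI X) (FOb sec_FI Y)"
    unfolding sec_FI_simps
  proof (rule lin_mapsI)
    fix \<phi> assume "\<phi> \<in> carrier (V\<lparr>carrier := sections X\<rparr>)"
    then have \<phi>: "\<phi> \<in> sections X" by simp
    show "restrict (act (extend X f)) (sections X) \<phi> \<in> carrier (V\<lparr>carrier := sections Y\<rparr>)"
      using act_sections[OF e(1) im \<phi>] \<phi> by simp
    show "restrict (act (extend X f)) (sections X) (a \<odot>\<^bsub>V\<lparr>carrier := sections X\<rparr>\<^esub> \<phi>) =
        a \<odot>\<^bsub>V\<lparr>carrier := sections Y\<rparr>\<^esub> restrict (act (extend X f)) (sections X) \<phi>" if "a \<in> carrier K" for a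
      using func.act_smult[OF e(1) that sections_D(1)[OF \<phi>]] SX.smult_closed[of a \<phi>] that \<phi> by simp
    fix \<psi> assume "\<psi> \<in> carrier (V\<lparr>carrier := sections X\<rparr>)"
    then have \<psi>: "\<psi> \<in> sections X" by simp
    show "restrict (act (extend X f)) (sections X) (\<phi> \<oplus>\<^bsub>V\<lparr>carrier := sections X\<rparr>\<^esub> \<psi>) =
        restrict (act (extend X f)) (sections X) \<phi> \<oplus>\<^bsub>V\<lparr>carrier := sections Y\<rparr>\<^esub> restrict (act (extend X f)) (sections X) \<psi>"
      using func.act_add[OF e(1) sections_D(1)[OF \<phi>] sections_D(1)[OF \<psi>]] SX.M.a_closed[of \<phi> \<psi>] \<phi> \<psi> by simp
  qed simp
  fix Z g \<phi> assume Z: "finite Z" and g: "g \<in> Hom FI Y Z" and "\<phi> \<in> carrier (FOb sec_FI X)"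
  then have \<phi>: "\<phi> \<in> sections X" by (simp add: sec_FI_simps(1))
  note e' = extend[OF Y g]
  have gf: "compose X g f \<in> Hom FI X Z" using f g by (auto simp: compose_def inj_on_def PiE_iff)
  have fY: "f x \<in> Y" if "x \<in> X" for x using f that by auto
  have "FMap sec_FI X Z (compose X g f) \<phi> = act (extend Y g \<circ> extend X f) \<phi>"
    by (rule sec_map[OF X gf inj_compose[OF e'(1) e(1)] _ \<phi>]) (simp add: e(2) e'(2) fY compose_eq)
  then show "FMap sec_FI X Z (compose X g f) \<phi> = FMap sec_FI Y Z g (FMap sec_FI X Y f \<phi>)"
    using \<phi> act_sections[OF e(1) im \<phi>] func.act_comp[OF e'(1) e(1) sections_D(1)[OF \<phi>]] by (simp add: sec_FI_simps(2))
qed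

text \<open>The sections over finite sets exhaust the finitely supported functions, and the
  transition maps restrict their action, so the colimit cocone consists of inclusions.\<close>

lemma sec_colim: "fi_colim K sec_FI V act (\<lambda>X \<phi>. \<phi>)"
proof (intro fi_colim.intro fi_colim_axioms.intro fi.intro sec_FI_module func_rep)
  show "FMap sec_FI X Y f u = act g u"
    if "finite X" "finite Y" "f \<in> Hom FI X Y" "inj g" "\<And>x. x \<in> X \<Longrightarrow> g x = f x" "u \<in> carrier (FOb sec_FI X)" for X Y f g u
    using sec_map[OF that(1,3-5)] that(6) by (simp add: sec_FI_simps(1))
  show "\<exists>Y f. finite Y \<and> f \<in> Hom FI X Y \<and> FMap sec_FI X Y f x = \<zero>\<^bsub>FOb sec_FI Y\<^esub>"
    if X: "finite X" and x: "x \<in> carrier (FOb sec_FI X)" "x = \<zero>\<^bsub>V\<^esub>" for X x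
  proof -
    interpret S: fi K sec_FI by (rule fi.intro[OF sec_FI_module])
    show ?thesis
      using S.inc_id[OF X x(1)] S.inc_hom[of X X] X x(2)
      by (intro exI[of _ X] exI[of _ "\<lambda>x\<in>X. x"] conjI) (simp_all add: sec_FI_simps(1))
  qed
  show "\<exists>X x. finite X \<and> x \<in> carrier (FOb sec_FI X) \<and> v = x" if v: "v \<in> carrier V" for v
    using func_finite[OF v] v by (auto simp: sec_FI_simps sections_def)
qed (auto simp: sec_FI_simps dest: sections_D)

end

lemma injection_with_image:
  assumes "finite S" "card S = n" shows "\<exists>f\<in>injections n. f ` {1..n} = S"
proof -
  obtain h where h: "bij_betw h {1..n} S" using ex_bij_betw_nat_finite_1[OF assms(1)] assms(2) by auto
  have "restrict h {1..n} \<in> injections n" using h by (simp add: injections_def bij_betw_def inj_on_restrict_eq)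
  moreover have "restrict h {1..n} ` {1..n} = S" using h by (auto simp: bij_betw_def)
  ultimately show ?thesis by blast
qed

text \<open>An enumeration of \<open>S\<close>, which trivializes the copy of \<open>E\<close>
  belonging to that subset.\<close>

definition rep_inj :: "nat \<Rightarrow> nat set \<Rightarrow> nat \<Rightarrow> nat" where
  "rep_inj n S = (SOME f. f \<in> injections n \<and> f ` {1..n} = S)"

definition subsets_of :: "nat \<Rightarrow> nat set \<Rightarrow> nat set set" where
  "subsets_of n X = {S \<in> Pow X. card S = n}"

lemma subsets_of_finite [simp]: "finite X \<Longrightarrow> finite (subsets_of n X)"
  by (simp add: subsets_of_def)

lemma rep_inj:
  assumes "finite X" "S \<in> subsets_of n X"
  shows "rep_inj n S \<in> injections n" "rep_inj n S ` {1..n} = S" "S \<subseteq> X"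
proof -
  have "finite S" "card S = n" "S \<subseteq> X" using assms finite_subset by (auto simp: subsets_of_def)
  then have "rep_inj n S \<in> injections n \<and> rep_inj n S ` {1..n} = S"
    using injection_with_image unfolding rep_inj_def by (metis (mono_tags, lifting) someI_ex)
  then show "rep_inj n S \<in> injections n" "rep_inj n S ` {1..n} = S" "S \<subseteq> X" using \<open>S \<subseteq> X\<close> by auto
qed

lemma injection_card: "f \<in> injections n \<Longrightarrow> card (f ` {1..n}) = n"
  using card_image[of f "{1..n}"] by (simp add: injections_def)

lemma injection_same_image:
  assumes f: "f \<in> injections n" and g: "g \<in> injections n" and im: "f ` {1..n} = g ` {1..n}"
  shows "\<exists>\<sigma>. \<sigma> permutes {1..n} \<and> f = g \<circ> \<sigma>"
proof -
  define h where "h = compose {1..n} (inv_into {1..n} g) f"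
  have gh: "g (h i) = f i" and hi: "h i \<in> {1..n}" if "i \<in> {1..n}" for i
  proof -
    have m: "f i \<in> g ` {1..n}" using im that by blast
    show "g (h i) = f i" using f_inv_into_f[OF m] that by (simp add: h_def compose_eq)
    show "h i \<in> {1..n}" using inv_into_into[OF m] that by (simp add: h_def compose_eq)
  qed
  have "inj_on h {1..n}"
  proof (rule inj_onI)
    fix i j assume ij: "i \<in> {1..n}" "j \<in> {1..n}" "h i = h j"
    then have "f i = f j" using gh by metis
    then show "i = j" using f ij unfolding injections_def inj_on_def by blast
  qed
  then have h: "h \<in> injections n" by (simp add: injections_def h_def compose_extensional)
  have "h ` {1..n} = {1..n}" using hi injection_card[OF h] by (intro card_seteq) auto
  then have p: "to_perm n h permutes {1..n}" using to_perm_permutes[OF h] by blast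
  have "f i = (g \<circ> to_perm n h) i" for i
  proof (cases "i \<in> {1..n}")
    case True
    then show ?thesis using gh by (simp add: to_perm_def)
  next
    case False
    then show ?thesis using f g unfolding to_perm_def injections_def extensional_def by auto
  qed
  then show ?thesis using p by blast
qed

lemma injection_hom: "f \<in> injections n \<Longrightarrow> f ` {1..n} \<subseteq> X \<Longrightarrow> f \<in> Hom FI {1..n} X"
  unfolding FI_simps injections_def PiE_def by auto

lemma std_hom: "restrict \<sigma> {1..n} \<in> Hom FI {1..n} {1..n}" if "\<sigma> permutes {1..n}"
  using permutes_in_image[OF that] permutes_inj_on[OF that, of "{1..n}"] unfolding FI_simps by (auto simp: inj_on_restrict_eq)

context perm_rep
begin

lemma embed_sections: "e \<in> carrier E \<Longrightarrow> embed e \<in> sections {1..n}"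
  using embed_closed by (auto simp: sections_def embed_def)

context
  fixes Q :: "('k, 'z) fi_mod" and \<phi>
  assumes Q: "FI_module K Q"
    and \<phi>: "\<phi> \<in> perm_maps K n E \<rho> (FOb Q {1..n}) (perm_act n Q)"
begin

interpretation Q: fi K Q by (rule fi.intro[OF Q])

interpretation \<phi>: lin_map K E "FOb Q {1..n}" \<phi>
  using \<phi> Q.mod[of "{1..n}"] left_module_axioms by (simp add: perm_maps_def lin_map_iff)

text \<open>The contribution of the subset enumerated by \<open>f\<close> to the image of
  \<open>u\<close> under the map extending \<open>\<phi>\<close>.\<close>

definition trm :: "nat set \<Rightarrow> ((nat \<Rightarrow> nat) \<Rightarrow> 'v) \<Rightarrow> (nat \<Rightarrow> nat) \<Rightarrow> 'z" where
  "trm X u f = FMap Q {1..n} X f (\<phi> (u f))"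

lemma trm_closed:
  assumes "finite X" "u \<in> carrier V" "f \<in> injections n" "f ` {1..n} \<subseteq> X" shows "trm X u f \<in> Q.C X"
  unfolding trm_def
  by (rule Q.map_closed[OF _ assms(1) injection_hom[OF assms(3,4)] \<phi>.closed[OF func_closed[OF assms(2,3)]]]) simp

text \<open>The equivariance of \<open>u\<close> introduces the inverse of \<open>\<sigma>\<close>,
  which \<open>\<phi>\<close> carries over to \<open>Q\<close>; there it cancels against the
  \<open>\<sigma>\<close> in the FI-morphism. So only the image of \<open>f\<close> matters.\<close>

lemma trm_permute:
  assumes X: "finite X" and u: "u \<in> carrier V" and f: "f \<in> injections n" "f ` {1..n} \<subseteq> X" and \<sigma>: "\<sigma> permutes {1..n}"
  shows "trm X u (f \<circ> \<sigma>) = trm X u f"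
proof -
  have inv: "inv' \<sigma> permutes {1..n}" using \<sigma> by (rule permutes_inv)
  have fs: "f \<circ> \<sigma> \<in> injections n" by (rule injection_permute[OF f(1) \<sigma>])
  have im: "(f \<circ> \<sigma>) ` {1..n} \<subseteq> X" using f(2) unfolding image_permute[OF \<sigma>] .
  have uf: "u f \<in> carrier E" by (rule func_closed[OF u f(1)])
  have "compose {1..n} (f \<circ> \<sigma>) (restrict (inv' \<sigma>) {1..n}) = f"
  proof
    show "compose {1..n} (f \<circ> \<sigma>) (restrict (inv' \<sigma>) {1..n}) i = f i" for i
      using f(1) permutes_inverses(1)[OF \<sigma>] unfolding injections_def extensional_def
      by (cases "i \<in> {1..n}") (auto simp: compose_def)
  qed
  moreover have "\<phi> (u (f \<circ> \<sigma>)) = FMap Q {1..n} {1..n} (restrict (inv' \<sigma>) {1..n}) (\<phi> (u f))"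
    using func_permute[OF u f(1) \<sigma>] \<phi> inv uf by (simp add: perm_maps_def)
  ultimately show ?thesis
    using Q.map_comp[OF _ _ X std_hom[OF inv] injection_hom[OF fs im] \<phi>.closed[OF uf]] by (simp add: trm_def)
qed

lemma trm_same_image:
  assumes X: "finite X" and u: "u \<in> carrier V" and f: "f \<in> injections n" and g: "g \<in> injections n"
    and im: "f ` {1..n} = g ` {1..n}" "g ` {1..n} \<subseteq> X"
  shows "trm X u f = trm X u g"
  using injection_same_image[OF f g im(1)] trm_permute[OF X u g im(2)] by blast

definition lift :: "nat set \<Rightarrow> ((nat \<Rightarrow> nat) \<Rightarrow> 'v) \<Rightarrow> 'z" where
  "lift = (\<lambda>X\<in>Ob FI. \<lambda>u\<in>sections X. \<Oplus>\<^bsub>FOb Q X\<^esub>S\<in>subsets_of n X. trm X u (rep_inj n S))"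

lemma lift_apply: "finite X \<Longrightarrow> u \<in> sections X \<Longrightarrow> lift X u = (\<Oplus>\<^bsub>FOb Q X\<^esub>S\<in>subsets_of n X. trm X u (rep_inj n S))"
  by (simp add: lift_def)

lemma rep_trm_closed: "finite X \<Longrightarrow> u \<in> carrier V \<Longrightarrow> S \<in> subsets_of n X \<Longrightarrow> trm X u (rep_inj n S) \<in> Q.C X"
  using rep_inj[of X S n] by (intro trm_closed) auto

text \<open>Linearity is checked summand by summand. For naturality along \<open>h\<close>, subsets
  of \<open>X\<close> are matched with their images, and the remaining subsets of \<open>Y\<close>
  contribute zero.\<close>

lemma lift_maps: "lift \<in> FI_maps K sec_FI Q"
proof (rule FI_mapsI)
  show "lift \<in> extensional (Ob FI)" by (simp add: lift_def)
next
  fix X assume X: "finite (X :: nat set)"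
  interpret QX: left_module K "FOb Q X" by (rule Q.mod[OF X])
  interpret SX: left_module K "V\<lparr>carrier := sections X\<rparr>" by (rule func.left_module_submodule[OF sections_submodule])
  show "lift X \<in> lin_maps K (FOb sec_FI X) (FOb Q X)"
    unfolding sec_FI_simps
  proof (rule lin_mapsI)
    show "lift X \<in> extensional (carrier (V\<lparr>carrier := sections X\<rparr>))" using X by (simp add: lift_def)
    fix u assume "u \<in> carrier (V\<lparr>carrier := sections X\<rparr>)"
    then have u: "u \<in> sections X" "u \<in> carrier V" using sections_D by auto
    show "lift X u \<in> Q.C X" using X u rep_trm_closed by (auto simp: lift_apply intro!: QX.M.finsum_closed)
    have hom: "rep_inj n S \<in> Hom FI {1..n} X" if "S \<in> subsets_of n X" for S
      using rep_inj[OF X that] by (intro injection_hom) auto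
    have lin: "lin_map K (FOb Q {1..n}) (FOb Q X) (FMap Q {1..n} X (rep_inj n S))" if "S \<in> subsets_of n X" for S
      by (rule Q.lin[OF _ X hom[OF that]]) simp
    show "lift X (a \<odot>\<^bsub>V\<lparr>carrier := sections X\<rparr>\<^esub> u) = a \<odot>\<^bsub>FOb Q X\<^esub> lift X u" if a: "a \<in> carrier K" for a
    proof -
      have "lift X (a \<odot>\<^bsub>V\<^esub> u) = (\<Oplus>\<^bsub>FOb Q X\<^esub>S\<in>subsets_of n X. a \<odot>\<^bsub>FOb Q X\<^esub> trm X u (rep_inj n S))"
        unfolding lift_apply[OF X SX.smult_closed[of a u, simplified, OF a u(1)]]
      proof (rule QX.M.finsum_cong'[OF refl])
        fix S assume S: "S \<in> subsets_of n X"
        note r = rep_inj[OF X S]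
        have "(a \<odot>\<^bsub>V\<^esub> u) (rep_inj n S) = a \<odot>\<^bsub>E\<^esub> u (rep_inj n S)" by (rule func_simps(3)[OF r(1)])
        then show "trm X (a \<odot>\<^bsub>V\<^esub> u) (rep_inj n S) = a \<odot>\<^bsub>FOb Q X\<^esub> trm X u (rep_inj n S)"
          using a func_closed[OF u(2) r(1)] by (simp add: trm_def \<phi>.smult lin_map.smult[OF lin[OF S]] \<phi>.closed)
      qed (use X u a rep_trm_closed QX.smult_closed in auto)
      then show ?thesis
        using X u a rep_trm_closed by (simp add: lift_apply QX.smult_finsum)
    qed
    fix v assume "v \<in> carrier (V\<lparr>carrier := sections X\<rparr>)"
    then have v: "v \<in> sections X" "v \<in> carrier V" using sections_D by auto
    have "lift X (u \<oplus>\<^bsub>V\<^esub> v) = (\<Oplus>\<^bsub>FOb Q X\<^esub>S\<in>subsets_of n X. trm X u (rep_inj n S) \<oplus>\<^bsub>FOb Q X\<^esub> trm X v (rep_inj n S))"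
      unfolding lift_apply[OF X SX.M.a_closed[of u v, simplified, OF u(1) v(1)]]
    proof (rule QX.M.finsum_cong'[OF refl])
      fix S assume S: "S \<in> subsets_of n X"
      note r = rep_inj[OF X S]
      have "(u \<oplus>\<^bsub>V\<^esub> v) (rep_inj n S) = u (rep_inj n S) \<oplus>\<^bsub>E\<^esub> v (rep_inj n S)" by (rule func_simps(2)[OF r(1)])
      then show "trm X (u \<oplus>\<^bsub>V\<^esub> v) (rep_inj n S) = trm X u (rep_inj n S) \<oplus>\<^bsub>FOb Q X\<^esub> trm X v (rep_inj n S)"
        using func_closed[OF u(2) r(1)] func_closed[OF v(2) r(1)] by (simp add: trm_def \<phi>.add lin_map.add[OF lin[OF S]] \<phi>.closed)
    qed (use X u v rep_trm_closed in auto)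
    also have "\<dots> = lift X u \<oplus>\<^bsub>FOb Q X\<^esub> lift X v"
      unfolding lift_apply[OF X u(1)] lift_apply[OF X v(1)]
      by (rule QX.M.finsum_addf) (use X u v rep_trm_closed in auto)
    finally show "lift X (u \<oplus>\<^bsub>V\<lparr>carrier := sections X\<rparr>\<^esub> v) = lift X u \<oplus>\<^bsub>FOb Q X\<^esub> lift X v" by simp
  qed
next
  fix X Y :: "nat set" and h u
  assume X: "finite X" and Y: "finite Y" and h: "h \<in> Hom FI X Y" and "u \<in> carrier (FOb sec_FI X)"
  then have u: "u \<in> sections X" "u \<in> carrier V" using sections_D by (auto simp: sec_FI_simps)
  interpret h: lin_map K "FOb Q X" "FOb Q Y" "FMap Q X Y h" by (rule Q.lin[OF X Y h])
  let ?g = "extend X h"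
  note g = extend[OF X h]
  have gX: "?g ` X \<subseteq> Y" by (rule hom_image[OF h g(2)])
  have gu: "act ?g u \<in> sections Y" "act ?g u \<in> carrier V"
    using act_sections[OF g(1) gX u(1)] sections_D by auto
  have inj: "inj_on ((`) ?g) (subsets_of n X)" using g(1) by (auto simp: inj_on_def inj_image_eq_iff)
  have imS: "?g ` S \<in> subsets_of n Y" if "S \<in> subsets_of n X" for S
    using that gX card_image[OF inj_on_subset[OF g(1) subset_UNIV], of S] by (auto simp: subsets_of_def)
  \<comment> \<open>A subset of \<open>Y\<close> that is not the image of a subset of
    \<open>X\<close> does not lie in the image of \<open>X\<close>, and the pushed function vanishes
    on it.\<close>
  have "lift Y (act ?g u) = (\<Oplus>\<^bsub>FOb Q Y\<^esub>S\<in>(`) ?g ` subsets_of n X. trm Y (act ?g u) (rep_inj n S))"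
    unfolding lift_apply[OF Y gu(1)]
  proof (rule h.N.M.add.finprod_mono_neutral_cong_right)
    show "finite (subsets_of n Y)" using Y by simp
    show "(`) ?g ` subsets_of n X \<subseteq> subsets_of n Y" using imS by blast
    show "(\<lambda>S. trm Y (act ?g u) (rep_inj n S)) \<in> subsets_of n Y \<rightarrow> Q.C Y" using rep_trm_closed[OF Y gu(2)] by blast
    fix S assume S: "S \<in> subsets_of n Y - (`) ?g ` subsets_of n X"
    note r = rep_inj[OF Y, of S n]
    have "\<not> S \<subseteq> ?g ` X"
    proof
      assume "S \<subseteq> ?g ` X"
      then obtain T where T: "T \<subseteq> X" "S = ?g ` T" by (metis subset_image_iff)
      moreover have "card T = n" using S T(2) card_image[OF inj_on_subset[OF g(1) subset_UNIV], of T] by (simp add: subsets_of_def)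
      ultimately show False using S by (auto simp: subsets_of_def)
    qed
    then have "act ?g u (rep_inj n S) = \<zero>\<^bsub>E\<^esub>"
      using act_support[OF sections_D[OF u(1)] r(1) g(1)] r(2) S by simp
    moreover have "lin_map K (FOb Q {1..n}) (FOb Q Y) (FMap Q {1..n} Y (rep_inj n S))"
      using r S by (intro Q.lin[OF _ Y] injection_hom) auto
    ultimately show "trm Y (act ?g u) (rep_inj n S) = \<zero>\<^bsub>FOb Q Y\<^esub>"
      by (simp add: trm_def \<phi>.zero lin_map.zero)
  qed simp
  also have "\<dots> = (\<Oplus>\<^bsub>FOb Q Y\<^esub>S\<in>subsets_of n X. trm Y (act ?g u) (rep_inj n (?g ` S)))"
    by (rule h.N.M.finsum_reindex[OF _ inj]) (use rep_trm_closed[OF Y gu(2)] imS in auto)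
  also have "\<dots> = (\<Oplus>\<^bsub>FOb Q Y\<^esub>S\<in>subsets_of n X. FMap Q X Y h (trm X u (rep_inj n S)))"
  proof (rule h.N.M.finsum_cong'[OF refl])
    fix S assume S: "S \<in> subsets_of n X"
    note r = rep_inj[OF X S] and r' = rep_inj[OF Y imS[OF S]]
    let ?f = "compose {1..n} ?g (rep_inj n S)"
    have f: "?f \<in> injections n" by (rule compose_injection[OF g(1) r(1)])
    have imf: "?f ` {1..n} = ?g ` S" using r(2) by (simp add: image_compose)
    have hr: "rep_inj n S \<in> Hom FI {1..n} X" using r by (intro injection_hom) auto
    have cf: "compose {1..n} h (rep_inj n S) = ?f"
    proof
      show "compose {1..n} h (rep_inj n S) i = ?f i" for i
      proof (cases "i \<in> {1..n}")
        case True
        then have "rep_inj n S i \<in> X" using r(2,3) by blast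
        then show ?thesis using g(2) True by (simp add: compose_eq)
      qed (auto simp: compose_def)
    qed
    \<comment> \<open>The chosen enumeration of the image need not be the image of the chosen
      enumeration; \<open>trm_same_image\<close> absorbs the difference.\<close>
    have "trm Y (act ?g u) (rep_inj n (?g ` S)) = trm Y (act ?g u) ?f"
      by (rule trm_same_image[OF Y gu(2) r'(1) f]) (use r'(2,3) imf in simp_all)
    also have "\<dots> = FMap Q {1..n} Y ?f (\<phi> (u (rep_inj n S)))"
      using act_range[OF u(2) r(1) g(1)] by (simp add: trm_def)
    also have "\<dots> = FMap Q X Y h (trm X u (rep_inj n S))"
      unfolding trm_def cf[symmetric]
      by (rule Q.map_comp[OF _ X Y hr h \<phi>.closed[OF func_closed[OF u(2) r(1)]]]) simp
    finally show "trm Y (act ?g u) (rep_inj n (?g ` S)) = FMap Q X Y h (trm X u (rep_inj n S))" .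
  qed (use rep_trm_closed[OF X u(2)] h.closed in auto)
  also have "\<dots> = FMap Q X Y h (lift X u)"
    unfolding lift_apply[OF X u(1)] using X rep_trm_closed[OF X u(2)] by (intro h.finsum[symmetric]) auto
  finally show "lift Y (FMap sec_FI X Y h u) = FMap Q X Y h (lift X u)" using u by (simp add: sec_FI_simps)
qed

lemma lift_embed:
  assumes e: "e \<in> carrier E" shows "lift {1..n} (embed e) = \<phi> e"
proof -
  interpret QX: left_module K "FOb Q {1..n}" by (rule Q.mod) simp
  have "subsets_of n {1..n} = {{1..n}}"
  proof -
    have "S = {1..n}" if "S \<subseteq> {1..n}" "card S = n" for S using that by (intro card_seteq) auto
    then show ?thesis by (auto simp: subsets_of_def)
  qed
  moreover have r: "rep_inj n {1..n} \<in> injections n" "rep_inj n {1..n} ` {1..n} = {1..n}"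
    using rep_inj[of "{1..n}" "{1..n}" n] by (auto simp: subsets_of_def)
  ultimately have "lift {1..n} (embed e) = trm {1..n} (embed e) (rep_inj n {1..n})"
    using lift_apply[OF _ embed_sections[OF e]] trm_closed[OF _ embed_closed[OF e] r(1), of "{1..n}"] by simp
  also have "\<dots> = trm {1..n} (embed e) (std n)"
    by (rule trm_same_image[OF _ embed_closed[OF e] r(1) std_injection]) (use r(2) in \<open>auto simp: std_def\<close>)
  also have "\<dots> = \<phi> e" using embed_std[OF e] Q.inc_id[OF _ \<phi>.closed[OF e]] by (simp add: trm_def std_def)
  finally show ?thesis .
qed

text \<open>The elements \<open>embed e\<close> generate \<open>sec_FI\<close>: a section is the sum
  of its restrictions to the individual subsets, each of them pushed forward from
  \<open>{1..n}\<close>. This yields uniqueness in the universal property.\<close>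

lemma section_decomposition:
  assumes X: "finite X" and u: "u \<in> sections X"
  shows "u = (\<Oplus>\<^bsub>V\<lparr>carrier := sections X\<rparr>\<^esub>S\<in>subsets_of n X. FMap sec_FI {1..n} X (rep_inj n S) (embed (u (rep_inj n S))))"
proof -
  interpret S: fi K sec_FI by (rule fi.intro[OF sec_FI_module])
  interpret SX: left_module K "V\<lparr>carrier := sections X\<rparr>" by (rule func.left_module_submodule[OF sections_submodule])
  note uc = sections_D(1)[OF u]
  let ?t = "\<lambda>S. FMap sec_FI {1..n} X (rep_inj n S) (embed (u (rep_inj n S)))"
  have e: "u (rep_inj n S) \<in> carrier E" if "S \<in> subsets_of n X" for S by (rule func_closed[OF uc rep_inj(1)[OF X that]])
  have hom: "rep_inj n S \<in> Hom FI {1..n} X" if "S \<in> subsets_of n X" for S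
    using rep_inj[OF X that] by (intro injection_hom) auto
  have tc: "?t S \<in> sections X" if "S \<in> subsets_of n X" for S
    using S.map_closed[OF _ X hom[OF that], of "embed (u (rep_inj n S))"] embed_sections[OF e[OF that]] by (simp add: sec_FI_simps(1))
  \<comment> \<open>At the chosen enumeration of \<open>S\<close> both functions agree by
    construction, and equivariance extends this to all its enumerations. Elsewhere the summand
    vanishes because the subsets have equal size.\<close>
  have val: "?t S f = (if f ` {1..n} = S then u f else \<zero>\<^bsub>E\<^esub>)" if S: "S \<in> subsets_of n X" and f: "f \<in> injections n" for S f
  proof -
    note r = rep_inj[OF X S]
    obtain g where g: "inj g" "\<And>i. i \<in> {1..n} \<Longrightarrow> g i = rep_inj n S i"
      using inj_extend[of "{1..n}" "rep_inj n S"] r(1) by (auto simp: injections_def)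
    have t: "?t S = act g (embed (u (rep_inj n S)))"
      by (rule sec_map[OF _ hom[OF S] g embed_sections[OF e[OF S]]]) simp
    have cg: "compose {1..n} g (std n) = rep_inj n S"
      using g(2) r(1) by (auto simp: compose_def std_def injections_def extensional_def fun_eq_iff)
    show ?thesis
    proof (cases "f ` {1..n} = S")
      case True
      obtain \<sigma> where \<sigma>: "\<sigma> permutes {1..n}" "f = rep_inj n S \<circ> \<sigma>"
        using injection_same_image[OF f r(1)] True r(2) by auto
      have "?t S (rep_inj n S) = u (rep_inj n S)"
        using act_range[OF embed_closed[OF e[OF S]] std_injection g(1)] embed_std[OF e[OF S]] cg t by simp
      then show ?thesis
        using func_permute[OF sections_D(1)[OF tc[OF S]] r(1) \<sigma>(1)] func_permute[OF uc r(1) \<sigma>(1)] \<sigma>(2) True by simp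
    next
      case False
      have gS: "g ` {1..n} = S" using g(2) r(2) by (metis image_cong)
      have "\<not> f ` {1..n} \<subseteq> g ` {1..n}"
      proof
        assume "f ` {1..n} \<subseteq> g ` {1..n}"
        then have "f ` {1..n} = S"
          unfolding gS using injection_card[OF f] S finite_subset[OF r(3) X] by (intro card_seteq) (auto simp: subsets_of_def)
        then show False using False by simp
      qed
      then have "?t S f = \<zero>\<^bsub>E\<^esub>"
        unfolding t by (rule act_support[OF sections_D[OF embed_sections[OF e[OF S]]] f g(1)])
      then show ?thesis using False by simp
    qed
  qed
  show ?thesis
  proof (rule func_eqI[OF uc])
    have sc: "(\<Oplus>\<^bsub>V\<lparr>carrier := sections X\<rparr>\<^esub>S\<in>subsets_of n X. ?t S) \<in> sections X"
      using SX.M.finsum_closed[of ?t "subsets_of n X"] tc by auto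
    then show "(\<Oplus>\<^bsub>V\<lparr>carrier := sections X\<rparr>\<^esub>S\<in>subsets_of n X. ?t S) \<in> carrier V" by (rule sections_D(1))
    fix f assume f: "f \<in> injections n"
    interpret ev: lin_map K "V\<lparr>carrier := sections X\<rparr>" E "\<lambda>\<phi>\<in>sections X. \<phi> f"
      unfolding lin_map_iff
    proof (intro conjI SX.left_module_axioms left_module_axioms lin_mapsI)
      show "(\<lambda>\<phi>\<in>sections X. \<phi> f) x \<in> carrier E" if "x \<in> carrier (V\<lparr>carrier := sections X\<rparr>)" for x
        using that func_closed[OF sections_D(1) f] by simp
      show "(\<lambda>\<phi>\<in>sections X. \<phi> f) (x \<oplus>\<^bsub>V\<lparr>carrier := sections X\<rparr>\<^esub> y) = (\<lambda>\<phi>\<in>sections X. \<phi> f) x \<oplus>\<^bsub>E\<^esub> (\<lambda>\<phi>\<in>sections X. \<phi> f) y"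
        if "x \<in> carrier (V\<lparr>carrier := sections X\<rparr>)" "y \<in> carrier (V\<lparr>carrier := sections X\<rparr>)" for x y
        using that SX.M.a_closed[of x y] by (simp add: func_simps f)
      show "(\<lambda>\<phi>\<in>sections X. \<phi> f) (a \<odot>\<^bsub>V\<lparr>carrier := sections X\<rparr>\<^esub> x) = a \<odot>\<^bsub>E\<^esub> (\<lambda>\<phi>\<in>sections X. \<phi> f) x"
        if "a \<in> carrier K" "x \<in> carrier (V\<lparr>carrier := sections X\<rparr>)" for a x
        using that SX.smult_closed[of a x] by (simp add: func_simps f)
    qed simp
    have "(\<Oplus>\<^bsub>V\<lparr>carrier := sections X\<rparr>\<^esub>S\<in>subsets_of n X. ?t S) f = (\<Oplus>\<^bsub>E\<^esub>S\<in>subsets_of n X. (\<lambda>\<phi>\<in>sections X. \<phi> f) (?t S))"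
      using ev.finsum[of "subsets_of n X" ?t] X tc sc by simp
    also have "\<dots> = (\<Oplus>\<^bsub>E\<^esub>S\<in>subsets_of n X. if f ` {1..n} = S then u f else \<zero>\<^bsub>E\<^esub>)"
      by (rule M.finsum_cong'[OF refl]) (use tc val f func_closed[OF uc f] in auto)
    also have "\<dots> = u f"
    proof (cases "f ` {1..n} \<subseteq> X")
      case True
      then have "f ` {1..n} \<in> subsets_of n X" using injection_card[OF f] by (simp add: subsets_of_def)
      then show ?thesis using M.finsum_singleton[of "f ` {1..n}" "subsets_of n X" "\<lambda>_. u f"] X func_closed[OF uc f] by simp
    next
      case False
      then have "(\<Oplus>\<^bsub>E\<^esub>S\<in>subsets_of n X. if f ` {1..n} = S then u f else \<zero>\<^bsub>E\<^esub>) = (\<Oplus>\<^bsub>E\<^esub>S\<in>subsets_of n X. \<zero>\<^bsub>E\<^esub>)"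
        by (intro M.finsum_cong') (auto simp: subsets_of_def)
      then show ?thesis using sections_D(2)[OF u] f False by simp
    qed
    finally show "u f = (\<Oplus>\<^bsub>V\<lparr>carrier := sections X\<rparr>\<^esub>S\<in>subsets_of n X. ?t S) f" by simp
  qed
qed

lemma sec_FI_universal:
  "\<exists>!\<psi>. \<psi> \<in> FI_maps K sec_FI Q \<and> (\<forall>e\<in>carrier E. \<psi> {1..n} (embed e) = \<phi> e)"
proof (rule ex1I)
  show "lift \<in> FI_maps K sec_FI Q \<and> (\<forall>e\<in>carrier E. lift {1..n} (embed e) = \<phi> e)"
    using lift_maps lift_embed by blast
  fix \<psi> assume \<psi>: "\<psi> \<in> FI_maps K sec_FI Q \<and> (\<forall>e\<in>carrier E. \<psi> {1..n} (embed e) = \<phi> e)"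
  interpret S: fi K sec_FI by (rule fi.intro[OF sec_FI_module])
  \<comment> \<open>Naturality reduces \<open>\<theta>\<close> to its values on
    \<open>embed e\<close>, which are prescribed by \<open>\<phi>\<close>.\<close>
  have determined: "\<theta> X u = (\<Oplus>\<^bsub>FOb Q X\<^esub>S\<in>subsets_of n X. trm X u (rep_inj n S))"
    if \<theta>: "\<theta> \<in> FI_maps K sec_FI Q" "\<forall>e\<in>carrier E. \<theta> {1..n} (embed e) = \<phi> e"
      and X: "finite X" and u: "u \<in> sections X" for \<theta> X u
  proof -
    interpret t: lin_map K "V\<lparr>carrier := sections X\<rparr>" "FOb Q X" "\<theta> X"
      using FI_mapsD(2)[OF \<theta>(1) X] S.mod[OF X] Q.mod[OF X] by (simp add: lin_map_iff sec_FI_simps(1))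
    let ?t = "\<lambda>S. FMap sec_FI {1..n} X (rep_inj n S) (embed (u (rep_inj n S)))"
    have e: "u (rep_inj n S) \<in> carrier E" if "S \<in> subsets_of n X" for S
      by (rule func_closed[OF sections_D(1)[OF u] rep_inj(1)[OF X that]])
    have hom: "rep_inj n S \<in> Hom FI {1..n} X" if "S \<in> subsets_of n X" for S
      using rep_inj[OF X that] by (intro injection_hom) auto
    have ec: "embed (u (rep_inj n S)) \<in> carrier (FOb sec_FI {1..n})" if "S \<in> subsets_of n X" for S
      using embed_sections[OF e[OF that]] by (simp add: sec_FI_simps(1))
    have tc: "?t S \<in> carrier (V\<lparr>carrier := sections X\<rparr>)" if "S \<in> subsets_of n X" for S
      using S.map_closed[OF _ X hom[OF that] ec[OF that]] by (simp add: sec_FI_simps(1))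
    have "\<theta> X u = \<theta> X (\<Oplus>\<^bsub>V\<lparr>carrier := sections X\<rparr>\<^esub>S\<in>subsets_of n X. ?t S)"
      using section_decomposition[OF X u] by simp
    also have "\<dots> = (\<Oplus>\<^bsub>FOb Q X\<^esub>S\<in>subsets_of n X. \<theta> X (?t S))" using X tc by (intro t.finsum) auto
    also have "\<dots> = (\<Oplus>\<^bsub>FOb Q X\<^esub>S\<in>subsets_of n X. trm X u (rep_inj n S))"
    proof (rule t.N.M.finsum_cong'[OF refl])
      show "(\<lambda>S. trm X u (rep_inj n S)) \<in> subsets_of n X \<rightarrow> Q.C X" using rep_trm_closed[OF X sections_D(1)[OF u]] by blast
      fix S assume S: "S \<in> subsets_of n X"
      have "\<theta> X (?t S) = FMap Q {1..n} X (rep_inj n S) (\<theta> {1..n} (embed (u (rep_inj n S))))"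
        by (rule FI_mapsD(3)[OF \<theta>(1) _ X hom[OF S] ec[OF S]]) simp
      then show "\<theta> X (?t S) = trm X u (rep_inj n S)" using \<theta>(2) e[OF S] by (simp add: trm_def)
    qed
    finally show ?thesis .
  qed
  show "\<psi> = lift"
  proof (rule FI_maps_eqI[of _ K sec_FI Q])
    show "\<psi> X u = lift X u" if "finite X" "u \<in> carrier (FOb sec_FI X)" for X u
      using that determined[of \<psi> X u] \<psi> lift_apply[of X u] by (simp add: sec_FI_simps(1))
  qed (use \<psi> lift_maps in auto)
qed

end

end

section \<open>Existence and uniqueness of induced FI-modules within the given universe\<close>

lemma ex1_unique: "\<exists>!x. P x \<Longrightarrow> P x \<Longrightarrow> P y \<Longrightarrow> x = y" by blast

context perm_rep
begin

abbreviation ev_maps :: "('k, 'z) fi_mod \<Rightarrow> ('v \<Rightarrow> 'z) set" where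
  "ev_maps M \<equiv> perm_maps K n E \<rho> (FOb M {1..n}) (perm_act n M)"

lemma ev_maps_push:
  assumes \<eta>: "\<eta> \<in> ev_maps M" and \<theta>: "\<theta> \<in> FI_maps K M N"
  shows "compose (carrier E) (\<theta> {1..n}) \<eta> \<in> ev_maps N"
proof -
  have h: "\<eta> \<in> lin_maps K E (FOb M {1..n})" using \<eta> by (simp add: perm_maps_def)
  have "compose (carrier E) (\<theta> {1..n}) \<eta> (\<rho> \<sigma> x) = FMap N {1..n} {1..n} (restrict \<sigma> {1..n}) (compose (carrier E) (\<theta> {1..n}) \<eta> x)"
    if \<sigma>: "\<sigma> permutes {1..n}" and x: "x \<in> carrier E" for \<sigma> x
    using \<eta> \<sigma> x FI_mapsD(3)[OF \<theta> _ _ std_hom[OF \<sigma>] lin_mapsD(1)[OF h x]] \<rho>_closed[OF \<sigma> x]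
    by (simp add: perm_maps_def compose_eq)
  then show ?thesis
    using lin_maps_compose[OF left_module_axioms h FI_mapsD(2)[OF \<theta>]] by (simp add: perm_maps_def)
qed

text \<open>The only subset of \<open>{1..n}\<close> with \<open>n\<close> elements is the whole
  set, so a section over it has a single free value.\<close>

lemma sections_std_eqI:
  assumes u: "u \<in> sections {1..n}" and v: "v \<in> sections {1..n}" and e: "u (std n) = v (std n)"
  shows "u = v"
proof (rule func_eqI[OF sections_D(1)[OF u] sections_D(1)[OF v]])
  fix f assume f: "f \<in> injections n"
  show "u f = v f"
  proof (cases "f ` {1..n} \<subseteq> {1..n}")
    case True
    have "f ` {1..n} = {1..n}" using True injection_card[OF f] by (intro card_seteq) auto
    moreover have "std n ` {1..n} = {1..n}" by (simp add: std_def)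
    ultimately obtain \<sigma> where "\<sigma> permutes {1..n}" "f = std n \<circ> \<sigma>"
      using injection_same_image[OF f std_injection] by auto
    then show ?thesis
      using func_permute[OF sections_D(1)[OF u] std_injection] func_permute[OF sections_D(1)[OF v] std_injection] e by simp
  next
    case False
    then show ?thesis using sections_D(2)[OF u] sections_D(2)[OF v] f by simp
  qed
qed

lemma embed_maps: "restrict embed (carrier E) \<in> ev_maps sec_FI"
proof -
  interpret S: left_module K "V\<lparr>carrier := sections {1..n}\<rparr>" by (rule func.left_module_submodule[OF sections_submodule])
  note s = embed_sections
  have "embed (x \<oplus>\<^bsub>E\<^esub> y) = embed x \<oplus>\<^bsub>V\<^esub> embed y" if x: "x \<in> carrier E" and y: "y \<in> carrier E" for x y
    using S.M.a_closed[of "embed x" "embed y"] s[OF x] s[OF y] s[OF M.a_closed[OF x y]] x y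
    by (intro sections_std_eqI) (simp_all add: embed_std func_simps std_injection)
  moreover have "embed (a \<odot>\<^bsub>E\<^esub> x) = a \<odot>\<^bsub>V\<^esub> embed x" if a: "a \<in> carrier K" and x: "x \<in> carrier E" for a x
    using S.smult_closed[of a "embed x"] s[OF x] s[OF smult_closed[OF a x]] a x
    by (intro sections_std_eqI) (simp_all add: embed_std func_simps std_injection smult_closed)
  ultimately have "restrict embed (carrier E) \<in> lin_maps K E (FOb sec_FI {1..n})"
    by (intro lin_mapsI) (simp_all add: sec_FI_simps(1) s smult_closed)
  moreover have "embed (\<rho> \<sigma> x) = FMap sec_FI {1..n} {1..n} (restrict \<sigma> {1..n}) (embed x)"
    if \<sigma>: "\<sigma> permutes {1..n}" and x: "x \<in> carrier E" for \<sigma> x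
  proof -
    have m: "FMap sec_FI {1..n} {1..n} (restrict \<sigma> {1..n}) (embed x) = act \<sigma> (embed x)"
      by (rule sec_map[OF _ std_hom[OF \<sigma>] permutes_inj[OF \<sigma>] _ s[OF x]]) simp_all
    have "act \<sigma> (embed x) \<in> sections {1..n}"
      by (rule act_sections[OF permutes_inj[OF \<sigma>] _ s[OF x]]) (simp add: permutes_image[OF \<sigma>])
    then show ?thesis unfolding m
      using s[OF \<rho>_closed[OF \<sigma> x]] act_std[OF embed_closed[OF x] \<sigma>] \<rho>_closed[OF \<sigma> x] x
      by (intro sections_std_eqI) (simp_all add: embed_std)
  qed
  ultimately show ?thesis using \<rho>_closed by (simp add: perm_maps_def)
qed

text \<open>The property defining \<open>induced_FI\<close>, restated for permutation
  representations in place of modules over the group algebra.\<close>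

definition universal :: "('k, 'v) fi_mod \<Rightarrow> ('v \<Rightarrow> 'v) \<Rightarrow> bool" where
  "universal P \<eta> \<longleftrightarrow> FI_module K P \<and> \<eta> \<in> ev_maps P \<and>
     (\<forall>Q :: ('k, 'v) fi_mod. FI_module K Q \<longrightarrow>
       (\<forall>\<phi>\<in>ev_maps Q. \<exists>!\<psi>. \<psi> \<in> FI_maps K P Q \<and> (\<forall>e\<in>carrier E. \<psi> {1..n} (\<eta> e) = \<phi> e)))"

lemma universalD:
  fixes Q :: "('k, 'v) fi_mod"
  assumes "universal P \<eta>"
  shows "FI_module K P" "\<eta> \<in> ev_maps P" "e \<in> carrier E \<Longrightarrow> \<eta> e \<in> carrier (FOb P {1..n})"
    "FI_module K Q \<Longrightarrow> \<phi> \<in> ev_maps Q \<Longrightarrow> \<exists>!\<psi>. \<psi> \<in> FI_maps K P Q \<and> (\<forall>e\<in>carrier E. \<psi> {1..n} (\<eta> e) = \<phi> e)"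
proof -
  show "FI_module K P" and \<eta>: "\<eta> \<in> ev_maps P" using assms by (simp_all add: universal_def)
  show "\<eta> e \<in> carrier (FOb P {1..n})" if "e \<in> carrier E"
    using \<eta> that by (auto simp: perm_maps_def dest: lin_mapsD(1))
  show "\<exists>!\<psi>. \<psi> \<in> FI_maps K P Q \<and> (\<forall>e\<in>carrier E. \<psi> {1..n} (\<eta> e) = \<phi> e)" if "FI_module K Q" "\<phi> \<in> ev_maps Q"
    using assms that by (simp add: universal_def)
qed

lemma universal_iso:
  assumes P: "universal P \<eta>" and P': "universal P' \<eta>'"
  shows "\<exists>\<theta>\<in>FI_maps K P P'. \<forall>X. finite X \<longrightarrow> bij_betw (\<theta> X) (carrier (FOb P X)) (carrier (FOb P' X))"
proof -
  note u = universalD[OF P] and u' = universalD[OF P']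
  obtain \<psi> where \<psi>: "\<psi> \<in> FI_maps K P P'" "\<forall>e\<in>carrier E. \<psi> {1..n} (\<eta> e) = \<eta>' e" using u(4)[OF u'(1,2)] by blast
  obtain \<theta> where \<theta>: "\<theta> \<in> FI_maps K P' P" "\<forall>e\<in>carrier E. \<theta> {1..n} (\<eta>' e) = \<eta> e" using u'(4)[OF u(1,2)] by blast
  have "FI_comp P \<theta> \<psi> = FI_id P"
    by (rule ex1_unique[OF u(4)[OF u(1,2)]])
      (use FI_comp_maps[OF u(1) \<psi>(1) \<theta>(1)] FI_id_maps[OF u(1)] \<psi>(2) \<theta>(2) u(3) in \<open>simp_all add: FI_comp_apply FI_id_apply\<close>)
  moreover have "FI_comp P' \<psi> \<theta> = FI_id P'"
    by (rule ex1_unique[OF u'(4)[OF u'(1,2)]])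
      (use FI_comp_maps[OF u'(1) \<theta>(1) \<psi>(1)] FI_id_maps[OF u'(1)] \<psi>(2) \<theta>(2) u'(3) in \<open>simp_all add: FI_comp_apply FI_id_apply\<close>)
  ultimately have inv: "\<And>X x. finite X \<Longrightarrow> x \<in> carrier (FOb P X) \<Longrightarrow> \<theta> X (\<psi> X x) = x"
    "\<And>X x. finite X \<Longrightarrow> x \<in> carrier (FOb P' X) \<Longrightarrow> \<psi> X (\<theta> X x) = x"
    by (metis FI_comp_apply FI_id_apply)+
  have "bij_betw (\<psi> X) (carrier (FOb P X)) (carrier (FOb P' X))" if X: "finite X" for X
    by (rule bij_betw_byWitness[where f' = "\<theta> X"])
      (use inv[OF X] lin_mapsD(1)[OF FI_mapsD(2)[OF \<psi>(1) X]] lin_mapsD(1)[OF FI_mapsD(2)[OF \<theta>(1) X]] in auto)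
  then show ?thesis using \<psi>(1) by blast
qed

text \<open>The model \<open>sec_FI\<close> has the universal property but the wrong element type. A
  section over a finite set is determined by finitely many values, so it can be coded by an element
  of \<open>'v\<close> and the model transported.\<close>

lemma universal_ex:
  assumes inf: "infinite (UNIV :: 'v set)"
  shows "\<exists>P \<eta> \<iota>. universal P \<eta> \<and> fi_colim K P V act \<iota>"
proof -
  \<comment> \<open>The finite set of injections at which a section over \<open>X\<close> may be
    nonzero.\<close>
  define I where "I X = {f \<in> injections n. f ` {1..n} \<subseteq> X}" for X
  have finI: "finite (I X)" if "finite X" for X
  proof (rule finite_subset)
    show "I X \<subseteq> {1..n} \<rightarrow>\<^sub>E X" by (auto simp: I_def injections_def PiE_def)
    show "finite ({1..n} \<rightarrow>\<^sub>E X)" using that by (simp add: finite_PiE)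
  qed
  define c where "c X = (SOME c :: ((nat \<Rightarrow> nat) \<Rightarrow> 'v) \<Rightarrow> 'v. inj_on c (extensional (I X)))" for X
  have c: "inj_on (c X) (extensional (I X))" if "finite X" for X
    unfolding c_def by (rule someI_ex[OF finite_PiE_encoding[OF inf finI[OF that]]])
  define enc where "enc X u = c X (restrict u (I X))" for X u
  have enc: "inj_on (enc X) (carrier (FOb sec_FI X))" if X: "finite X" for X
  proof (rule inj_onI)
    fix u v assume "u \<in> carrier (FOb sec_FI X)" "v \<in> carrier (FOb sec_FI X)" and e: "enc X u = enc X v"
    then have u: "u \<in> sections X" and v: "v \<in> sections X" by (simp_all add: sec_FI_simps(1))
    have r: "restrict u (I X) = restrict v (I X)" using inj_onD[OF c[OF X], of "restrict u (I X)" "restrict v (I X)"] e by (simp add: enc_def)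
    show "u = v"
    proof (rule func_eqI[OF sections_D(1)[OF u] sections_D(1)[OF v]])
      fix f assume f: "f \<in> injections n"
      show "u f = v f"
        using fun_cong[OF r, of f] sections_D(2)[OF u] sections_D(2)[OF v] f by (cases "f \<in> I X") (auto simp: I_def)
    qed
  qed
  define P :: "('k, 'v) fi_mod" where "P = transport_FI enc sec_FI"
  define \<epsilon> where "\<epsilon> = (\<lambda>X\<in>Ob FI. restrict (enc X) (carrier (FOb sec_FI X)))"
  define \<delta> where "\<delta> = (\<lambda>X\<in>Ob FI. restrict (inv_into (carrier (FOb sec_FI X)) (enc X)) (carrier (FOb P X)))"
  have P: "FI_module K P" and \<epsilon>: "\<epsilon> \<in> FI_maps K sec_FI P" and \<delta>: "\<delta> \<in> FI_maps K P sec_FI"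
    using transport_FI[OF sec_FI_module enc] by (simp_all add: P_def \<epsilon>_def \<delta>_def)
  have cP: "carrier (FOb P X) = enc X ` carrier (FOb sec_FI X)" for X by (simp add: P_def transport_FI_def transport_def)
  have \<delta>\<epsilon>: "\<delta> X (\<epsilon> X u) = u" if "finite X" "u \<in> carrier (FOb sec_FI X)" for X u
    using that enc[OF that(1)] cP by (simp add: \<delta>_def \<epsilon>_def)
  have \<epsilon>\<delta>: "\<epsilon> X (\<delta> X x) = x" if "finite X" "x \<in> carrier (FOb P X)" for X x
    using that enc[OF that(1)] cP by (auto simp: \<delta>_def \<epsilon>_def)
  have \<epsilon>c: "\<epsilon> X u \<in> carrier (FOb P X)" if "finite X" "u \<in> carrier (FOb sec_FI X)" for X u
    using lin_mapsD(1)[OF FI_mapsD(2)[OF \<epsilon> that(1)] that(2)] .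
  have \<delta>c: "\<delta> X x \<in> carrier (FOb sec_FI X)" if "finite X" "x \<in> carrier (FOb P X)" for X x
    using lin_mapsD(1)[OF FI_mapsD(2)[OF \<delta> that(1)] that(2)] .
  have es: "embed e \<in> carrier (FOb sec_FI {1..n})" if "e \<in> carrier E" for e
    using embed_sections[OF that] by (simp add: sec_FI_simps(1))
  define \<eta> where "\<eta> = compose (carrier E) (\<epsilon> {1..n}) (restrict embed (carrier E))"
  have \<eta>: "\<eta> e = \<epsilon> {1..n} (embed e)" if "e \<in> carrier E" for e using that by (simp add: \<eta>_def compose_eq)
  have "universal P \<eta>"
    unfolding universal_def
  proof (intro conjI allI impI ballI P)
    show "\<eta> \<in> ev_maps P" unfolding \<eta>_def by (rule ev_maps_push[OF embed_maps \<epsilon>])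
    fix Q :: "('k, 'v) fi_mod" and \<phi> assume Q: "FI_module K Q" and \<phi>: "\<phi> \<in> ev_maps Q"
    note ex1 = sec_FI_universal[OF Q \<phi>]
    obtain \<psi> where \<psi>: "\<psi> \<in> FI_maps K sec_FI Q" "\<forall>e\<in>carrier E. \<psi> {1..n} (embed e) = \<phi> e" using ex1 by blast
    show "\<exists>!\<psi>. \<psi> \<in> FI_maps K P Q \<and> (\<forall>e\<in>carrier E. \<psi> {1..n} (\<eta> e) = \<phi> e)"
    proof (rule ex1I)
      show "FI_comp P \<psi> \<delta> \<in> FI_maps K P Q \<and> (\<forall>e\<in>carrier E. FI_comp P \<psi> \<delta> {1..n} (\<eta> e) = \<phi> e)"
        using FI_comp_maps[OF P \<delta> \<psi>(1)] \<psi>(2) es by (simp add: \<eta> FI_comp_apply \<epsilon>c \<delta>\<epsilon>)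
      fix \<theta> assume \<theta>: "\<theta> \<in> FI_maps K P Q \<and> (\<forall>e\<in>carrier E. \<theta> {1..n} (\<eta> e) = \<phi> e)"
      have "FI_comp sec_FI \<theta> \<epsilon> \<in> FI_maps K sec_FI Q \<and> (\<forall>e\<in>carrier E. FI_comp sec_FI \<theta> \<epsilon> {1..n} (embed e) = \<phi> e)"
        using FI_comp_maps[OF sec_FI_module \<epsilon>, of \<theta> Q] \<theta> es by (simp add: \<eta> FI_comp_apply)
      then have e: "FI_comp sec_FI \<theta> \<epsilon> = \<psi>" using ex1 \<psi> by blast
      show "\<theta> = FI_comp P \<psi> \<delta>"
      proof (rule FI_maps_eqI)
        show "\<theta> \<in> FI_maps K P Q" "FI_comp P \<psi> \<delta> \<in> FI_maps K P Q" using \<theta> FI_comp_maps[OF P \<delta> \<psi>(1)] by auto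
        show "\<theta> X x = FI_comp P \<psi> \<delta> X x" if X: "finite X" "x \<in> carrier (FOb P X)" for X x
          using FI_comp_apply[OF X(1) \<delta>c[OF X], of \<theta> \<epsilon>] e \<epsilon>\<delta>[OF X] X by (simp add: FI_comp_apply)
      qed
    qed
  qed
  \<comment> \<open>Decoding is an isomorphism on every level, so the colimit of the coded model is
    the same representation of functions.\<close>
  moreover have "bij_betw (\<delta> X) (carrier (FOb P X)) (carrier (FOb sec_FI X))" if "finite X" for X
    by (rule bij_betw_byWitness[where f' = "\<epsilon> X"]) (use that \<delta>\<epsilon> \<epsilon>\<delta> \<epsilon>c \<delta>c in auto)
  ultimately show ?thesis using fi_colim_iso[OF sec_colim P \<delta>] by blast
qed

text \<open>Induced modules are unique up to isomorphism, so each of them, not only the constructed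
  one, has the functions as its colimit.\<close>

lemma universal_colim:
  assumes inf: "infinite (UNIV :: 'v set)" and P: "universal P \<eta>"
  shows "\<exists>\<iota>. fi_colim K P V act \<iota>"
proof -
  obtain P' \<eta>' \<iota> where P': "universal P' \<eta>'" "fi_colim K P' V act \<iota>" using universal_ex[OF inf] by blast
  obtain \<theta> where "\<theta> \<in> FI_maps K P P'" "\<forall>X. finite X \<longrightarrow> bij_betw (\<theta> X) (carrier (FOb P X)) (carrier (FOb P' X))"
    using universal_iso[OF P P'(1)] by blast
  then show ?thesis using fi_colim_iso[OF P'(2) universalD(1)[OF P]] by blast
qed

end

lemma induced_iff:
  assumes K: "ring K" and E: "left_module (alg K n) (E :: ((nat \<Rightarrow> nat) \<Rightarrow> 'k, 'v) module)"
  shows "induced_FI K n E P \<longleftrightarrow> (\<exists>\<eta>. perm_rep.universal K n (base_module K n E) (base_action K n E) P \<eta>)"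
proof -
  interpret B: perm_rep K n "base_module K n E" "base_action K n E" by (rule module_over_alg(1)[OF K E])
  show ?thesis
    unfolding induced_FI_def B.universal_def
    by (simp add: eval_at_lin_maps[OF K E] cong: conj_cong) blast
qed

lemma induced_colim:
  assumes K: "ring K" and inf: "infinite (UNIV :: 'v set)"
    and E: "left_module (alg K n) (E :: ((nat \<Rightarrow> nat) \<Rightarrow> 'k, 'v) module)"
  shows "\<exists>P. induced_FI K n E P"
    "induced_FI K n E P \<Longrightarrow>
      \<exists>\<iota>. fi_colim K P (func n (base_module K n E) (base_action K n E)) (func_act n (base_module K n E) (base_action K n E)) \<iota>"
proof -
  interpret B: perm_rep K n "base_module K n E" "base_action K n E" by (rule module_over_alg(1)[OF K E])
  show "\<exists>P. induced_FI K n E P" using B.universal_ex[OF inf] induced_iff[OF K E] by blast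
  show "\<exists>\<iota>. fi_colim K P B.V B.act \<iota>" if "induced_FI K n E P"
    using that B.universal_colim[OF inf] induced_iff[OF K E] by blast
qed

section \<open>The correspondence\<close>

text \<open>Reflexivity and transitivity of isomorphism are premises because the record
  \<open>cat\<close> carries no category laws; symmetry is built into \<open>is_iso\<close>.\<close>

lemma iso_class_eq_iff:
  assumes "\<And>X. X \<in> Ob C \<Longrightarrow> \<exists>f. is_iso C X X f"
    and "\<And>X Y Z f g. X \<in> Ob C \<Longrightarrow> Y \<in> Ob C \<Longrightarrow> Z \<in> Ob C \<Longrightarrow> is_iso C X Y f \<Longrightarrow> is_iso C Y Z g \<Longrightarrow> \<exists>h. is_iso C X Z h"
    and "X \<in> Ob C" "Y \<in> Ob C"
  shows "iso_class C X = iso_class C Y \<longleftrightarrow> (\<exists>f. is_iso C X Y f)"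
proof
  assume "iso_class C X = iso_class C Y"
  then have "Y \<in> iso_class C X" using assms(1,4) by (simp add: iso_class_def)
  then show "\<exists>f. is_iso C X Y f" by (simp add: iso_class_def)
next
  assume "\<exists>f. is_iso C X Y f"
  then obtain f g where "is_iso C X Y f" "is_iso C Y X g" unfolding is_iso_def by blast
  then show "iso_class C X = iso_class C Y" using assms(2-4) unfolding iso_class_def by blast
qed

lemma LMod_iso_class:
  fixes E E' :: "('r, 'v) module"
  assumes "left_module R E" "left_module R E'"
  shows "iso_class (LMod R) E = iso_class (LMod R) E' \<longleftrightarrow> (\<exists>h\<in>lin_maps R E E'. bij_betw h (carrier E) (carrier E'))"
proof -
  have "iso_class (LMod R) E = iso_class (LMod R) E' \<longleftrightarrow> (\<exists>f. is_iso (LMod R) E E' f)"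
  proof (rule iso_class_eq_iff)
    fix X :: "('r, 'v) module" assume "X \<in> Ob (LMod R)"
    then have X: "left_module R X" by simp
    have "bij_betw (\<lambda>x\<in>carrier X. x) (carrier X) (carrier X)" by (auto simp: bij_betw_def inj_on_def)
    then show "\<exists>f. is_iso (LMod R) X X f" using is_iso_LMod[OF X X] lin_maps_id[OF X] by blast
    fix Y :: "('r, 'v) module" and f assume "Y \<in> Ob (LMod R)" and iso: "is_iso (LMod R) X Y f"
    then have Y: "left_module R Y" by simp
    have f: "f \<in> lin_maps R X Y" "bij_betw f (carrier X) (carrier Y)" using iso by (simp_all add: is_iso_LMod[OF X Y])
    fix Z :: "('r, 'v) module" and g assume "Z \<in> Ob (LMod R)" and iso: "is_iso (LMod R) Y Z g"
    then have Z: "left_module R Z" by simp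
    have g: "g \<in> lin_maps R Y Z" "bij_betw g (carrier Y) (carrier Z)" using iso by (simp_all add: is_iso_LMod[OF Y Z])
    have "bij_betw (compose (carrier X) g f) (carrier X) (carrier Z)" by (rule bij_betw_compose[OF f(2) g(2)])
    then show "\<exists>h. is_iso (LMod R) X Z h"
      using is_iso_LMod[OF X Z] lin_maps_compose[OF X f(1) g(1)] by blast
  qed (use assms in simp_all)
  then show ?thesis using is_iso_LMod[OF assms] by blast
qed

lemma simple_alg_module:
  assumes K: "ring K" and s: "simple_perm_rep K n E \<rho>"
  shows "simple_module (alg K n) (alg_module n E \<rho>)"
proof -
  interpret perm_rep K n E \<rho> using s by (simp add: simple_perm_rep_def)
  have L: "left_module (alg K n) (alg_module n E \<rho>)" by (rule alg_module_left_module[OF ring_group_algebra[OF K]])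
  let ?B = "base_module K n (alg_module n E \<rho>)" and ?\<rho> = "base_action K n (alg_module n E \<rho>)"
  interpret B: perm_rep K n ?B ?\<rho> by (rule module_over_alg(1)[OF K L])
  have "perm_sub K n E \<rho> H" if H: "perm_sub K n ?B ?\<rho> H" for H
  proof -
    have h: "submodule H K ?B" "\<And>\<sigma> x. \<sigma> permutes {1..n} \<Longrightarrow> x \<in> H \<Longrightarrow> ?\<rho> \<sigma> x \<in> H"
      using H by (simp_all add: perm_sub_def)
    note hd = B.submoduleD[OF h(1)]
    have c: "x \<in> carrier E" if "x \<in> H" for x using hd(3)[OF that] by simp
    have "submodule H K E"
    proof (rule submoduleI)
      show "H \<subseteq> carrier E" using c by blast
      show "\<zero>\<^bsub>E\<^esub> \<in> H" using hd(2) by simp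
      show "x \<oplus>\<^bsub>E\<^esub> y \<in> H" if "x \<in> H" "y \<in> H" for x y using hd(4)[OF that] by simp
      show "a \<odot>\<^bsub>E\<^esub> x \<in> H" if "a \<in> carrier K" "x \<in> H" for a x
        using hd(5)[OF that] base_alg_module(1)[OF c[OF that(2)] that(1)] by simp
    qed
    then show ?thesis using h(2) base_alg_module(2)[OF c] by (simp add: perm_sub_def)
  qed
  then have "simple_perm_rep K n ?B ?\<rho>"
    using s B.perm_rep_axioms by (simp add: simple_perm_rep_def)
  then show ?thesis using simple_alg_iff[OF K L] by simp
qed

text \<open>The relation between generic modules and modules of the group algebra that realizes the
  correspondence.\<close>

definition embeds_in_induced ::
  "('k, 'x) ring_scheme \<Rightarrow> ('k, 'v) fi_mod \<Rightarrow> nat \<Rightarrow> ((nat \<Rightarrow> nat) \<Rightarrow> 'k, 'v) module \<Rightarrow> bool" where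
  "embeds_in_induced K L n E \<longleftrightarrow> (\<exists>P f. induced_FI K n E P \<and> is_mono (Gen K) L P f)"

abbreviation "func_of K n E \<equiv> func n (base_module K n E) (base_action K n E)"
abbreviation "func_act_of K n E \<equiv> func_act n (base_module K n E) (base_action K n E)"

text \<open>All induced modules of \<open>E\<close> have the same colimit, so it does not matter
  which of them contains the object.\<close>

lemma (in fi_colim) embeds_in_induced_iff:
  assumes inf: "infinite (UNIV :: 'v set)" and E: "left_module (alg K n) (E :: ((nat \<Rightarrow> nat) \<Rightarrow> 'k, 'v) module)"
  shows "embeds_in_induced K M n E \<longleftrightarrow> (\<exists>F\<in>rep_maps K V act (func_of K n E) (func_act_of K n E). inj_on F (carrier V))"
proof -
  note c = induced_colim[OF R.ring_axioms inf E]
  have iff: "(\<exists>f. is_mono (Gen K) M P f) \<longleftrightarrow> (\<exists>F\<in>rep_maps K V act (func_of K n E) (func_act_of K n E). inj_on F (carrier V))"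
    if P: "induced_FI K n E P" for P
  proof -
    obtain \<iota>' where i: "fi_colim K P (func_of K n E) (func_act_of K n E) \<iota>'" using c(2)[OF P] by blast
    interpret gen_pair K M V act \<iota> P "func_of K n E" "func_act_of K n E" \<iota>'
      by (intro gen_pair.intro fi_colim_axioms i)
    show ?thesis by (rule is_mono_iff[OF inf])
  qed
  then show ?thesis unfolding embeds_in_induced_def using c(1) by blast
qed

lemma Gen_iso_class:
  fixes L L' :: "('k, 'v) fi_mod"
  assumes K: "ring K" and inf: "infinite (UNIV :: 'v set)" and FI: "FI_module K L" "FI_module K L'"
  shows "iso_class (Gen K) L = iso_class (Gen K) L' \<longleftrightarrow> (\<exists>c. is_iso (Gen K) L L' c)"
proof (rule iso_class_eq_iff)
  have colim: "\<exists>(V :: ('k, 'v) module) act \<iota>. fi_colim K X V act \<iota>" if "X \<in> Ob (Gen K)" for X :: "('k, 'v) fi_mod"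
    using fi.colim_ex[OF fi.intro inf K] that by simp
  fix X :: "('k, 'v) fi_mod" assume "X \<in> Ob (Gen K)"
  then obtain V :: "('k, 'v) module" and act \<iota> where X: "fi_colim K X V act \<iota>" using colim by blast
  interpret X: fi_colim K X V act \<iota> by fact
  have "bij_betw (\<lambda>x\<in>carrier V. x) (carrier V) (carrier V)" by (auto simp: bij_betw_def inj_on_def)
  then show "\<exists>c. is_iso (Gen K) X X c"
    using gen_pair.is_iso_iff[OF gen_pair.intro[OF X X]] rep_maps_id[OF X.inj_rep_axioms] by blast
  fix Y :: "('k, 'v) fi_mod" and c assume "Y \<in> Ob (Gen K)" and iso: "is_iso (Gen K) X Y c"
  then obtain V' :: "('k, 'v) module" and act' \<iota>' where Y: "fi_colim K Y V' act' \<iota>'" using colim by blast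
  interpret Y: fi_colim K Y V' act' \<iota>' by fact
  obtain F where F: "F \<in> rep_maps K V act V' act'" "bij_betw F (carrier V) (carrier V')"
    using iso gen_pair.is_iso_iff[OF gen_pair.intro[OF X Y]] by blast
  fix Z :: "('k, 'v) fi_mod" and d assume "Z \<in> Ob (Gen K)" and iso: "is_iso (Gen K) Y Z d"
  then obtain V'' :: "('k, 'v) module" and act'' \<iota>'' where Z: "fi_colim K Z V'' act'' \<iota>''" using colim by blast
  obtain G where G: "G \<in> rep_maps K V' act' V'' act''" "bij_betw G (carrier V') (carrier V'')"
    using iso gen_pair.is_iso_iff[OF gen_pair.intro[OF Y Z]] by blast
  show "\<exists>c. is_iso (Gen K) X Z c"
    using gen_pair.is_iso_iff[OF gen_pair.intro[OF X Z]] rep_maps_compose[OF X.inj_rep_axioms F(1) G(1)]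
      bij_betw_compose[OF F(2) G(2)] by blast
qed (use FI in simp_all)

context
  fixes K :: "('k, 'x) ring_scheme"
  assumes K: "ring K" and inf: "infinite (UNIV :: 'v set)"
begin

abbreviation (input) irr_gen :: "('k, 'v) fi_mod \<Rightarrow> bool" where
  "irr_gen \<equiv> irreducible_object (Gen K)"

abbreviation (input) irr_alg :: "nat \<Rightarrow> ((nat \<Rightarrow> nat) \<Rightarrow> 'k, 'v) module \<Rightarrow> bool" where
  "irr_alg n \<equiv> irreducible_object (LMod (alg K n))"

lemma irr_algD:
  assumes "irr_alg n E"
  shows "left_module (alg K n) E" "perm_rep K n (base_module K n E) (base_action K n E)"
    "simple_perm_rep K n (base_module K n E) (base_action K n E)"
proof -
  have s: "simple_module (alg K n) E" using assms by (simp add: irreducible_LMod)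
  then show E: "left_module (alg K n) E" by (simp add: simple_module_def)
  then show "perm_rep K n (base_module K n E) (base_action K n E)" by (rule module_over_alg(1)[OF K])
  show "simple_perm_rep K n (base_module K n E) (base_action K n E)" using s simple_alg_iff[OF K E] by simp
qed

lemma irr_genE:
  assumes "irr_gen L"
  obtains V :: "('k, 'v) module" and act \<iota> where "fi_colim K L V act \<iota>" "simple_rep K V act"
proof -
  have "FI_module K L" using assms by (simp add: irreducible_object_def)
  then obtain V :: "('k, 'v) module" and act \<iota> where c: "fi_colim K L V act \<iota>"
    using fi.colim_ex[OF fi.intro inf K] by blast
  then show thesis using that[OF c] fi_colim.irreducible_iff[OF c inf] assms by simp
qed

lemma func_embeddingE:
  assumes c: "fi_colim K L V act \<iota>" and s: "simple_rep K V act" and E: "irr_alg n E" and R: "embeds_in_induced K L n E"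
  obtains F where "func_embedding K V act n (base_module K n E) (base_action K n E) F"
proof -
  interpret fi_colim K L V act \<iota> by fact
  interpret B: perm_rep K n "base_module K n E" "base_action K n E" by (rule irr_algD(2)[OF E])
  obtain F where "F \<in> rep_maps K V act B.V B.act" "inj_on F (carrier V)"
    using R embeds_in_induced_iff[OF inf irr_algD(1)[OF E]] by blast
  then show thesis
    using that[of F] s irr_algD(3)[OF E] inj_rep_axioms B.func_rep
    by (simp add: func_embedding_def func_embedding_axioms_def rep_map_iff simple_rep_def)
qed

text \<open>The embedding theorem yields a \<open>K\<close>-module with a permutation action; it
  still has to be turned into a module over the group algebra and back.\<close>

lemma embeds_ex:
  assumes L: "irr_gen L"
  shows "\<exists>n E. irr_alg n E \<and> embeds_in_induced K L n E"
proof -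
  obtain V :: "('k, 'v) module" and act \<iota> where c: "fi_colim K L V act \<iota>" and s: "simple_rep K V act"
    using irr_genE[OF L] .
  interpret fi_colim K L V act \<iota> by fact
  obtain n and E :: "('k, 'v) module" and \<rho> F where E: "simple_perm_rep K n E \<rho>"
    and F: "F \<in> rep_maps K V act (func n E \<rho>) (func_act n E \<rho>)" "inj_on F (carrier V)"
    using simple_rep_embeds[OF s] by blast
  interpret E: perm_rep K n E \<rho> using E by (simp add: simple_perm_rep_def)
  define A where "A = alg_module n E \<rho>"
  have A: "irr_alg n A" using simple_alg_module[OF K E] by (simp add: irreducible_LMod A_def)
  interpret B: perm_rep K n "base_module K n A" "base_action K n A" by (rule irr_algD(2)[OF A])
  \<comment> \<open>\<open>E\<close> and the base module of \<open>A\<close> agree only on the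
    carrier, so the identity is used as an equivariant map and the embedding is composed with the
    map that it induces.\<close>
  have id: "(\<lambda>x\<in>carrier E. x) \<in> perm_maps K n E \<rho> (base_module K n A) (base_action K n A)"
    unfolding perm_maps_def
  proof (intro CollectI conjI allI impI ballI lin_mapsI)
    show "(\<lambda>x\<in>carrier E. x) (a \<odot>\<^bsub>E\<^esub> x) = a \<odot>\<^bsub>base_module K n A\<^esub> (\<lambda>x\<in>carrier E. x) x" if "a \<in> carrier K" "x \<in> carrier E" for a x
      using that E.base_alg_module(1) by (simp add: A_def E.smult_closed)
    show "(\<lambda>x\<in>carrier E. x) (\<rho> \<sigma> x) = base_action K n A \<sigma> ((\<lambda>x\<in>carrier E. x) x)" if "\<sigma> permutes {1..n}" "x \<in> carrier E" for \<sigma> x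
      using that E.base_alg_module(2) by (simp add: A_def E.\<rho>_closed)
  qed (auto simp: A_def)
  have "inj_on (\<lambda>x\<in>carrier E. x) (carrier E)" by (simp add: inj_on_def)
  then obtain G where G: "G \<in> rep_maps K E.V E.act B.V B.act" "inj_on G (carrier E.V)"
    using func_map[OF E.perm_rep_axioms B.perm_rep_axioms id] by blast
  have "F ` carrier V \<subseteq> carrier E.V" using F(1) by (auto simp: rep_maps_def dest: lin_mapsD(1))
  then have "inj_on (compose (carrier V) G F) (carrier V)"
    using comp_inj_on[OF F(2) inj_on_subset[OF G(2)]] by (simp add: inj_on_def compose_eq)
  then have "embeds_in_induced K L n A"
    using embeds_in_induced_iff[OF inf irr_algD(1)[OF A]] rep_maps_compose[OF inj_rep_axioms F(1) G(1)] by blast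
  then show ?thesis using A by blast
qed

lemma embeds_gen_iso:
  assumes L: "irr_gen L" "irr_gen L'" and E: "irr_alg n E" and R: "embeds_in_induced K L n E"
    and iso: "iso_class (Gen K) L = iso_class (Gen K) L'"
  shows "embeds_in_induced K L' n E"
proof -
  obtain V :: "('k, 'v) module" and act \<iota> where c: "fi_colim K L V act \<iota>" and s: "simple_rep K V act"
    using irr_genE[OF L(1)] .
  obtain V' :: "('k, 'v) module" and act' \<iota>' where c': "fi_colim K L' V' act' \<iota>'" and s': "simple_rep K V' act'"
    using irr_genE[OF L(2)] .
  interpret c: fi_colim K L V act \<iota> by fact
  interpret c': fi_colim K L' V' act' \<iota>' by fact
  obtain G where G: "G \<in> rep_maps K V' act' V act" "bij_betw G (carrier V') (carrier V)"
    using iso Gen_iso_class[OF K inf c'.FI c.FI] gen_pair.is_iso_iff[OF gen_pair.intro[OF c' c]] by metis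
  obtain F where F: "F \<in> rep_maps K V act (func_of K n E) (func_act_of K n E)" "inj_on F (carrier V)"
    using R c.embeds_in_induced_iff[OF inf irr_algD(1)[OF E]] by blast
  have "inj_on (F \<circ> G) (carrier V')" by (rule comp_inj_on) (use G(2) F(2) in \<open>simp_all add: bij_betw_def\<close>)
  then have "inj_on (compose (carrier V') F G) (carrier V')" by (simp add: inj_on_def compose_eq)
  then show ?thesis
    using c'.embeds_in_induced_iff[OF inf irr_algD(1)[OF E]] rep_maps_compose[OF c'.inj_rep_axioms G(1) F(1)] by blast
qed

lemma embeds_alg_iso:
  assumes L: "irr_gen L" and E: "irr_alg n E" "irr_alg n E'" and R: "embeds_in_induced K L n E"
    and iso: "iso_class (LMod (alg K n)) E = iso_class (LMod (alg K n)) E'"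
  shows "embeds_in_induced K L n E'"
proof -
  obtain V :: "('k, 'v) module" and act \<iota> where c: "fi_colim K L V act \<iota>" and s: "simple_rep K V act"
    using irr_genE[OF L] .
  interpret c: fi_colim K L V act \<iota> by fact
  note e = irr_algD[OF E(1)] and e' = irr_algD[OF E(2)]
  obtain h where h: "h \<in> lin_maps (alg K n) E E'" "bij_betw h (carrier E) (carrier E')"
    using iso LMod_iso_class[OF e(1) e'(1)] by blast
  obtain G where G: "G \<in> rep_maps K (func_of K n E) (func_act_of K n E) (func_of K n E') (func_act_of K n E')"
    "inj_on G (carrier (func_of K n E))"
    using func_map[OF e(2) e'(2), of h] h lin_maps_alg[OF K e(1) e'(1)] by (auto simp: bij_betw_def)
  obtain F where F: "F \<in> rep_maps K V act (func_of K n E) (func_act_of K n E)" "inj_on F (carrier V)"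
    using R c.embeds_in_induced_iff[OF inf e(1)] by blast
  have "F ` carrier V \<subseteq> carrier (func_of K n E)" using F(1) by (auto simp: rep_maps_def dest: lin_mapsD(1))
  then have "inj_on (compose (carrier V) G F) (carrier V)"
    using comp_inj_on[OF F(2) inj_on_subset[OF G(2)]] by (simp add: inj_on_def compose_eq)
  then show ?thesis
    using c.embeds_in_induced_iff[OF inf e'(1)] rep_maps_compose[OF c.inj_rep_axioms F(1) G(1)] by blast
qed

text \<open>\<open>L\<close> determines the degree as the last one with nonvanishing differences,
  and the module as the quotient of its colimit by the kernel of \<open>Dn n\<close>.\<close>

lemma embeds_unique:
  assumes L: "irr_gen L" and E: "irr_alg n E" "irr_alg n' E'"
    and R: "embeds_in_induced K L n E" "embeds_in_induced K L n' E'"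
  shows "n = n' \<and> iso_class (LMod (alg K n)) E = iso_class (LMod (alg K n')) E'"
proof -
  obtain V :: "('k, 'v) module" and act \<iota> where c: "fi_colim K L V act \<iota>" and s: "simple_rep K V act"
    using irr_genE[OF L] .
  obtain F where F: "func_embedding K V act n (base_module K n E) (base_action K n E) F"
    using func_embeddingE[OF c s E(1) R(1)] .
  obtain F' where F': "func_embedding K V act n' (base_module K n' E') (base_action K n' E') F'"
    using func_embeddingE[OF c s E(2) R(2)] .
  note u = func_embedding_unique[OF F F']
  then have n: "n' = n" by simp
  show ?thesis
    using u E irr_algD(1)[OF E(1)] irr_algD(1)[OF E(2)] lin_maps_alg[OF K, of n E E'] LMod_iso_class[of "alg K n" E E']
    unfolding n by simp
qed

lemma embeds_iso:
  assumes L: "irr_gen L" "irr_gen L'" and E: "irr_alg n E"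
    and R: "embeds_in_induced K L n E" "embeds_in_induced K L' n E"
  shows "iso_class (Gen K) L = iso_class (Gen K) L'"
proof -
  obtain V :: "('k, 'v) module" and act \<iota> where c: "fi_colim K L V act \<iota>" and s: "simple_rep K V act"
    using irr_genE[OF L(1)] .
  obtain V' :: "('k, 'v) module" and act' \<iota>' where c': "fi_colim K L' V' act' \<iota>'" and s': "simple_rep K V' act'"
    using irr_genE[OF L(2)] .
  obtain F where F: "func_embedding K V act n (base_module K n E) (base_action K n E) F"
    using func_embeddingE[OF c s E R(1)] .
  obtain F' where F': "func_embedding K V' act' n (base_module K n E) (base_action K n E) F'"
    using func_embeddingE[OF c' s' E R(2)] .
  show ?thesis
    using func_embedding_iso[OF F F' s s'] Gen_iso_class[OF K inf] gen_pair.is_iso_iff[OF gen_pair.intro[OF c c']]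
      fi.FI[OF fi_colim.axioms(1)[OF c]] fi.FI[OF fi_colim.axioms(1)[OF c']] by blast
qed

text \<open>The simple subrepresentation of the functions is cut out of an induced module
  \<open>P\<close> as a subobject, and its inclusion is the required monomorphism.\<close>

lemma embeds_surj:
  assumes E: "irr_alg n E"
  shows "\<exists>L. irr_gen L \<and> embeds_in_induced K L n E"
proof -
  interpret B: perm_rep K n "base_module K n E" "base_action K n E" by (rule irr_algD(2)[OF E])
  obtain W where W: "subrep K B.V B.act W" "simple_rep K (B.V\<lparr>carrier := W\<rparr>) (\<lambda>g. restrict (B.act g) W)"
    using B.socle[OF irr_algD(3)[OF E]] by blast
  obtain P \<iota> where P: "induced_FI K n E P" "fi_colim K P B.V B.act \<iota>"
    using induced_colim[OF K inf irr_algD(1)[OF E]] by blast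
  interpret P: fi_colim K P B.V B.act \<iota> by fact
  let ?L = "restrict_FI P (P.sub_of W)"
  note c = P.restrict_colim[OF W(1)]
  have "irr_gen ?L" using fi_colim.irreducible_iff[OF c inf] W(2) by simp
  moreover have "inj_on (\<lambda>v\<in>W. v) (carrier (B.V\<lparr>carrier := W\<rparr>))" by (auto simp: inj_on_def)
  then have "embeds_in_induced K ?L n E"
    using fi_colim.embeds_in_induced_iff[OF c inf irr_algD(1)[OF E]] rep_maps_incl[OF B.func_rep W(1)] by blast
  ultimately show ?thesis by blast
qed

end

text \<open>\<open>iff\<close> makes the choice of a related element irrelevant and the resulting
  map injective; \<open>resp\<close> is what allows the relation to be read back from an equality of
  classes.\<close>

lemma class_bijection:
  assumes total: "\<And>a. a \<in> A \<Longrightarrow> \<exists>b\<in>B. R a b" and surj: "\<And>b. b \<in> B \<Longrightarrow> \<exists>a\<in>A. R a b"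
    and iff: "\<And>a a' b b'. a \<in> A \<Longrightarrow> a' \<in> A \<Longrightarrow> b \<in> B \<Longrightarrow> b' \<in> B \<Longrightarrow> R a b \<Longrightarrow> R a' b' \<Longrightarrow> f a = f a' \<longleftrightarrow> g b = g b'"
    and resp: "\<And>a b b'. a \<in> A \<Longrightarrow> b \<in> B \<Longrightarrow> b' \<in> B \<Longrightarrow> R a b \<Longrightarrow> g b = g b' \<Longrightarrow> R a b'"
  shows "\<exists>\<Phi>. bij_betw \<Phi> (f ` A) (g ` B) \<and> (\<forall>a\<in>A. \<forall>b\<in>B. \<Phi> (f a) = g b \<longleftrightarrow> R a b)"
proof -
  define \<Phi> where "\<Phi> c = g (SOME b. b \<in> B \<and> (\<exists>a\<in>A. f a = c \<and> R a b))" for c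
  have \<Phi>: "\<Phi> (f a) = g b" if ab: "a \<in> A" "b \<in> B" "R a b" for a b
  proof -
    define b' where "b' = (SOME b. b \<in> B \<and> (\<exists>a'\<in>A. f a' = f a \<and> R a' b))"
    have "b' \<in> B \<and> (\<exists>a'\<in>A. f a' = f a \<and> R a' b')" unfolding b'_def by (rule someI[of _ b]) (use ab in blast)
    then obtain a' where "b' \<in> B" "a' \<in> A" "f a' = f a" "R a' b'" by blast
    then have "g b' = g b" using iff[of a' a b' b] ab by simp
    then show ?thesis by (simp add: \<Phi>_def b'_def)
  qed
  have "bij_betw \<Phi> (f ` A) (g ` B)"
    unfolding bij_betw_def
  proof
    show "inj_on \<Phi> (f ` A)"
    proof (rule inj_onI)
      fix c c' assume "c \<in> f ` A" "c' \<in> f ` A" and e: "\<Phi> c = \<Phi> c'"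
      then obtain a a' where a: "a \<in> A" "c = f a" "a' \<in> A" "c' = f a'" by blast
      obtain b b' where "b \<in> B" "R a b" "b' \<in> B" "R a' b'" using total a(1,3) by blast
      then show "c = c'" using \<Phi> iff[of a a' b b'] a e by simp
    qed
    show "\<Phi> ` f ` A = g ` B"
    proof (rule equalityI; rule subsetI)
      fix y assume "y \<in> \<Phi> ` f ` A"
      then show "y \<in> g ` B" using total \<Phi> by blast
    next
      fix y assume "y \<in> g ` B"
      then obtain b a where b: "b \<in> B" "y = g b" "a \<in> A" "R a b" using surj by blast
      have "y = \<Phi> (f a)" using \<Phi>[OF b(3,1,4)] b(2) by simp
      then show "y \<in> \<Phi> ` f ` A" using b(3) by blast
    qed
  qed
  moreover have "\<Phi> (f a) = g b \<longleftrightarrow> R a b" if ab: "a \<in> A" "b \<in> B" for a b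
  proof
    assume e: "\<Phi> (f a) = g b"
    obtain b' where "b' \<in> B" "R a b'" using total ab(1) by blast
    then show "R a b" using \<Phi>[OF ab(1)] resp[of a b' b] ab e by simp
  qed (rule \<Phi>[OF ab])
  ultimately show ?thesis by blast
qed

text \<open>Naturality of the correspondence is expressed by the second clause: classes correspond
  exactly when the generic module embeds in an FI-module induced from the representation of the
  symmetric group. By totality on irreducible objects this determines the bijection.\<close>

theorem theorem1p10:
  fixes K :: "('k, 'x) ring_scheme"
  assumes field: "field K"
    and universe: "infinite (UNIV :: 'v set)" "\<exists>i :: 'k \<Rightarrow> 'v. inj_on i (carrier K)"
  shows "\<exists>\<Phi> :: ('k, 'v) fi_mod set \<Rightarrow> nat \<times> ((nat \<Rightarrow> nat) \<Rightarrow> 'k, 'v) module set.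
     bij_betw \<Phi> (Irr (Gen K)) (SIGMA n:UNIV. Irr (LMod (group_algebra K (sym_group n)))) \<and>
     (\<forall>L n E. irreducible_object (Gen K) L \<longrightarrow>
        irreducible_object (LMod (group_algebra K (sym_group n))) E \<longrightarrow>
        (\<Phi> (iso_class (Gen K) L) = (n, iso_class (LMod (group_algebra K (sym_group n))) E) \<longleftrightarrow>
          (\<exists>P f. induced_FI K n E P \<and> is_mono (Gen K) L P f)))"
proof -
  interpret field K by fact
  note K = ring_axioms and inf = universe(1)
  define A :: "('k, 'v) fi_mod set" where "A = {L. irreducible_object (Gen K) L}"
  define B :: "(nat \<times> ((nat \<Rightarrow> nat) \<Rightarrow> 'k, 'v) module) set" where "B = {(n, E). irreducible_object (LMod (alg K n)) E}"
  define g :: "nat \<times> ((nat \<Rightarrow> nat) \<Rightarrow> 'k, 'v) module \<Rightarrow> _" where "g = (\<lambda>(n, E). (n, iso_class (LMod (alg K n)) E))"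
  define R where "R L = (\<lambda>(n, E :: ((nat \<Rightarrow> nat) \<Rightarrow> 'k, 'v) module). embeds_in_induced K L n E)" for L :: "('k, 'v) fi_mod"
  have "\<exists>\<Phi>. bij_betw \<Phi> (iso_class (Gen K) ` A) (g ` B) \<and> (\<forall>a\<in>A. \<forall>b\<in>B. \<Phi> (iso_class (Gen K) a) = g b \<longleftrightarrow> R a b)"
  proof (rule class_bijection)
    show "\<exists>b\<in>B. R a b" if "a \<in> A" for a using embeds_ex[OF K inf, of a] that by (auto simp: A_def B_def R_def)
    show "\<exists>a\<in>A. R a b" if "b \<in> B" for b using embeds_surj[OF K inf] that by (auto simp: A_def B_def R_def)
    fix a a' b b' assume a: "a \<in> A" "b \<in> B" "b' \<in> B" "R a b"
    obtain n E where b: "b = (n, E)" by (cases b)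
    obtain n' E' where b': "b' = (n', E')" by (cases b')
    have irr: "irreducible_object (Gen K) a" "irreducible_object (LMod (alg K n)) E" "irreducible_object (LMod (alg K n')) E'"
      and r: "embeds_in_induced K a n E" using a by (simp_all add: A_def B_def R_def b b')
    show "R a b'" if "g b = g b'"
      using that embeds_alg_iso[OF K inf irr(1,2) _ r, of E'] irr(3) by (auto simp: R_def g_def b b')
    assume a': "a' \<in> A" "R a' b'"
    then have irr': "irreducible_object (Gen K) a'" and r': "embeds_in_induced K a' n' E'" by (simp_all add: A_def R_def b')
    show "iso_class (Gen K) a = iso_class (Gen K) a' \<longleftrightarrow> g b = g b'"
    proof
      assume e: "iso_class (Gen K) a = iso_class (Gen K) a'"
      show "g b = g b'"
        \<comment> \<open>The embedding of \<open>a\<close> is carried along the isomorphism to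
          \<open>a'\<close>, which then embeds in both induced modules.\<close>
        using embeds_unique[OF K inf irr' irr(2,3) embeds_gen_iso[OF K inf irr(1) irr' irr(2) r e] r'] by (auto simp: g_def b b')
    next
      assume e: "g b = g b'"
      then have n: "n' = n" and i: "iso_class (LMod (alg K n)) E = iso_class (LMod (alg K n)) E'" by (auto simp: g_def b b')
      show "iso_class (Gen K) a = iso_class (Gen K) a'"
        \<comment> \<open>The embedding of \<open>a\<close> is pushed along the isomorphism of
          modules, so that both objects embed in modules induced from the same
          \<open>E'\<close>.\<close>
        using embeds_iso[OF K inf irr(1) irr' _ embeds_alg_iso[OF K inf irr(1,2) _ r i]] irr(3) r' unfolding n by blast
    qed
  qed
  moreover have "iso_class (Gen K) ` A = Irr (Gen K)" by (simp add: A_def Irr_def)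
  moreover have "g ` B = (SIGMA n:UNIV. Irr (LMod (alg K n)))" by (force simp: B_def g_def Irr_def)
  ultimately obtain \<Phi> where \<Phi>: "bij_betw \<Phi> (Irr (Gen K)) (SIGMA n:UNIV. Irr (LMod (alg K n)))"
    "\<forall>a\<in>A. \<forall>b\<in>B. \<Phi> (iso_class (Gen K) a) = g b \<longleftrightarrow> R a b" by auto
  have "\<Phi> (iso_class (Gen K) L) = (n, iso_class (LMod (alg K n)) E) \<longleftrightarrow> (\<exists>P f. induced_FI K n E P \<and> is_mono (Gen K) L P f)"
    if "irreducible_object (Gen K) L" "irreducible_object (LMod (alg K n)) E" for L n and E :: "((nat \<Rightarrow> nat) \<Rightarrow> 'k, 'v) module"
  proof -
    have "L \<in> A" "(n, E) \<in> B" using that by (simp_all add: A_def B_def)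
    then have "\<Phi> (iso_class (Gen K) L) = g (n, E) \<longleftrightarrow> R L (n, E)" using \<Phi>(2) by blast
    then show ?thesis by (simp add: g_def R_def embeds_in_induced_def)
  qed
  then show ?thesis using \<Phi>(1) by blast
qed

end
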